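(* Assume the i.i.d. random variables $\{\Theta_z\}_{z\in\mathbb{Z}}$ are nonconstant with essential infimum $\theta_*>0$, and let $\theta$ be the 1D random checkerboard (with $a\equiv1$). Suppose that $\epsilon\mapsto\delta(\epsilon)>0$ is any scaling such that $\epsilon^{-1}\delta(\epsilon)\to0$ as $\epsilon\to0$. If there is a $\kappa\in[0,\infty]$ such that $$\lim_{\epsilon\downarrow0}\frac{\delta(\epsilon)|\log\epsilon|}{\epsilon}=\kappa,$$ then for any bounded open interval $I\subseteq\mathbb{R}$, the functional $\mathscr{F}_{\epsilon,\delta(\epsilon)}(\cdot\,;I)$ $\Gamma$-converges in probability to the energy $\check{\mathscr{E}}_\kappa(\cdot\,;I)$ given by $$\check{\mathscr{E}}_\kappa(u;I)=\begin{cases}\check\sigma(\kappa)\,\#(S_u\cap I),&\text{if }u\in BV(I;\{-1,1\}),\\ \infty,&\text{otherwise,}\end{cases}$$ where $S_u$ is the jump set of $u$ and $\#$ denotes cardinality.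
   Context: Let $W:\mathbb{R}\to[0,\infty)$ be continuous with zeros precisely at $-1$ and $1$. $\{\Theta_z\}_{z\in\mathbb{Z}}$ are i.i.d. real random variables with $\theta_*\le\Theta_z\le\theta^*$ a.s., $0<\theta_*\le\theta^*<\infty$, and $\theta(x)=\sum_{z\in\mathbb{Z}}\Theta_z\mathbf{1}_{z+(-1/2,1/2)}(x)$; $\bar\theta=\mathbb{E}[\Theta_0]$. For an interval $I$, $\mathscr{F}_{\epsilon,\delta}(u;I)=\int_I\big(\frac\epsilon2|u'|^2+\frac1\epsilon\theta(\delta^{-1}x)W(u)\big)dx$, regarded as a functional on $L^1(I)$ (equal to $+\infty$ if $u\notin H^1(I)$). Definition of $\check\sigma$. For $c>0$ let $\mathscr{F}_c(u;\mathbb{R})=\int_{\mathbb{R}}(\frac12|u'|^2+cW(u))\,dy$, $\bar{\mathscr{F}}=\mathscr{F}_{\bar\theta}$, $\bar\sigma=\min\{\bar{\mathscr{F}}(u;\mathbb{R})\mid u(\pm\infty)=\pm1\}$. Let $\Lambda(\xi)=\log\mathbb{E}[\exp(\xi(\Theta_0-\bar\theta))]$. For $r\ge1$, let $\mathcal{U}_r$ be the set of $u:\mathbb{R}\to[-1,1]$ with $\mathscr{F}_{\theta_*}(u;\mathbb{R})<\infty$ and $u(x)=\mathrm{sgn}(x)$ for $|x|\ge r$. For $u\in\mathcal{U}_r$ and $\zeta\ge0$ let $$J_u(\zeta)=\sup_{\xi\le0}\Big\{-\xi(\zeta+\bar{\mathscr{F}}(u;\mathbb{R})-\bar\sigma)-\int_{\mathbb{R}}\Lambda(\xi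 W(u))\,dy\Big\}\in[0,\infty],$$ $J_r(\zeta)=\inf_{u\in\mathcal{U}_r}J_u(\zeta)$, $J(\zeta)=\inf_{r\ge1}J_r(\zeta)$. Then $\check\sigma(\kappa)=\bar\sigma-\inf\{\zeta\ge0\mid J(\zeta)\ge\kappa\}$ for $\kappa\in[0,\infty]$. $\Gamma$-convergence in probability: for a bounded interval $I$ there is a metric space $(\mathcal{M},d_\Gamma)$ of l.s.c. functionals on $L^1(I)$ (containing the limit functionals $\check{\mathscr{E}}_\kappa(\cdot\,;I)$) such that convergence in $(\mathcal{M},d_\Gamma)$ is equivalent to $\Gamma$-convergence (with respect to $L^1(I)$) and $\mathbb{P}\{\mathscr{F}_{\epsilon,\delta}(\cdot\,;I)\in\mathcal{M}\}=1$ for all $\epsilon\in(0,1)$, $\delta>0$. Random elements $\mathscr{G}_\epsilon$ of $\mathcal{M}$ $\Gamma$-converge in probability to $\mathscr{G}$ if $d_\Gamma(\mathscr{G}_\epsilon,\mathscr{G})\to0$ in probability. *)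

theory Defs
  imports "HOL-Probability.Probability"
begin

section \<open>Function spaces on open subsets of the real line\<close>

text \<open>Elements of Lebesgue spaces are represented by functions \<open>real \<Rightarrow> real\<close>; all notions below depend
  only on the class of a function modulo Lebesgue null subsets of the open set \<open>I\<close>.\<close>

definition test_functions :: "real set \<Rightarrow> (real \<Rightarrow> real) set" where
  "test_functions I = {\<phi>. (\<forall>n. (deriv ^^ n) \<phi> differentiable_on UNIV) \<and>
     (\<exists>K. compact K \<and> K \<subseteq> I \<and> (\<forall>x. x \<notin> K \<longrightarrow> \<phi> x = 0))}"

definition L1 :: "real set \<Rightarrow> (real \<Rightarrow> real) set" where
  "L1 I = {u. integrable (lebesgue_on I) u}"

definition L2 :: "real set \<Rightarrow> (real \<Rightarrow> real) set" where
  "L2 I = {u. u \<in> borel_measurable (lebesgue_on I) \<and> integrable (lebesgue_on I) (\<lambda>x. (u x)\<^sup>2)}"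

definition L1_loc :: "real set \<Rightarrow> (real \<Rightarrow> real) set" where
  "L1_loc I = {u. \<forall>K. compact K \<and> K \<subseteq> I \<longrightarrow> integrable (lebesgue_on K) u}"

definition has_weak_deriv :: "real set \<Rightarrow> (real \<Rightarrow> real) \<Rightarrow> (real \<Rightarrow> real) \<Rightarrow> bool" where
  "has_weak_deriv I u g \<longleftrightarrow> u \<in> L1_loc I \<and> g \<in> L1_loc I \<and>
     (\<forall>\<phi>\<in>test_functions I.
        (LINT x|lebesgue_on I. u x * deriv \<phi> x) = - (LINT x|lebesgue_on I. g x * \<phi> x))"

definition weak_deriv :: "real set \<Rightarrow> (real \<Rightarrow> real) \<Rightarrow> real \<Rightarrow> real" where
  "weak_deriv I u = (SOME g. has_weak_deriv I u g)"

definition H1 :: "real set \<Rightarrow> (real \<Rightarrow> real) set" where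
  "H1 I = {u \<in> L2 I. \<exists>g \<in> L2 I. has_weak_deriv I u g}"

text \<open>\<open>BV(I; {-1,1})\<close>, with the total variation defined by duality.\<close>

definition BV_pm1 :: "real set \<Rightarrow> (real \<Rightarrow> real) set" where
  "BV_pm1 I = {u \<in> L1 I. (AE x in lebesgue_on I. u x = -1 \<or> u x = 1) \<and>
     (\<exists>C. \<forall>\<phi>\<in>test_functions I. (\<forall>x. \<bar>\<phi> x\<bar> \<le> 1) \<longrightarrow>
        (LINT x|lebesgue_on I. u x * deriv \<phi> x) \<le> C)}"

text \<open>Approximate jump points: the blow-ups of \<open>u\<close> at \<open>x\<close> from the left and from the right
  converge in mean to two different constants.\<close>

definition jump_set :: "(real \<Rightarrow> real) \<Rightarrow> real set" where
  "jump_set u = {x. \<exists>a b. a \<noteq> b \<and>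
     ((\<lambda>r. (LINT y|lebesgue_on {x - r<..<x}. \<bar>u y - a\<bar>) / r) \<longlongrightarrow> 0) (at_right 0) \<and>
     ((\<lambda>r. (LINT y|lebesgue_on {x<..<x + r}. \<bar>u y - b\<bar>) / r) \<longlongrightarrow> 0) (at_right 0)}"


section \<open>\<open>\<Gamma>\<close>-convergence with respect to \<open>L\<^sup>1(I)\<close>\<close>

type_synonym functional = "(real \<Rightarrow> real) \<Rightarrow> ereal"

definition L1_tendsto :: "real set \<Rightarrow> (nat \<Rightarrow> real \<Rightarrow> real) \<Rightarrow> (real \<Rightarrow> real) \<Rightarrow> bool" where
  "L1_tendsto I us u \<longleftrightarrow> (\<forall>n. us n \<in> L1 I) \<and> u \<in> L1 I \<and>
     (\<lambda>n. LINT x|lebesgue_on I. \<bar>us n x - u x\<bar>) \<longlonglongrightarrow> 0"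

text \<open>Functionals on \<open>L\<^sup>1(I)\<close> take the value \<open>\<infinity>\<close> on functions that are not in \<open>L\<^sup>1(I)\<close>, so that equality
  of such functionals is equality on \<open>L\<^sup>1(I)\<close>. Lower semicontinuity, applied to constant sequences,
  implies that they do not distinguish functions that agree almost everywhere on \<open>I\<close>.\<close>

definition lsc_functionals :: "real set \<Rightarrow> functional set" where
  "lsc_functionals I = {F. (\<forall>u. u \<notin> L1 I \<longrightarrow> F u = \<infinity>) \<and>
     (\<forall>us u. L1_tendsto I us u \<longrightarrow> F u \<le> liminf (\<lambda>n. F (us n)))}"

definition Gamma_tendsto :: "real set \<Rightarrow> (nat \<Rightarrow> functional) \<Rightarrow> functional \<Rightarrow> bool" where
  "Gamma_tendsto I Fs F \<longleftrightarrow> (\<forall>u\<in>L1 I.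
     (\<forall>us. L1_tendsto I us u \<longrightarrow> F u \<le> liminf (\<lambda>n. Fs n (us n))) \<and>
     (\<exists>us. L1_tendsto I us u \<and> limsup (\<lambda>n. Fs n (us n)) \<le> F u))"

text \<open>A metric on a set of lower semicontinuous functionals that metrizes \<open>\<Gamma>\<close>-convergence.\<close>

definition Gamma_metric :: "real set \<Rightarrow> functional metric \<Rightarrow> bool" where
  "Gamma_metric I m \<longleftrightarrow> mspace m \<subseteq> lsc_functionals I \<and>
     (\<forall>Fs F. (\<forall>n. Fs n \<in> mspace m) \<and> F \<in> mspace m \<longrightarrow>
        (limitin (mtopology_of m) Fs F sequentially \<longleftrightarrow> Gamma_tendsto I Fs F))"

text \<open>Convergence in probability of random elements of a metric space as \<open>\<epsilon> \<down> 0\<close>. The outer measure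
  makes this meaningful without any assumption on the measurability of \<open>\<omega> \<mapsto> d(G \<epsilon> \<omega>, F)\<close>; it is the
  probability itself when that map is measurable.\<close>

definition tendsto_in_prob :: "'w measure \<Rightarrow> 'a metric \<Rightarrow> (real \<Rightarrow> 'w \<Rightarrow> 'a) \<Rightarrow> 'a \<Rightarrow> bool" where
  "tendsto_in_prob P m G F \<longleftrightarrow> (\<forall>\<eta>>0.
     ((\<lambda>\<epsilon>. outer_measure_of P {\<omega> \<in> space P. \<eta> < mdist m (G \<epsilon> \<omega>) F}) \<longlongrightarrow> 0) (at_right 0))"


section \<open>The random functionals\<close>

definition checkerboard :: "(int \<Rightarrow> real) \<Rightarrow> real \<Rightarrow> real" where
  "checkerboard t x =
     (\<Sum>\<^sub>\<infinity>z. t z * indicator {real_of_int z - 1/2 <..< real_of_int z + 1/2} x)"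

definition F_eps :: "(real \<Rightarrow> real) \<Rightarrow> (int \<Rightarrow> real) \<Rightarrow> real \<Rightarrow> real \<Rightarrow> real set \<Rightarrow> functional" where
  "F_eps W t \<epsilon> \<delta> I u =
     (if u \<in> H1 I then
        enn2ereal (\<integral>\<^sup>+x. ennreal (\<epsilon> / 2 * (weak_deriv I u x)\<^sup>2
          + 1 / \<epsilon> * checkerboard t (inverse \<delta> * x) * W (u x)) \<partial>lebesgue_on I)
      else \<infinity>)"


section \<open>The effective surface tension\<close>

text \<open>A locally integrable function with locally integrable weak derivative and finite energy
  is locally in \<open>H\<^sup>1\<close>.\<close>

definition F_line :: "(real \<Rightarrow> real) \<Rightarrow> real \<Rightarrow> functional" where
  "F_line W c u =
     (if \<exists>g. has_weak_deriv UNIV u g then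
        enn2ereal (\<integral>\<^sup>+y. ennreal (1 / 2 * (weak_deriv UNIV u y)\<^sup>2 + c * W (u y)) \<partial>lebesgue)
      else \<infinity>)"

text \<open>In the following, \<open>X\<close> is a random variable on the probability space \<open>P\<close> with the common law of
  the coefficients, and \<open>th\<close> is its essential infimum.\<close>

abbreviation mean :: "'w measure \<Rightarrow> ('w \<Rightarrow> real) \<Rightarrow> real" where
  "mean P X \<equiv> (LINT \<omega>|P. X \<omega>)"

definition sigma_bar :: "(real \<Rightarrow> real) \<Rightarrow> 'w measure \<Rightarrow> ('w \<Rightarrow> real) \<Rightarrow> ereal" where
  "sigma_bar W P X =
     Inf {F_line W (mean P X) u | u. (u \<longlongrightarrow> -1) at_bot \<and> (u \<longlongrightarrow> 1) at_top}"

definition log_mgf :: "'w measure \<Rightarrow> ('w \<Rightarrow> real) \<Rightarrow> real \<Rightarrow> real" where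
  "log_mgf P X \<xi> = ln (LINT \<omega>|P. exp (\<xi> * (X \<omega> - mean P X)))"

definition profiles :: "(real \<Rightarrow> real) \<Rightarrow> real \<Rightarrow> real \<Rightarrow> (real \<Rightarrow> real) set" where
  "profiles W th r = {u. (\<forall>x. u x \<in> {-1..1}) \<and> F_line W th u < \<infinity> \<and>
     (\<forall>x. \<bar>x\<bar> \<ge> r \<longrightarrow> u x = sgn x)}"

text \<open>Both energies converted to real numbers here are finite for profiles \<open>u\<close>.\<close>

definition rate_profile ::
    "(real \<Rightarrow> real) \<Rightarrow> 'w measure \<Rightarrow> ('w \<Rightarrow> real) \<Rightarrow> (real \<Rightarrow> real) \<Rightarrow> real \<Rightarrow> ereal" where
  "rate_profile W P X u \<zeta> = (SUP \<xi>\<in>{..0}. ereal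
     (- \<xi> * (\<zeta> + real_of_ereal (F_line W (mean P X) u) - real_of_ereal (sigma_bar W P X))
      - (LINT y|lebesgue. log_mgf P X (\<xi> * W (u y)))))"

definition rate_radius ::
    "(real \<Rightarrow> real) \<Rightarrow> 'w measure \<Rightarrow> ('w \<Rightarrow> real) \<Rightarrow> real \<Rightarrow> real \<Rightarrow> real \<Rightarrow> ereal" where
  "rate_radius W P X th r \<zeta> = (INF u\<in>profiles W th r. rate_profile W P X u \<zeta>)"

definition rate ::
    "(real \<Rightarrow> real) \<Rightarrow> 'w measure \<Rightarrow> ('w \<Rightarrow> real) \<Rightarrow> real \<Rightarrow> real \<Rightarrow> ereal" where
  "rate W P X th \<zeta> = (INF r\<in>{1..}. rate_radius W P X th r \<zeta>)"

definition sigma_check ::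
    "(real \<Rightarrow> real) \<Rightarrow> 'w measure \<Rightarrow> ('w \<Rightarrow> real) \<Rightarrow> real \<Rightarrow> ereal \<Rightarrow> ereal" where
  "sigma_check W P X th \<kappa> =
     sigma_bar W P X - Inf {ereal \<zeta> | \<zeta>. 0 \<le> \<zeta> \<and> \<kappa> \<le> rate W P X th \<zeta>}"

text \<open>The counting measure is used because \<open>card\<close> is \<open>0\<close> on infinite sets.\<close>

definition E_check ::
    "(real \<Rightarrow> real) \<Rightarrow> 'w measure \<Rightarrow> ('w \<Rightarrow> real) \<Rightarrow> real \<Rightarrow> ereal \<Rightarrow> real set \<Rightarrow> functional" where
  "E_check W P X th \<kappa> I u =
     (if u \<in> BV_pm1 I
      then sigma_check W P X th \<kappa> * enn2ereal (emeasure (count_space UNIV) (jump_set u \<inter> I))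
      else \<infinity>)"

end

theory Submission
  imports Defs
begin

text \<open>A function of finite energy crosses from \<open>-1\<close> to \<open>1\<close> on an interval of length of order \<open>\<epsilon>\<close>, and the
medium oscillates on the much smaller scale \<open>\<delta>\<close>. After rescaling by \<open>\<epsilon>\<close>, a crossing with profile \<open>v\<close>
at the location \<open>x\<close> costs its kinetic energy plus a sum of the coefficients over about \<open>\<epsilon> / \<delta>\<close> cells with
weights given by \<open>W (v y)\<close>. This sum is its mean plus a fluctuation, a weighted sum of independent
centred variables, and by Cramer's theorem the probability that the fluctuation lowers the cost of
the profile to \<open>\<zeta>\<close> below the mean surface tension is \<open>exp (- (\<epsilon> / \<delta>) J\<^sub>v(\<zeta>))\<close> to leading exponential order. An
interval contains about \<open>1 / \<epsilon>\<close> independent locations, and \<open>\<delta> |log \<epsilon>| / \<epsilon> \<rightarrow> \<kappa>\<close> says that this number is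
\<open>exp ((\<epsilon> / \<delta>) (\<kappa> + o(1)))\<close>. Hence a gain \<open>\<zeta>\<close> with \<open>J \<zeta> < \<kappa>\<close> is realized somewhere in every interval, while a
gain larger than one with \<open>\<kappa> \<le> J \<zeta>\<close> is realized nowhere. The price of a jump is therefore the mean surface
tension minus the critical gain \<open>z\<close> of \<open>ex_critical_gain\<close>, which is \<open>sigma_check\<close>.

Both halves are asymptotic statements about a fixed profile: \<open>lower_bound_fixed_profile\<close> is Chernoff's
bound and a union bound over the sites \<open>\<epsilon> k\<close>, and \<open>upper_bound_realized\<close> combines the lower bound
\<open>cramer_lower_bound\<close> with the independence of distant locations. The lower bound extends to all profiles
with support in a fixed ball, because these are a compact family (\<open>finite_transition_net\<close>), and then to
arbitrary crossings, because every crossing of bounded energy contains a short piece which can be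
completed to such a profile at little cost (\<open>ex_extraction_radius\<close>). Crossings from \<open>1\<close> to \<open>-1\<close> become
crossings from \<open>-1\<close> to \<open>1\<close> in the reflected medium, which has the same law.

From here on the argument is deterministic. In a typical medium every alternation of signs costs almost
\<open>sb - z\<close>, so that a limit of functions of bounded energy has finitely many jumps (\<open>limit_energy_bound\<close>); and
cheap crossings glued at locations near the jumps of a step function form a recovery sequence
(\<open>recovery_function\<close>). Being typical is a countable conjunction of requirements, each of which holds with
probability tending to one. If the energies did not converge in probability, then one could choose
environments satisfying more and more of these requirements along which they stay away from the limit,
contradicting the deterministic statement (\<open>tendsto_in_probI\<close>).

The functionals are defined through weak derivatives and total variation by duality. Finite energy is
translated into the existence of an absolutely continuous representative, \<open>AC\<close>, and bounded variation into
the existence of a step function, \<open>stepfun\<close>; both translations test with smooth plateaus and use that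
almost every point is a Lebesgue point.\<close>

section \<open>Smooth cut-off functions\<close>

definition smooth :: "(real => real) => bool" where
  "smooth f \<longleftrightarrow> (\<forall>n. (deriv ^^ n) f differentiable_on UNIV)"

text \<open>Smoothness is a coinductive notion: a set of functions that is closed under some choice of derivatives
consists of smooth functions. This avoids formulas for higher derivatives.\<close>

lemma smooth_coinduct:
  assumes "f \<in> S"
    and step: "\<And>g. g \<in> S ==> \<exists>g'\<in>S. \<forall>x. (g has_real_derivative g' x) (at x)"
  shows "smooth f"
proof -
  have "(deriv ^^ n) f \<in> S" for n
  proof (induction n)
    case 0 show ?case using assms(1) by simp
  next
    case (Suc n)
    then obtain g' where "g' \<in> S" "\<forall>x. ((deriv ^^ n) f has_real_derivative g' x) (at x)"
      using step by blast
    moreover from this have "deriv ((deriv ^^ n) f) = g'"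
      by (auto intro!: ext DERIV_imp_deriv)
    ultimately show ?case by simp
  qed
  then show ?thesis
    unfolding smooth_def differentiable_on_def
    using step by (metis UNIV_I differentiableI has_field_derivative_imp_has_derivative real_differentiable_def)
qed

lemma smooth_has_derivative: "smooth f ==> (f has_real_derivative deriv f x) (at x)"
  unfolding smooth_def by (metis DERIV_deriv_iff_real_differentiable differentiable_on_def UNIV_I funpow_0)

lemma smooth_deriv: "smooth f ==> smooth (deriv f)"
  unfolding smooth_def by (metis funpow_Suc_right comp_apply)

lemma smooth_antiderivative:
  assumes "smooth g" "\<And>x. (f has_real_derivative g x) (at x)"
  shows "smooth f"
  by (rule smooth_coinduct[of f "insert f (Collect smooth)"])
    (use assms in \<open>auto intro: smooth_has_derivative smooth_deriv\<close>)

lemma smooth_add: "smooth f ==> smooth g ==> smooth (\<lambda>x. f x + g x)"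
proof -
  assume fg: "smooth f" "smooth g"
  show "smooth (\<lambda>x. f x + g x)"
  proof (rule smooth_coinduct[of _ "{\<lambda>x. f x + g x | f g. smooth f \<and> smooth g}"])
    show "(\<lambda>x. f x + g x) \<in> {\<lambda>x. f x + g x | f g. smooth f \<and> smooth g}" using fg by blast
  next
    fix k assume "k \<in> {\<lambda>x. f x + g x | f g. smooth f \<and> smooth g}"
    then obtain f g where k: "k = (\<lambda>x. f x + g x)" "smooth f" "smooth g" by blast
    then have "\<forall>x. (k has_real_derivative deriv f x + deriv g x) (at x)"
      by (auto intro!: DERIV_add smooth_has_derivative)
    then show "\<exists>g'\<in>{\<lambda>x. f x + g x | f g. smooth f \<and> smooth g}. \<forall>x. (k has_real_derivative g' x) (at x)"
      using k smooth_deriv by (intro bexI[of _ "\<lambda>x. deriv f x + deriv g x"]) auto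
  qed
qed

lemma smooth_affine: assumes "smooth f" shows "smooth (\<lambda>x. k * f (c * x + d))"
proof (rule smooth_coinduct[of _ "{\<lambda>x. k * f (c * x + d) | k f. smooth f}"])
  show "(\<lambda>x. k * f (c * x + d)) \<in> {\<lambda>x. k * f (c * x + d) | k f. smooth f}" using assms by blast
next
  fix g assume "g \<in> {\<lambda>x. k * f (c * x + d) | k f. smooth f}"
  then obtain k f where g: "g = (\<lambda>x. k * f (c * x + d))" "smooth f" by blast
  have "(g has_real_derivative (k * c) * deriv f (c * x + d)) (at x)" for x
    unfolding g(1)
    by (rule derivative_eq_intros DERIV_chain'[where g=f and f="\<lambda>x. c * x + d", OF _ smooth_has_derivative[OF g(2)]] refl | simp)+
  then show "\<exists>g'\<in>{\<lambda>x. k * f (c * x + d) | k f. smooth f}. \<forall>x. (g has_real_derivative g' x) (at x)"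
    using smooth_deriv[OF g(2)] by (intro bexI[of _ "\<lambda>x. (k * c) * deriv f (c * x + d)"]) blast+
qed

lemma smooth_const: "smooth (\<lambda>x. c)"
  by (rule smooth_coinduct[of _ "range (\<lambda>c x. c)"]) (auto intro!: DERIV_const)

lemma smooth_sum: "(\<And>i. i \<in> A ==> smooth (f i)) ==> smooth (\<lambda>x. \<Sum>i\<in>A. f i x)"
  by (induction A rule: infinite_finite_induct) (auto intro: smooth_const smooth_add)

lemma smooth_mult: assumes "smooth f" "smooth g" shows "smooth (\<lambda>x. f x * g x)"
proof -
  let ?S = "{\<lambda>x. \<Sum>(f,g)\<leftarrow>xs. f x * g x | xs. \<forall>(f,g)\<in>set xs. smooth f \<and> smooth g}"
  show ?thesis
  proof (rule smooth_coinduct[of _ ?S])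
    show "(\<lambda>x. f x * g x) \<in> ?S"
      using assms by (intro CollectI exI[of _ "[(f,g)]"]) auto
  next
    fix k assume "k \<in> ?S"
    then obtain xs where xs: "\<forall>(f,g)\<in>set xs. smooth f \<and> smooth g"
      and k: "k = (\<lambda>x. \<Sum>(f,g)\<leftarrow>xs. f x * g x)" by blast
    define ys where "ys = concat (map (\<lambda>(f,g). [(deriv f, g), (f, deriv g)]) xs)"
    have ys: "\<forall>(f,g)\<in>set ys. smooth f \<and> smooth g"
      using xs smooth_deriv by (fastforce simp: ys_def)
    have "(k has_real_derivative (\<Sum>(f,g)\<leftarrow>ys. f x * g x)) (at x)" for x
      using xs unfolding k ys_def
    proof (induction xs)
      case Nil show ?case by simp
    next
      case (Cons a xs)
      obtain f g where a: "a = (f,g)" by force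
      have s: "smooth f" "smooth g" using Cons.prems a by auto
      have "((\<lambda>x. f x * g x + (\<Sum>(f,g)\<leftarrow>xs. f x * g x)) has_real_derivative
         (deriv f x * g x + deriv g x * f x) + (\<Sum>(f,g)\<leftarrow>concat (map (\<lambda>(f,g). [(deriv f, g), (f, deriv g)]) xs). f x * g x)) (at x)"
        using Cons by (intro DERIV_add DERIV_mult smooth_has_derivative s) auto
      then show ?case using a by (simp add: algebra_simps)
    qed
    then show "\<exists>g'\<in>?S. \<forall>x. (k has_real_derivative g' x) (at x)"
      using ys by (intro bexI[of _ "\<lambda>x. \<Sum>(f,g)\<leftarrow>ys. f x * g x"]) blast+
  qed
qed

definition half_bump :: "real => real" where
  "half_bump x = (if 0 < x then exp (- inverse x) else 0)"

text \<open>All derivatives of \<open>half_bump\<close> on the positive half-line are of this form, so they extend by zero.\<close>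

lemma poly_exp_tendsto_0: "((\<lambda>x. poly p (inverse x) * exp (- inverse x)) \<longlongrightarrow> (0::real)) (at_right 0)"
proof -
  have "((\<lambda>y::real. \<Sum>i\<le>degree p. coeff p i * (y ^ i / exp y)) \<longlongrightarrow> (\<Sum>i\<le>degree p. coeff p i * 0)) at_top"
    by (intro tendsto_sum tendsto_mult tendsto_const tendsto_power_div_exp_0)
  then have "((\<lambda>y::real. poly p y * exp (- y)) \<longlongrightarrow> 0) at_top"
    by (simp add: poly_altdef sum_distrib_right exp_minus divide_inverse mult.assoc)
  then show ?thesis
    using filterlim_compose[OF _ filterlim_inverse_at_top_right] by (auto simp: o_def)
qed

lemma smooth_half_bump: "smooth half_bump"
proof -
  define G where "G p = (\<lambda>x::real. if 0 < x then poly p (inverse x) * exp (- inverse x) else 0)" for p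
  define D where "D p = [:0,0,1:] * (p - pderiv p)" for p :: "real poly"
  have der: "(G p has_real_derivative G (D p) x) (at x)" for p x
  proof -
    consider "x > 0" | "x < 0" | "x = 0" by linarith
    then show ?thesis
    proof cases
      case 1
      have "((\<lambda>x. poly p (inverse x) * exp (- inverse x)) has_real_derivative
          (poly (D p) (inverse x) * exp (- inverse x))) (at x)"
        using 1 unfolding D_def
        by (auto intro!: derivative_eq_intros DERIV_chain'[where g="poly p", OF _ poly_DERIV]
             simp: algebra_simps power2_eq_square)
      moreover have "\<forall>\<^sub>F y in nhds x. G p y = poly p (inverse y) * exp (- inverse y)"
        using 1 eventually_nhds_in_open[of "{0<..}" x]
        by (auto elim!: eventually_mono simp: G_def)
      ultimately show ?thesis
        using 1 DERIV_cong_ev[OF refl _ refl, where f="G p" and g="\<lambda>y. poly p (inverse y) * exp (- inverse y)"]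
        by (simp add: G_def[of "D p"])
    next
      case 2
      have "\<forall>\<^sub>F y in nhds x. G p y = 0"
        using 2 eventually_nhds_in_open[of "{..<0}" x]
        by (auto elim!: eventually_mono simp: G_def)
      then have "(G p has_real_derivative 0) (at x)"
        using DERIV_cong_ev[OF refl _ refl, where f="G p" and g="\<lambda>_. 0"] by auto
      then show ?thesis using 2 by (simp add: G_def)
    next
      case 3
      have q: "G p h / h = poly (pCons 0 p) (inverse h) * exp (- inverse h)" if "h > 0" for h
        using that by (simp add: G_def divide_inverse)
      have "((\<lambda>h. G p h / h) \<longlongrightarrow> 0) (at_right 0)"
        by (rule Lim_transform_eventually[OF poly_exp_tendsto_0[of "pCons 0 p"]])
           (use q in \<open>auto simp: eventually_at_right_less eventually_at_filter\<close>)
      moreover have "((\<lambda>h. G p h / h) \<longlongrightarrow> 0) (at_left 0)"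
        by (rule Lim_transform_eventually[OF tendsto_const])
           (auto simp: G_def eventually_at_filter)
      ultimately have "((\<lambda>h. G p h / h) \<longlongrightarrow> 0) (at 0)"
        by (simp add: filterlim_split_at)
      moreover have "G q 0 = 0" for q by (simp add: G_def)
      ultimately show ?thesis using 3 by (simp add: DERIV_def)
    qed
  qed
  have "half_bump = G 1" by (auto simp: half_bump_def G_def fun_eq_iff)
  then show ?thesis
    using der by (intro smooth_coinduct[of _ "range G"]) blast+
qed

definition bump :: "real => real" where
  "bump x = half_bump x * half_bump (1 - x)"

lemma smooth_bump: "smooth bump"
  using smooth_mult[OF smooth_half_bump smooth_affine[OF smooth_half_bump, of 1 "-1" 1]]
  by (simp add: bump_def[abs_def])

lemma bump_nonneg: "0 <= bump x"
  by (simp add: bump_def half_bump_def)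

lemma bump_eq_0: "x \<notin> {0<..<1} ==> bump x = 0"
  by (auto simp: bump_def half_bump_def)

lemma deriv_zero_on_open:
  fixes f :: "real => real"
  assumes "open U" "\<And>x. x \<in> U ==> f x = 0" "x \<in> U"
  shows "deriv f x = 0"
proof -
  have "\<forall>\<^sub>F y in nhds x. f y = 0"
    using eventually_nhds_in_open[OF assms(1,3)] by eventually_elim (rule assms(2))
  then have "(f has_real_derivative 0) (at x)"
    using DERIV_cong_ev[OF refl _ refl, where f=f and g="\<lambda>_. 0"] by auto
  then show ?thesis by (rule DERIV_imp_deriv)
qed

lemma smooth_imp_continuous: "smooth f ==> continuous_on A f"
  by (meson DERIV_continuous_on smooth_has_derivative has_field_derivative_at_within)

text \<open>A normalized primitive of a smooth bump.\<close>

lemma ex_smooth_step: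
  "\<exists>R. smooth R \<and> mono R \<and> (\<forall>x\<le>0. R x = 0) \<and> (\<forall>x\<ge>1. R x = (1::real))"
proof -
  define P where "P x = integral {-1..x} bump" for x
  have cont: "continuous_on A bump" for A by (intro smooth_imp_continuous smooth_bump)
  have P0: "P x = 0" if "x <= 0" for x
    unfolding P_def using that by (subst integral_cong[of _ _ "\<lambda>_. 0"]) (auto intro!: bump_eq_0)
  have der: "(P has_real_derivative bump x) (at x)" for x
  proof (cases "x < 0")
    case True
    have "\<forall>\<^sub>F y in nhds x. P y = 0"
      using True eventually_nhds_in_open[of "{..<0}" x] by (auto elim!: eventually_mono intro: P0)
    then have "(P has_real_derivative 0) (at x)"
      using DERIV_cong_ev[OF refl _ refl, where f=P and g="\<lambda>_. 0"] by auto
    then show ?thesis using True bump_eq_0[of x] by simp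
  next
    case False
    have "(P has_real_derivative bump x) (at x within {-1..x+1})"
      unfolding P_def using False by (intro integral_has_real_derivative cont) auto
    moreover have "at x within {-1..x+1} = at x"
      using False by (intro at_within_interior) auto
    ultimately show ?thesis by simp
  qed
  have P_mono: "P x <= P y" if "x <= y" for x y
    by (rule DERIV_nonneg_imp_nondecreasing[OF that]) (use der bump_nonneg in blast)
  have P1: "P x = P 1" if "1 <= x" for x
  proof (rule antisym)
    show "P x <= P 1"
    proof (rule DERIV_nonpos_imp_nonincreasing[OF that])
      fix y :: real assume "1 <= y"
      then show "\<exists>d. (P has_real_derivative d) (at y) \<and> d <= 0"
        using der[of y] bump_eq_0[of y] by auto
    qed
  qed (rule P_mono[OF that])
  have pos: "P 1 > 0"
  proof -
    have "P 0 < P 1"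
    proof (rule DERIV_pos_imp_increasing_open[where f=P and a=0 and b=1])
      show "\<exists>y. (P has_real_derivative y) (at x) \<and> 0 < y" if "0 < x" "x < 1" for x
        using der[of x] that by (intro exI[of _ "bump x"]) (auto simp: bump_def half_bump_def)
      show "continuous_on {0..1} P"
        by (intro continuous_at_imp_continuous_on) (auto intro: DERIV_isCont der)
    qed simp
    then show ?thesis using P0[of 0] by simp
  qed
  have "smooth (\<lambda>x. inverse (P 1) * P (1 * x + 0))"
    by (intro smooth_affine smooth_antiderivative[OF smooth_bump der])
  then have "smooth (\<lambda>x. P x / P 1)" by (simp add: field_simps)
  moreover have "mono (\<lambda>x. P x / P 1)"
    by (rule monoI) (simp add: divide_right_mono P_mono less_imp_le[OF pos])
  moreover have "P x / P 1 = 0" if "x <= 0" for x using P0[OF that] by simp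
  moreover have "P x / P 1 = 1" if "1 <= x" for x using P1[OF that] pos by simp
  ultimately show ?thesis by blast
qed

definition smooth_step :: "real => real" where
  "smooth_step = (SOME R. smooth R \<and> mono R \<and> (\<forall>x\<le>0. R x = 0) \<and> (\<forall>x\<ge>1. R x = (1::real)))"

lemma
  shows smooth_smooth_step: "smooth smooth_step"
    and mono_smooth_step: "mono smooth_step"
    and smooth_step_0: "x <= 0 ==> smooth_step x = 0"
    and smooth_step_1: "x >= 1 ==> smooth_step x = 1"
  using someI_ex[OF ex_smooth_step] unfolding smooth_step_def by blast+

lemma smooth_step_range: "0 <= smooth_step x" "smooth_step x <= 1"
proof -
  show "0 <= smooth_step x"
    using monoD[OF mono_smooth_step, of "min 0 x" x] smooth_step_0[of "min 0 x"] by simp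
  show "smooth_step x <= 1"
    using monoD[OF mono_smooth_step, of x "max 1 x"] smooth_step_1[of "max 1 x"] by simp
qed

text \<open>A smooth version of the indicator of \<open>{p..q}\<close>, in the form of a difference of two translates of one step.
Its derivative consists of an approximate identity at \<open>p\<close> and the negative of one at \<open>q\<close>, and sums over
adjacent intervals telescope.\<close>

definition plateau :: "real => real => real => real => real" where
  "plateau \<tau> p q x = smooth_step ((x - p) / \<tau>) - smooth_step ((x - q) / \<tau>)"

lemma smooth_plateau: "smooth (plateau \<tau> p q)"
proof -
  have "smooth (\<lambda>x. 1 * smooth_step (inverse \<tau> * x + (- p / \<tau>)) + (-1) * smooth_step (inverse \<tau> * x + (- q / \<tau>)))"
    by (intro smooth_add smooth_affine smooth_smooth_step)
  then show ?thesis
    by (simp add: plateau_def[abs_def] divide_inverse algebra_simps)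
qed

lemma plateau_zero: "0 < \<tau> ==> p <= q ==> x \<notin> {p..q+\<tau>} ==> plateau \<tau> p q x = 0"
  by (cases "x < p") (auto simp: plateau_def smooth_step_0 smooth_step_1 field_simps)

lemma plateau_one: "0 < \<tau> ==> p + \<tau> <= x ==> x <= q ==> plateau \<tau> p q x = 1"
  by (auto simp: plateau_def smooth_step_0 smooth_step_1 field_simps)

lemma plateau_bounds: "0 < \<tau> ==> p <= q ==> 0 <= plateau \<tau> p q x \<and> plateau \<tau> p q x <= 1"
  using monoD[OF mono_smooth_step, of "(x - q) / \<tau>" "(x - p) / \<tau>"]
    smooth_step_range[of "(x - q) / \<tau>"] smooth_step_range[of "(x - p) / \<tau>"]
  by (auto simp: plateau_def divide_right_mono)

lemma deriv_plateau:
  "deriv (plateau \<tau> p q) x = deriv smooth_step ((x - p) / \<tau>) / \<tau> - deriv smooth_step ((x - q) / \<tau>) / \<tau>"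
proof (rule DERIV_imp_deriv)
  have "((\<lambda>x. smooth_step ((x - r) / \<tau>)) has_real_derivative deriv smooth_step ((x - r) / \<tau>) / \<tau>) (at x)" for r
  proof -
    have "((\<lambda>x. (x - r) / \<tau>) has_real_derivative 1 / \<tau>) (at x)"
      by (auto intro!: derivative_eq_intros simp: divide_inverse)
    from DERIV_chain'[OF this smooth_has_derivative[OF smooth_smooth_step]] show ?thesis by simp
  qed
  from DERIV_diff[OF this[of p] this[of q]]
  show "(plateau \<tau> p q has_real_derivative
     deriv smooth_step ((x - p) / \<tau>) / \<tau> - deriv smooth_step ((x - q) / \<tau>) / \<tau>) (at x)"
    by (simp add: plateau_def[abs_def])
qed

lemma test_functions_iff:
  "\<phi> \<in> test_functions I \<longleftrightarrow> smooth \<phi> \<and> (\<exists>K. compact K \<and> K \<subseteq> I \<and> (\<forall>x. x \<notin> K --> \<phi> x = 0))"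
  by (simp add: test_functions_def smooth_def)

lemma plateau_test_function:
  assumes "0 < \<tau>" "p <= q" "{p..q+\<tau>} \<subseteq> I"
  shows "plateau \<tau> p q \<in> test_functions I"
  unfolding test_functions_iff
  using smooth_plateau plateau_zero[OF assms(1,2)] assms(3)
  by (intro conjI exI[of _ "{p..q+\<tau>}"]) auto

section \<open>Lebesgue points\<close>

lemma integrable_lebesgue_on_iff:
  "S \<in> sets lebesgue ==> integrable (lebesgue_on S) f \<longleftrightarrow> f absolutely_integrable_on S"
  by (simp add: set_integrable_def integrable_restrict_space)

lemma LINT_eq_integral:
  fixes f :: "real => real"
  shows "f absolutely_integrable_on S ==> S \<in> sets lebesgue ==> (LINT x|lebesgue_on S. f x) = integral S f"
  by (simp add: integrable_lebesgue_on_iff lebesgue_integral_eq_integral)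

lemma LINT_supported:
  fixes f :: "real => real"
  assumes "T \<subseteq> S" "S \<in> sets lebesgue" "T \<in> sets lebesgue" "\<And>x. x \<in> S ==> x \<notin> T ==> f x = 0"
  shows "(LINT x|lebesgue_on S. f x) = (LINT x|lebesgue_on T. f x)"
proof -
  have "(LINT x|lebesgue_on S. f x) = (LINT x|lebesgue_on S. (if x \<in> T then f x else 0))"
    using assms by (intro Bochner_Integration.integral_cong) auto
  then show ?thesis using integral_restrict[OF assms(1) assms(3) assms(2), of f] by simp
qed

text \<open>The notion is one-sided because the kernels \<open>deriv smooth_step (_ / \<tau>) / \<tau>\<close> are supported to the right of their
base point.\<close>

definition lebesgue_point :: "(real => real) => real => bool" where
  "lebesgue_point f x \<longleftrightarrow>
     ((\<lambda>h. integral {x..x+h} (\<lambda>y. \<bar>f y - f x\<bar>) / h) \<longlongrightarrow> 0) (at_right 0)"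

text \<open>Differentiation of the integrals of \<open>\<bar>f - q\<bar>\<close> for all rational \<open>q\<close> at once; a rational \<open>q\<close> close to \<open>f x\<close> then
gives the claim at \<open>x\<close>.\<close>

lemma AE_lebesgue_point:
  fixes f :: "real => real"
  assumes f: "f absolutely_integrable_on {c..d}"
  shows "AE x in lebesgue. x \<in> {c<..<d} --> lebesgue_point f x"
proof -
  define F where "F = (\<lambda>x. if x \<in> {c..d} then f x else 0)"
  have F: "F absolutely_integrable_on UNIV"
    using f unfolding F_def absolutely_integrable_restrict_UNIV .
  have Fq: "(\<lambda>x. F x - q) absolutely_integrable_on {a..b}" for q a b :: real
  proof -
    have "F absolutely_integrable_on {a..b}"
      using F absolutely_integrable_on_subinterval by blast
    moreover have "(\<lambda>x. q) absolutely_integrable_on {a..b}"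
      by (intro absolutely_integrable_continuous_real continuous_intros)
    ultimately show ?thesis by (rule set_integral_diff(1))
  qed
  have Fqa: "(\<lambda>x. \<bar>F x - q\<bar>) absolutely_integrable_on {a..b}" for q a b :: real
    by (rule absolutely_integrable_norm[OF Fq, unfolded o_def real_norm_def])
  have "\<exists>N. negligible N \<and> (\<forall>x e. x \<notin> N \<and> 0 < e --> (\<exists>d>0. \<forall>h. 0 < h \<and> h < d -->
            norm (integral (cbox x (x + h *\<^sub>R One)) (\<lambda>x. \<bar>F x - q\<bar>) /\<^sub>R h ^ DIM(real) - \<bar>F x - q\<bar>) < e))" for q
  proof -
    have *: "(\<lambda>x. \<bar>F x - q\<bar>) integrable_on cbox a b" for a b
      using Fqa[where q=q and a=a and b=b] unfolding absolutely_integrable_on_def box_real by (rule conjunct1)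
    show ?thesis
      by (rule integrable_ccontinuous_explicit[of "\<lambda>x. \<bar>F x - q\<bar>", OF *]) metis
  qed
  then obtain N where N: "\<And>q. negligible (N q)"
    and Nq': "\<And>q x e. x \<notin> N q ==> 0 < e ==> \<exists>d>0. \<forall>h. 0 < h \<and> h < d -->
            norm (integral (cbox x (x + h *\<^sub>R One)) (\<lambda>x. \<bar>F x - q\<bar>) /\<^sub>R h ^ DIM(real) - \<bar>F x - q\<bar>) < e"
    by metis
  have Nq: "\<exists>d>0. \<forall>h. 0 < h \<and> h < d -->
            \<bar>integral {x..x + h} (\<lambda>x. \<bar>F x - q\<bar>) / h - \<bar>F x - q\<bar>\<bar> < e" if "x \<notin> N q" "0 < e" for q x e
    using Nq'[OF that] by (simp add: divide_inverse mult.commute)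
  define NN where "NN = (\<Union>q\<in>\<rat>. N q)"
  have "negligible NN" unfolding NN_def
    using N by (metis (no_types, lifting) countable_rat countable_image imageE negligible_countable_Union)
  then have "AE x in lebesgue. x \<notin> NN"
    by (simp add: AE_not_in negligible_iff_null_sets)
  moreover have "lebesgue_point f x" if x: "x \<notin> NN" "x \<in> {c<..<d}" for x
    unfolding lebesgue_point_def
  proof (rule tendstoI)
    fix e :: real assume e: "e > 0"
    have "\<exists>q\<in>\<rat>. f x < q \<and> q < f x + e/3" using e by (intro Rats_dense_in_real) auto
    then obtain q where q: "q \<in> \<rat>" "\<bar>f x - q\<bar> < e/3" by fastforce
    obtain D where D: "D > 0" and DD: "\<And>h. 0 < h ==> h < D ==> \<bar>integral {x..x + h} (\<lambda>x. \<bar>F x - q\<bar>) / h - \<bar>F x - q\<bar>\<bar> < e/3"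
      using Nq[of x q "e/3"] x q e unfolding NN_def by auto
    have "dist (integral {x..x+h} (\<lambda>y. \<bar>f y - f x\<bar>) / h) 0 < e" if h: "0 < h" "h < min D (d - x)" for h
    proof -
      have "integral {x..x+h} (\<lambda>y. \<bar>f y - f x\<bar>) = integral {x..x+h} (\<lambda>y. \<bar>F y - F x\<bar>)"
        using h x by (intro integral_cong) (auto simp: F_def)
      also have "\<dots> <= integral {x..x+h} (\<lambda>y. \<bar>F y - q\<bar> + \<bar>F x - q\<bar>)"
        using Fqa[where q="F x" and a=x and b="x+h"] Fqa[where q=q and a=x and b="x+h"]
        by (intro integral_le integrable_add) (auto simp: absolutely_integrable_on_def)
      also have "\<dots> = integral {x..x+h} (\<lambda>y. \<bar>F y - q\<bar>) + h * \<bar>F x - q\<bar>"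
        using Fqa[where q=q and a=x and b="x+h"] h by (subst integral_add) (auto simp: absolutely_integrable_on_def)
      finally have "integral {x..x+h} (\<lambda>y. \<bar>f y - f x\<bar>) / h <= integral {x..x+h} (\<lambda>y. \<bar>F y - q\<bar>) / h + \<bar>F x - q\<bar>"
        using h by (simp add: field_simps)
      moreover have "F x = f x" using x by (simp add: F_def)
      moreover have "0 <= integral {x..x+h} (\<lambda>y. \<bar>f y - f x\<bar>)" 
        by (cases "(\<lambda>y. \<bar>f y - f x\<bar>) integrable_on {x..x+h}")
           (auto intro: Henstock_Kurzweil_Integration.integral_nonneg simp: not_integrable_integral)
      ultimately have "integral {x..x+h} (\<lambda>y. \<bar>f y - f x\<bar>) / h < e" "0 <= integral {x..x+h} (\<lambda>y. \<bar>f y - f x\<bar>) / h"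
        using DD[of h] h q(2) by (linarith, simp)
      then show ?thesis unfolding dist_real_def by linarith
    qed
    moreover have "0 < min D (d - x)" using D x by auto
    ultimately show "\<forall>\<^sub>F h in at_right 0. dist (integral {x..x+h} (\<lambda>y. \<bar>f y - f x\<bar>) / h) 0 < e"
      unfolding eventually_at_right_field by blast
  qed
  ultimately show ?thesis by (auto elim: AE_mp)
qed

lemma L1_loc_interval:
  assumes "f \<in> L1_loc I" "{p..q} \<subseteq> I" shows "f absolutely_integrable_on {p..q}"
  using assms by (auto simp: L1_loc_def integrable_lebesgue_on_iff)

lemma AE_lebesgue_point_open:
  assumes "open I" "f \<in> L1_loc I"
  shows "AE x in lebesgue. x \<in> I --> lebesgue_point f x"
proof -
  define Q where "Q = {(c,d). c \<in> \<rat> \<and> d \<in> \<rat> \<and> {c..d} \<subseteq> I}"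
  have "countable Q" unfolding Q_def
    by (rule countable_subset[of _ "\<rat> \<times> \<rat>"]) (auto intro: countable_SIGMA countable_rat)
  have *: "AE x in lebesgue. \<forall>i\<in>Q. x \<in> {fst i<..<snd i} --> lebesgue_point f x"
    unfolding AE_ball_countable[OF \<open>countable Q\<close>]
  proof (rule ballI)
    fix i assume "i \<in> Q"
    then have "{fst i..snd i} \<subseteq> I" by (auto simp: Q_def)
    from AE_lebesgue_point[OF L1_loc_interval[OF assms(2) this]]
    show "AE x in lebesgue. x \<in> {fst i<..<snd i} --> lebesgue_point f x" .
  qed
  have "\<exists>i\<in>Q. x \<in> {fst i<..<snd i}" if xI: "x \<in> I" for x
  proof -
    obtain e where e: "e > 0" "ball x e \<subseteq> I" using xI assms(1) open_contains_ball by metis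
    obtain c where c: "c \<in> \<rat>" "x - e < c" "c < x" using Rats_dense_in_real[of "x - e" x] e by auto
    obtain d where d: "d \<in> \<rat>" "x < d" "d < x + e" using Rats_dense_in_real[of x "x + e"] e by auto
    have "{c..d} \<subseteq> ball x e" using c d by (auto simp: dist_real_def)
    then show ?thesis using c d e by (intro bexI[of _ "(c,d)"]) (auto simp: Q_def)
  qed
  then have "(\<forall>i\<in>Q. x \<in> {fst i<..<snd i} --> lebesgue_point f x) --> x \<in> I --> lebesgue_point f x" for x
    by blast
  from AE_mp[OF * AE_I2[OF this]] show ?thesis .
qed

lemma continuous_deriv_smooth_step: "continuous_on A (deriv smooth_step)"
  by (intro smooth_imp_continuous smooth_deriv smooth_smooth_step)

lemma continuous_kernel:
  "\<tau> \<noteq> 0 ==> continuous_on A (\<lambda>y. deriv smooth_step ((y - p) / \<tau>) / \<tau>)"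
  by (intro continuous_intros continuous_on_compose2[OF continuous_deriv_smooth_step[of UNIV]]) auto

lemma deriv_smooth_step_0: "x \<notin> {0..1} ==> deriv smooth_step x = 0"
proof -
  assume x: "x \<notin> {0..1}"
  have "\<forall>\<^sub>F y in nhds x. smooth_step y = smooth_step x"
  proof (cases "x < 0")
    case True
    have "\<forall>\<^sub>F y in nhds x. y \<in> {..<0}" by (rule eventually_nhds_in_open) (use True in auto)
    then show ?thesis by eventually_elim (use True in \<open>simp add: smooth_step_0\<close>)
  next
    case False
    have "\<forall>\<^sub>F y in nhds x. y \<in> {1<..}" by (rule eventually_nhds_in_open) (use x False in auto)
    then show ?thesis by eventually_elim (use x False in \<open>simp add: smooth_step_1\<close>)
  qed
  then have "(smooth_step has_real_derivative 0) (at x)"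
    using DERIV_cong_ev[OF refl _ refl, where f=smooth_step and g="\<lambda>_. smooth_step x"] by auto
  then show ?thesis by (rule DERIV_imp_deriv)
qed

lemma mollifier_tendsto:
  fixes f :: "real => real"
  assumes f: "f absolutely_integrable_on {p..p+h0}" "h0 > 0" and L: "lebesgue_point f p"
  shows "((\<lambda>\<tau>. integral {p..p+\<tau>} (\<lambda>y. f y * (deriv smooth_step ((y - p) / \<tau>) / \<tau>))) \<longlongrightarrow> f p) (at_right 0)"
proof -
  obtain B where B: "\<And>x. \<bar>deriv smooth_step x\<bar> <= B" "B > 0"
  proof -
    have "compact (deriv smooth_step ` {0..1})"
      by (intro compact_continuous_image continuous_deriv_smooth_step) auto
    then obtain B where "\<And>x. x \<in> {0..1} ==> \<bar>deriv smooth_step x\<bar> <= B" "B > 0"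
      using compact_imp_bounded bounded_pos by (metis imageI real_norm_def)
    then have "\<bar>deriv smooth_step x\<bar> <= B" for x
      by (cases "x \<in> {0..1}") (auto simp: deriv_smooth_step_0)
    then show ?thesis using that \<open>B > 0\<close> by blast
  qed
  have est: "\<bar>integral {p..p+\<tau>} (\<lambda>y. f y * (deriv smooth_step ((y - p) / \<tau>) / \<tau>)) - f p\<bar>
      <= B * (integral {p..p+\<tau>} (\<lambda>y. \<bar>f y - f p\<bar>) / \<tau>)" if \<tau>: "0 < \<tau>" "\<tau> < h0" for \<tau>
  proof -
    let ?k = "\<lambda>y. deriv smooth_step ((y - p) / \<tau>) / \<tau>"
    have k: "continuous_on {p..p+\<tau>} ?k" using \<tau> by (simp add: continuous_kernel)
    have fi: "f absolutely_integrable_on {p..p+\<tau>}"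
      using f \<tau> by (auto elim: absolutely_integrable_on_subinterval)
    have ci: "(\<lambda>y. f p) absolutely_integrable_on {p..p+\<tau>}"
      by (intro absolutely_integrable_continuous_real continuous_intros)
    have prod: "(\<lambda>y. ?k y * g y) absolutely_integrable_on {p..p+\<tau>}" if "g absolutely_integrable_on {p..p+\<tau>}" for g
      using that compact_imp_bounded[OF compact_continuous_image[OF k]] k
      by (intro absolutely_integrable_bounded_measurable_product_real continuous_imp_measurable_on_sets_lebesgue) auto
    have one: "(?k has_integral 1) {p..p+\<tau>}"
    proof -
      have "(?k has_integral (smooth_step ((p + \<tau> - p) / \<tau>) - smooth_step ((p - p) / \<tau>))) {p..p+\<tau>}"
      proof (rule fundamental_theorem_of_calculus)
        fix x
        have "((\<lambda>x. (x - p) / \<tau>) has_real_derivative 1 / \<tau>) (at x)"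
          by (auto intro!: derivative_eq_intros simp: divide_inverse)
        from DERIV_chain'[OF this smooth_has_derivative[OF smooth_smooth_step]]
        have "((\<lambda>x. smooth_step ((x - p) / \<tau>)) has_real_derivative ?k x) (at x)" by simp
        then show "((\<lambda>x. smooth_step ((x - p) / \<tau>)) has_vector_derivative ?k x) (at x within {p..p+\<tau>})"
          using has_real_derivative_iff_has_vector_derivative has_vector_derivative_at_within by blast
      qed (use \<tau> in auto)
      then show ?thesis using \<tau> by (simp add: smooth_step_0 smooth_step_1)
    qed
    have "integral {p..p+\<tau>} (\<lambda>y. f y * ?k y) - f p = integral {p..p+\<tau>} (\<lambda>y. ?k y * f y) - integral {p..p+\<tau>} (\<lambda>y. ?k y * f p)"
    proof -
      have "((\<lambda>y. ?k y * f p) has_integral 1 * f p) {p..p+\<tau>}" by (rule has_integral_mult_left[OF one])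
      then have "integral {p..p+\<tau>} (\<lambda>y. ?k y * f p) = 1 * f p" by (rule integral_unique)
      then show ?thesis by (simp add: mult.commute)
    qed
    also have "\<dots> = integral {p..p+\<tau>} (\<lambda>y. ?k y * (f y - f p))"
      using prod[OF fi] prod[OF ci]
      by (subst integral_diff[symmetric]) (auto simp: absolutely_integrable_on_def right_diff_distrib)
    also have "\<bar>\<dots>\<bar> <= integral {p..p+\<tau>} (\<lambda>y. B / \<tau> * \<bar>f y - f p\<bar>)"
    proof -
      have d: "(\<lambda>y. f y - f p) absolutely_integrable_on {p..p+\<tau>}" by (rule set_integral_diff(1)[OF fi ci])
      have "\<bar>?k y * (f y - f p)\<bar> <= B / \<tau> * \<bar>f y - f p\<bar>" for y
        using B(1)[of "(y - p) / \<tau>"] \<tau> by (auto simp: abs_mult intro!: mult_right_mono divide_right_mono)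
      moreover have "(\<lambda>y. B / \<tau> * \<bar>f y - f p\<bar>) integrable_on {p..p+\<tau>}"
        using d by (intro integrable_on_mult_right) (simp add: absolutely_integrable_on_def)
      moreover have "(\<lambda>y. ?k y * (f y - f p)) integrable_on {p..p+\<tau>}"
        using prod[OF d] by (simp only: absolutely_integrable_on_def)
      ultimately show ?thesis
        unfolding real_norm_def[symmetric] by (intro integral_norm_bound_integral)
    qed
    finally show ?thesis by simp
  qed
  have "((\<lambda>\<tau>. integral {p..p+\<tau>} (\<lambda>y. f y * (deriv smooth_step ((y - p) / \<tau>) / \<tau>)) - f p) \<longlongrightarrow> 0) (at_right 0)"
  proof (rule Lim_null_comparison)
    show "((\<lambda>\<tau>. B * (integral {p..p+\<tau>} (\<lambda>y. \<bar>f y - f p\<bar>) / \<tau>)) \<longlongrightarrow> 0) (at_right 0)"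
      using tendsto_mult[OF tendsto_const L[unfolded lebesgue_point_def]] by simp
    show "\<forall>\<^sub>F \<tau> in at_right 0. norm (integral {p..p+\<tau>} (\<lambda>y. f y * (deriv smooth_step ((y - p) / \<tau>) / \<tau>)) - f p)
        <= B * (integral {p..p+\<tau>} (\<lambda>y. \<bar>f y - f p\<bar>) / \<tau>)"
      unfolding eventually_at_right_field using est f(2) by (auto intro!: exI[of _ h0])
  qed
  then show ?thesis using LIM_zero_iff by blast
qed

text \<open>Testing a weak derivative with plateaus recovers point values: the derivative of the plateau averages
\<open>f\<close> over short intervals to the right of \<open>p\<close> and of \<open>q\<close>.\<close>

lemma LINT_mult_deriv_plateau_tendsto:
  assumes I: "open I" and f: "f \<in> L1_loc I" and pq: "p \<in> I" "q \<in> I"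
    and L: "lebesgue_point f p" "lebesgue_point f q"
  shows "((\<lambda>\<tau>. LINT x|lebesgue_on I. f x * deriv (plateau \<tau> p q) x) \<longlongrightarrow> f p - f q) (at_right 0)"
proof -
  have one: "\<exists>h0>0. {r..r+h0} \<subseteq> I \<and> (\<forall>\<tau>. 0 < \<tau> \<and> \<tau> < h0 -->
      integrable (lebesgue_on I) (\<lambda>x. f x * (deriv smooth_step ((x - r) / \<tau>) / \<tau>)) \<and>
      (LINT x|lebesgue_on I. f x * (deriv smooth_step ((x - r) / \<tau>) / \<tau>)) =
        integral {r..r+\<tau>} (\<lambda>x. f x * (deriv smooth_step ((x - r) / \<tau>) / \<tau>)))"
    if r: "r \<in> I" for r
  proof -
    obtain e where e: "e > 0" "ball r e \<subseteq> I" using r I open_contains_ball by metis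
    define h0 where "h0 = e / 2"
    have h0: "{r..r+h0} \<subseteq> I" "h0 > 0" using e by (auto simp: h0_def dist_real_def subset_eq)
    have "integrable (lebesgue_on I) (\<lambda>x. f x * (deriv smooth_step ((x - r) / \<tau>) / \<tau>)) \<and>
      (LINT x|lebesgue_on I. f x * (deriv smooth_step ((x - r) / \<tau>) / \<tau>)) =
        integral {r..r+\<tau>} (\<lambda>x. f x * (deriv smooth_step ((x - r) / \<tau>) / \<tau>))" if \<tau>: "0 < \<tau>" "\<tau> < h0" for \<tau>
    proof -
      let ?g = "\<lambda>x. f x * (deriv smooth_step ((x - r) / \<tau>) / \<tau>)"
      have z: "?g x = 0" if "x \<notin> {r..r+\<tau>}" for x
      proof -
        have "(x - r) / \<tau> \<notin> {0..1}" using that \<tau> by (auto simp: field_simps)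
        then show ?thesis by (simp add: deriv_smooth_step_0)
      qed
      have k: "continuous_on {r..r+\<tau>} (\<lambda>y. deriv smooth_step ((y - r) / \<tau>) / \<tau>)"
          using \<tau> by (simp add: continuous_kernel)
      have sub: "{r..r+\<tau>} \<subseteq> I" using h0 \<tau> by auto
      have "(\<lambda>x. (deriv smooth_step ((x - r) / \<tau>) / \<tau>) * f x) absolutely_integrable_on {r..r+\<tau>}"
        using L1_loc_interval[OF f sub] compact_imp_bounded[OF compact_continuous_image[OF k]] k
        by (intro absolutely_integrable_bounded_measurable_product_real continuous_imp_measurable_on_sets_lebesgue) auto
      then have ai: "?g absolutely_integrable_on {r..r+\<tau>}" by (simp add: mult.commute)
      have Im: "I \<in> sets lebesgue" using I by auto
      have "integrable lebesgue (\<lambda>x. if x \<in> I then ?g x else 0)"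
      proof -
        have "(\<lambda>x. if x \<in> I then ?g x else 0) = (\<lambda>x. if x \<in> {r..r+\<tau>} then ?g x else 0)"
          using sub z by (auto simp: fun_eq_iff)
        moreover have "integrable lebesgue (\<lambda>x. if x \<in> {r..r+\<tau>} then ?g x else 0)"
        proof -
          have "{r..r+\<tau>} \<in> sets lebesgue" by auto
          from iffD2[OF Lebesgue_Measure.integrable_restrict_UNIV[OF this] iffD2[OF integrable_lebesgue_on_iff[OF this] ai]]
          show ?thesis .
        qed
        ultimately show ?thesis by simp
      qed
      moreover have "(LINT x|lebesgue_on I. ?g x) = integral {r..r+\<tau>} ?g"
      proof -
        have "{r..r+\<tau>} \<in> sets lebesgue" by auto
        from LINT_supported[OF sub Im this, of ?g] LINT_eq_integral[OF ai this] z show ?thesis by metis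
      qed
      ultimately show ?thesis using Lebesgue_Measure.integrable_restrict_UNIV[OF Im] by blast
    qed
    then show ?thesis using h0 by blast
  qed
  obtain h1 where h1: "h1 > 0" "{p..p+h1} \<subseteq> I" and H1: "\<And>\<tau>. 0 < \<tau> ==> \<tau> < h1 ==>
      integrable (lebesgue_on I) (\<lambda>x. f x * (deriv smooth_step ((x - p) / \<tau>) / \<tau>)) \<and>
      (LINT x|lebesgue_on I. f x * (deriv smooth_step ((x - p) / \<tau>) / \<tau>)) =
        integral {p..p+\<tau>} (\<lambda>x. f x * (deriv smooth_step ((x - p) / \<tau>) / \<tau>))"
    using one[OF pq(1)] by blast
  obtain h2 where h2: "h2 > 0" "{q..q+h2} \<subseteq> I" and H2: "\<And>\<tau>. 0 < \<tau> ==> \<tau> < h2 ==>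
      integrable (lebesgue_on I) (\<lambda>x. f x * (deriv smooth_step ((x - q) / \<tau>) / \<tau>)) \<and>
      (LINT x|lebesgue_on I. f x * (deriv smooth_step ((x - q) / \<tau>) / \<tau>)) =
        integral {q..q+\<tau>} (\<lambda>x. f x * (deriv smooth_step ((x - q) / \<tau>) / \<tau>))"
    using one[OF pq(2)] by blast
  have lim: "((\<lambda>\<tau>. integral {p..p+\<tau>} (\<lambda>y. f y * (deriv smooth_step ((y - p) / \<tau>) / \<tau>)) -
      integral {q..q+\<tau>} (\<lambda>y. f y * (deriv smooth_step ((y - q) / \<tau>) / \<tau>))) \<longlongrightarrow> f p - f q) (at_right 0)"
    using h1 h2 by (intro tendsto_diff mollifier_tendsto[where ?h0.0=h1] mollifier_tendsto[where ?h0.0=h2] L L1_loc_interval[OF f]) auto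
  have "\<forall>\<^sub>F \<tau> in at_right 0. integral {p..p+\<tau>} (\<lambda>y. f y * (deriv smooth_step ((y - p) / \<tau>) / \<tau>)) -
      integral {q..q+\<tau>} (\<lambda>y. f y * (deriv smooth_step ((y - q) / \<tau>) / \<tau>))
     = (LINT x|lebesgue_on I. f x * deriv (plateau \<tau> p q) x)"
    unfolding eventually_at_right_field
  proof (intro exI[of _ "min h1 h2"] conjI allI impI)
    fix \<tau> assume \<tau>: "0 < \<tau>" "\<tau> < min h1 h2"
    show "integral {p..p+\<tau>} (\<lambda>y. f y * (deriv smooth_step ((y - p) / \<tau>) / \<tau>)) -
      integral {q..q+\<tau>} (\<lambda>y. f y * (deriv smooth_step ((y - q) / \<tau>) / \<tau>))
     = (LINT x|lebesgue_on I. f x * deriv (plateau \<tau> p q) x)"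
      using H1[of \<tau>] H2[of \<tau>] \<tau> by (simp add: deriv_plateau right_diff_distrib)
  qed (use h1 h2 in auto)
  then show ?thesis by (rule Lim_transform_eventually[OF lim])
qed

lemma LINT_mult_plateau_tendsto:
  assumes I: "open I" and g: "g \<in> L1_loc I" and pq: "p <= q" "{p..q+h} \<subseteq> I" "h > 0"
  shows "(\<lambda>n. LINT x|lebesgue_on I. g x * plateau (h / real (Suc n)) p q x) \<longlonglongrightarrow> integral {p..q} g"
proof -
  have Im: "I \<in> sets lebesgue" using I by auto
  have gi: "g absolutely_integrable_on {p..q+h}" by (rule L1_loc_interval[OF g pq(2)])
  then have gL: "integrable (lebesgue_on {p..q+h}) g" by (simp add: integrable_lebesgue_on_iff)
  have "(\<lambda>n. LINT x|lebesgue_on {p..q+h}. g x * plateau (h / real (Suc n)) p q x) \<longlonglongrightarrow>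
        (LINT x|lebesgue_on {p..q+h}. (if x \<in> {p<..q} then g x else 0))"
  proof (rule integral_dominated_convergence[where w="\<lambda>x. \<bar>g x\<bar>"])
    show "AE x in lebesgue_on {p..q+h}. (\<lambda>n. g x * plateau (h / real (Suc n)) p q x) \<longlonglongrightarrow> (if x \<in> {p<..q} then g x else 0)"
    proof (rule AE_I2)
      fix x assume "x \<in> space (lebesgue_on {p..q+h})"
      then have x: "p <= x" "x <= q + h" by auto
      have ev: "\<forall>\<^sub>F n in sequentially. h / real (Suc n) < d" if "d > 0" for d
      proof -
        have "(\<lambda>n. h * (1 / real (Suc n))) \<longlonglongrightarrow> h * 0" by (intro tendsto_mult tendsto_const LIMSEQ_Suc lim_1_over_n)
        then have "(\<lambda>n. h / real (Suc n)) \<longlonglongrightarrow> 0" by simp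
        then show ?thesis using that by (rule order_tendstoD(2))
      qed
      consider "x = p" | "p < x" "x <= q" | "q < x" using x by linarith
      then have "\<forall>\<^sub>F n in sequentially. plateau (h / real (Suc n)) p q x = (if x \<in> {p<..q} then 1 else 0)"
      proof cases
        case 1
        have "smooth_step ((p - q) / (h / real (Suc n))) = 0" for n
          using pq by (intro smooth_step_0 divide_nonpos_pos) auto
        then show ?thesis unfolding plateau_def 1 by (simp only: diff_self div_0 smooth_step_0) simp
      next
        case 2
        show ?thesis using ev[of "x - p"] 2(1)
          by (auto elim!: eventually_mono intro!: plateau_one simp: pq 2 simp del: of_nat_Suc)
      next
        case 3
        have "\<forall>\<^sub>F n in sequentially. h / real (Suc n) < x - q" using 3 by (intro ev) auto
        then show ?thesis
          by eventually_elim (use 3 pq in \<open>auto intro!: plateau_zero simp del: of_nat_Suc\<close>)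
      qed
      then show "(\<lambda>n. g x * plateau (h / real (Suc n)) p q x) \<longlonglongrightarrow> (if x \<in> {p<..q} then g x else 0)"
        by (intro tendsto_eventually) (auto elim!: eventually_mono)
    qed
    show "(\<lambda>x. if x \<in> {p<..q} then g x else 0) \<in> borel_measurable (lebesgue_on {p..q+h})"
      using borel_measurable_integrable[OF gL]
      by (intro measurable_If_set) (simp_all add: sets_restrict_space_iff)
    show "(\<lambda>x. g x * plateau (h / real (Suc n)) p q x) \<in> borel_measurable (lebesgue_on {p..q+h})" for n
      using borel_measurable_integrable[OF gL]
      by (intro borel_measurable_times[OF borel_measurable_integrable[OF gL]] continuous_imp_measurable_on_sets_lebesgue smooth_imp_continuous smooth_plateau) auto
    show "integrable (lebesgue_on {p..q+h}) (\<lambda>x. \<bar>g x\<bar>)" using gL by simp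
    show "AE x in lebesgue_on {p..q+h}. norm (g x * plateau (h / real (Suc n)) p q x) <= \<bar>g x\<bar>" for n
    proof (rule AE_I2)
      fix x
      show "norm (g x * plateau (h / real (Suc n)) p q x) <= \<bar>g x\<bar>"
        using plateau_bounds[of "h / real (Suc n)" p q x] pq
        by (simp add: abs_mult mult_left_le del: of_nat_Suc)
    qed
  qed
  moreover have "(LINT x|lebesgue_on I. g x * plateau (h / real (Suc n)) p q x) =
     (LINT x|lebesgue_on {p..q+h}. g x * plateau (h / real (Suc n)) p q x)" for n
  proof (rule LINT_supported)
    fix x assume "x \<in> I" "x \<notin> {p..q+h}"
    moreover have "h / real (Suc n) <= h" using pq by (simp add: field_simps)
    ultimately have "x \<notin> {p..q + h / real (Suc n)}" by auto
    then show "g x * plateau (h / real (Suc n)) p q x = 0"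
      using plateau_zero[of "h / real (Suc n)" p q x] pq by simp
  qed (use Im pq in auto)
  moreover have "(LINT x|lebesgue_on {p..q+h}. (if x \<in> {p<..q} then g x else 0)) = integral {p..q} g"
  proof -
    have "(LINT x|lebesgue_on {p..q+h}. (if x \<in> {p<..q} then g x else 0)) = (LINT x|lebesgue_on {p<..q}. g x)"
      using pq by (intro integral_restrict) auto
    also have "g absolutely_integrable_on {p<..q}"
      by (rule set_integrable_subset[OF gi]) (use pq in auto)
    then have "(LINT x|lebesgue_on {p<..q}. g x) = integral {p<..q} g"
      by (intro LINT_eq_integral) auto
    also have "\<dots> = integral {p..q} g"
      by (rule integral_spike_set) (auto intro: negligible_subset[of "{p}"])
    finally show ?thesis .
  qed
  ultimately show ?thesis by simp
qed

text \<open>The fundamental theorem of calculus for weak derivatives, obtained by letting the width \<open>\<tau>\<close> of the flanks of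
the plateau on \<open>{p..q}\<close> tend to zero in the definition of \<open>has_weak_deriv\<close>.\<close>

lemma weak_deriv_lebesgue_points:
  assumes w: "has_weak_deriv I u g" and I: "open I" and pq: "p <= q" "{p..q} \<subseteq> I"
    and L: "lebesgue_point u p" "lebesgue_point u q"
  shows "integral {p..q} g = u q - u p"
proof -
  have u: "u \<in> L1_loc I" and g: "g \<in> L1_loc I" using w by (auto simp: has_weak_deriv_def)
  have in_I: "p \<in> I" "q \<in> I" using pq by auto
  obtain e where e: "e > 0" "ball q e \<subseteq> I" using in_I I open_contains_ball by metis
  define h where "h = e / 2"
  have "{q..q+h} \<subseteq> ball q e" using e by (auto simp: h_def dist_real_def)
  then have h: "h > 0" "{p..q+h} \<subseteq> I" using e pq
    by (auto simp: h_def subset_eq)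
  define t where "t n = h / real (Suc n)" for n
  have t: "0 < t n" "t n <= h" for n using h by (auto simp: t_def field_simps)
  have t0: "filterlim t (at_right 0) sequentially"
  proof -
    have "(\<lambda>n. h * (1 / real (Suc n))) \<longlonglongrightarrow> h * 0" by (intro tendsto_mult tendsto_const LIMSEQ_Suc lim_1_over_n)
    then have "t \<longlonglongrightarrow> 0" by (simp add: t_def[abs_def])
    then show "filterlim t (at_right 0) sequentially"
      using t(1) by (simp add: filterlim_at greaterThan_def less_imp_neq[symmetric])
  qed
  have A: "(\<lambda>n. LINT x|lebesgue_on I. u x * deriv (plateau (t n) p q) x) \<longlonglongrightarrow> u p - u q"
    by (rule filterlim_compose[OF LINT_mult_deriv_plateau_tendsto[OF I u in_I L] t0])
  have "(LINT x|lebesgue_on I. u x * deriv (plateau (t n) p q) x) = - (LINT x|lebesgue_on I. g x * plateau (t n) p q x)" for n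
  proof -
    have "{p..q + t n} \<subseteq> I" using h(2) t[of n] by auto
    then have "plateau (t n) p q \<in> test_functions I"
      using t[of n] pq by (intro plateau_test_function) auto
    then show ?thesis using w by (auto simp: has_weak_deriv_def)
  qed
  moreover have "(\<lambda>n. - (LINT x|lebesgue_on I. g x * plateau (t n) p q x)) \<longlonglongrightarrow> - integral {p..q} g"
    unfolding t_def by (intro tendsto_minus LINT_mult_plateau_tendsto I g pq(1) h)
  ultimately have "u p - u q = - integral {p..q} g" using A LIMSEQ_unique by simp
  then show ?thesis by simp
qed

section \<open>Absolutely continuous representatives\<close>

lemma AE_lebesgue_obtain_negligible:
  assumes "AE x in lebesgue. P (x::real)"
  obtains N where "negligible N" "\<And>x. x \<notin> N ==> P x"
proof -
  obtain N where "N \<in> null_sets lebesgue" "{x \<in> space lebesgue. \<not> P x} \<subseteq> N"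
    using assms unfolding eventually_ae_filter by blast
  then show ?thesis using that[of N] by (auto simp: negligible_iff_null_sets)
qed

lemma AE_lebesgue_dense:
  assumes "AE x in lebesgue. P (x::real)" "a < b"
  shows "\<exists>x. a < x \<and> x < b \<and> P x"
proof (rule ccontr)
  obtain N where N: "negligible N" "\<And>x. x \<notin> N ==> P x"
    using AE_lebesgue_obtain_negligible[OF assms(1)] by metis
  assume "\<not> ?thesis"
  then have "box a b \<subseteq> N" using N(2) by (force simp: box_real)
  then have "negligible (box a b)" using N(1) negligible_subset by blast
  then have "box a b = {}" using open_not_negligible open_box by metis
  then show False using assms(2) by (simp add: box_real)
qed

lemma is_interval_Icc_subset: "is_interval I ==> p \<in> I ==> q \<in> I ==> {p..q} \<subseteq> (I :: real set)"
  by (meson atLeastAtMost_iff mem_is_interval_1_I subsetI)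

text \<open>Absolute continuity is used through its integral characterization, with the derivative as part of the data.
The set is mostly an interval, closed at the points where functions are glued.\<close>

definition AC :: "real set => (real => real) => (real => real) => bool" where
  "AC I v g \<longleftrightarrow> (\<forall>p\<in>I. \<forall>q\<in>I. p <= q --> g absolutely_integrable_on {p..q} \<and> integral {p..q} g = v q - v p)"

lemma ACD: "AC I v g ==> p \<in> I ==> q \<in> I ==> p <= q ==>
    g absolutely_integrable_on {p..q} \<and> integral {p..q} g = v q - v p"
  by (simp add: AC_def)

lemma AC_subset: "AC I v g ==> J \<subseteq> I ==> AC J v g"
  unfolding AC_def by blast

lemma AC_continuous_Icc: assumes "AC {p..q} v g" shows "continuous_on {p..q} v"
proof (cases "p <= q")
  case True
  then have "g integrable_on {p..q}" using ACD[OF assms, of p q] by (auto simp: absolutely_integrable_on_def)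
  then have "continuous_on {p..q} (\<lambda>x. v p + integral {p..x} g)"
    by (intro continuous_intros indefinite_integral_continuous_1)
  then show ?thesis
    by (rule continuous_on_eq) (use ACD[OF assms, of p] True in auto)
qed auto

lemma AC_continuous_open: assumes "AC I v g" "open I" shows "continuous_on I v"
proof (rule continuous_at_imp_continuous_on, rule ballI)
  fix x assume x: "x \<in> I"
  obtain e where e: "e > 0" "ball x e \<subseteq> I" using x assms(2) open_contains_ball by metis
  have "{x - e/2..x + e/2} \<subseteq> ball x e" using e by (auto simp: dist_real_def)
  then have "AC {x - e/2..x + e/2} v g" using e AC_subset[OF assms(1)] by blast
  then have "continuous_on {x - e/2..x + e/2} v" by (rule AC_continuous_Icc)
  then show "isCont v x" by (rule continuous_on_interior) (use e in auto)
qed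

lemma AC_const: "AC I (\<lambda>x. c) (\<lambda>x. 0)"
  by (simp add: AC_def)

lemma AC_linear: "AC I (\<lambda>x. k * x + c) (\<lambda>x. k)"
  unfolding AC_def by (auto intro!: absolutely_integrable_continuous_real simp: algebra_simps)

lemma AC_glue:
  assumes v: "AC I v g" and w: "AC J w k" and q: "q \<in> I" "q \<in> J" "v q = w q"
    and le: "\<And>x. x \<in> I ==> x <= q" and ge: "\<And>x. x \<in> J ==> q <= x"
  shows "AC (I \<union> J) (\<lambda>x. if x <= q then v x else w x) (\<lambda>x. if x <= q then g x else k x)"
    (is "AC _ ?v ?g")
  unfolding AC_def
proof (intro ballI impI)
  have L: "?g absolutely_integrable_on {r..s} \<and> integral {r..s} ?g = ?v s - ?v r"
    if "r \<in> I" "s \<in> I" "r <= s" for r s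
  proof -
    have vs: "?v s = v s" "?v r = v r" using le[of r] le[of s] that by auto
    have "?g absolutely_integrable_on {r..s} \<longleftrightarrow> g absolutely_integrable_on {r..s}"
      by (rule set_integrable_cong) (use le[of s] that in auto)
    moreover have "integral {r..s} ?g = integral {r..s} g"
      by (rule integral_cong) (use le[of s] that in auto)
    ultimately show ?thesis using ACD[OF v that] vs by simp
  qed
  have R: "?g absolutely_integrable_on {r..s} \<and> integral {r..s} ?g = ?v s - ?v r"
    if "r \<in> J" "s \<in> J" "r <= s" for r s
  proof -
    have vs: "?v s = w s" "?v r = w r" using ge[of r] ge[of s] that q by (auto dest: antisym)
    have n: "negligible {q}" by simp
    have e: "?g x = k x" if "x \<in> {r..s} - {q}" for x using that ge[of r] \<open>r \<in> J\<close> by auto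
    have "?g absolutely_integrable_on {r..s}"
      using ACD[OF w that] by (intro absolutely_integrable_spike[where f=k, OF _ n e]) auto
    moreover have "integral {r..s} k = integral {r..s} ?g"
      by (rule integral_spike[OF n e])
    ultimately show ?thesis using ACD[OF w that] vs by simp
  qed
  fix r s assume rs: "r \<in> I \<union> J" "s \<in> I \<union> J" "r <= s"
  consider "r \<in> I" "s \<in> I" | "r \<in> J" "s \<in> J" | "r \<in> I" "s \<in> J"
    | "r \<in> J" "s \<in> I" using rs by blast
  then show "?g absolutely_integrable_on {r..s} \<and> integral {r..s} ?g = ?v s - ?v r"
  proof cases
    case 1 then show ?thesis using L rs by blast
  next
    case 2 then show ?thesis using R rs by blast
  next
    case 3
    have l: "?g absolutely_integrable_on {r..q} \<and> integral {r..q} ?g = ?v q - ?v r"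
      using L[of r q] 3 q le by blast
    have r: "?g absolutely_integrable_on {q..s} \<and> integral {q..s} ?g = ?v s - ?v q"
      using R[of q s] 3 q ge by blast
    have o: "r <= q" "q <= s" using 3 le ge by auto
    have ai: "?g absolutely_integrable_on {r..s}"
      by (rule absolutely_integrable_on_combine[where a=r and c=q and b=s]) (use l r o in auto)
    then have "integral {r..q} ?g + integral {q..s} ?g = integral {r..s} ?g"
      by (intro Henstock_Kurzweil_Integration.integral_combine o) (simp add: absolutely_integrable_on_def)
    then show ?thesis using l r ai by linarith
  next
    case 4
    then have "r = q" "s = q" using le[of s] ge[of r] rs by auto
    then show ?thesis using L[of q q] q by simp
  qed
qed

lemma AC_affine:
  assumes "AC I v g" "m > 0"
  shows "AC ((\<lambda>y. m * y + c) -` I) (\<lambda>y. v (m * y + c)) (\<lambda>y. m * g (m * y + c))"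
  unfolding AC_def
proof (intro ballI impI)
  fix p q assume pq: "p \<in> (\<lambda>y. m * y + c) -` I" "q \<in> (\<lambda>y. m * y + c) -` I" "p <= q"
  let ?p = "m * p + c" and ?q = "m * q + c"
  have A: "g absolutely_integrable_on {?p..?q} \<and> integral {?p..?q} g = v ?q - v ?p"
    using pq assms by (intro ACD[OF assms(1)]) (auto intro: mult_left_mono)
  have aff: "((\<lambda>x. f (m * x + c)) has_integral inverse m * i) {p..q}" if "(f has_integral i) {?p..?q}" for f :: "real => real" and i
  proof -
    have e: "inverse m * (m * z) = z" for z using assms(2) by simp
    show ?thesis using has_integral_affinity'[of f i ?p ?q m c] that assms(2) e
      by (simp add: box_real)
  qed
  have "((\<lambda>x. g (m * x + c)) has_integral inverse m * (v ?q - v ?p)) {p..q}"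
    using A by (intro aff) (auto simp: absolutely_integrable_on_def has_integral_iff)
  then have h: "((\<lambda>x. m * g (m * x + c)) has_integral m * (inverse m * (v ?q - v ?p))) {p..q}"
    by (rule has_integral_mult_right)
  have "((\<lambda>x. \<bar>g (m * x + c)\<bar>) has_integral inverse m * (integral {?p..?q} (\<lambda>x. \<bar>g x\<bar>))) {p..q}"
    using A by (intro aff[of "\<lambda>x. \<bar>g x\<bar>"]) (auto simp: absolutely_integrable_on_def has_integral_iff)
  then have "(\<lambda>x. m * \<bar>g (m * x + c)\<bar>) integrable_on {p..q}"
    by (intro integrable_on_mult_right) auto
  then have "(\<lambda>x. \<bar>m * g (m * x + c)\<bar>) integrable_on {p..q}"
    using assms(2) by (simp add: abs_mult)
  then show "(\<lambda>y. m * g (m * y + c)) absolutely_integrable_on {p..q} \<and>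
       integral {p..q} (\<lambda>y. m * g (m * y + c)) = v (m * q + c) - v (m * p + c)"
    using h assms(2) by (auto simp: absolutely_integrable_on_def has_integral_iff)
qed

lemma AC_reflect:
  assumes "AC I v g"
  shows "AC (uminus -` I) (\<lambda>y. v (- y)) (\<lambda>y. - g (- y))"
  unfolding AC_def
proof (intro ballI impI)
  fix p q assume pq: "p \<in> uminus -` I" "q \<in> uminus -` I" "(p::real) <= q"
  have A: "g absolutely_integrable_on {-q..-p} \<and> integral {-q..-p} g = v (-p) - v (-q)"
    using pq by (intro ACD[OF assms(1)]) auto
  have "(\<lambda>x. g (- x)) absolutely_integrable_on {p..q}"
    using A absolutely_integrable_reflect_real[where f=g and a="-q" and b="-p"] by simp
  moreover have "integral {p..q} (\<lambda>x. g (- x)) = v (-p) - v (-q)"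
    using A Henstock_Kurzweil_Integration.integral_reflect_real[where f=g and a="-q" and b="-p"] by simp
  ultimately show "(\<lambda>y. - g (- y)) absolutely_integrable_on {p..q} \<and>
     integral {p..q} (\<lambda>y. - g (- y)) = v (- q) - v (- p)"
    by (simp add: absolutely_integrable_on_def integrable_neg_iff)
qed

text \<open>The representative is the primitive of the weak derivative that agrees with \<open>u\<close> at one Lebesgue point.\<close>

lemma weak_deriv_imp_AC:
  assumes w: "has_weak_deriv I u g" and I: "open I" "is_interval I"
  obtains v where "AC I v g" "AE x in lebesgue. x \<in> I --> u x = v x"
proof (cases "I = {}")
  case True
  then show ?thesis using that[of u] by (simp add: AC_def)
next
  case False
  have sub: "{p..q} \<subseteq> I" if "p \<in> I" "q \<in> I" for p q
    using is_interval_Icc_subset[OF I(2)] that by blast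
  have u: "u \<in> L1_loc I" and g: "g \<in> L1_loc I" using w by (auto simp: has_weak_deriv_def)
  have L: "AE x in lebesgue. x \<in> I --> lebesgue_point u x" by (rule AE_lebesgue_point_open[OF I(1) u])
  obtain y where y: "y \<in> I" using False by blast
  obtain e where e: "e > 0" "ball y e \<subseteq> I" using y I(1) open_contains_ball by metis
  obtain p0 where p0: "y < p0" "p0 < y + e" "p0 \<in> I --> lebesgue_point u p0"
    using AE_lebesgue_dense[OF L, of y "y + e"] e by auto
  then have p0: "p0 \<in> I" "lebesgue_point u p0" using e by (auto simp: dist_real_def subset_eq)
  define v where "v x = u p0 + (if p0 <= x then integral {p0..x} g else - integral {x..p0} g)" for x
  have gi: "g absolutely_integrable_on {p..q}" if "p \<in> I" "q \<in> I" for p q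
    using L1_loc_interval[OF g sub[OF that]] .
  have comb: "integral {p..q} g + integral {q..r} g = integral {p..r} g" if "p \<in> I" "r \<in> I" "p <= q" "q <= r" for p q r
    using gi[OF that(1,2)] that by (intro Henstock_Kurzweil_Integration.integral_combine) (auto simp: absolutely_integrable_on_def)
  have "integral {p..q} g = v q - v p" if "p \<in> I" "q \<in> I" "p <= q" for p q
  proof -
    consider "p0 <= p" | "p < p0" "p0 <= q" | "q < p0" by linarith
    then show ?thesis
    proof cases
      case 1 then show ?thesis using comb[of p0 q p] that p0 by (simp add: v_def)
    next
      case 2 then show ?thesis using comb[of p q p0] that p0 by (simp add: v_def)
    next
      case 3 then show ?thesis using comb[of p p0 q] that p0 by (simp add: v_def)
    qed
  qed
  then have "AC I v g" using gi by (simp add: AC_def)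
  moreover have "u x = v x" if "x \<in> I" "lebesgue_point u x" for x
  proof (cases "p0 <= x")
    case True
    then show ?thesis
      using weak_deriv_lebesgue_points[OF w I(1) True sub[OF p0(1) that(1)] p0(2) that(2)] by (simp add: v_def)
  next
    case False
    then show ?thesis
      using weak_deriv_lebesgue_points[OF w I(1) _ sub[OF that(1) p0(1)] that(2) p0(2)] by (simp add: v_def)
  qed
  then have "AE x in lebesgue. (x \<in> I --> lebesgue_point u x) --> x \<in> I --> u x = v x" by simp
  then have "AE x in lebesgue. x \<in> I --> u x = v x" by (rule AE_mp[OF L])
  ultimately show ?thesis by (rule that)
qed

text \<open>An additive interval function that is of higher order than the length vanishes. Here \<open>G\<close> is itself additive, so
that bisecting the interval gains a factor of two in each step.\<close>

lemma additive_dyadic_zero: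
  fixes T :: "real => real => real"
  assumes add: "\<And>x y z. p <= x ==> x <= y ==> y <= z ==> z <= q ==> T x z = T x y + T y z"
    and addG: "\<And>x y z. p <= x ==> x <= y ==> y <= z ==> z <= q ==> G x z = G x y + G y z"
    and bd: "\<And>x y. p <= x ==> x <= y ==> y <= q ==> \<bar>T x y\<bar> <= C * (y - x) * G x y"
    and pq: "p <= q"
  shows "T p q = 0"
proof -
  have "\<forall>x y. p <= x --> x <= y --> y <= q --> \<bar>T x y\<bar> <= C * (y - x) * G x y / 2 ^ n" for n
  proof (induction n)
    case 0 then show ?case using bd by simp
  next
    case (Suc n)
    show ?case
    proof (intro allI impI)
      fix x y assume xy: "p <= x" "x <= y" "y <= q"
      define m where "m = (x + y) / 2"
      have m: "x <= m" "m <= y" "m - x = (y - x) / 2" "y - m = (y - x) / 2" using xy by (auto simp: m_def field_simps)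
      have "\<bar>T x y\<bar> <= \<bar>T x m\<bar> + \<bar>T m y\<bar>" using add[of x m y] m xy by simp
      also have "\<dots> <= C * ((y - x) / 2) * G x m / 2 ^ n + C * ((y - x) / 2) * G m y / 2 ^ n"
        using Suc[rule_format, of x m] Suc[rule_format, of m y] m xy by simp
      also have "\<dots> = C * (y - x) * (G x m + G m y) / 2 ^ Suc n" by (simp add: field_simps)
      finally show "\<bar>T x y\<bar> <= C * (y - x) * G x y / 2 ^ Suc n"
        using addG[of x m y] m xy by simp
    qed
  qed
  then have b: "\<bar>T p q\<bar> <= C * (q - p) * G p q / 2 ^ n" for n using pq by simp
  have "(\<lambda>n. C * (q - p) * G p q * (1/2) ^ n) \<longlonglongrightarrow> C * (q - p) * G p q * 0"
    by (intro tendsto_mult tendsto_const LIMSEQ_realpow_zero) auto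
  then have "(\<lambda>n. C * (q - p) * G p q / 2 ^ n) \<longlonglongrightarrow> 0" by (simp add: power_divide)
  then have "\<bar>T p q\<bar> <= 0" by (rule LIMSEQ_le_const) (use b in auto)
  then show ?thesis by simp
qed

lemma absolutely_integrable_continuous_mult:
  fixes f g :: "real => real"
  assumes "continuous_on {p..q} f" "g absolutely_integrable_on {p..q}"
  shows "(\<lambda>x. f x * g x) absolutely_integrable_on {p..q}"
  using assms compact_imp_bounded[OF compact_continuous_image[OF assms(1)]]
  by (intro absolutely_integrable_bounded_measurable_product_real continuous_imp_measurable_on_sets_lebesgue) auto

text \<open>The defect of the formula is additive in the interval, and on \<open>{x..y}\<close> it is at most \<open>y - x\<close> times the integral of
\<open>\<bar>g\<bar>\<close>, so \<open>additive_dyadic_zero\<close> applies.\<close>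

lemma AC_integration_by_parts:
  assumes v: "AC {p..q} v g" and pq: "p <= q"
    and der: "\<And>x. (\<phi> has_real_derivative \<phi>' x) (at x)" and cont: "continuous_on UNIV \<phi>'"
  shows "integral {p..q} (\<lambda>x. \<phi> x * g x) + integral {p..q} (\<lambda>x. v x * \<phi>' x) = v q * \<phi> q - v p * \<phi> p"
proof -
  have cv: "continuous_on {p..q} v" by (rule AC_continuous_Icc[OF v])
  have c\<phi>: "continuous_on A \<phi>" for A using der by (meson DERIV_continuous_on has_field_derivative_at_within)
  have c\<phi>': "continuous_on A \<phi>'" for A using cont continuous_on_subset by blast
  have gi: "g absolutely_integrable_on {x..y}" and gv: "integral {x..y} g = v y - v x" if "p <= x" "x <= y" "y <= q" for x y
    using ACD[OF v, of x y] that by auto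
  have i1: "(\<lambda>x. \<phi> x * g x) integrable_on {x..y}" if "p <= x" "x <= y" "y <= q" for x y
    using absolutely_integrable_continuous_mult[OF c\<phi> gi[OF that]] by (simp add: absolutely_integrable_on_def)
  have i2: "(\<lambda>x. v x * \<phi>' x) integrable_on {x..y}" if "p <= x" "x <= y" "y <= q" for x y
    using that by (intro integrable_continuous_real continuous_intros c\<phi>' continuous_on_subset[OF cv]) auto
  have ga: "(\<lambda>t. \<bar>g t\<bar>) integrable_on {x..y}" if "p <= x" "x <= y" "y <= q" for x y
    using gi[OF that] by (simp add: absolutely_integrable_on_def)
  define G where "G x y = integral {x..y} (\<lambda>t. \<bar>g t\<bar>)" for x y
  define T where "T x y = integral {x..y} (\<lambda>x. \<phi> x * g x) + integral {x..y} (\<lambda>x. v x * \<phi>' x) - (v y * \<phi> y - v x * \<phi> x)" for x y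
  obtain M where M: "\<And>x. x \<in> {p..q} ==> \<bar>\<phi>' x\<bar> <= M" "M > 0"
    using compact_imp_bounded[OF compact_continuous_image[OF c\<phi>' compact_Icc]] bounded_pos
    by (metis imageI real_norm_def)
  have lip: "\<bar>\<phi> t - \<phi> y\<bar> <= M * (y - x)" if "p <= x" "x <= t" "t <= y" "y <= q" for x t y
  proof -
    have "norm (\<phi> t - \<phi> y) <= M * norm (t - y)"
      by (rule field_differentiable_bound[of "{p..q}" \<phi> \<phi>'])
         (use that M in \<open>auto intro: has_field_derivative_at_within[OF der]\<close>)
    also have "\<dots> <= M * (y - x)" using that M by (intro mult_left_mono) auto
    finally show ?thesis by simp
  qed
  have vb: "\<bar>v t - v x\<bar> <= G x y" if "p <= x" "x <= t" "t <= y" "y <= q" for x t y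
  proof -
    have "\<bar>v t - v x\<bar> = norm (integral {x..t} g)" using gv[of x t] that by simp
    also have "\<dots> <= integral {x..t} (\<lambda>t. \<bar>g t\<bar>)"
      using gi[of x t] that by (intro integral_norm_bound_integral) (auto simp: absolutely_integrable_on_def)
    also have "\<dots> <= G x y" unfolding G_def
      using ga[of x t] ga[of x y] that by (intro integral_subset_le) auto
    finally show ?thesis .
  qed
  have "T p q = 0"
  proof (rule additive_dyadic_zero[where G=G and C="2 * M" and p=p and q=q and T=T])
    fix x y z assume o: "p <= x" "x <= y" "y <= z" "z <= q"
    show "T x z = T x y + T y z"
      using Henstock_Kurzweil_Integration.integral_combine[OF o(2,3) i1]
        Henstock_Kurzweil_Integration.integral_combine[OF o(2,3) i2] o by (simp add: T_def)
    show "G x z = G x y + G y z"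
      using Henstock_Kurzweil_Integration.integral_combine[OF o(2,3) ga] o by (simp add: G_def)
  next
    fix x y assume o: "p <= x" "x <= y" "y <= q"
    have a: "\<bar>integral {x..y} (\<lambda>t. \<phi> t * g t) - \<phi> y * (v y - v x)\<bar> <= M * (y - x) * G x y"
    proof -
      have e: "integral {x..y} (\<lambda>t. \<phi> t * g t) - \<phi> y * (v y - v x) = integral {x..y} (\<lambda>t. \<phi> t * g t - \<phi> y * g t)"
        using i1[OF o] gi[OF o] gv[OF o]
        by (subst integral_diff) (auto simp: absolutely_integrable_on_def intro!: integrable_on_mult_right)
      have f: "(\<lambda>t. \<phi> t * g t - \<phi> y * g t) integrable_on {x..y}"
        using i1[OF o] gi[OF o] by (intro integrable_diff integrable_on_mult_right) (auto simp: absolutely_integrable_on_def)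
      have "norm (integral {x..y} (\<lambda>t. \<phi> t * g t - \<phi> y * g t)) <= integral {x..y} (\<lambda>t. (M * (y - x)) * \<bar>g t\<bar>)"
      proof (rule integral_norm_bound_integral[OF f])
        show "(\<lambda>t. M * (y - x) * \<bar>g t\<bar>) integrable_on {x..y}" by (intro integrable_on_mult_right ga o)
        fix t assume "t \<in> {x..y}"
        then show "norm (\<phi> t * g t - \<phi> y * g t) <= M * (y - x) * \<bar>g t\<bar>"
          using lip[of x t y] o by (simp add: left_diff_distrib[symmetric] abs_mult mult_right_mono)
      qed
      then show ?thesis unfolding e by (simp add: G_def)
    qed
    have b: "\<bar>integral {x..y} (\<lambda>t. v t * \<phi>' t) - v x * (\<phi> y - \<phi> x)\<bar> <= M * (y - x) * G x y"
    proof -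
      have ft: "(\<phi>' has_integral (\<phi> y - \<phi> x)) {x..y}"
        using der by (intro fundamental_theorem_of_calculus o)
          (auto simp: has_real_derivative_iff_has_vector_derivative[symmetric] intro: has_field_derivative_at_within)
      have e: "integral {x..y} (\<lambda>t. v t * \<phi>' t) - v x * (\<phi> y - \<phi> x) = integral {x..y} (\<lambda>t. v t * \<phi>' t - v x * \<phi>' t)"
        using i2[OF o] ft by (subst integral_diff) (auto simp: has_integral_iff intro!: integrable_on_mult_right)
      have f: "(\<lambda>t. v t * \<phi>' t - v x * \<phi>' t) integrable_on {x..y}"
        using i2[OF o] ft by (intro integrable_diff integrable_on_mult_right) auto
      have "norm (integral {x..y} (\<lambda>t. v t * \<phi>' t - v x * \<phi>' t)) <= integral {x..y} (\<lambda>t. G x y * M)"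
      proof (rule integral_norm_bound_integral[OF f])
        fix t assume t: "t \<in> {x..y}"
        have "\<bar>v t - v x\<bar> * \<bar>\<phi>' t\<bar> <= G x y * M"
          using vb[of x t y] M t o by (intro mult_mono) (auto intro: order_trans[OF abs_ge_zero])
        then show "norm (v t * \<phi>' t - v x * \<phi>' t) <= G x y * M"
          by (simp add: left_diff_distrib[symmetric] abs_mult)
      qed auto
      then show ?thesis unfolding e using o by (simp add: mult.commute mult.left_commute)
    qed
    have "T x y = (integral {x..y} (\<lambda>t. \<phi> t * g t) - \<phi> y * (v y - v x)) + (integral {x..y} (\<lambda>t. v t * \<phi>' t) - v x * (\<phi> y - \<phi> x))"
      by (simp add: T_def algebra_simps)
    then show "\<bar>T x y\<bar> <= 2 * M * (y - x) * G x y" using a b by linarith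
  qed (rule pq)
  then show ?thesis by (simp add: T_def)
qed

lemma test_function_support:
  assumes "\<phi> \<in> test_functions I" "open I" "is_interval I" "I \<noteq> {}"
  obtains p q where "p <= q" "{p..q} \<subseteq> I" "\<And>x. x \<notin> {p<..<q} ==> \<phi> x = 0"
proof -
  obtain K where K: "compact K" "K \<subseteq> I" "\<And>x. x \<notin> K ==> \<phi> x = 0"
    using assms(1) by (auto simp: test_functions_iff)
  show ?thesis
  proof (cases "K = {}")
    case True
    obtain y where "y \<in> I" using assms(4) by blast
    then show ?thesis using K(3) True by (intro that[of y y]) auto
  next
    case False
    obtain s where s: "s \<in> K" "\<And>x. x \<in> K ==> s <= x" using compact_attains_inf[OF K(1) False] by blast
    obtain t where t: "t \<in> K" "\<And>x. x \<in> K ==> x <= t" using compact_attains_sup[OF K(1) False] by blast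
    obtain e1 where e1: "e1 > 0" "ball s e1 \<subseteq> I" using s(1) K(2) assms(2) open_contains_ball by (metis subsetD)
    obtain e2 where e2: "e2 > 0" "ball t e2 \<subseteq> I" using t(1) K(2) assms(2) open_contains_ball by (metis subsetD)
    have "s - e1/2 \<in> ball s e1" "t + e2/2 \<in> ball t e2" using e1 e2 by (auto simp: dist_real_def)
    then have in_I: "s - e1/2 \<in> I" "t + e2/2 \<in> I" using e1 e2 by blast+
    then have sub: "{s - e1/2..t + e2/2} \<subseteq> I" using is_interval_Icc_subset[OF assms(3)] by blast
    have le: "s - e1/2 <= t + e2/2" using s(2)[OF t(1)] e1 e2 by simp
    show ?thesis
    proof (rule that[OF le sub])
      fix x assume "x \<notin> {s - e1/2<..<t + e2/2}"
      then have "x \<notin> K" using s(2)[of x] t(2)[of x] e1 e2 by force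
      then show "\<phi> x = 0" by (rule K(3))
    qed
  qed
qed

lemma AC_imp_weak_deriv:
  assumes v: "AC I v g" and I: "open I" "is_interval I"
    and uv: "AE x in lebesgue. x \<in> I --> u x = v x"
  shows "has_weak_deriv I u g"
proof (cases "I = {}")
  case True
  then show ?thesis by (auto simp: has_weak_deriv_def L1_loc_def)
next
  case False
  obtain N where N: "negligible N" "\<And>x. x \<notin> N ==> x \<in> I --> u x = v x"
    using AE_lebesgue_obtain_negligible[OF uv] by metis
  have sub: "{p..q} \<subseteq> I" if "p \<in> I" "q \<in> I" for p q
    using is_interval_Icc_subset[OF I(2)] that by blast
  have cont: "continuous_on I v" by (rule AC_continuous_open[OF v I(1)])
  have loc: "w \<in> L1_loc I" if w: "\<And>p q. p \<in> I ==> q \<in> I ==> p <= q ==> w absolutely_integrable_on {p..q}" for w :: "real => real"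
    unfolding L1_loc_def
  proof (intro CollectI allI impI, elim conjE)
    fix K assume K: "compact K" "K \<subseteq> I"
    have Km: "K \<in> sets lebesgue" using borel_compact[OF K(1)] by (simp add: sets_completionI_sets)
    show "integrable (lebesgue_on K) w"
    proof (cases "K = {}")
      case False
      obtain s where s: "s \<in> K" "\<And>x. x \<in> K ==> s <= x" using compact_attains_inf[OF K(1) False] by blast
      obtain t where t: "t \<in> K" "\<And>x. x \<in> K ==> x <= t" using compact_attains_sup[OF K(1) False] by blast
      have "w absolutely_integrable_on K"
        by (rule set_integrable_subset[OF w[of s t] Km]) (use s t K in auto)
      then show ?thesis by (simp add: integrable_lebesgue_on_iff[OF Km])
    qed simp
  qed
  have vi: "v absolutely_integrable_on {p..q}" if "p \<in> I" "q \<in> I" for p q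
    by (intro absolutely_integrable_continuous_real continuous_on_subset[OF cont] sub that)
  have ue: "u x = v x" if "x \<in> {p..q} - N" "p \<in> I" "q \<in> I" for x p q
    using that N(2)[of x] sub[of p q] by blast
  have "u absolutely_integrable_on {p..q}" if "p \<in> I" "q \<in> I" for p q
    by (rule absolutely_integrable_spike[OF vi[OF that] N(1) ue[OF _ that]])
  then have uL: "u \<in> L1_loc I" by (intro loc)
  have gL: "g \<in> L1_loc I" using ACD[OF v] by (intro loc) blast
  have "(LINT x|lebesgue_on I. u x * deriv \<phi> x) = - (LINT x|lebesgue_on I. g x * \<phi> x)"
    if \<phi>: "\<phi> \<in> test_functions I" for \<phi>
  proof -
    obtain p q where pq: "p <= q" "{p..q} \<subseteq> I" "\<And>x. x \<notin> {p<..<q} ==> \<phi> x = 0"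
      using test_function_support[OF \<phi> I False] by metis
    have sm: "smooth \<phi>" using \<phi> by (simp add: test_functions_iff)
    have d0: "deriv \<phi> x = 0" if "x \<notin> {p..q}" for x
      by (rule deriv_zero_on_open[of "- {p..q}"]) (use that pq(3) in auto)
    have cd: "continuous_on A (deriv \<phi>)" for A by (intro smooth_imp_continuous smooth_deriv sm)
    have in_I: "p \<in> I" "q \<in> I" using pq by auto
    have Im: "I \<in> sets lebesgue" using I by auto
    have Pm: "{p..q} \<in> sets lebesgue" by auto
    have "(LINT x|lebesgue_on I. u x * deriv \<phi> x) = (LINT x|lebesgue_on {p..q}. u x * deriv \<phi> x)"
      by (rule LINT_supported[OF pq(2) Im Pm]) (use d0 in auto)
    also have "\<dots> = integral {p..q} (\<lambda>x. u x * deriv \<phi> x)"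
      using absolutely_integrable_continuous_mult[OF cd L1_loc_interval[OF uL pq(2)]]
      by (intro LINT_eq_integral Pm) (simp add: mult.commute)
    also have "\<dots> = integral {p..q} (\<lambda>x. v x * deriv \<phi> x)"
      by (rule integral_spike[OF N(1)]) (use ue[of _ p q] in_I in auto)
    also have "\<dots> = - integral {p..q} (\<lambda>x. \<phi> x * g x)"
      using AC_integration_by_parts[OF AC_subset[OF v pq(2)] pq(1) smooth_has_derivative[OF sm] cd] pq(3)[of p] pq(3)[of q]
      by simp
    also have "integral {p..q} (\<lambda>x. \<phi> x * g x) = (LINT x|lebesgue_on {p..q}. \<phi> x * g x)"
      using absolutely_integrable_continuous_mult[OF smooth_imp_continuous[OF sm] L1_loc_interval[OF gL pq(2)]]
      by (intro LINT_eq_integral[symmetric] Pm)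
    also have "\<dots> = (LINT x|lebesgue_on I. g x * \<phi> x)"
    proof -
      have "(LINT x|lebesgue_on I. \<phi> x * g x) = (LINT x|lebesgue_on {p..q}. \<phi> x * g x)"
        by (rule LINT_supported[OF pq(2) Im Pm]) (use pq(3) in auto)
      then show ?thesis by (simp add: mult.commute)
    qed
    finally show ?thesis .
  qed
  then show ?thesis using uL gL by (simp add: has_weak_deriv_def)
qed

lemma lebesgue_point_integral_zero:
  assumes L: "lebesgue_point f x" and fi: "f absolutely_integrable_on {x..x+e}" and e: "e > 0"
    and z: "\<And>h. 0 < h ==> h < e ==> integral {x..x+h} f = 0"
  shows "f x = 0"
proof -
  have "\<bar>f x\<bar> <= integral {x..x+h} (\<lambda>y. \<bar>f y - f x\<bar>) / h" if h: "0 < h" "h < e" for h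
  proof -
    have fh: "f absolutely_integrable_on {x..x+h}"
      using fi h by (auto elim: absolutely_integrable_on_subinterval)
    have ch: "(\<lambda>_. f x) absolutely_integrable_on {x..x+h}"
      by (intro absolutely_integrable_continuous_real continuous_intros)
    have d: "(\<lambda>y. f y - f x) absolutely_integrable_on {x..x+h}" by (rule set_integral_diff(1)[OF fh ch])
    have "integral {x..x+h} (\<lambda>y. f y - f x) = - (h * f x)"
      using fh ch z[OF h] h by (subst integral_diff) (auto simp: absolutely_integrable_on_def)
    moreover have "norm (integral {x..x+h} (\<lambda>y. f y - f x)) <= integral {x..x+h} (\<lambda>y. \<bar>f y - f x\<bar>)"
      using d by (intro integral_norm_bound_integral) (auto simp: absolutely_integrable_on_def)
    ultimately show ?thesis using h by (simp add: abs_mult field_simps)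
  qed
  then have "\<forall>\<^sub>F h in at_right 0. \<bar>f x\<bar> <= integral {x..x+h} (\<lambda>y. \<bar>f y - f x\<bar>) / h"
    unfolding eventually_at_right_field using e by blast
  then have "\<bar>f x\<bar> <= 0"
    using L unfolding lebesgue_point_def by (intro tendsto_lowerbound) auto
  then show ?thesis by simp
qed

text \<open>The difference of the derivatives has vanishing integrals, hence vanishes at its Lebesgue points.\<close>

lemma AC_unique_derivative:
  assumes "AC I v g" "AC I w k" "open I" "is_interval I" "AE x in lebesgue. x \<in> I --> v x = w x"
  shows "AE x in lebesgue. x \<in> I --> g x = k x"
proof -
  have sub: "{p..q} \<subseteq> I" if "p \<in> I" "q \<in> I" for p q
    using is_interval_Icc_subset[OF assms(4)] that by blast
  have vw: "v x = w x" if x: "x \<in> I" for x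
  proof (rule ccontr)
    assume ne: "v x \<noteq> w x"
    have "continuous_on I (\<lambda>x. v x - w x)"
      by (intro continuous_intros AC_continuous_open[OF assms(1)] AC_continuous_open[OF assms(2)] assms(3))
    then have "isCont (\<lambda>x. v x - w x) x" using assms(3) x by (simp add: continuous_on_eq_continuous_at)
    then have "\<forall>\<^sub>F y in at x. v y - w y \<noteq> 0"
      using ne unfolding isCont_def by (intro tendsto_imp_eventually_ne) auto
    moreover have "\<forall>\<^sub>F y in at x. y \<in> I" by (rule eventually_at_in_open'[OF assms(3) x])
    ultimately have "\<forall>\<^sub>F y in at x. v y - w y \<noteq> 0 \<and> y \<in> I" by (rule eventually_conj)
    then obtain d where d: "d > 0" "\<And>y. y \<noteq> x ==> dist y x < d ==> v y - w y \<noteq> 0 \<and> y \<in> I"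
      unfolding eventually_at by auto
    then show False using AE_lebesgue_dense[OF assms(5), of x "x + d"] by (auto simp: dist_real_def)
  qed
  have gi: "g absolutely_integrable_on {p..q}" "k absolutely_integrable_on {p..q}"
    "integral {p..q} g = integral {p..q} k" if "p \<in> I" "q \<in> I" "p <= q" for p q
    using ACD[OF assms(1) that] ACD[OF assms(2) that] vw that by auto
  define f where "f x = g x - k x" for x
  have fi: "f absolutely_integrable_on {p..q} \<and> integral {p..q} f = 0" if "p \<in> I" "q \<in> I" "p <= q" for p q
    using set_integral_diff(1)[OF gi(1,2)[OF that]] gi[OF that] unfolding f_def
    by (auto simp: absolutely_integrable_on_def integral_diff)
  have "AC I (\<lambda>x. 0) f" unfolding AC_def using fi by simp
  then have "has_weak_deriv I (\<lambda>x. 0) f" by (intro AC_imp_weak_deriv[where v="\<lambda>x. 0"] assms) auto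
  then have "f \<in> L1_loc I" by (simp add: has_weak_deriv_def)
  then have "AE x in lebesgue. x \<in> I --> lebesgue_point f x" by (rule AE_lebesgue_point_open[OF assms(3)])
  moreover have "g x = k x" if x: "x \<in> I" "lebesgue_point f x" for x
  proof -
    obtain e where e: "e > 0" "ball x e \<subseteq> I" using x(1) assms(3) open_contains_ball by metis
    have in_I: "x + h \<in> I" if "0 < h" "h <= e/2" for h using e that by (auto simp: dist_real_def subset_eq)
    have "f x = 0"
      by (rule lebesgue_point_integral_zero[OF x(2), of "e/2"]) (use fi[of x] in_I e x in auto)
    then show ?thesis by (simp add: f_def)
  qed
  ultimately show ?thesis by (auto elim!: eventually_mono)
qed

lemma weak_deriv_AC:
  assumes "has_weak_deriv I u g" "open I" "is_interval I"
  obtains v where "AC I v (weak_deriv I u)" "AE x in lebesgue. x \<in> I --> u x = v x"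
proof -
  have "has_weak_deriv I u (weak_deriv I u)" unfolding weak_deriv_def by (rule someI[where P="has_weak_deriv I u", OF assms(1)])
  then show ?thesis using that by (rule weak_deriv_imp_AC[OF _ assms(2,3)])
qed

text \<open>Although \<open>weak_deriv\<close> is defined by choice, it is determined almost everywhere by an absolutely continuous
representative.\<close>

lemma AC_weak_deriv:
  assumes v: "AC I v g" and I: "open I" "is_interval I" and uv: "AE x in lebesgue. x \<in> I --> u x = v x"
  shows "has_weak_deriv I u g" "AE x in lebesgue. x \<in> I --> weak_deriv I u x = g x"
proof -
  show w: "has_weak_deriv I u g" by (rule AC_imp_weak_deriv[OF assms])
  obtain v' where v': "AC I v' (weak_deriv I u)" "AE x in lebesgue. x \<in> I --> u x = v' x"
    using weak_deriv_AC[OF w I] by blast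
  have "AE x in lebesgue. x \<in> I --> v' x = v x" using v'(2) uv by eventually_elim simp
  then show "AE x in lebesgue. x \<in> I --> weak_deriv I u x = g x"
    by (rule AC_unique_derivative[OF v'(1) v I])
qed

section \<open>Cells of the checkerboard and cumulants\<close>

lemma exp_quadratic_bound: "\<bar>x\<bar> <= 1 ==> exp x <= 1 + x + x\<^sup>2" for x :: real
proof (cases "x >= 0")
  case True
  assume "\<bar>x\<bar> <= 1" then show ?thesis using exp_bound[of x] True by simp
next
  case False
  assume "\<bar>x\<bar> <= 1"
  define t where "t = - x"
  have t: "0 < t" using False by (simp add: t_def)
  have "exp x * exp t = 1" by (simp add: t_def exp_minus)
  then have "exp x * (1 + t) <= 1"
    using mult_left_mono[OF exp_ge_add_one_self[of t], of "exp x"] by simp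
  also have "1 <= (1 - t + t\<^sup>2) * (1 + t)"
  proof -
    have "(1 - t + t\<^sup>2) * (1 + t) = 1 + t ^ 3" by (simp add: algebra_simps power2_eq_square power3_eq_cube)
    then show ?thesis using t by simp
  qed
  finally have "exp x <= 1 - t + t\<^sup>2" using t by simp
  then show ?thesis by (simp add: t_def)
qed

text \<open>In the rescaled variable \<open>y\<close>, with \<open>\<alpha> = \<epsilon> / \<delta>\<close> and \<open>\<beta> = x / \<delta>\<close>, the coefficient \<open>\<Theta> z\<close> occupies \<open>cell \<alpha> \<beta> z\<close>, and
\<open>cells \<alpha> \<beta> r\<close> enumerates the cells that can meet \<open>{-r..r}\<close>.\<close>

definition cell :: "real => real => int => real set" where
  "cell \<alpha> \<beta> z = {y. real_of_int z - 1/2 < \<alpha> * y + \<beta> \<and> \<alpha> * y + \<beta> < real_of_int z + 1/2}"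

definition cells :: "real => real => real => int set" where
  "cells \<alpha> \<beta> r = {\<lceil>\<beta> - \<alpha> * r - 1/2\<rceil>..\<lfloor>\<beta> + \<alpha> * r + 1/2\<rfloor>}"

definition weight :: "real => real => (real => real) => int => real" where
  "weight \<alpha> \<beta> f z = (LINT y|lebesgue. indicator (cell \<alpha> \<beta> z) y * f y)"

definition potential :: "(int => real) => real => real => (real => real) => real" where
  "potential t \<alpha> \<beta> f = (LINT y|lebesgue. checkerboard t (\<alpha> * y + \<beta>) * f y)"

lemma mem_cells: "z \<in> cells \<alpha> \<beta> r \<longleftrightarrow> \<bar>real_of_int z - \<beta>\<bar> <= \<alpha> * r + 1/2"
  unfolding cells_def atLeastAtMost_iff ceiling_le_iff le_floor_iff by linarith

lemma finite_cells [simp]: "finite (cells \<alpha> \<beta> r)"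
  by (simp add: cells_def)

lemma card_cells: "0 <= \<alpha> * r ==> real (card (cells \<alpha> \<beta> r)) <= 2 * \<alpha> * r + 2"
proof -
  assume a: "0 <= \<alpha> * r"
  have "\<lfloor>\<beta> + \<alpha> * r + 1/2\<rfloor> - \<lceil>\<beta> - \<alpha> * r - 1/2\<rceil> >= -1" using a by linarith
  then have "real (card (cells \<alpha> \<beta> r)) = real_of_int (\<lfloor>\<beta> + \<alpha> * r + 1/2\<rfloor> - \<lceil>\<beta> - \<alpha> * r - 1/2\<rceil> + 1)"
    by (simp add: cells_def)
  also have "\<dots> <= 2 * \<alpha> * r + 2" by linarith
  finally show ?thesis .
qed

lemma cell_eq: "\<alpha> > 0 ==> cell \<alpha> \<beta> z = {(real_of_int z - 1/2 - \<beta>) / \<alpha> <..< (real_of_int z + 1/2 - \<beta>) / \<alpha>}"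
  by (auto simp: cell_def field_simps)

lemma cell_sets [measurable]: "\<alpha> > 0 ==> cell \<alpha> \<beta> z \<in> sets borel"
  by (simp add: cell_eq)

lemma emeasure_cell: "\<alpha> > 0 ==> emeasure lebesgue (cell \<alpha> \<beta> z) = ennreal (1 / \<alpha>)"
proof -
  assume a: "\<alpha> > 0"
  have "(real_of_int z + 1/2 - \<beta>) / \<alpha> - (real_of_int z - 1/2 - \<beta>) / \<alpha> = 1 / \<alpha>"
    by (simp add: diff_divide_distrib[symmetric])
  moreover have "(real_of_int z - 1/2 - \<beta>) / \<alpha> <= (real_of_int z + 1/2 - \<beta>) / \<alpha>"
    using a by (simp add: divide_right_mono)
  ultimately show ?thesis using a by (simp add: cell_eq)
qed

lemma checkerboard_supported:
  assumes "\<alpha> > 0" "f y \<noteq> 0 --> y \<in> {-r..r}"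
  shows "checkerboard t (\<alpha> * y + \<beta>) * f y = (\<Sum>z\<in>cells \<alpha> \<beta> r. t z * (indicator (cell \<alpha> \<beta> z) y * f y))"
proof (cases "f y = 0")
  case False
  then have y: "\<bar>y\<bar> <= r" using assms(2) by auto
  have ind: "indicator {real_of_int z - 1/2 <..< real_of_int z + 1/2} (\<alpha> * y + \<beta>) = (indicator (cell \<alpha> \<beta> z) y :: real)" for z
    by (simp add: cell_def indicator_def)
  have "indicator (cell \<alpha> \<beta> z) y = (0::real)" if "z \<notin> cells \<alpha> \<beta> r" for z
  proof -
    have "\<bar>\<alpha> * y\<bar> <= \<alpha> * r" using y assms(1) by (simp add: abs_mult)
    then show ?thesis using that unfolding mem_cells cell_def by (auto simp: indicator_def)
  qed
  then have "checkerboard t (\<alpha> * y + \<beta>) = (\<Sum>\<^sub>\<infinity>z\<in>cells \<alpha> \<beta> r. t z * indicator (cell \<alpha> \<beta> z) y)"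
    unfolding checkerboard_def ind by (intro infsum_cong_neutral) auto
  also have "\<dots> = (\<Sum>z\<in>cells \<alpha> \<beta> r. t z * indicator (cell \<alpha> \<beta> z) y)" by simp
  finally show ?thesis by (simp only: sum_distrib_right mult.assoc)
qed simp

lemma cells_partition_AE:
  assumes "\<alpha> > 0" "\<And>y. g y \<noteq> 0 ==> y \<in> {-r..r}"
  shows "AE y in lebesgue. g y = (\<Sum>z\<in>cells \<alpha> \<beta> r. indicator (cell \<alpha> \<beta> z) y * (g y :: real))"
proof -
  define N where "N = (\<lambda>z::int. (real_of_int z - 1/2 - \<beta>) / \<alpha>) ` UNIV"
  have "countable N" by (simp add: N_def)
  then have "N \<in> null_sets lebesgue"
    using countable_imp_null_set_lborel null_sets_completionI by blast
  then have "AE y in lebesgue. y \<notin> N" by (rule AE_not_in)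
  then show ?thesis
  proof eventually_elim
    case (elim y)
    show ?case
    proof (cases "g y = 0")
      case False
      then have "y \<in> {-r..r}" by (rule assms(2))
      then have y: "\<bar>\<alpha> * y\<bar> <= \<alpha> * r" using assms(1) by (auto simp: abs_mult)
      define x where "x = \<alpha> * y + \<beta>"
      define z where "z = \<lfloor>x + 1/2\<rfloor>"
      have x1: "real_of_int z <= x + 1/2" "x + 1/2 < real_of_int z + 1" unfolding z_def by linarith+
      have "x \<noteq> real_of_int z - 1/2"
      proof
        assume "x = real_of_int z - 1/2"
        then have "y = (real_of_int z - 1/2 - \<beta>) / \<alpha>" using assms(1) by (simp add: x_def field_simps)
        then show False using elim by (auto simp: N_def)
      qed
      then have zc: "y \<in> cell \<alpha> \<beta> z" using x1 by (auto simp: cell_def x_def)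
      have zC: "z \<in> cells \<alpha> \<beta> r" unfolding mem_cells using x1 y unfolding x_def by linarith
      have "indicator (cell \<alpha> \<beta> z') y * g y = (if z' = z then g y else 0)" for z'
      proof (cases "z' = z")
        case False
        have "y \<notin> cell \<alpha> \<beta> z'"
        proof
          assume "y \<in> cell \<alpha> \<beta> z'"
          then have "\<bar>real_of_int z' - real_of_int z\<bar> < 1" using zc by (auto simp: cell_def abs_if)
          then show False using False by linarith
        qed
        then show ?thesis using False by simp
      qed (use zc in simp)
      then show ?thesis using zC by simp
    qed simp
  qed
qed

text \<open>The functions \<open>y \<mapsto> W (v y)\<close> for transition profiles \<open>v\<close> have this form, and the large deviation estimates
depend on the profile only through them.\<close>

definition bump_profile :: "real => (real => real) => bool" where
  "bump_profile r f \<longleftrightarrow> 0 < r \<and> continuous_on UNIV f \<and> (\<forall>y. 0 <= f y) \<and> (\<forall>y. f y \<noteq> 0 --> y \<in> {-r..r})"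

lemma integrable_supported:
  fixes g :: "real => real"
  assumes "g \<in> borel_measurable borel" "\<And>y. \<bar>g y\<bar> <= C" "\<And>y. g y \<noteq> 0 ==> y \<in> {-r..r}"
  shows "integrable lebesgue g"
proof (rule integrableI_bounded_set[where A="{-r..r}" and B=C])
  show "{-r..r} \<in> sets lebesgue" by auto
  show "g \<in> borel_measurable lebesgue" using assms(1) by (simp add: measurable_completion)
  show "emeasure lebesgue {-r..r} < \<infinity>" using emeasure_lborel_cbox_finite[of "-r" r] by (simp add: box_real)
  show "AE x in lebesgue. x \<in> {- r..r} --> norm (g x) <= C" using assms(2) by simp
  show "AE x in lebesgue. x \<notin> {- r..r} --> g x = 0" using assms(3) by blast
qed

lemma integrable_indicator_cell:
  fixes g :: "real => real"
  assumes "integrable lebesgue g" "\<alpha> > 0"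
  shows "integrable lebesgue (\<lambda>y. indicator (cell \<alpha> \<beta> z) y * g y)"
proof -
  have "cell \<alpha> \<beta> z \<in> sets lebesgue" using cell_sets[OF assms(2)] by (simp add: sets_completionI_sets)
  then show ?thesis using integrable_mult_indicator[OF _ assms(1), of "cell \<alpha> \<beta> z"] by simp
qed

lemma integral_cells:
  fixes g :: "real => real"
  assumes "\<alpha> > 0" "integrable lebesgue g" "\<And>y. g y \<noteq> 0 ==> y \<in> {-r..r}"
  shows "(LINT y|lebesgue. g y) = (\<Sum>z\<in>cells \<alpha> \<beta> r. (LINT y|lebesgue. indicator (cell \<alpha> \<beta> z) y * g y))"
proof -
  have "(LINT y|lebesgue. g y) = (LINT y|lebesgue. (\<Sum>z\<in>cells \<alpha> \<beta> r. indicator (cell \<alpha> \<beta> z) y * g y))"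
    using integrable_indicator_cell[OF assms(2,1)] assms(2) cells_partition_AE[OF assms(1,3)]
    by (intro integral_cong_AE borel_measurable_sum) (auto dest: borel_measurable_integrable)
  also have "\<dots> = (\<Sum>z\<in>cells \<alpha> \<beta> r. (LINT y|lebesgue. indicator (cell \<alpha> \<beta> z) y * g y))"
    by (intro Bochner_Integration.integral_sum integrable_indicator_cell assms)
  finally show ?thesis .
qed

lemma bump_profile_bounded:
  assumes "bump_profile r f" obtains C where "C > 0" "\<And>y. f y <= C" "\<And>y. \<bar>f y\<bar> <= C"
proof -
  have c: "continuous_on {-r..r} f" using assms continuous_on_subset unfolding bump_profile_def by blast
  obtain C where C: "C > 0" "\<And>y. y \<in> {-r..r} ==> \<bar>f y\<bar> <= C"
    using compact_imp_bounded[OF compact_continuous_image[OF c compact_Icc]] bounded_pos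
    by (metis imageI real_norm_def)
  have "\<bar>f y\<bar> <= C" for y
    using C assms unfolding bump_profile_def by (cases "f y = 0") auto
  then show ?thesis using that[of C] C(1) by (meson abs_le_D1)
qed

lemma bump_profile_compose_integrable:
  fixes g :: "real => real"
  assumes f: "bump_profile r f" and g: "g \<in> borel_measurable borel" "g 0 = 0"
    and bd: "\<And>C. \<exists>B. \<forall>x\<in>{0..C}. \<bar>g x\<bar> <= B"
  shows "integrable lebesgue (\<lambda>y. g (f y))"
proof -
  have fm: "f \<in> borel_measurable borel" using f by (auto simp: bump_profile_def intro: borel_measurable_continuous_onI)
  obtain C where C: "C > 0" "\<And>y. f y <= C" using bump_profile_bounded[OF f] by metis
  obtain B where B: "\<forall>x\<in>{0..C}. \<bar>g x\<bar> <= B" using bd by blast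
  show ?thesis
  proof (rule integrable_supported[where C=B and r=r])
    show "(\<lambda>y. g (f y)) \<in> borel_measurable borel" using measurable_compose[OF fm g(1)] .
    show "\<bar>g (f y)\<bar> <= B" for y using B C f by (auto simp: bump_profile_def)
    show "y \<in> {-r..r}" if "g (f y) \<noteq> 0" for y using that g(2) f by (metis bump_profile_def)
  qed
qed

lemma bump_profile_integrable: "bump_profile r f ==> integrable lebesgue f"
  using bump_profile_compose_integrable[of r f "\<lambda>x. x"] by (force simp: abs_if)

lemma potential_eq_sum:
  assumes "\<alpha> > 0" "bump_profile r f"
  shows "potential t \<alpha> \<beta> f = (\<Sum>z\<in>cells \<alpha> \<beta> r. t z * weight \<alpha> \<beta> f z)"
proof -
  have i: "integrable lebesgue (\<lambda>y. indicator (cell \<alpha> \<beta> z) y * f y)" for z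
    by (intro integrable_indicator_cell bump_profile_integrable[OF assms(2)] assms(1))
  have "potential t \<alpha> \<beta> f = (LINT y|lebesgue. (\<Sum>z\<in>cells \<alpha> \<beta> r. t z * (indicator (cell \<alpha> \<beta> z) y * f y)))"
    unfolding potential_def
    using assms by (intro Bochner_Integration.integral_cong checkerboard_supported refl) (auto simp: bump_profile_def)
  also have "\<dots> = (\<Sum>z\<in>cells \<alpha> \<beta> r. t z * weight \<alpha> \<beta> f z)"
    using i by (simp add: weight_def)
  finally show ?thesis .
qed

lemma sum_weight:
  assumes "\<alpha> > 0" "bump_profile r f"
  shows "(\<Sum>z\<in>cells \<alpha> \<beta> r. weight \<alpha> \<beta> f z) = (LINT y|lebesgue. f y)"
  unfolding weight_def
  using assms by (intro integral_cells[where r=r, symmetric] bump_profile_integrable[OF assms(2)]) (auto simp: bump_profile_def)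

lemma bump_profile_uniformly_continuous:
  assumes f: "bump_profile r f" and e: "e > 0"
  obtains d where "d > 0" "\<And>x y. \<bar>x - y\<bar> <= d ==> \<bar>f x - f y\<bar> <= e"
proof -
  have "continuous_on {-r-2..r+2} f" using f continuous_on_subset unfolding bump_profile_def by blast
  then have "uniformly_continuous_on {-r-2..r+2} f" by (intro compact_uniformly_continuous) auto
  then obtain d where d: "d > 0" "\<And>x y. x \<in> {-r-2..r+2} ==> y \<in> {-r-2..r+2} ==> dist y x < d ==> dist (f y) (f x) < e"
    unfolding uniformly_continuous_on_def using e by metis
  have z: "f y = 0" if "y \<notin> {-r..r}" for y using f that by (auto simp: bump_profile_def)
  show ?thesis
  proof (rule that[of "min 1 (d/2)"])
    fix x y assume xy: "\<bar>x - y\<bar> <= min 1 (d/2)"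
    show "\<bar>f x - f y\<bar> <= e"
    proof (cases "x \<in> {-r-2..r+2} \<and> y \<in> {-r-2..r+2}")
      case True
      then show ?thesis using d(2)[of y x] xy d(1) by (auto simp: dist_real_def)
    next
      case False
      then have "x \<notin> {-r..r}" "y \<notin> {-r..r}" using xy by auto
      then show ?thesis using z e by simp
    qed
  qed (use d in auto)
qed

locale iid_bounded = prob_space P for P :: "'w measure" +
  fixes \<Theta> :: "int => 'w => real" and tl tu :: real
  assumes indep: "indep_vars (\<lambda>_. borel) \<Theta> UNIV"
    and ident: "\<And>z. distr P borel (\<Theta> z) = distr P borel (\<Theta> 0)"
    and bounds: "\<And>z. AE \<omega> in P. tl <= \<Theta> z \<omega> \<and> \<Theta> z \<omega> <= tu"
    and tl_pos: "0 < tl"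
begin

definition "\<mu> = mean P (\<Theta> 0)"
definition "B = tu - tl"
abbreviation "\<Lambda> \<equiv> log_mgf P (\<Theta> 0)"
definition "mgf \<xi> = (LINT \<omega>|P. exp (\<xi> * (\<Theta> 0 \<omega> - \<mu>)))"
definition "tilted_mean \<xi> = (LINT \<omega>|P. (\<Theta> 0 \<omega> - \<mu>) * exp (\<xi> * (\<Theta> 0 \<omega> - \<mu>))) / mgf \<xi>"

lemma rv [measurable]: "\<Theta> z \<in> borel_measurable P"
  using indep unfolding indep_vars_def by blast

lemma integrable_\<Theta>: "integrable P (\<Theta> z)"
  by (rule integrable_const_bound[where B="\<bar>tl\<bar> + \<bar>tu\<bar>"]) (use bounds[of z] in \<open>auto elim!: eventually_mono intro: abs_leI simp del: AE_conj_iff\<close>)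

lemma \<mu>_bounds: "tl <= \<mu>" "\<mu> <= tu"
proof -
  have "(LINT \<omega>|P. tl) <= (LINT \<omega>|P. \<Theta> 0 \<omega>)"
    using bounds[of 0] by (intro integral_mono_AE integrable_\<Theta>) (auto elim!: eventually_mono)
  then show "tl <= \<mu>" by (simp add: \<mu>_def prob_space)
  have "(LINT \<omega>|P. \<Theta> 0 \<omega>) <= (LINT \<omega>|P. tu)"
    using bounds[of 0] by (intro integral_mono_AE integrable_\<Theta>) (auto elim!: eventually_mono)
  then show "\<mu> <= tu" by (simp add: \<mu>_def prob_space)
qed

lemma B_nonneg: "0 <= B" using \<mu>_bounds by (simp add: B_def)

lemma abs_dev: "AE \<omega> in P. \<bar>\<Theta> z \<omega> - \<mu>\<bar> <= B"
  using bounds[of z] by eventually_elim (use \<mu>_bounds in \<open>auto simp: B_def\<close>)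

lemma integrable_dev_exp: "integrable P (\<lambda>\<omega>. exp (\<xi> * (\<Theta> z \<omega> - \<mu>)))"
proof (rule integrable_const_bound[where B="exp (\<bar>\<xi>\<bar> * B)"])
  show "AE \<omega> in P. norm (exp (\<xi> * (\<Theta> z \<omega> - \<mu>))) <= exp (\<bar>\<xi>\<bar> * B)"
    using abs_dev[of z]
  proof eventually_elim
    case (elim \<omega>)
    have "\<xi> * (\<Theta> z \<omega> - \<mu>) <= \<bar>\<xi>\<bar> * \<bar>\<Theta> z \<omega> - \<mu>\<bar>" by (metis abs_ge_self abs_mult)
    also have "\<dots> <= \<bar>\<xi>\<bar> * B" using elim by (intro mult_left_mono) auto
    finally show ?case by simp
  qed
qed measurable

lemma integrable_dev_mult_exp: "integrable P (\<lambda>\<omega>. (\<Theta> z \<omega> - \<mu>) * exp (\<xi> * (\<Theta> z \<omega> - \<mu>)))"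
proof (rule Bochner_Integration.integrable_bound)
  show "integrable P (\<lambda>\<omega>. B * exp (\<xi> * (\<Theta> z \<omega> - \<mu>)))" by (intro integrable_mult_right integrable_dev_exp)
  show "AE \<omega> in P. norm ((\<Theta> z \<omega> - \<mu>) * exp (\<xi> * (\<Theta> z \<omega> - \<mu>))) <= norm (B * exp (\<xi> * (\<Theta> z \<omega> - \<mu>)))"
    using abs_dev[of z] by eventually_elim (auto simp: abs_mult B_nonneg intro: mult_right_mono)
qed measurable

lemma mgf_pos: "mgf \<xi> > 0"
proof -
  have "exp (- (\<bar>\<xi>\<bar> * B)) <= mgf \<xi>"
  proof -
    have "(LINT \<omega>|P. exp (- (\<bar>\<xi>\<bar> * B))) <= mgf \<xi>"
      unfolding mgf_def
    proof (rule integral_mono_AE[OF _ integrable_dev_exp])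
      show "AE \<omega> in P. exp (- (\<bar>\<xi>\<bar> * B)) <= exp (\<xi> * (\<Theta> 0 \<omega> - \<mu>))"
        using abs_dev[of 0]
      proof eventually_elim
        case (elim \<omega>)
        have "- (\<xi> * (\<Theta> 0 \<omega> - \<mu>)) <= \<bar>\<xi>\<bar> * \<bar>\<Theta> 0 \<omega> - \<mu>\<bar>" by (metis abs_ge_minus_self abs_mult)
        also have "\<dots> <= \<bar>\<xi>\<bar> * B" using elim by (intro mult_left_mono) auto
        finally show ?case by simp
      qed
    qed simp
    then show ?thesis by (simp add: prob_space)
  qed
  then show ?thesis using exp_gt_zero[of "- (\<bar>\<xi>\<bar> * B)"] by linarith
qed

lemma \<Lambda>_eq: "\<Lambda> \<xi> = ln (mgf \<xi>)"
  by (simp add: log_mgf_def mgf_def \<mu>_def)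

lemma exp_\<Lambda>: "exp (\<Lambda> \<xi>) = mgf \<xi>"
  by (simp add: \<Lambda>_eq mgf_pos)

lemma \<Lambda>_le_iff: "\<Lambda> a <= c \<longleftrightarrow> mgf a <= exp c" "c <= \<Lambda> a \<longleftrightarrow> exp c <= mgf a"
  using exp_\<Lambda>[of a] by (metis exp_le_cancel_iff)+

lemma mgf_translate: "(LINT \<omega>|P. exp (\<xi> * (\<Theta> z \<omega> - \<mu>))) = mgf \<xi>"
proof -
  have "(LINT \<omega>|P. exp (\<xi> * (\<Theta> z \<omega> - \<mu>))) = (LINT x|distr P borel (\<Theta> z). exp (\<xi> * (x - \<mu>)))"
    by (simp add: integral_distr)
  also have "\<dots> = mgf \<xi>" unfolding ident[of z] mgf_def by (simp add: integral_distr)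
  finally show ?thesis .
qed

lemma tilted_mean_mult: "tilted_mean \<xi> * mgf \<xi> = (LINT \<omega>|P. (\<Theta> 0 \<omega> - \<mu>) * exp (\<xi> * (\<Theta> 0 \<omega> - \<mu>)))"
  using mgf_pos[of \<xi>] by (simp add: tilted_mean_def)

text \<open>Convexity of the logarithmic moment generating function, in the form that the tangent lines lie below it.
The slope \<open>tilted_mean a\<close> is the mean under the exponentially tilted law.\<close>

lemma \<Lambda>_tangent: "\<Lambda> a + tilted_mean a * (b - a) <= \<Lambda> b"
proof -
  let ?Y = "\<lambda>\<omega>. \<Theta> 0 \<omega> - \<mu>" and ?m = "tilted_mean a" and ?e = "\<lambda>\<omega>. exp (a * (\<Theta> 0 \<omega> - \<mu>))"
  have "exp (?m * (b - a)) * mgf a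
     = (LINT \<omega>|P. exp (?m * (b - a)) * (?e \<omega> + (b - a) * (?Y \<omega> * ?e \<omega> - ?m * ?e \<omega>)))"
    using tilted_mean_mult[of a] integrable_dev_exp[of a 0] integrable_dev_mult_exp[of 0 a]
    by (simp add: mgf_def)
  also have "\<dots> <= mgf b"
    unfolding mgf_def
  proof (rule integral_mono)
    show "integrable P (\<lambda>\<omega>. exp (?m * (b - a)) * (?e \<omega> + (b - a) * (?Y \<omega> * ?e \<omega> - ?m * ?e \<omega>)))"
      by (intro integrable_mult_right Bochner_Integration.integrable_add Bochner_Integration.integrable_diff
          integrable_dev_exp integrable_dev_mult_exp)
    fix \<omega>
    have "1 + (b - a) * (?Y \<omega> - ?m) <= exp ((b - a) * (?Y \<omega> - ?m))" by (rule exp_ge_add_one_self)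
    then have "exp (?m * (b - a)) * (?e \<omega> * (1 + (b - a) * (?Y \<omega> - ?m))) <= exp (?m * (b - a)) * (?e \<omega> * exp ((b - a) * (?Y \<omega> - ?m)))"
      by (intro mult_left_mono) auto
    also have "\<dots> = exp (b * ?Y \<omega>)" by (simp add: exp_add[symmetric] algebra_simps)
    finally show "exp (?m * (b - a)) * (?e \<omega> + (b - a) * (?Y \<omega> * ?e \<omega> - ?m * ?e \<omega>)) <= exp (b * ?Y \<omega>)"
      by (simp add: algebra_simps)
  qed (rule integrable_dev_exp)
  finally show ?thesis by (simp add: \<Lambda>_le_iff exp_add exp_\<Lambda> mult.commute)
qed

text \<open>A second-order upper bound with a constant that does not depend on \<open>a\<close>; together with \<open>\<Lambda>_tangent\<close> it replaces
the differentiability of \<open>\<Lambda>\<close>.\<close>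

lemma \<Lambda>_quadratic:
  assumes "\<bar>\<tau>\<bar> * B <= 1"
  shows "\<Lambda> (a + \<tau>) <= \<Lambda> a + \<tau> * tilted_mean a + \<tau>\<^sup>2 * B\<^sup>2"
proof -
  let ?Y = "\<lambda>\<omega>. \<Theta> 0 \<omega> - \<mu>" and ?e = "\<lambda>\<omega>. exp (a * (\<Theta> 0 \<omega> - \<mu>))"
  have "mgf (a + \<tau>) <= (LINT \<omega>|P. ?e \<omega> + \<tau> * (?Y \<omega> * ?e \<omega>) + \<tau>\<^sup>2 * B\<^sup>2 * ?e \<omega>)"
    unfolding mgf_def
  proof (rule integral_mono_AE[OF integrable_dev_exp])
    show "integrable P (\<lambda>\<omega>. ?e \<omega> + \<tau> * (?Y \<omega> * ?e \<omega>) + \<tau>\<^sup>2 * B\<^sup>2 * ?e \<omega>)"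
      by (intro integrable_mult_right Bochner_Integration.integrable_add integrable_dev_exp integrable_dev_mult_exp)
    show "AE \<omega> in P. exp ((a + \<tau>) * ?Y \<omega>) <= ?e \<omega> + \<tau> * (?Y \<omega> * ?e \<omega>) + \<tau>\<^sup>2 * B\<^sup>2 * ?e \<omega>"
      using abs_dev[of 0]
    proof eventually_elim
      case (elim \<omega>)
      have "\<bar>\<tau> * ?Y \<omega>\<bar> <= \<bar>\<tau>\<bar> * B" using elim by (simp add: abs_mult mult_left_mono)
      then have le: "\<bar>\<tau> * ?Y \<omega>\<bar> <= 1" using assms by linarith
      have "(?Y \<omega>)\<^sup>2 <= B\<^sup>2" using elim B_nonneg by (simp add: abs_le_square_iff[symmetric])
      then have "(\<tau> * ?Y \<omega>)\<^sup>2 <= \<tau>\<^sup>2 * B\<^sup>2" by (simp add: power_mult_distrib mult_left_mono)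
      then have "exp (\<tau> * ?Y \<omega>) <= 1 + \<tau> * ?Y \<omega> + \<tau>\<^sup>2 * B\<^sup>2"
        using exp_quadratic_bound[OF le] by linarith
      then have "?e \<omega> * exp (\<tau> * ?Y \<omega>) <= ?e \<omega> * (1 + \<tau> * ?Y \<omega> + \<tau>\<^sup>2 * B\<^sup>2)" by (intro mult_left_mono) auto
      then show ?case by (simp add: exp_add[symmetric] algebra_simps)
    qed
  qed
  also have "\<dots> = mgf a * (1 + \<tau> * tilted_mean a + \<tau>\<^sup>2 * B\<^sup>2)"
  proof -
    have "(LINT \<omega>|P. ?e \<omega> + \<tau> * (?Y \<omega> * ?e \<omega>) + \<tau>\<^sup>2 * B\<^sup>2 * ?e \<omega>)
       = mgf a + \<tau> * (LINT \<omega>|P. ?Y \<omega> * ?e \<omega>) + \<tau>\<^sup>2 * B\<^sup>2 * mgf a"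
      using integrable_dev_exp[of a 0] integrable_dev_mult_exp[of 0 a] by (simp add: mgf_def)
    then show ?thesis unfolding tilted_mean_mult[symmetric] by (simp only:) (simp add: algebra_simps)
  qed
  also have "\<dots> <= mgf a * exp (\<tau> * tilted_mean a + \<tau>\<^sup>2 * B\<^sup>2)"
    using exp_ge_add_one_self[of "\<tau> * tilted_mean a + \<tau>\<^sup>2 * B\<^sup>2"] mgf_pos[of a]
    by (intro mult_left_mono) (auto simp: add.assoc)
  finally show ?thesis by (simp add: \<Lambda>_le_iff exp_add exp_\<Lambda> mult.assoc)
qed

lemma \<Lambda>_0: "\<Lambda> 0 = 0"
  by (simp add: \<Lambda>_eq mgf_def prob_space)

lemma tilted_mean_0: "tilted_mean 0 = 0"
  using integrable_\<Theta>[of 0] by (simp add: tilted_mean_def \<mu>_def prob_space)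

lemma \<Lambda>_nonneg: "0 <= \<Lambda> \<xi>"
  using \<Lambda>_tangent[of 0 \<xi>] by (simp add: \<Lambda>_0 tilted_mean_0)

lemma \<Lambda>_lipschitz: "\<bar>\<Lambda> b - \<Lambda> a\<bar> <= B * \<bar>b - a\<bar>"
proof -
  have "\<Lambda> b <= \<Lambda> a + B * \<bar>b - a\<bar>" for a b
  proof -
    have "mgf b <= (LINT \<omega>|P. exp (B * \<bar>b - a\<bar>) * exp (a * (\<Theta> 0 \<omega> - \<mu>)))"
      unfolding mgf_def
    proof (rule integral_mono_AE[OF integrable_dev_exp])
      show "AE \<omega> in P. exp (b * (\<Theta> 0 \<omega> - \<mu>)) <= exp (B * \<bar>b - a\<bar>) * exp (a * (\<Theta> 0 \<omega> - \<mu>))"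
        using abs_dev[of 0]
      proof eventually_elim
        case (elim \<omega>)
        have "(b - a) * (\<Theta> 0 \<omega> - \<mu>) <= \<bar>b - a\<bar> * \<bar>\<Theta> 0 \<omega> - \<mu>\<bar>" by (metis abs_ge_self abs_mult)
        also have "\<dots> <= \<bar>b - a\<bar> * B" using elim by (intro mult_left_mono) auto
        finally have "b * (\<Theta> 0 \<omega> - \<mu>) <= B * \<bar>b - a\<bar> + a * (\<Theta> 0 \<omega> - \<mu>)" by (simp add: algebra_simps)
        then show ?case by (simp add: exp_add[symmetric])
      qed
    qed (intro integrable_mult_right integrable_dev_exp)
    also have "\<dots> = exp (B * \<bar>b - a\<bar>) * mgf a" by (simp add: mgf_def)
    finally show ?thesis by (simp add: \<Lambda>_le_iff exp_add exp_\<Lambda> mult.commute)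
  qed
  from this[of a b] this[of b a] show ?thesis by (simp add: abs_minus_commute abs_le_iff)
qed

text \<open>Coefficients are at least \<open>tl\<close>, so negative tilts gain at most linearly. This is what makes the rate function
infinite beyond a gain smaller than the surface tension.\<close>

lemma \<Lambda>_le_linear: "\<xi> <= 0 ==> \<Lambda> \<xi> <= \<xi> * (tl - \<mu>)"
proof -
  assume \<xi>: "\<xi> <= 0"
  have "mgf \<xi> <= (LINT \<omega>|P. exp (\<xi> * (tl - \<mu>)))"
    unfolding mgf_def
  proof (rule integral_mono_AE[OF integrable_dev_exp])
    show "AE \<omega> in P. exp (\<xi> * (\<Theta> 0 \<omega> - \<mu>)) <= exp (\<xi> * (tl - \<mu>))"
      using bounds[of 0] by eventually_elim (use \<xi> in \<open>auto intro: mult_left_mono_neg\<close>)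
  qed simp
  then show ?thesis by (simp add: prob_space \<Lambda>_le_iff)
qed

lemma tilted_mean_mono: "mono tilted_mean"
proof (rule monoI)
  fix a b :: real assume "a <= b"
  have "(tilted_mean b - tilted_mean a) * (b - a) >= 0"
    using \<Lambda>_tangent[of a b] \<Lambda>_tangent[of b a] by (simp add: algebra_simps)
  then show "tilted_mean a <= tilted_mean b"
    using \<open>a <= b\<close> by (cases "a = b") (auto simp: zero_le_mult_iff)
qed

lemma \<Lambda>_continuous: "continuous_on A \<Lambda>"
proof (rule continuous_on_subset[OF _ subset_UNIV], rule continuous_onI)
  fix x e :: real assume e: "e > 0"
  have "dist (\<Lambda> x') (\<Lambda> x) <= e" if "dist x' x < e / (B + 1)" for x'
  proof -
    have "\<bar>\<Lambda> x' - \<Lambda> x\<bar> <= B * \<bar>x' - x\<bar>" by (rule \<Lambda>_lipschitz)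
    also have "\<dots> <= (B + 1) * (e / (B + 1))"
      using that B_nonneg by (intro mult_mono) (auto simp: dist_real_def)
    also have "\<dots> = e" using B_nonneg by simp
    finally show ?thesis by (simp add: dist_real_def)
  qed
  then show "\<exists>d>0. \<forall>x'\<in>UNIV. dist x' x < d --> dist (\<Lambda> x') (\<Lambda> x) <= e"
    using e B_nonneg by (intro exI[of _ "e / (B + 1)"]) auto
qed

lemma \<Lambda>_abs: "\<bar>\<Lambda> \<xi>\<bar> <= B * \<bar>\<xi>\<bar>" using \<Lambda>_lipschitz[of \<xi> 0] by (simp add: \<Lambda>_0)

text \<open>The scaled limit, as \<open>\<alpha> \<rightarrow> \<infinity>\<close>, of the logarithmic moment generating function of \<open>\<alpha> * fluct\<close>.\<close>

definition "cumulant f \<xi> = (LINT y|lebesgue. \<Lambda> (\<xi> * f y))"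

lemma integrable_\<Lambda>: assumes "bump_profile r f" shows "integrable lebesgue (\<lambda>y. \<Lambda> (\<xi> * f y))"
proof (rule bump_profile_compose_integrable[OF assms])
  show "(\<lambda>x. \<Lambda> (\<xi> * x)) \<in> borel_measurable borel"
    by (intro borel_measurable_continuous_onI continuous_on_compose2[OF \<Lambda>_continuous[of UNIV]] continuous_intros) auto
  show "\<exists>C'. \<forall>x\<in>{0..C}. \<bar>\<Lambda> (\<xi> * x)\<bar> <= C'" for C
  proof (intro exI ballI)
    fix x assume "x \<in> {0..C}"
    have "\<bar>\<Lambda> (\<xi> * x)\<bar> <= B * (\<bar>\<xi>\<bar> * \<bar>x\<bar>)" using \<Lambda>_abs[of "\<xi> * x"] by (simp add: abs_mult)
    also have "\<dots> <= B * (\<bar>\<xi>\<bar> * C)" using \<open>x \<in> {0..C}\<close> B_nonneg by (intro mult_left_mono) auto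
    finally show "\<bar>\<Lambda> (\<xi> * x)\<bar> <= B * (\<bar>\<xi>\<bar> * C)" .
  qed
qed (simp add: \<Lambda>_0)

lemma cumulant_nonneg: "0 <= cumulant f \<xi>"
  unfolding cumulant_def by (intro Bochner_Integration.integral_nonneg \<Lambda>_nonneg)

lemma cumulant_0: "cumulant f 0 = 0"
  by (simp add: cumulant_def \<Lambda>_0)

lemma cumulant_le_linear:
  assumes "bump_profile r f" "\<xi> <= 0"
  shows "cumulant f \<xi> <= \<xi> * (tl - \<mu>) * (LINT y|lebesgue. f y)"
proof -
  have "cumulant f \<xi> <= (LINT y|lebesgue. \<xi> * (tl - \<mu>) * f y)"
    unfolding cumulant_def
  proof (rule integral_mono)
    fix y
    have "\<xi> * f y <= 0" using assms by (simp add: bump_profile_def mult_nonpos_nonneg)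
    from \<Lambda>_le_linear[OF this] show "\<Lambda> (\<xi> * f y) <= \<xi> * (tl - \<mu>) * f y" by (simp add: algebra_simps)
  qed (use integrable_\<Lambda>[OF assms(1)] bump_profile_integrable[OF assms(1)] in auto)
  then show ?thesis by simp
qed

lemma cumulant_lipschitz:
  assumes "bump_profile r f"
  shows "\<bar>cumulant f b - cumulant f a\<bar> <= B * \<bar>b - a\<bar> * (LINT y|lebesgue. f y)"
proof -
  have fi: "integrable lebesgue f" by (rule bump_profile_integrable[OF assms])
  have "\<bar>cumulant f b - cumulant f a\<bar> = \<bar>LINT y|lebesgue. \<Lambda> (b * f y) - \<Lambda> (a * f y)\<bar>"
    unfolding cumulant_def using integrable_\<Lambda>[OF assms] by simp
  also have "\<dots> <= (LINT y|lebesgue. B * \<bar>b - a\<bar> * f y)"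
    unfolding real_norm_def[symmetric]
  proof (rule Bochner_Integration.integral_norm_bound_integral)
    fix y
    have "\<bar>\<Lambda> (b * f y) - \<Lambda> (a * f y)\<bar> <= B * \<bar>b * f y - a * f y\<bar>" by (rule \<Lambda>_lipschitz)
    also have "\<dots> = B * \<bar>b - a\<bar> * f y" using assms by (simp add: left_diff_distrib[symmetric] abs_mult bump_profile_def)
    finally show "norm (\<Lambda> (b * f y) - \<Lambda> (a * f y)) <= B * norm (b - a) * f y" by simp
  qed (use integrable_\<Lambda>[OF assms] fi in auto)
  finally show ?thesis by simp
qed

definition "cumulant_slope f \<xi> = (LINT y|lebesgue. f y * tilted_mean (\<xi> * f y))"

lemma cumulant_slope_0: "cumulant_slope f 0 = 0"
  by (simp add: cumulant_slope_def tilted_mean_0)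

lemma cumulant_quadratic:
  assumes f: "bump_profile r f"
  obtains C \<tau>0 where "C >= 0" "\<tau>0 > 0"
    "\<And>\<xi> \<tau>. \<bar>\<tau>\<bar> <= \<tau>0 ==> cumulant f (\<xi> + \<tau>) <= cumulant f \<xi> + \<tau> * cumulant_slope f \<xi> + C * \<tau>\<^sup>2"
proof -
  obtain M where M: "M > 0" "\<And>y. f y <= M" using bump_profile_bounded[OF f] by metis
  have f0: "0 <= f y" for y using f by (simp add: bump_profile_def)
  define \<tau>0 where "\<tau>0 = 1 / ((B + 1) * M)"
  have \<tau>0: "\<tau>0 > 0" using M B_nonneg by (simp add: \<tau>0_def)
  have i1: "integrable lebesgue (\<lambda>y. f y * tilted_mean (\<xi> * f y))" for \<xi>
  proof (rule bump_profile_compose_integrable[OF f])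
    show "(\<lambda>x. x * tilted_mean (\<xi> * x)) \<in> borel_measurable borel"
      using borel_measurable_mono[OF tilted_mean_mono] by measurable
    show "\<exists>C'. \<forall>x\<in>{0..C}. \<bar>x * tilted_mean (\<xi> * x)\<bar> <= C'" for C
    proof (intro exI ballI)
      fix x assume x: "x \<in> {0..C}"
      have le: "- (\<bar>\<xi>\<bar> * C) <= \<xi> * x" "\<xi> * x <= \<bar>\<xi>\<bar> * C"
      proof -
        have "\<bar>\<xi> * x\<bar> <= \<bar>\<xi>\<bar> * C" using x by (auto simp: abs_mult intro: mult_left_mono)
        then show "- (\<bar>\<xi>\<bar> * C) <= \<xi> * x" "\<xi> * x <= \<bar>\<xi>\<bar> * C" by linarith+
      qed
      have "\<bar>tilted_mean (\<xi> * x)\<bar> <= \<bar>tilted_mean (- (\<bar>\<xi>\<bar> * C))\<bar> + \<bar>tilted_mean (\<bar>\<xi>\<bar> * C)\<bar>"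
        using monoD[OF tilted_mean_mono le(1)] monoD[OF tilted_mean_mono le(2)] by linarith
      then show "\<bar>x * tilted_mean (\<xi> * x)\<bar> <= C * (\<bar>tilted_mean (- (\<bar>\<xi>\<bar> * C))\<bar> + \<bar>tilted_mean (\<bar>\<xi>\<bar> * C)\<bar>)"
        unfolding abs_mult using x by (intro mult_mono) auto
    qed
  qed simp
  have i2: "integrable lebesgue (\<lambda>y. (f y)\<^sup>2 * B\<^sup>2)"
  proof (rule bump_profile_compose_integrable[OF f])
    show "\<exists>C'. \<forall>x\<in>{0..C}. \<bar>x\<^sup>2 * B\<^sup>2\<bar> <= C'" for C
      by (rule exI[of _ "C\<^sup>2 * B\<^sup>2"]) (auto simp: abs_mult intro!: mult_right_mono power_mono)
  qed auto
  define C where "C = (LINT y|lebesgue. (f y)\<^sup>2 * B\<^sup>2)"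
  have "C >= 0" unfolding C_def by (intro Bochner_Integration.integral_nonneg) auto
  moreover have "cumulant f (\<xi> + \<tau>) <= cumulant f \<xi> + \<tau> * cumulant_slope f \<xi> + C * \<tau>\<^sup>2" if \<tau>: "\<bar>\<tau>\<bar> <= \<tau>0" for \<xi> \<tau>
  proof -
    have "cumulant f (\<xi> + \<tau>) <= (LINT y|lebesgue. \<Lambda> (\<xi> * f y) + \<tau> * (f y * tilted_mean (\<xi> * f y)) + \<tau>\<^sup>2 * ((f y)\<^sup>2 * B\<^sup>2))"
      unfolding cumulant_def
    proof (rule integral_mono)
      fix y
      have "\<bar>\<tau> * f y\<bar> * B <= (\<tau>0 * M) * (B + 1)"
        unfolding abs_mult using \<tau> M f0[of y] B_nonneg \<tau>0 by (intro mult_mono) auto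
      also have "\<dots> = 1"
      proof -
        have "B + 1 \<noteq> 0" "M \<noteq> 0" using M B_nonneg by auto
        then show ?thesis by (simp add: \<tau>0_def)
      qed
      finally have "\<Lambda> (\<xi> * f y + \<tau> * f y) <= \<Lambda> (\<xi> * f y) + \<tau> * f y * tilted_mean (\<xi> * f y) + (\<tau> * f y)\<^sup>2 * B\<^sup>2"
        by (rule \<Lambda>_quadratic)
      then show "\<Lambda> ((\<xi> + \<tau>) * f y) <= \<Lambda> (\<xi> * f y) + \<tau> * (f y * tilted_mean (\<xi> * f y)) + \<tau>\<^sup>2 * ((f y)\<^sup>2 * B\<^sup>2)"
        by (simp add: algebra_simps power_mult_distrib)
    qed (use integrable_\<Lambda>[OF f] i1 i2 in auto)
    also have "\<dots> = cumulant f \<xi> + \<tau> * cumulant_slope f \<xi> + C * \<tau>\<^sup>2"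
      using integrable_\<Lambda>[OF f] i1 i2 by (simp add: cumulant_def cumulant_slope_def C_def del: integral_mult_left_zero integral_mult_left)
    finally show ?thesis .
  qed
  ultimately show ?thesis using \<tau>0 that by blast
qed

end

section \<open>Large deviations of weighted sums\<close>

context iid_bounded begin

definition "fluct r \<alpha> \<beta> f \<omega> = (\<Sum>z\<in>cells \<alpha> \<beta> r. (\<Theta> z \<omega> - \<mu>) * weight \<alpha> \<beta> f z)"

lemma potential_eq_fluct:
  assumes "\<alpha> > 0" "bump_profile r f"
  shows "potential (\<lambda>z. \<Theta> z \<omega>) \<alpha> \<beta> f = \<mu> * (LINT y|lebesgue. f y) + fluct r \<alpha> \<beta> f \<omega>"
  unfolding potential_eq_sum[OF assms] sum_weight[OF assms, of \<beta>, symmetric] fluct_def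
  by (simp add: sum_distrib_left sum.distrib[symmetric] algebra_simps)

lemma fluct_measurable [measurable]: "fluct r \<alpha> \<beta> f \<in> borel_measurable P"
  unfolding fluct_def[abs_def] by measurable

text \<open>Independence turns the moment generating function of the weighted sum into a product over cells.\<close>

lemma mgf_fluct:
  assumes "\<alpha> > 0"
  shows "integrable P (\<lambda>\<omega>. exp (\<alpha> * \<xi> * fluct r \<alpha> \<beta> f \<omega>))"
    and "(LINT \<omega>|P. exp (\<alpha> * \<xi> * fluct r \<alpha> \<beta> f \<omega>)) = exp (\<Sum>z\<in>cells \<alpha> \<beta> r. \<Lambda> (\<xi> * \<alpha> * weight \<alpha> \<beta> f z))"
proof -
  define c where "c z = \<xi> * \<alpha> * weight \<alpha> \<beta> f z" for z
  have eq: "exp (\<alpha> * \<xi> * fluct r \<alpha> \<beta> f \<omega>) = (\<Prod>z\<in>cells \<alpha> \<beta> r. exp (c z * (\<Theta> z \<omega> - \<mu>)))" for \<omega>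
    by (simp add: fluct_def exp_sum[symmetric] sum_distrib_left c_def mult.assoc mult.left_commute)
      (rule sum.cong, simp_all add: algebra_simps)
  have iv: "indep_vars (\<lambda>_. borel) (\<lambda>z \<omega>. exp (c z * (\<Theta> z \<omega> - \<mu>))) (cells \<alpha> \<beta> r)"
    by (rule indep_vars_compose2[OF indep_vars_subset[OF indep subset_UNIV], where Y="\<lambda>z x. exp (c z * (x - \<mu>))"]) measurable
  note ii = integrable_dev_exp
  show "integrable P (\<lambda>\<omega>. exp (\<alpha> * \<xi> * fluct r \<alpha> \<beta> f \<omega>))"
    unfolding eq by (rule indep_vars_integrable[OF finite_cells iv ii])
  have "(LINT \<omega>|P. exp (\<alpha> * \<xi> * fluct r \<alpha> \<beta> f \<omega>)) = (\<Prod>z\<in>cells \<alpha> \<beta> r. LINT \<omega>|P. exp (c z * (\<Theta> z \<omega> - \<mu>)))"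
    unfolding eq by (rule indep_vars_lebesgue_integral[OF finite_cells iv ii])
  also have "\<dots> = exp (\<Sum>z\<in>cells \<alpha> \<beta> r. \<Lambda> (c z))"
    by (simp add: mgf_translate exp_sum exp_\<Lambda>)
  finally show "(LINT \<omega>|P. exp (\<alpha> * \<xi> * fluct r \<alpha> \<beta> f \<omega>)) = exp (\<Sum>z\<in>cells \<alpha> \<beta> r. \<Lambda> (\<xi> * \<alpha> * weight \<alpha> \<beta> f z))"
    by (simp add: c_def)
qed

lemma integrable_indicator_cell_const:
  assumes "\<alpha> > 0"
  shows "integrable lebesgue (indicator (cell \<alpha> \<beta> z) :: real => real)"
    "(LINT y|lebesgue. indicator (cell \<alpha> \<beta> z) y) = 1 / \<alpha>"
  using cell_sets[OF assms, of \<beta> z] emeasure_cell[OF assms, of \<beta> z] assms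
  by (auto simp: sets_completionI_sets measure_def)

text \<open>Jensen's inequality on a cell, whose length is \<open>1 / \<alpha>\<close>: integrate the tangent line at the mean of \<open>\<xi> f\<close>.\<close>

lemma \<Lambda>_jensen:
  assumes "\<alpha> > 0" "bump_profile r f"
  shows "\<Lambda> (\<xi> * \<alpha> * weight \<alpha> \<beta> f z) <= \<alpha> * (LINT y|lebesgue. indicator (cell \<alpha> \<beta> z) y * \<Lambda> (\<xi> * f y))"
proof -
  let ?a = "\<xi> * \<alpha> * weight \<alpha> \<beta> f z" and ?i = "indicator (cell \<alpha> \<beta> z) :: real => real"
  have i1: "integrable lebesgue (\<lambda>y. ?i y * f y)"
    by (intro integrable_indicator_cell bump_profile_integrable[OF assms(2)] assms(1))
  have i2: "integrable lebesgue (\<lambda>y. ?i y * \<Lambda> (\<xi> * f y))"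
    by (intro integrable_indicator_cell integrable_\<Lambda>[OF assms(2)] assms(1))
  note i0 = integrable_indicator_cell_const[OF assms(1), of \<beta> z]
  have "\<Lambda> ?a / \<alpha> = (LINT y|lebesgue. (\<Lambda> ?a - tilted_mean ?a * ?a) * ?i y + tilted_mean ?a * \<xi> * (?i y * f y))"
  proof -
    define m where "m = tilted_mean ?a"
    define w where "w = weight \<alpha> \<beta> f z"
    have "(LINT y|lebesgue. (\<Lambda> ?a - m * ?a) * ?i y + m * \<xi> * (?i y * f y))
        = (LINT y|lebesgue. (\<Lambda> ?a - m * ?a) * ?i y) + (LINT y|lebesgue. m * \<xi> * (?i y * f y))"
      using i0(1) i1 by (intro Bochner_Integration.integral_add integrable_mult_right)
    also have "\<dots> = (\<Lambda> ?a - m * ?a) * (1 / \<alpha>) + m * \<xi> * w"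
      using i0(2) by (simp only: integral_mult_right_zero weight_def w_def)
    also have "\<dots> = \<Lambda> ?a / \<alpha>" using assms(1) unfolding w_def[symmetric] by (simp add: field_simps)
    finally show ?thesis unfolding m_def by simp
  qed
  also have "\<dots> <= (LINT y|lebesgue. ?i y * \<Lambda> (\<xi> * f y))"
  proof (rule integral_mono[OF _ i2])
    show "integrable lebesgue (\<lambda>y. (\<Lambda> ?a - tilted_mean ?a * ?a) * ?i y + tilted_mean ?a * \<xi> * (?i y * f y))"
      using i0 i1 by (intro Bochner_Integration.integrable_add integrable_mult_right)
    fix y show "(\<Lambda> ?a - tilted_mean ?a * ?a) * ?i y + tilted_mean ?a * \<xi> * (?i y * f y) <= ?i y * \<Lambda> (\<xi> * f y)"
      using \<Lambda>_tangent[of ?a "\<xi> * f y"] by (simp add: indicator_def algebra_simps)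
  qed
  finally show ?thesis using assms(1) by (simp add: field_simps)
qed

lemma cumulant_cells:
  assumes "\<alpha> > 0" "bump_profile r f"
  shows "cumulant f \<xi> = (\<Sum>z\<in>cells \<alpha> \<beta> r. (LINT y|lebesgue. indicator (cell \<alpha> \<beta> z) y * \<Lambda> (\<xi> * f y)))"
  unfolding cumulant_def
proof (rule integral_cells[OF assms(1) integrable_\<Lambda>[OF assms(2)]])
  fix y assume "\<Lambda> (\<xi> * f y) \<noteq> 0"
  then have "f y \<noteq> 0" by (auto simp: \<Lambda>_0)
  then show "y \<in> {-r..r}" using assms(2) by (simp add: bump_profile_def)
qed

lemma mgf_fluct_le:
  assumes "\<alpha> > 0" "bump_profile r f"
  shows "(LINT \<omega>|P. exp (\<alpha> * \<xi> * fluct r \<alpha> \<beta> f \<omega>)) <= exp (\<alpha> * cumulant f \<xi>)"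
  unfolding mgf_fluct(2)[OF assms(1)] exp_le_cancel_iff cumulant_cells[OF assms, where \<beta>=\<beta>] sum_distrib_left
  by (intro sum_mono \<Lambda>_jensen[OF assms])

text \<open>Chernoff's bound relative to an exponential tilt: where \<open>c <= (\<xi>1 - \<xi>0) * fluct\<close>, the weight with tilt \<open>\<xi>0\<close> is at
most \<open>exp (- \<alpha> c)\<close> times the weight with tilt \<open>\<xi>1\<close>.\<close>

lemma tilted_tail:
  assumes "\<alpha> > 0" "bump_profile r f"
  shows "(LINT \<omega>|P. indicator {\<omega>. c <= (\<xi>1 - \<xi>0) * fluct r \<alpha> \<beta> f \<omega>} \<omega> * exp (\<alpha> * \<xi>0 * fluct r \<alpha> \<beta> f \<omega>))
      <= exp (\<alpha> * (cumulant f \<xi>1 - c))"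
    and "integrable P (\<lambda>\<omega>. indicator {\<omega>. c <= (\<xi>1 - \<xi>0) * fluct r \<alpha> \<beta> f \<omega>} \<omega> * exp (\<alpha> * \<xi>0 * fluct r \<alpha> \<beta> f \<omega>))"
proof -
  let ?S = "fluct r \<alpha> \<beta> f" and ?A = "{\<omega>. c <= (\<xi>1 - \<xi>0) * fluct r \<alpha> \<beta> f \<omega>}"
  show i: "integrable P (\<lambda>\<omega>. indicator ?A \<omega> * exp (\<alpha> * \<xi>0 * ?S \<omega>))"
  proof (rule Bochner_Integration.integrable_bound[OF mgf_fluct(1)[OF assms(1), of \<xi>0]])
    have "(\<lambda>\<omega>. (if c <= (\<xi>1 - \<xi>0) * ?S \<omega> then 1 else 0) * exp (\<alpha> * \<xi>0 * ?S \<omega>)) \<in> borel_measurable P"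
      by measurable
    then show "(\<lambda>\<omega>. indicator ?A \<omega> * exp (\<alpha> * \<xi>0 * ?S \<omega>)) \<in> borel_measurable P"
      by (simp add: indicator_def of_bool_def)
  qed (auto simp: indicator_def)
  have "(LINT \<omega>|P. indicator ?A \<omega> * exp (\<alpha> * \<xi>0 * ?S \<omega>)) <= (LINT \<omega>|P. exp (- (\<alpha> * c)) * exp (\<alpha> * \<xi>1 * ?S \<omega>))"
  proof (rule integral_mono[OF i])
    show "integrable P (\<lambda>\<omega>. exp (- (\<alpha> * c)) * exp (\<alpha> * \<xi>1 * ?S \<omega>))"
      by (intro integrable_mult_right mgf_fluct assms)
    fix \<omega>
    show "indicator ?A \<omega> * exp (\<alpha> * \<xi>0 * ?S \<omega>) <= exp (- (\<alpha> * c)) * exp (\<alpha> * \<xi>1 * ?S \<omega>)"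
    proof (cases "\<omega> \<in> ?A")
      case True
      then have "\<alpha> * c <= \<alpha> * ((\<xi>1 - \<xi>0) * ?S \<omega>)" using assms(1) by (intro mult_left_mono) auto
      then have "\<alpha> * \<xi>0 * ?S \<omega> <= - (\<alpha> * c) + \<alpha> * \<xi>1 * ?S \<omega>" by (simp add: algebra_simps)
      then show ?thesis using True by (simp add: exp_add[symmetric])
    qed simp
  qed
  also have "\<dots> <= exp (- (\<alpha> * c)) * exp (\<alpha> * cumulant f \<xi>1)"
    using mgf_fluct_le[OF assms, of \<xi>1 \<beta>] by simp
  also have "\<dots> = exp (\<alpha> * (cumulant f \<xi>1 - c))" by (simp add: exp_add[symmetric] algebra_simps)
  finally show "(LINT \<omega>|P. indicator ?A \<omega> * exp (\<alpha> * \<xi>0 * ?S \<omega>)) <= exp (\<alpha> * (cumulant f \<xi>1 - c))" .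
qed

lemma chernoff:
  assumes "\<alpha> > 0" "bump_profile r f"
  shows "prob {\<omega> \<in> space P. c <= \<xi> * fluct r \<alpha> \<beta> f \<omega>} <= exp (\<alpha> * (cumulant f \<xi> - c))"
proof -
  have "prob {\<omega> \<in> space P. c <= \<xi> * fluct r \<alpha> \<beta> f \<omega>} = (LINT \<omega>|P. indicator {\<omega> \<in> space P. c <= \<xi> * fluct r \<alpha> \<beta> f \<omega>} \<omega>)"
    by simp
  also have "\<dots> = (LINT \<omega>|P. indicator {\<omega>. c <= (\<xi> - 0) * fluct r \<alpha> \<beta> f \<omega>} \<omega> * exp (\<alpha> * 0 * fluct r \<alpha> \<beta> f \<omega>))"
    by (intro Bochner_Integration.integral_cong) (auto simp: indicator_def)
  also have "\<dots> <= exp (\<alpha> * (cumulant f \<xi> - c))" by (rule tilted_tail[OF assms])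
  finally show ?thesis .
qed

text \<open>The converse of \<open>mgf_fluct_le\<close> up to an error \<open>\<gamma>\<close>. For large \<open>\<alpha>\<close> the cells are so short that \<open>f\<close> is almost constant on
each of them, uniformly in the offset \<open>\<beta>\<close>, and Jensen's inequality is almost an equality.\<close>

lemma mgf_fluct_ge:
  assumes f: "bump_profile r f" and \<gamma>: "\<gamma> > 0"
  obtains \<alpha>1 where "\<alpha>1 > 0"
    "\<And>\<alpha> \<beta>. \<alpha> >= \<alpha>1 ==> exp (\<alpha> * (cumulant f \<xi> - \<gamma>)) <= (LINT \<omega>|P. exp (\<alpha> * \<xi> * fluct r \<alpha> \<beta> f \<omega>))"
proof -
  have r: "0 < r" using f by (simp add: bump_profile_def)
  define D where "D = (\<bar>\<xi>\<bar> + 1) * (B + 1) * (2 * r + 2)"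
  have D: "D > 0" using r B_nonneg by (auto simp: D_def)
  define e where "e = \<gamma> / D"
  have e: "e > 0" using \<gamma> D by (simp add: e_def)
  obtain d where d: "d > 0" "\<And>x y. \<bar>x - y\<bar> <= d ==> \<bar>f x - f y\<bar> <= e"
    using bump_profile_uniformly_continuous[OF f e] by blast
  have main: "\<alpha> * (cumulant f \<xi> - \<gamma>) <= (\<Sum>z\<in>cells \<alpha> \<beta> r. \<Lambda> (\<xi> * \<alpha> * weight \<alpha> \<beta> f z))"
    if \<alpha>: "\<alpha> >= max 1 (1 / d)" for \<alpha> \<beta>
  proof -
    have a0: "\<alpha> > 0" "\<alpha> >= 1" using \<alpha> by auto
    have "1 / d <= \<alpha>" using \<alpha> by simp
    then have ad: "1 / \<alpha> <= d" using a0 d(1) by (simp add: field_simps)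
    have fi: "integrable lebesgue f" by (rule bump_profile_integrable[OF f])
    have cellbd: "(LINT y|lebesgue. indicator (cell \<alpha> \<beta> z) y * \<Lambda> (\<xi> * f y))
        <= (1 / \<alpha>) * \<Lambda> (\<xi> * \<alpha> * weight \<alpha> \<beta> f z) + (1 / \<alpha>) * (B * \<bar>\<xi>\<bar> * e)" for z
    proof -
      let ?w = "\<alpha> * weight \<alpha> \<beta> f z" and ?i = "indicator (cell \<alpha> \<beta> z) :: real => real"
      note i0 = integrable_indicator_cell_const[OF a0(1), of \<beta> z]
      have i1: "integrable lebesgue (\<lambda>y. ?i y * f y)"
        by (intro integrable_indicator_cell fi a0)
      have osc: "\<bar>f y - ?w\<bar> <= e" if y: "y \<in> cell \<alpha> \<beta> z" for y
      proof -
        have near: "\<bar>f y - f y'\<bar> <= e" if y': "y' \<in> cell \<alpha> \<beta> z" for y'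
        proof (rule d(2))
          have "\<bar>\<alpha> * (y - y')\<bar> <= 1" using y y' by (auto simp: cell_def abs_le_iff algebra_simps)
          then have "\<alpha> * \<bar>y - y'\<bar> <= 1" using a0 by (simp only: abs_mult abs_of_pos)
          then have "\<bar>y - y'\<bar> <= 1 / \<alpha>" using a0 by (simp add: pos_le_divide_eq mult.commute)
          then show "\<bar>y - y'\<bar> <= d" using ad by simp
        qed
        have "(LINT y'|lebesgue. (f y - e) * ?i y') <= (LINT y'|lebesgue. ?i y' * f y')"
          using near by (intro integral_mono integrable_mult_right i0 i1) (auto simp: indicator_def abs_le_iff algebra_simps)
        then have "(f y - e) * (1 / \<alpha>) <= weight \<alpha> \<beta> f z"
          by (simp only: integral_mult_right_zero i0(2) weight_def)
        then have l: "f y - e <= ?w" using a0 by (simp add: field_simps)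
        have "(LINT y'|lebesgue. ?i y' * f y') <= (LINT y'|lebesgue. (f y + e) * ?i y')"
          using near by (intro integral_mono integrable_mult_right i0 i1) (auto simp: indicator_def abs_le_iff algebra_simps)
        then have "weight \<alpha> \<beta> f z <= (f y + e) * (1 / \<alpha>)"
          by (simp only: integral_mult_right_zero i0(2) weight_def)
        then have u: "?w <= f y + e" using a0 by (simp add: field_simps)
        from l u show ?thesis by linarith
      qed
      have "(LINT y|lebesgue. ?i y * \<Lambda> (\<xi> * f y)) <= (LINT y|lebesgue. (\<Lambda> (\<xi> * ?w) + B * \<bar>\<xi>\<bar> * e) * ?i y)"
      proof (rule integral_mono)
        show "integrable lebesgue (\<lambda>y. ?i y * \<Lambda> (\<xi> * f y))"
          by (intro integrable_indicator_cell integrable_\<Lambda>[OF f] a0)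
        show "integrable lebesgue (\<lambda>y. (\<Lambda> (\<xi> * ?w) + B * \<bar>\<xi>\<bar> * e) * ?i y)"
          by (intro integrable_mult_right i0)
        fix y show "?i y * \<Lambda> (\<xi> * f y) <= (\<Lambda> (\<xi> * ?w) + B * \<bar>\<xi>\<bar> * e) * ?i y"
        proof (cases "y \<in> cell \<alpha> \<beta> z")
          case True
          have "\<bar>\<Lambda> (\<xi> * f y) - \<Lambda> (\<xi> * ?w)\<bar> <= B * \<bar>\<xi> * f y - \<xi> * ?w\<bar>" by (rule \<Lambda>_lipschitz)
          also have "\<dots> = B * \<bar>\<xi>\<bar> * \<bar>f y - ?w\<bar>" by (simp add: right_diff_distrib[symmetric] abs_mult)
          also have "\<dots> <= B * \<bar>\<xi>\<bar> * e" using osc[OF True] B_nonneg by (intro mult_left_mono) auto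
          finally show ?thesis using True by simp
        qed simp
      qed
      also have "\<dots> = (\<Lambda> (\<xi> * ?w) + B * \<bar>\<xi>\<bar> * e) * (1 / \<alpha>)"
        by (simp only: integral_mult_right_zero i0(2))
      finally show ?thesis by (simp add: algebra_simps)
    qed
    have "cumulant f \<xi> <= (\<Sum>z\<in>cells \<alpha> \<beta> r. (1 / \<alpha>) * \<Lambda> (\<xi> * \<alpha> * weight \<alpha> \<beta> f z) + (1 / \<alpha>) * (B * \<bar>\<xi>\<bar> * e))"
      unfolding cumulant_cells[OF a0(1) f, where \<beta>=\<beta>] by (intro sum_mono cellbd)
    also have "\<dots> = (1 / \<alpha>) * (\<Sum>z\<in>cells \<alpha> \<beta> r. \<Lambda> (\<xi> * \<alpha> * weight \<alpha> \<beta> f z)) + real (card (cells \<alpha> \<beta> r)) / \<alpha> * (B * \<bar>\<xi>\<bar> * e)"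
      by (simp add: sum.distrib sum_distrib_left)
    also have "real (card (cells \<alpha> \<beta> r)) / \<alpha> * (B * \<bar>\<xi>\<bar> * e) <= \<gamma>"
    proof -
      have "real (card (cells \<alpha> \<beta> r)) <= 2 * \<alpha> * r + 2" using a0 r by (intro card_cells) auto
      also have "\<dots> <= (2 * r + 2) * \<alpha>" using a0 by (simp add: algebra_simps)
      finally have "real (card (cells \<alpha> \<beta> r)) / \<alpha> <= 2 * r + 2" using a0 by (simp add: field_simps)
      moreover have "B * \<bar>\<xi>\<bar> * e <= (\<bar>\<xi>\<bar> + 1) * (B + 1) * e"
        using B_nonneg e by (intro mult_right_mono) (auto simp: algebra_simps)
      moreover have "0 <= B * \<bar>\<xi>\<bar> * e" using B_nonneg e by simp
      ultimately have "real (card (cells \<alpha> \<beta> r)) / \<alpha> * (B * \<bar>\<xi>\<bar> * e) <= (2 * r + 2) * ((\<bar>\<xi>\<bar> + 1) * (B + 1) * e)"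
        using r by - (rule mult_mono, assumption, assumption, simp, assumption)
      also have "\<dots> = D * e" by (simp add: D_def)
      also have "\<dots> = \<gamma>" using D by (simp add: e_def)
      finally show ?thesis .
    qed
    finally show ?thesis using a0 by (simp add: field_simps)
  qed
  show ?thesis
  proof (rule that[of "max 1 (1 / d)"])
    fix \<alpha> \<beta> assume \<alpha>: "max 1 (1 / d) <= \<alpha>"
    then have "\<alpha> > 0" by auto
    then show "exp (\<alpha> * (cumulant f \<xi> - \<gamma>)) <= (LINT \<omega>|P. exp (\<alpha> * \<xi> * fluct r \<alpha> \<beta> f \<omega>))"
      using main[OF \<alpha>] by (simp add: mgf_fluct)
  qed simp
qed

text \<open>If the Legendre transform is finite at \<open>s\<close>, then it is attained at every smaller \<open>s0 > 0\<close>, since the concave function to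
be maximized tends to \<open>- \<infinity>\<close> with the tilt. The quadratic bound of \<open>cumulant_quadratic\<close> suffices for the first-order condition at
a maximizer.\<close>

lemma ex_optimal_tilt:
  assumes f: "bump_profile r f" and s0: "0 < s0" "s0 < s"
    and J: "\<And>\<xi>. \<xi> <= 0 ==> - \<xi> * s - cumulant f \<xi> <= J"
  obtains \<xi>0 where "\<xi>0 < 0" "cumulant_slope f \<xi>0 = - s0"
proof -
  obtain C \<tau>0 where C: "C >= 0" "\<tau>0 > 0"
    "\<And>\<xi> \<tau>. \<bar>\<tau>\<bar> <= \<tau>0 ==> cumulant f (\<xi> + \<tau>) <= cumulant f \<xi> + \<tau> * cumulant_slope f \<xi> + C * \<tau>\<^sup>2"
    using cumulant_quadratic[OF f] by blast
  define g where "g \<xi> = - \<xi> * s0 - cumulant f \<xi>" for \<xi>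
  (* beyond - R the bound at s makes g nonpositive, while g 0 = 0 *)
  define R where "R = \<bar>J\<bar> / (s - s0) + 1"
  have R: "R > 0" using s0 by (auto simp: R_def intro: add_nonneg_pos)
  define L where "L = B * (LINT y|lebesgue. f y)"
  have lip: "\<bar>cumulant f b - cumulant f a\<bar> <= L * \<bar>b - a\<bar>" for a b
    using cumulant_lipschitz[OF f, of b a] by (simp add: L_def mult_ac)
  have "L-lipschitz_on {-R..0} (cumulant f)"
  proof (rule lipschitz_onI)
    show "dist (cumulant f x) (cumulant f y) <= L * dist x y" for x y
      using lip[of x y] by (simp add: dist_real_def)
    show "0 <= L" using lip[of 1 0] by (auto dest: order_trans[OF abs_ge_zero])
  qed
  then have "continuous_on {-R..0} (cumulant f)" by (rule lipschitz_on_continuous_on)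
  then have "continuous_on {-R..0} g" unfolding g_def by (intro continuous_intros)
  then obtain \<xi>0 where \<xi>0: "\<xi>0 \<in> {-R..0}" "\<And>\<xi>. \<xi> \<in> {-R..0} ==> g \<xi> <= g \<xi>0"
    using continuous_attains_sup[of "{-R..0}" g] R by auto
  have max: "g \<xi> <= g \<xi>0" if "\<xi> <= 0" for \<xi>
  proof (cases "\<xi> >= -R")
    case False
    have "g \<xi> = (- \<xi> * s - cumulant f \<xi>) + \<xi> * (s - s0)" by (simp add: g_def algebra_simps)
    also have "\<dots> <= J + (- R) * (s - s0)" using J[OF that] False s0 by (intro add_mono mult_right_mono) auto
    also have "\<dots> <= 0"
    proof -
      have "R * (s - s0) = \<bar>J\<bar> + (s - s0)" using s0 by (simp add: R_def distrib_right)
      then show ?thesis using s0 by linarith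
    qed
    also have "0 = g 0" by (simp add: g_def cumulant_0)
    also have "\<dots> <= g \<xi>0" using \<xi>0 R by auto
    finally show ?thesis .
  qed (use \<xi>0 that in auto)
  let ?D = "cumulant_slope f \<xi>0"
  have le: "s0 + ?D <= C * t" if t: "0 < t" "t <= \<tau>0" for t
  proof -
    have "g (\<xi>0 - t) <= g \<xi>0" using \<xi>0 t by (intro max) auto
    then have "t * s0 <= cumulant f (\<xi>0 - t) - cumulant f \<xi>0" by (simp add: g_def algebra_simps)
    also have "\<dots> <= - t * ?D + C * t\<^sup>2" using C(3)[of "-t" \<xi>0] t by simp
    finally have "t * (s0 + ?D) <= t * (C * t)" by (simp add: algebra_simps power2_eq_square)
    then show ?thesis using t by simp
  qed
  have lim0: "x <= 0" if "\<And>t. 0 < t ==> t <= u ==> x <= C * t" "u > 0" for x u :: real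
  proof (rule ccontr)
    assume x: "\<not> x <= 0"
    define t where "t = min u (x / (2 * (C + 1)))"
    have t: "0 < t" "t <= u" using x C that by (auto simp: t_def)
    have "x <= C * t" using that(1)[OF t] .
    also have "\<dots> <= (C + 1) * (x / (2 * (C + 1)))" using x C t by (intro mult_mono) (auto simp: t_def)
    also have "\<dots> = x / 2" using C by (simp add: field_simps)
    finally show False using x by simp
  qed
  have D1: "s0 + ?D <= 0" by (rule lim0[OF le C(2)])
  have neg: "\<xi>0 < 0"
  proof (rule ccontr)
    assume "\<not> \<xi>0 < 0"
    then have "\<xi>0 = 0" using \<xi>0 by auto
    then show False using D1 s0 by (simp add: cumulant_slope_0)
  qed
  have le2: "- (s0 + ?D) <= C * t" if t: "0 < t" "t <= min \<tau>0 (- \<xi>0)" for t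
  proof -
    have "g (\<xi>0 + t) <= g \<xi>0" using t by (intro max) auto
    then have "- t * s0 <= cumulant f (\<xi>0 + t) - cumulant f \<xi>0" by (simp add: g_def algebra_simps)
    also have "\<dots> <= t * ?D + C * t\<^sup>2" using C(3)[of t \<xi>0] t by simp
    finally have "t * (- (s0 + ?D)) <= t * (C * t)" by (simp add: algebra_simps power2_eq_square)
    then show ?thesis using t by simp
  qed
  have "0 < min \<tau>0 (- \<xi>0)" using C(2) neg by simp
  from lim0[OF le2 this] have "- (s0 + ?D) <= 0" by blast
  with D1 have "?D = - s0" by linarith
  with neg show ?thesis by (rule that)
qed

text \<open>The lower bound of Cramer's theorem, uniform in \<open>\<beta>\<close>. Tilting by the optimal \<open>\<xi>0\<close> moves the mean of the fluctuation
to \<open>- s0\<close>. By \<open>tilted_tail\<close> with tilts \<open>\<xi>0 \<plusminus> t\<close>, the tilted weight of fluctuations outside a window around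
\<open>- s0\<close> is exponentially smaller than the lower bound of \<open>mgf_fluct_ge\<close> for the total, so half of that bound remains in the
window, where the density of the tilt is controlled.\<close>

lemma cramer_lower_bound:
  assumes f: "bump_profile r f" and s: "0 < s" and \<eta>: "0 < \<eta>" and JK: "J < K"
    and J: "\<And>\<xi>. \<xi> <= 0 ==> - \<xi> * s - cumulant f \<xi> <= J"
  obtains \<alpha>1 where "\<alpha>1 > 0"
    "\<And>\<alpha> \<beta>. \<alpha> >= \<alpha>1 ==> exp (- \<alpha> * K) <= prob {\<omega> \<in> space P. fluct r \<alpha> \<beta> f \<omega> <= - s + \<eta>}"
proof -
  (* strictly below s, where the optimal tilt exists *)
  define s0 where "s0 = s - min (s / 2) (\<eta> / 2)"
  have s0: "0 < s0" "s0 < s" "s - s0 <= \<eta> / 2" using s \<eta> by (auto simp: s0_def min_def)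
  obtain \<xi>0 where \<xi>0: "\<xi>0 < 0" "cumulant_slope f \<xi>0 = - s0"
    using ex_optimal_tilt[OF f s0(1,2) J] by blast
  obtain C \<tau>0 where C: "C >= 0" "\<tau>0 > 0"
    "\<And>\<xi> \<tau>. \<bar>\<tau>\<bar> <= \<tau>0 ==> cumulant f (\<xi> + \<tau>) <= cumulant f \<xi> + \<tau> * cumulant_slope f \<xi> + C * \<tau>\<^sup>2"
    using cumulant_quadratic[OF f] by blast
  define \<eta>1 where "\<eta>1 = min (\<eta> / 2) ((K - J) / (2 * (\<bar>\<xi>0\<bar> + 1)))"
  have \<eta>1: "\<eta>1 > 0" "\<eta>1 <= \<eta> / 2" using \<eta> JK unfolding \<eta>1_def by (simp, intro min.cobounded1)
  have "\<bar>\<xi>0\<bar> * \<eta>1 <= (\<bar>\<xi>0\<bar> + 1) * ((K - J) / (2 * (\<bar>\<xi>0\<bar> + 1)))"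
    using \<eta>1 by (intro mult_mono) (auto simp: \<eta>1_def)
  also have "\<dots> = (K - J) / 2"
  proof -
    have "\<bar>\<xi>0\<bar> + 1 \<noteq> 0" by linarith
    then show ?thesis by (simp add: field_simps)
  qed
  finally have gap: "\<bar>\<xi>0\<bar> * \<eta>1 <= (K - J) / 2" .
  define t where "t = min \<tau>0 (\<eta>1 / (2 * (C + 1)))"
  have t: "t > 0" "t <= \<tau>0" using C \<eta>1 by (auto simp: t_def)
  have Ct: "C * t\<^sup>2 <= t * \<eta>1 / 2"
  proof -
    have "C * t <= (C + 1) * (\<eta>1 / (2 * (C + 1)))" using C t by (intro mult_mono) (auto simp: t_def)
    also have "\<dots> = \<eta>1 / 2" using C by (simp add: field_simps)
    finally have "t * (C * t) <= t * (\<eta>1 / 2)" using t by (intro mult_left_mono) auto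
    then show ?thesis by (simp add: power2_eq_square mult_ac)
  qed
  define \<gamma> where "\<gamma> = min (t * \<eta>1 / 4) ((K - J) / 4)"
  have \<gamma>: "\<gamma> > 0" "2 * \<gamma> <= t * \<eta>1 / 2" "\<gamma> <= (K - J) / 4" using t \<eta>1 JK by (auto simp: \<gamma>_def min_def)
  obtain \<alpha>2 where \<alpha>2: "\<alpha>2 > 0" "\<And>\<alpha> \<beta>. \<alpha> >= \<alpha>2 ==> exp (\<alpha> * (cumulant f \<xi>0 - \<gamma>)) <= (LINT \<omega>|P. exp (\<alpha> * \<xi>0 * fluct r \<alpha> \<beta> f \<omega>))"
    using mgf_fluct_ge[OF f \<gamma>(1)] by metis
  (* the three conditions make mgf_fluct_ge applicable, the two tails at most half of its lower bound, and absorb the remaining factor 1/2 *)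
  define \<alpha>1 where "\<alpha>1 = Max {\<alpha>2, ln 4 / \<gamma>, 4 * ln 2 / (K - J)}"
  show ?thesis
  proof (rule that[of \<alpha>1])
    show "\<alpha>1 > 0" using \<alpha>2 by (auto simp: \<alpha>1_def less_max_iff_disj)
    fix \<alpha> \<beta> assume "\<alpha>1 <= \<alpha>"
    then have \<alpha>: "\<alpha>2 <= \<alpha>" "ln 4 / \<gamma> <= \<alpha>" "4 * ln 2 / (K - J) <= \<alpha>" by (auto simp: \<alpha>1_def)
    have a0: "\<alpha> > 0" using \<alpha>(1) \<alpha>2 by linarith
    let ?S = "fluct r \<alpha> \<beta> f" and ?A = "cumulant f \<xi>0"
    let ?E = "\<lambda>\<omega>. exp (\<alpha> * \<xi>0 * ?S \<omega>)"
    let ?W = "{\<omega> \<in> space P. ?S \<omega> <= - s + \<eta>}"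
    let ?U1 = "{\<omega>. t * (- s0 + \<eta>1) <= ((\<xi>0 + t) - \<xi>0) * ?S \<omega>}"
    let ?U2 = "{\<omega>. t * (s0 + \<eta>1) <= ((\<xi>0 - t) - \<xi>0) * ?S \<omega>}"
    have T1: "(LINT \<omega>|P. indicator ?U1 \<omega> * ?E \<omega>) <= exp (\<alpha> * (?A - 2 * \<gamma>))"
    proof -
      have "(LINT \<omega>|P. indicator ?U1 \<omega> * ?E \<omega>) <= exp (\<alpha> * (cumulant f (\<xi>0 + t) - t * (- s0 + \<eta>1)))"
        by (rule tilted_tail[OF a0 f])
      also have "cumulant f (\<xi>0 + t) - t * (- s0 + \<eta>1) <= ?A - 2 * \<gamma>"
        using C(3)[of t \<xi>0] t Ct \<gamma>(2) by (simp add: \<xi>0(2) algebra_simps)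
      then have "exp (\<alpha> * (cumulant f (\<xi>0 + t) - t * (- s0 + \<eta>1))) <= exp (\<alpha> * (?A - 2 * \<gamma>))"
        using a0 by simp
      finally show ?thesis .
    qed
    have T2: "(LINT \<omega>|P. indicator ?U2 \<omega> * ?E \<omega>) <= exp (\<alpha> * (?A - 2 * \<gamma>))"
    proof -
      have "(LINT \<omega>|P. indicator ?U2 \<omega> * ?E \<omega>) <= exp (\<alpha> * (cumulant f (\<xi>0 - t) - t * (s0 + \<eta>1)))"
        by (rule tilted_tail[OF a0 f])
      also have "cumulant f (\<xi>0 - t) - t * (s0 + \<eta>1) <= ?A - 2 * \<gamma>"
        using C(3)[of "-t" \<xi>0] t Ct \<gamma>(2) by (simp add: \<xi>0(2) algebra_simps)
      then have "exp (\<alpha> * (cumulant f (\<xi>0 - t) - t * (s0 + \<eta>1))) <= exp (\<alpha> * (?A - 2 * \<gamma>))"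
        using a0 by simp
      finally show ?thesis .
    qed
    define M where "M = exp (- \<alpha> * \<xi>0 * (s0 + \<eta>1))"
    have Wm: "?W \<in> sets P" by measurable
    have iU1: "integrable P (\<lambda>\<omega>. indicator ?U1 \<omega> * ?E \<omega>)" by (rule tilted_tail(2)[OF a0 f])
    have iU2: "integrable P (\<lambda>\<omega>. indicator ?U2 \<omega> * ?E \<omega>)" by (rule tilted_tail(2)[OF a0 f])
    have iW: "integrable P (\<lambda>\<omega>. M * indicator ?W \<omega> :: real)" using Wm by (intro integrable_mult_right integrable_real_indicator) (auto simp: less_top[symmetric])
    have "exp (\<alpha> * (?A - \<gamma>)) <= (LINT \<omega>|P. ?E \<omega>)" by (rule \<alpha>2(2)[OF \<alpha>(1)])
    also have "\<dots> <= (LINT \<omega>|P. indicator ?U1 \<omega> * ?E \<omega> + indicator ?U2 \<omega> * ?E \<omega> + M * indicator ?W \<omega>)"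
    proof (rule integral_mono[OF mgf_fluct(1)[OF a0]])
      show "integrable P (\<lambda>\<omega>. indicator ?U1 \<omega> * ?E \<omega> + indicator ?U2 \<omega> * ?E \<omega> + M * indicator ?W \<omega>)"
        by (intro Bochner_Integration.integrable_add iU1 iU2 iW)
      fix \<omega> assume \<omega>: "\<omega> \<in> space P"
      have nn: "0 <= M" "0 <= ?E \<omega>" by (auto simp: M_def)
      consider "\<omega> \<in> ?U1" | "\<omega> \<in> ?U2" | "\<omega> \<notin> ?U1" "\<omega> \<notin> ?U2" by blast
      then show "?E \<omega> <= indicator ?U1 \<omega> * ?E \<omega> + indicator ?U2 \<omega> * ?E \<omega> + M * indicator ?W \<omega>"
      proof cases
        case 3
        have "t * ?S \<omega> < t * (- s0 + \<eta>1)" "t * (- ?S \<omega>) < t * (s0 + \<eta>1)" using 3 by auto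
        then have S: "?S \<omega> < - s0 + \<eta>1" "- ?S \<omega> < s0 + \<eta>1"
          using mult_less_cancel_left_pos[OF t(1)] by blast+
        have "?S \<omega> <= - s + \<eta>" using S(1) s0(3) \<eta>1(2) by linarith
        then have W: "\<omega> \<in> ?W" using \<omega> by simp
        have "(- \<alpha> * \<xi>0) * (- ?S \<omega>) <= (- \<alpha> * \<xi>0) * (s0 + \<eta>1)"
          using S(2) a0 \<xi>0(1) by (intro mult_left_mono) (auto simp: mult_nonneg_nonpos)
        then have "?E \<omega> <= M" by (simp add: M_def)
        moreover have "indicator ?U1 \<omega> = (0::real)" "indicator ?U2 \<omega> = (0::real)" "indicator ?W \<omega> = (1::real)"
          using indicator_simps(2)[OF 3(1)] indicator_simps(2)[OF 3(2)] indicator_simps(1)[OF W] by blast+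
        ultimately show ?thesis by (simp only:)
      qed (use nn in \<open>auto simp: indicator_def\<close>)
    qed
    also have "\<dots> = (LINT \<omega>|P. indicator ?U1 \<omega> * ?E \<omega>) + (LINT \<omega>|P. indicator ?U2 \<omega> * ?E \<omega>) + M * prob ?W"
      using iU1 iU2 iW by simp
    also have "\<dots> <= 2 * exp (\<alpha> * (?A - 2 * \<gamma>)) + M * prob ?W" using T1 T2 by linarith
    finally have e1: "exp (\<alpha> * (?A - \<gamma>)) - 2 * exp (\<alpha> * (?A - 2 * \<gamma>)) <= M * prob ?W" by linarith
    have "2 * exp (\<alpha> * (?A - 2 * \<gamma>)) <= exp (\<alpha> * (?A - \<gamma>)) / 2"
    proof -
      have "ln 4 <= \<alpha> * \<gamma>" using \<alpha>(2) \<gamma>(1) by (simp add: field_simps)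
      then have "exp (ln 4) <= exp (\<alpha> * \<gamma>)" by (simp only: exp_le_cancel_iff)
      then have "4 <= exp (\<alpha> * \<gamma>)" by simp
      then have "4 * exp (\<alpha> * (?A - 2 * \<gamma>)) <= exp (\<alpha> * \<gamma>) * exp (\<alpha> * (?A - 2 * \<gamma>))" by (intro mult_right_mono) auto
      also have "\<dots> = exp (\<alpha> * (?A - \<gamma>))" by (simp add: exp_add[symmetric] algebra_simps)
      finally show ?thesis by simp
    qed
    with e1 have e2: "exp (\<alpha> * (?A - \<gamma>)) / 2 <= M * prob ?W" by linarith
    have "exp (\<alpha> * (?A - \<gamma>)) / 2 * exp (\<alpha> * \<xi>0 * (s0 + \<eta>1)) <= M * prob ?W * exp (\<alpha> * \<xi>0 * (s0 + \<eta>1))"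
      using e2 by (intro mult_right_mono) auto
    also have "\<dots> = prob ?W"
    proof -
      have "M * exp (\<alpha> * \<xi>0 * (s0 + \<eta>1)) = 1" by (simp add: M_def exp_add[symmetric])
      moreover have "M * prob ?W * exp (\<alpha> * \<xi>0 * (s0 + \<eta>1)) = M * exp (\<alpha> * \<xi>0 * (s0 + \<eta>1)) * prob ?W"
        by (simp only: mult.assoc mult.commute mult.left_commute)
      ultimately show ?thesis by simp
    qed
    finally have e3: "exp (\<alpha> * (?A - \<gamma> + \<xi>0 * (s0 + \<eta>1))) / 2 <= prob ?W"
      by (simp add: exp_add[symmetric] algebra_simps)
    have "- \<xi>0 * s0 - ?A <= J"
    proof -
      have "- \<xi>0 * s0 <= - \<xi>0 * s" using \<xi>0(1) s0(2) by (intro mult_left_mono) auto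
      then show ?thesis using J[of \<xi>0] \<xi>0(1) by linarith
    qed
    then have "- K + (K - J) / 4 <= ?A - \<gamma> + \<xi>0 * (s0 + \<eta>1)"
    proof -
      have "- (\<xi>0 * \<eta>1) <= (K - J) / 2" using gap \<xi>0(1) by simp
      moreover have "- K + d / 4 <= A - c + (x + y)"
        if "- y <= d / 2" "- x - A <= J" "c <= d / 4" "d = K - J" for x y A c d :: real
        using that by linarith
      ultimately show ?thesis
        unfolding distrib_left using \<open>- \<xi>0 * s0 - ?A <= J\<close> \<gamma>(3) by simp
    qed
    then have "\<alpha> * (- K + (K - J) / 4) <= \<alpha> * (?A - \<gamma> + \<xi>0 * (s0 + \<eta>1))" using a0 by (intro mult_left_mono) auto
    moreover have "ln 2 <= \<alpha> * ((K - J) / 4)" using \<alpha>(3) JK by (simp add: field_simps)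
    then have "ln 2 - \<alpha> * K <= \<alpha> * (- K + (K - J) / 4)"
      unfolding distrib_left by simp
    ultimately have "ln 2 - \<alpha> * K <= \<alpha> * (?A - \<gamma> + \<xi>0 * (s0 + \<eta>1))" by simp
    then have "exp (ln 2 - \<alpha> * K) <= exp (\<alpha> * (?A - \<gamma> + \<xi>0 * (s0 + \<eta>1)))" by simp
    moreover have "exp (ln 2 - \<alpha> * K) = 2 * exp (- \<alpha> * K)" by (simp add: exp_diff exp_minus field_simps)
    ultimately have "exp (- \<alpha> * K) <= exp (\<alpha> * (?A - \<gamma> + \<xi>0 * (s0 + \<eta>1))) / 2" by simp
    then show "exp (- \<alpha> * K) <= prob ?W" using e3 by linarith
  qed
qed

lemma fluct_indep:
  assumes L: "finite L" "L \<noteq> {}" and dis: "disjoint_family_on (\<lambda>k. cells \<alpha> (\<beta> k) r) L"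
  shows "prob {\<omega> \<in> space P. \<forall>k\<in>L. c < fluct r \<alpha> (\<beta> k) f \<omega>} = (\<Prod>k\<in>L. prob {\<omega> \<in> space P. c < fluct r \<alpha> (\<beta> k) f \<omega>})"
proof -
  have iv: "indep_vars (\<lambda>k. PiM (cells \<alpha> (\<beta> k) r) (\<lambda>_. borel)) (\<lambda>k \<omega>. restrict (\<lambda>z. \<Theta> z \<omega>) (cells \<alpha> (\<beta> k) r)) L"
    by (rule indep_vars_restrict[OF indep _ dis]) auto
  have iv2: "indep_vars (\<lambda>k. borel) (\<lambda>k \<omega>. (\<lambda>g. \<Sum>z\<in>cells \<alpha> (\<beta> k) r. (g z - \<mu>) * weight \<alpha> (\<beta> k) f z) (restrict (\<lambda>z. \<Theta> z \<omega>) (cells \<alpha> (\<beta> k) r))) L"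
    by (rule indep_vars_compose2[OF iv]) measurable
  have "indep_vars (\<lambda>k. borel) (\<lambda>k. fluct r \<alpha> (\<beta> k) f) L"
    by (rule iffD1[OF indep_vars_cong iv2]) (auto simp: fluct_def fun_eq_iff)
  from indep_varsD_finite[OF this L(2,1), of "\<lambda>_. {c<..}"]
  have "prob (\<Inter>k\<in>L. fluct r \<alpha> (\<beta> k) f -` {c<..} \<inter> space P) = (\<Prod>k\<in>L. prob (fluct r \<alpha> (\<beta> k) f -` {c<..} \<inter> space P))"
    by simp
  moreover have "(\<Inter>k\<in>L. fluct r \<alpha> (\<beta> k) f -` {c<..} \<inter> space P) = {\<omega> \<in> space P. \<forall>k\<in>L. c < fluct r \<alpha> (\<beta> k) f \<omega>}"
    using L by auto
  moreover have "fluct r \<alpha> (\<beta> k) f -` {c<..} \<inter> space P = {\<omega> \<in> space P. c < fluct r \<alpha> (\<beta> k) f \<omega>}" for k by auto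
  ultimately show ?thesis by simp
qed

end

section \<open>Transition profiles\<close>

lemma enn2ereal_less_infinity: "enn2ereal x < \<infinity> ==> x < \<infinity>"
  by (cases "x = \<top>") (auto simp: less_top)

lemma enn2ereal_le_ereal:
  assumes "enn2ereal x <= ereal e" shows "0 <= e" "x <= ennreal e"
proof -
  show "0 <= e" using order_trans[OF enn2ereal_nonneg assms] by simp
  then show "x <= ennreal e" using assms by (simp add: less_eq_ennreal.rep_eq enn2ereal_ennreal)
qed

lemma AC_measurable:
  assumes "AC UNIV v g" shows "g \<in> borel_measurable lebesgue"
proof (rule borel_measurable_LIMSEQ_real)
  fix x
  have "\<forall>\<^sub>F n in sequentially. indicator {- real n..real n} x * g x = g x"
    using eventually_ge_at_top[of "nat \<lceil>\<bar>x\<bar>\<rceil>"]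
  proof eventually_elim
    case (elim n)
    then have "\<bar>x\<bar> <= real n" by linarith
    then have "x \<in> {- real n..real n}" by auto
    then show ?case by simp
  qed
  then show "(\<lambda>n. indicator {- real n..real n} x * g x) \<longlonglongrightarrow> g x" by (rule tendsto_eventually)
next
  fix n :: nat
  have "g absolutely_integrable_on {- real n..real n}" using ACD[OF assms] by simp
  then show "(\<lambda>x. indicator {- real n..real n} x * g x) \<in> borel_measurable lebesgue"
    unfolding set_integrable_def by (simp add: borel_measurable_integrable)
qed

lemma AC_UNIV_borel: "AC UNIV v g ==> continuous_on UNIV v" "AC UNIV v g ==> v \<in> borel_measurable borel"
  using AC_continuous_open[of UNIV v g] by (auto intro: borel_measurable_continuous_onI)

text \<open>Last time at \<open>lo\<close> before the first time at \<open>hi\<close>.\<close>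

lemma crossing_interval:
  fixes v :: "real => real"
  assumes c: "continuous_on {p..q} v" and pq: "p <= q" and lo: "v p <= lo" and hi: "hi <= v q" and lh: "lo < hi"
  obtains p' q' where "p <= p'" "p' < q'" "q' <= q" "v p' = lo" "v q' = hi" "\<And>x. x \<in> {p'..q'} ==> lo <= v x \<and> v x <= hi"
proof -
  have "closed {x \<in> {p..q}. hi <= v x}"
    using continuous_closed_preimage[OF c closed_atLeastAtMost closed_atLeast[of hi]] by (simp add: vimage_def Int_def conj_commute)
  then have cA: "compact {x \<in> {p..q}. hi <= v x}" by (auto simp: compact_eq_bounded_closed intro: bounded_subset[OF bounded_closed_interval])
  have "{x \<in> {p..q}. hi <= v x} \<noteq> {}" using pq hi by auto
  from compact_attains_inf[OF cA this] obtain q'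
    where q': "q' \<in> {p..q}" "hi <= v q'" "\<And>x. x \<in> {p..q} ==> hi <= v x ==> q' <= x" by blast
  have cq: "continuous_on {p..q'} v" using c q'(1) by (auto intro: continuous_on_subset)
  have vq: "v q' = hi"
  proof -
    obtain x where x: "p <= x" "x <= q'" "v x = hi" using IVT'[of v p hi q'] lo lh q' cq by auto
    then have "q' <= x" using q'(1) by (intro q'(3)) auto
    then show ?thesis using x by simp
  qed
  have "closed {x \<in> {p..q'}. v x <= lo}"
    using continuous_closed_preimage[OF cq closed_atLeastAtMost closed_atMost[of lo]] by (simp add: vimage_def Int_def conj_commute)
  then have cB: "compact {x \<in> {p..q'}. v x <= lo}" by (auto simp: compact_eq_bounded_closed intro: bounded_subset[OF bounded_closed_interval])
  have "{x \<in> {p..q'}. v x <= lo} \<noteq> {}" using q' lo by auto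
  from compact_attains_sup[OF cB this] obtain p'
    where p': "p' \<in> {p..q'}" "v p' <= lo" "\<And>x. x \<in> {p..q'} ==> v x <= lo ==> x <= p'" by blast
  have vp: "v p' = lo"
  proof -
    have "continuous_on {p'..q'} v" using cq p'(1) by (auto intro: continuous_on_subset)
    then obtain x where x: "p' <= x" "x <= q'" "v x = lo" using IVT'[of v p' lo q'] p' lh vq by auto
    then have "x <= p'" using p'(1) by (intro p'(3)) auto
    then show ?thesis using x by simp
  qed
  have lt: "p' < q'" using p'(1) vp vq lh by (cases "p' = q'") auto
  show ?thesis
  proof (rule that[OF _ lt _ vp vq])
    fix x assume x: "x \<in> {p'..q'}"
    have "lo <= v x" using p'(3)[of x] x p'(1) vp by (cases "x = p'") force+
    moreover have "v x <= hi" using q'(3)[of x] x p'(1) q'(1) vq by (cases "x = q'") force+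
    ultimately show "lo <= v x \<and> v x <= hi" by simp
  qed (use p' q' in auto)
qed

text \<open>Profiles of rate functions with their derivative: \<open>transition\<close> is the absolutely continuous counterpart of
\<open>profiles\<close>, see \<open>transition_profile\<close> and \<open>profile_transition\<close>. At rescaled distance \<open>r\<close> from the centre the profile
has reached its limits.\<close>

definition transition :: "(real => real) => real => (real => real) => (real => real) => bool" where
  "transition W r v g \<longleftrightarrow> 1 <= r \<and> AC UNIV v g \<and> (\<forall>x. v x \<in> {-1..1}) \<and> (\<forall>x. r <= \<bar>x\<bar> --> v x = sgn x) \<and>
     integrable lebesgue (\<lambda>x. (g x)\<^sup>2)"

definition kinetic :: "(real => real) => real" where
  "kinetic g = (LINT y|lebesgue. 1 / 2 * (g y)\<^sup>2)"

lemma kinetic_nonneg: "0 <= kinetic g"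
  unfolding kinetic_def by (intro Bochner_Integration.integral_nonneg) auto

locale double_well =
  fixes W :: "real => real"
  assumes W_cont: "continuous_on UNIV W"
    and W_nonneg: "\<And>s. 0 <= W s"
    and W_zeros: "\<And>s. W s = 0 \<longleftrightarrow> s = -1 \<or> s = 1"
begin

definition "W_max = (SUP s\<in>{-1..1}. W s)"

lemma W_le_max: "s \<in> {-1..1} ==> W s <= W_max"
  unfolding W_max_def
  by (intro cSUP_upper compact_imp_bounded bounded_imp_bdd_above compact_continuous_image continuous_on_subset[OF W_cont]) auto

lemma W_max_nonneg: "0 <= W_max" using W_le_max[of 0] W_nonneg[of 0] by auto

lemma W_lower_bound:
  assumes "0 < \<eta>" "\<eta> < 1"
  obtains w where "w > 0" "\<And>s. s \<in> {-1 + \<eta>..1 - \<eta>} ==> w <= W s"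
proof -
  have "\<exists>s\<in>{-1 + \<eta>..1 - \<eta>}. \<forall>t\<in>{-1 + \<eta>..1 - \<eta>}. W s <= W t"
    using assms by (intro continuous_attains_inf continuous_on_subset[OF W_cont]) auto
  then obtain s where s: "s \<in> {-1 + \<eta>..1 - \<eta>}" "\<And>t. t \<in> {-1 + \<eta>..1 - \<eta>} ==> W s <= W t" by blast
  have "W s \<noteq> 0" using W_zeros[of s] s(1) assms by auto
  then have "W s > 0" using W_nonneg[of s] by simp
  then show ?thesis using that s by blast
qed

lemma transition_bump:
  assumes "transition W r v g" shows "bump_profile r (\<lambda>y. W (v y))"
  unfolding bump_profile_def
proof (intro conjI allI impI)
  have v: "AC UNIV v g" using assms by (simp add: transition_def)
  show "continuous_on UNIV (\<lambda>y. W (v y))"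
    by (rule continuous_on_compose2[OF W_cont AC_UNIV_borel(1)[OF v]]) auto
  fix y assume "W (v y) \<noteq> 0"
  then have "v y \<noteq> -1" "v y \<noteq> 1" by (simp_all add: W_zeros)
  then have "\<not> r <= \<bar>y\<bar>" using assms unfolding transition_def by (metis abs_zero not_one_le_zero sgn_if order_trans)
  then show "y \<in> {-r..r}" by auto
qed (use assms W_nonneg in \<open>auto simp: transition_def\<close>)

lemma transition_limits:
  assumes "transition W r v g" shows "(v \<longlongrightarrow> -1) at_bot" "(v \<longlongrightarrow> 1) at_top"
proof -
  have s: "r <= \<bar>x\<bar> ==> v x = sgn x" and r: "1 <= r" for x using assms by (auto simp: transition_def)
  have "\<forall>\<^sub>F x in at_bot. v x = -1"
    using eventually_le_at_bot[of "-r"] by eventually_elim (use s r in \<open>auto simp: sgn_if\<close>)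
  then show "(v \<longlongrightarrow> -1) at_bot" by (rule tendsto_eventually)
  have "\<forall>\<^sub>F x in at_top. v x = 1"
    using eventually_ge_at_top[of "r"] by eventually_elim (use s r in \<open>auto simp: sgn_if\<close>)
  then show "(v \<longlongrightarrow> 1) at_top" by (rule tendsto_eventually)
qed

lemma F_line_transition:
  assumes t: "transition W r v g" and uv: "AE x in lebesgue. u x = v x" and c: "0 <= c"
  shows "F_line W c u = ereal (kinetic g + c * (LINT y|lebesgue. W (v y)))"
proof -
  have v: "AC UNIV v g" and g: "integrable lebesgue (\<lambda>x. (g x)\<^sup>2)" using t by (auto simp: transition_def)
  have uv': "AE x in lebesgue. x \<in> UNIV --> u x = v x" using uv by simp
  note w = AC_weak_deriv[OF v _ _ uv', simplified]
  have fi: "integrable lebesgue (\<lambda>y. W (v y))" by (rule bump_profile_integrable[OF transition_bump[OF t]])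
  have i: "integrable lebesgue (\<lambda>y. 1 / 2 * (g y)\<^sup>2 + c * W (v y))"
    using g fi by (intro Bochner_Integration.integrable_add integrable_mult_right)
  have "(\<integral>\<^sup>+y. ennreal (1 / 2 * (weak_deriv UNIV u y)\<^sup>2 + c * W (u y)) \<partial>lebesgue)
      = (\<integral>\<^sup>+y. ennreal (1 / 2 * (g y)\<^sup>2 + c * W (v y)) \<partial>lebesgue)"
  proof (rule nn_integral_cong_AE)
    show "AE y in lebesgue. ennreal (1 / 2 * (weak_deriv UNIV u y)\<^sup>2 + c * W (u y)) = ennreal (1 / 2 * (g y)\<^sup>2 + c * W (v y))"
      using w(2) uv by eventually_elim simp
  qed
  also have "\<dots> = ennreal (LINT y|lebesgue. 1 / 2 * (g y)\<^sup>2 + c * W (v y))"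
    by (rule nn_integral_eq_integral[OF i]) (use W_nonneg c in auto)
  also have "(LINT y|lebesgue. 1 / 2 * (g y)\<^sup>2 + c * W (v y)) = kinetic g + c * (LINT y|lebesgue. W (v y))"
    unfolding kinetic_def using g fi by (subst Bochner_Integration.integral_add) auto
  finally have e: "(\<integral>\<^sup>+y. ennreal (1 / 2 * (weak_deriv UNIV u y)\<^sup>2 + c * W (u y)) \<partial>lebesgue) = ennreal (kinetic g + c * (LINT y|lebesgue. W (v y)))" .
  have nn: "0 <= kinetic g + c * (LINT y|lebesgue. W (v y))"
    using c kinetic_nonneg W_nonneg by (intro add_nonneg_nonneg mult_nonneg_nonneg Bochner_Integration.integral_nonneg) auto
  have ex: "\<exists>g. has_weak_deriv UNIV u g" using w(1) by blast
  show ?thesis unfolding F_line_def using ex e nn by (simp add: enn2ereal_ennreal)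
qed

lemma transition_profile:
  assumes t: "transition W r v g" and "0 <= th" shows "v \<in> profiles W th r"
  using t F_line_transition[OF t _ assms(2), of v] unfolding profiles_def transition_def by auto

lemma finite_energy_square_integrable:
  assumes v: "AC UNIV v g" and c: "0 <= c"
    and fin: "(\<integral>\<^sup>+y. ennreal (1 / 2 * (g y)\<^sup>2 + c * W (u y)) \<partial>lebesgue) < \<infinity>"
  shows "integrable lebesgue (\<lambda>x. (g x)\<^sup>2)"
proof -
  have gm: "g \<in> borel_measurable lebesgue" by (rule AC_measurable[OF v])
  have "(\<integral>\<^sup>+y. ennreal (1 / 2 * (g y)\<^sup>2) \<partial>lebesgue) <= (\<integral>\<^sup>+y. ennreal (1 / 2 * (g y)\<^sup>2 + c * W (u y)) \<partial>lebesgue)"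
    using c W_nonneg by (intro nn_integral_mono ennreal_leI) simp
  also note fin
  finally have "integrable lebesgue (\<lambda>y. 1 / 2 * (g y)\<^sup>2)" using gm by (intro integrableI_bounded) auto
  from integrable_mult_right[OF this, of 2] show ?thesis by simp
qed

lemma profile_transition:
  assumes u: "u \<in> profiles W th r" and r: "1 <= r" and th: "0 < th"
  obtains v g where "transition W r v g" "AE x in lebesgue. u x = v x"
proof -
  have ub: "u x \<in> {-1..1}" and us: "r <= \<bar>x\<bar> ==> u x = sgn x" and fin: "F_line W th u < \<infinity>" for x
    using u by (auto simp: profiles_def)
  have ex: "\<exists>g. has_weak_deriv UNIV u g" using fin unfolding F_line_def by (cases "\<exists>g. has_weak_deriv UNIV u g") auto
  then obtain g0 where "has_weak_deriv UNIV u g0" by blast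
  from weak_deriv_AC[OF this] obtain v where v: "AC UNIV v (weak_deriv UNIV u)" and uv: "AE x in lebesgue. u x = v x"
    by auto
  let ?g = "weak_deriv UNIV u"
  have cv: "continuous_on UNIV v" by (rule AC_UNIV_borel(1)[OF v])
  have dense: "v x \<in> S" if "closed S" "open U" "x \<in> closure U" "\<And>y. y \<in> U ==> u y = v y ==> v y \<in> S" for x S U
  proof (rule ccontr)
    assume "v x \<notin> S"
    have "open (v -` (- S))" using cv that(1) by (intro open_vimage) auto
    then have o: "open (v -` (- S) \<inter> U)" using that(2) by auto
    have "x \<in> v -` (- S)" using \<open>v x \<notin> S\<close> by simp
    then have "v -` (- S) \<inter> U \<noteq> {}"
      using that(3) \<open>open (v -` (- S))\<close> open_Int_closure_eq_empty by blast
    then obtain z where z: "z \<in> v -` (- S) \<inter> U" by blast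
    obtain e where e: "e > 0" "ball z e \<subseteq> v -` (- S) \<inter> U" using o z open_contains_ball by metis
    obtain y where y: "z < y" "y < z + e" "u y = v y" using AE_lebesgue_dense[OF uv, of z "z + e"] e by auto
    have "y \<in> ball z e" using y by (auto simp: dist_real_def)
    then have "y \<in> v -` (- S) \<inter> U" using e(2) by blast
    then show False using that(4)[of y] y by auto
  qed
  have "v x \<in> {-1..1}" for x 
  proof (rule dense[of "{-1..1}" UNIV])
    fix y show "u y = v y ==> v y \<in> {-1..1}" using ub[of y] by simp
  qed auto
  moreover have "v x = sgn x" if "r <= \<bar>x\<bar>" for x
  proof (cases "x > 0")
    case True
    then have "x \<in> closure {r<..}" using that by simp
    then have "v x \<in> {1}" by (rule dense[of "{1}" "{r<..}", rotated 2]) (use us r in \<open>auto simp: sgn_if\<close>)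
    then show ?thesis using True by simp
  next
    case False
    then have "x \<in> closure {..<-r}" using that by simp
    then have "v x \<in> {-1}" by (rule dense[of "{-1}" "{..<-r}", rotated 2]) (use us r in \<open>auto simp: sgn_if\<close>)
    then show ?thesis using False that r by (auto simp: sgn_if)
  qed
  moreover have "integrable lebesgue (\<lambda>x. (?g x)\<^sup>2)"
  proof (rule finite_energy_square_integrable[OF v])
    show "(\<integral>\<^sup>+y. ennreal (1 / 2 * (?g y)\<^sup>2 + th * W (u y)) \<partial>lebesgue) < \<infinity>"
      by (rule enn2ereal_less_infinity) (use fin ex in \<open>simp add: F_line_def\<close>)
  qed (use th in simp)
  ultimately have "transition W r v ?g" using v r by (simp add: transition_def)
  then show ?thesis using uv by (rule that)
qed

text \<open>The Modica--Mortola inequality \<open>c0 * g <= g\<^sup>2 / 2 + th * W v\<close> on an interval where \<open>v\<close> crosses from \<open>-1/2\<close> to \<open>1/2\<close>.\<close>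

lemma transition_energy_lower_bound:
  assumes th: "0 < th"
  obtains c0 where "c0 > 0" "\<And>r v g. transition W r v g ==> c0 <= kinetic g + th * (LINT y|lebesgue. W (v y))"
proof -
  obtain w where w: "w > 0" "\<And>s. s \<in> {-1 + 1/2..1 - 1/2} ==> w <= W s" using W_lower_bound[of "1/2"] by auto
  define c0 where "c0 = sqrt (2 * th * w)"
  have c0: "c0 > 0" "c0\<^sup>2 = 2 * (th * w)" using w th by (auto simp: c0_def)
  have "c0 <= kinetic g + th * (LINT y|lebesgue. W (v y))" if t: "transition W r v g" for r v g
  proof -
    have v: "AC UNIV v g" and g2: "integrable lebesgue (\<lambda>x. (g x)\<^sup>2)" and r: "1 <= r" and vs: "\<And>x. r <= \<bar>x\<bar> ==> v x = sgn x"
      using t by (auto simp: transition_def)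
    have fi: "integrable lebesgue (\<lambda>y. W (v y))" by (rule bump_profile_integrable[OF transition_bump[OF t]])
    have c: "continuous_on {-r..r} v" using AC_UNIV_borel(1)[OF v] continuous_on_subset by blast
    have "v (-r) <= -1/2" "1/2 <= v r" using vs[of r] vs[of "-r"] r by (auto simp: sgn_if)
    then obtain p q where pq: "-r <= p" "p < q" "q <= r" "v p = -1/2" "v q = 1/2" "\<And>x. x \<in> {p..q} ==> -1/2 <= v x \<and> v x <= 1/2"
      using crossing_interval[OF c _ , of "-1/2" "1/2"] r by auto
    have gi: "g absolutely_integrable_on {p..q}" and gv: "integral {p..q} g = 1" using ACD[OF v, of p q] pq by auto
    have gi': "integrable lebesgue (\<lambda>x. indicator {p..q} x * g x)" using gi unfolding set_integrable_def by simp
    have "c0 = (LINT x|lebesgue. c0 * (indicator {p..q} x * g x))"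
    proof -
      have "(LINT x|lebesgue. indicator {p..q} x *\<^sub>R g x) = integral {p..q} g"
        using set_lebesgue_integral_eq_integral(2)[OF gi] by (simp add: set_lebesgue_integral_def)
      then show ?thesis using gv by simp
    qed
    also have "\<dots> <= (LINT y|lebesgue. 1 / 2 * (g y)\<^sup>2 + th * W (v y))"
    proof (rule integral_mono)
      show "integrable lebesgue (\<lambda>y. 1 / 2 * (g y)\<^sup>2 + th * W (v y))"
        using g2 fi by (intro Bochner_Integration.integrable_add integrable_mult_right)
      fix x
      show "c0 * (indicator {p..q} x * g x) <= 1 / 2 * (g x)\<^sup>2 + th * W (v x)"
      proof (cases "x \<in> {p..q}")
        case True
        then have "w <= W (v x)" using pq(6)[OF True] by (intro w(2)) auto
        then have "th * w <= th * W (v x)" using th by simp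
        moreover have "2 * (c0 * g x) <= (g x)\<^sup>2 + 2 * (th * w)"
          using zero_le_power2[of "g x - c0"] c0(2) by (simp add: power2_diff mult.commute mult.left_commute)
        ultimately have "c0 * g x <= 1 / 2 * (g x)\<^sup>2 + th * W (v x)" by linarith
        then show ?thesis using True by simp
      qed (use th W_nonneg in simp)
    qed (use gi' in simp)
    also have "\<dots> = kinetic g + th * (LINT y|lebesgue. W (v y))"
      unfolding kinetic_def using g2 fi by (subst Bochner_Integration.integral_add) auto
    finally show ?thesis .
  qed
  then show ?thesis using that c0(1) by blast
qed

end

section \<open>Extraction of a transition profile from a crossing\<close>

lemma checkerboard_eq:
  "checkerboard t x = (if x = real_of_int \<lfloor>x + 1/2\<rfloor> - 1/2 then 0 else t \<lfloor>x + 1/2\<rfloor>)"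
proof -
  define z where "z = \<lfloor>x + 1/2\<rfloor>"
  have z: "real_of_int z <= x + 1/2" "x + 1/2 < real_of_int z + 1" unfolding z_def by linarith+
  have "t z' * indicator {real_of_int z' - 1/2 <..< real_of_int z' + 1/2} x = 0" if "z' \<noteq> z" for z'
  proof -
    have "x \<notin> {real_of_int z' - 1/2 <..< real_of_int z' + 1/2}"
    proof
      assume "x \<in> {real_of_int z' - 1/2 <..< real_of_int z' + 1/2}"
      then have "\<bar>real_of_int z' - real_of_int z\<bar> < 1" using z by (auto simp: abs_if)
      then show False using that by linarith
    qed
    then show ?thesis by simp
  qed
  then have "checkerboard t x = (\<Sum>\<^sub>\<infinity>z\<in>{z}. t z * indicator {real_of_int z - 1/2 <..< real_of_int z + 1/2} x)"
    unfolding checkerboard_def by (intro infsum_cong_neutral) auto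
  also have "\<dots> = (\<Sum>z\<in>{z}. t z * indicator {real_of_int z - 1/2 <..< real_of_int z + 1/2} x)"
    by (rule infsum_finite) simp
  also have "\<dots> = t z * indicator {real_of_int z - 1/2 <..< real_of_int z + 1/2} x"
    by (subst sum.insert) simp_all
  also have "\<dots> = (if x = real_of_int z - 1/2 then 0 else t z)" using z by (auto simp: indicator_def)
  finally show ?thesis by (simp add: z_def)
qed

lemma checkerboard_measurable [measurable]: "checkerboard t \<in> borel_measurable borel"
proof -
  have f: "(\<lambda>x::real. \<lfloor>x + 1/2\<rfloor>) \<in> borel \<rightarrow>\<^sub>M count_space UNIV" by measurable
  have t: "t \<in> count_space UNIV \<rightarrow>\<^sub>M borel" by simp
  have m: "(\<lambda>x::real. t \<lfloor>x + 1/2\<rfloor>) \<in> borel_measurable borel" using measurable_compose[OF f t] .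
  have r: "(\<lambda>x::real. real_of_int \<lfloor>x + 1/2\<rfloor> - 1/2) \<in> borel_measurable borel"
    using measurable_compose[OF f, of "\<lambda>z. real_of_int z - 1/2" borel] by simp
  have "{x \<in> space borel. x = real_of_int \<lfloor>x + 1/2\<rfloor> - 1/2} \<in> sets borel"
    by (rule borel_measurable_eq[OF _ r]) simp
  then have "(\<lambda>x. if x = real_of_int \<lfloor>x + 1/2\<rfloor> - 1/2 then 0 else t \<lfloor>x + 1/2\<rfloor>) \<in> borel_measurable borel"
    by (intro measurable_If m) auto
  then show ?thesis unfolding checkerboard_eq[abs_def] .
qed

lemma checkerboard_bounds:
  assumes "\<And>z. th <= t z \<and> t z <= tu" "0 < th"
  shows "0 <= checkerboard t x" "checkerboard t x <= tu" "\<And>\<alpha> \<beta>. \<alpha> \<noteq> 0 ==> AE x in lebesgue. th <= checkerboard t (\<alpha> * x + \<beta>)"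
proof -
  have tb: "th <= t z" "t z <= tu" "0 <= t z" "0 <= tu" for z
    using assms(1)[of z] assms(1)[of 0] assms(2) by auto
  show "0 <= checkerboard t x" "checkerboard t x <= tu" using tb by (auto simp: checkerboard_eq)
  fix \<alpha> \<beta> :: real assume a: "\<alpha> \<noteq> 0"
  define N where "N = (\<lambda>z::int. (real_of_int z - 1/2 - \<beta>) / \<alpha>) ` UNIV"
  have "countable N" by (simp add: N_def)
  then have "N \<in> null_sets lebesgue"
    using countable_imp_null_set_lborel null_sets_completionI by blast
  then have "AE y in lebesgue. y \<notin> N" by (rule AE_not_in)
  then show "AE x in lebesgue. th <= checkerboard t (\<alpha> * x + \<beta>)"
  proof eventually_elim
    case (elim y)
    have "\<alpha> * y + \<beta> \<noteq> real_of_int z - 1/2" for z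
    proof
      assume "\<alpha> * y + \<beta> = real_of_int z - 1/2"
      then have "y = (real_of_int z - 1/2 - \<beta>) / \<alpha>" using a by (simp add: field_simps)
      then show False using elim by (auto simp: N_def)
    qed
    then show ?case using tb by (simp add: checkerboard_eq)
  qed
qed

context double_well begin

text \<open>A radius \<open>r\<close> for which every crossing of energy \<open>e <= E0\<close>, in every medium with values between \<open>th\<close> and \<open>tu\<close>, can
be replaced by a transition profile of radius \<open>r\<close> centred at a site \<open>\<epsilon> k\<close>, at an additional cost of order \<open>\<eta>\<close>. Restricting
the centres to the lattice makes the union bound over locations finite.\<close>

definition extraction_radius :: "real => real => real => real => real => bool" where
  "extraction_radius r th tu \<eta> E0 \<longleftrightarrow> 1 <= r \<and> (\<forall>\<epsilon> p q v g c e. 0 < \<epsilon> --> p <= q --> AC {p..q} v g --> c \<in> borel_measurable borel -->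
     (\<forall>x. 0 <= c x \<and> c x <= tu) --> (AE x in lebesgue. th <= c x) --> v p <= -1 + \<eta> --> 1 - \<eta> <= v q --> 0 <= e --> e <= E0 -->
     (\<integral>\<^sup>+x\<in>{p..q}. ennreal (\<epsilon> / 2 * (g x)\<^sup>2 + 1 / \<epsilon> * c x * W (v x)) \<partial>lebesgue) <= ennreal e -->
     (\<exists>(k::int) w h. transition W r w h \<and> p - \<epsilon> <= \<epsilon> * real_of_int k \<and> \<epsilon> * real_of_int k <= q \<and>
       kinetic h + (LINT y|lebesgue. c (\<epsilon> * real_of_int k + \<epsilon> * y) * W (w y)) <= e + \<eta> * (1 + 2 * tu * W_max)))"

text \<open>Between its first value \<open>1 - \<eta>\<close> and the last value \<open>-1 + \<eta>\<close> before it the function stays where \<open>W\<close> is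
bounded below, so the energy bounds the duration by a multiple of \<open>\<epsilon>\<close>. The piece is rescaled around the nearest
site to the left, and continued on both sides to \<open>-1\<close> and \<open>1\<close> with slope one; each of these two ends has length \<open>\<eta>\<close>
and costs at most \<open>(1/2 + tu * W_max) * \<eta>\<close>.\<close>

lemma ex_extraction_radius:
  assumes th: "0 < th" and tu: "0 <= tu" and \<eta>: "0 < \<eta>" "\<eta> < 1" and E0: "0 <= E0"
  shows "\<exists>r. extraction_radius r th tu \<eta> E0"
proof -
  obtain wm where wm: "wm > 0" "\<And>s. s \<in> {-1 + \<eta>..1 - \<eta>} ==> wm <= W s" using W_lower_bound[OF \<eta>] by blast
  define r where "r = E0 / (th * wm) + 2"
  have r2: "2 <= r" using E0 th wm by (simp add: r_def)
  show ?thesis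
    unfolding extraction_radius_def
  proof (intro exI[of _ r] conjI allI impI)
    fix \<epsilon> p q :: real and v g c :: "real => real" and e :: real
    assume \<epsilon>: "0 < \<epsilon>" and pq: "p <= q" and v: "AC {p..q} v g" and cm: "c \<in> borel_measurable borel"
      and cb': "\<forall>x. 0 <= c x \<and> c x <= tu" and cth: "AE x in lebesgue. th <= c x"
      and vp: "v p <= -1 + \<eta>" and vq: "1 - \<eta> <= v q" and e: "0 <= e" "e <= E0"
      and en: "(\<integral>\<^sup>+x\<in>{p..q}. ennreal (\<epsilon> / 2 * (g x)\<^sup>2 + 1 / \<epsilon> * c x * W (v x)) \<partial>lebesgue) <= ennreal e"
    have cb: "0 <= c x \<and> c x <= tu" for x using cb' by blast
    have vc: "continuous_on {p..q} v" by (rule AC_continuous_Icc[OF v])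
    show "\<exists>(k::int) w h. transition W r w h \<and> p - \<epsilon> <= \<epsilon> * real_of_int k \<and> \<epsilon> * real_of_int k <= q \<and>
       kinetic h + (LINT y|lebesgue. c (\<epsilon> * real_of_int k + \<epsilon> * y) * W (w y)) <= e + \<eta> * (1 + 2 * tu * W_max)"
    proof (cases "-1 + \<eta> < 1 - \<eta>")
      case False
      then have "\<eta> >= 1" using \<eta> by linarith
      then show ?thesis using \<eta> by simp
    next
      case True
      obtain p' q' where pq': "p <= p'" "p' < q'" "q' <= q" "v p' = -1 + \<eta>" "v q' = 1 - \<eta>"
        "\<And>x. x \<in> {p'..q'} ==> -1 + \<eta> <= v x \<and> v x <= 1 - \<eta>"
        using crossing_interval[OF vc pq vp vq True] by blast
      (* the piece starts less than one unit to the right of the centre of the rescaled profile *)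
      define k where "k = \<lfloor>p' / \<epsilon>\<rfloor>"
      define y0 where "y0 = p' / \<epsilon> - real_of_int k"
      define y1 where "y1 = q' / \<epsilon> - real_of_int k"
      have y0: "0 <= y0" "y0 < 1" unfolding y0_def k_def by linarith+
      have y01: "y0 < y1" using pq' \<epsilon> by (simp add: y0_def y1_def divide_strict_right_mono)
      have X0: "\<epsilon> * y0 + \<epsilon> * real_of_int k = p'" "\<epsilon> * y1 + \<epsilon> * real_of_int k = q'"
        using \<epsilon> by (simp_all add: y0_def y1_def algebra_simps)
      have kb: "p - \<epsilon> <= \<epsilon> * real_of_int k" "\<epsilon> * real_of_int k <= q"
      proof -
        have "\<epsilon> * y0 <= \<epsilon> * 1" "0 <= \<epsilon> * y0" using y0 \<epsilon> by auto
        then show "p - \<epsilon> <= \<epsilon> * real_of_int k" "\<epsilon> * real_of_int k <= q" using X0(1) pq' by linarith+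
      qed
      have width: "y1 - y0 <= E0 / (th * wm)"
      proof -
        have "ennreal (1 / \<epsilon> * th * wm) * emeasure lebesgue {p'..q'} = (\<integral>\<^sup>+x. ennreal (1 / \<epsilon> * th * wm) * indicator {p'..q'} x \<partial>lebesgue)"
          by (subst nn_integral_cmult_indicator) auto
        also have "\<dots> <= (\<integral>\<^sup>+x\<in>{p..q}. ennreal (\<epsilon> / 2 * (g x)\<^sup>2 + 1 / \<epsilon> * c x * W (v x)) \<partial>lebesgue)"
        proof (rule nn_integral_mono_AE)
          show "AE x in lebesgue. ennreal (1 / \<epsilon> * th * wm) * indicator {p'..q'} x <= ennreal (\<epsilon> / 2 * (g x)\<^sup>2 + 1 / \<epsilon> * c x * W (v x)) * indicator {p..q} x"
            using cth
          proof eventually_elim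
            case (elim x)
            show ?case
            proof (cases "x \<in> {p'..q'}")
              case True
              have "wm <= W (v x)" using pq'(6)[OF True] by (intro wm(2)) auto
              then have "th * wm <= c x * W (v x)" using elim th wm by (intro mult_mono) auto
              then have "1 / \<epsilon> * (th * wm) <= 1 / \<epsilon> * (c x * W (v x))" using \<epsilon> by (intro mult_left_mono) auto
              then have "1 / \<epsilon> * th * wm <= 0 + 1 / \<epsilon> * c x * W (v x)" by (simp only: mult.assoc add_0)
              also have "\<dots> <= \<epsilon> / 2 * (g x)\<^sup>2 + 1 / \<epsilon> * c x * W (v x)" using \<epsilon> by (intro add_right_mono) simp
              finally have "ennreal (1 / \<epsilon> * th * wm) <= ennreal (\<epsilon> / 2 * (g x)\<^sup>2 + 1 / \<epsilon> * c x * W (v x))" by (rule ennreal_leI)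
              moreover have "x \<in> {p..q}" using True pq' by auto
              ultimately show ?thesis using True by simp
            qed simp
          qed
        qed
        also note en
        finally have "ennreal (1 / \<epsilon> * th * wm * (q' - p')) <= ennreal e"
          using pq' \<epsilon> th wm by (simp add: ennreal_mult[symmetric])
        then have "1 / \<epsilon> * th * wm * (q' - p') <= e" using e by (simp add: ennreal_le_iff)
        moreover have "1 / \<epsilon> * th * wm * (q' - p') = (y1 - y0) * (th * wm)"
          by (simp add: y0_def y1_def diff_divide_distrib algebra_simps)
        ultimately have "(y1 - y0) * (th * wm) <= E0" using e by simp
        then show ?thesis using th wm by (simp add: pos_le_divide_eq)
      qed
      define w where "w y = (if y <= y0 - \<eta> then -1 else if y <= y0 then 1 * y + (-1 + \<eta> - y0)
          else if y <= y1 then v (\<epsilon> * y + \<epsilon> * real_of_int k) else if y <= y1 + \<eta> then 1 * y + (1 - \<eta> - y1) else 1)" for y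
      define h where "h y = (if y <= y0 - \<eta> then 0 else if y <= y0 then 1
          else if y <= y1 then \<epsilon> * g (\<epsilon> * y + \<epsilon> * real_of_int k) else if y <= y1 + \<eta> then 1 else 0)" for y
      have pre: "(\<lambda>y. \<epsilon> * y + \<epsilon> * real_of_int k) -` {p'..q'} = {y0..y1}"
      proof -
        have "p' <= \<epsilon> * y + \<epsilon> * real_of_int k \<longleftrightarrow> y0 <= y" "\<epsilon> * y + \<epsilon> * real_of_int k <= q' \<longleftrightarrow> y <= y1" for y
          using \<epsilon> X0 by (metis add_le_cancel_right mult_le_cancel_left_pos)+
        then show ?thesis by auto
      qed
      have AC_w: "AC UNIV w h"
      proof -
        have 1: "AC ({y1..y1+\<eta>} \<union> {y1+\<eta>..}) (\<lambda>y. if y <= y1+\<eta> then 1 * y + (1 - \<eta> - y1) else 1) (\<lambda>y. if y <= y1+\<eta> then 1 else 0)"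
          by (rule AC_glue[OF AC_linear AC_const]) (use \<eta> in auto)
        have u1: "{y1..y1+\<eta>} \<union> {y1+\<eta>..} = {y1..}" using \<eta> by auto
        have "AC ((\<lambda>y. \<epsilon> * y + \<epsilon> * real_of_int k) -` {p'..q'}) (\<lambda>y. v (\<epsilon> * y + \<epsilon> * real_of_int k)) (\<lambda>y. \<epsilon> * g (\<epsilon> * y + \<epsilon> * real_of_int k))"
          by (rule AC_affine[OF AC_subset[OF v] \<epsilon>]) (use pq' in auto)
        then have v': "AC {y0..y1} (\<lambda>y. v (\<epsilon> * y + \<epsilon> * real_of_int k)) (\<lambda>y. \<epsilon> * g (\<epsilon> * y + \<epsilon> * real_of_int k))"
          unfolding pre .
        have 2: "AC ({y0..y1} \<union> {y1..}) (\<lambda>y. if y <= y1 then v (\<epsilon> * y + \<epsilon> * real_of_int k) else if y <= y1+\<eta> then 1 * y + (1 - \<eta> - y1) else 1)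
            (\<lambda>y. if y <= y1 then \<epsilon> * g (\<epsilon> * y + \<epsilon> * real_of_int k) else if y <= y1+\<eta> then 1 else 0)"
          by (rule AC_glue[OF v' 1[unfolded u1]]) (use y01 X0 pq'(4,5) \<eta> in auto)
        have u2: "{y0..y1} \<union> {y1..} = {y0..}" using y01 by auto
        have 3: "AC ({y0-\<eta>..y0} \<union> {y0..}) (\<lambda>y. if y <= y0 then 1 * y + (-1 + \<eta> - y0) else if y <= y1 then v (\<epsilon> * y + \<epsilon> * real_of_int k) else if y <= y1+\<eta> then 1 * y + (1 - \<eta> - y1) else 1)
            (\<lambda>y. if y <= y0 then 1 else if y <= y1 then \<epsilon> * g (\<epsilon> * y + \<epsilon> * real_of_int k) else if y <= y1+\<eta> then 1 else 0)"
          by (rule AC_glue[OF AC_linear 2[unfolded u2]]) (use y01 X0 pq'(4,5) \<eta> in auto)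
        have u3: "{y0-\<eta>..y0} \<union> {y0..} = {y0-\<eta>..}" using \<eta> by auto
        have 4: "AC ({..y0-\<eta>} \<union> {y0-\<eta>..}) w h"
          unfolding w_def[abs_def] h_def[abs_def]
          by (rule AC_glue[OF AC_const 3[unfolded u3]]) (use \<eta> in auto)
        have "{..y0-\<eta>} \<union> {y0-\<eta>..} = (UNIV :: real set)" by auto
        with 4 show ?thesis by simp
      qed
      have w_range: "w y \<in> {-1..1}" for y
      proof -
        have "v (\<epsilon> * y + \<epsilon> * real_of_int k) \<in> {-1..1}" if "y0 < y" "y <= y1"
        proof -
          have "\<epsilon> * y + \<epsilon> * real_of_int k \<in> {p'..q'}" using pre that by auto
          from pq'(6)[OF this] show ?thesis using \<eta> by auto
        qed
        then show ?thesis using \<eta> by (auto simp: w_def)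
      qed
      have w_sgn: "w y = sgn y" if "r <= \<bar>y\<bar>" for y
      proof (cases "y >= 0")
        case True
        then have "y1 + \<eta> < y" using that width y0 \<eta> by (simp add: r_def)
        then show ?thesis using True y01 y0 \<eta> by (auto simp: w_def)
      next
        case False
        then have "y <= y0 - \<eta>" using that r2 y0 \<eta> by linarith
        then show ?thesis using False by (simp add: w_def)
      qed
      define H where "H y = 1 / 2 * (h y)\<^sup>2 + c (\<epsilon> * real_of_int k + \<epsilon> * y) * W (w y)" for y
      define F where "F x = ennreal (\<epsilon> / 2 * (indicator {p..q} x * g x)\<^sup>2 + 1 / \<epsilon> * c x * (indicator {p..q} x * W (v x))) * indicator {p'..q'} x" for x
      (* bound for the energy density on the two linear ends *)
      define M where "M = 1 / 2 + tu * W_max"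
      have M0: "0 <= M" using tu W_max_nonneg by (simp add: M_def)
      have Fm: "F \<in> borel_measurable lebesgue"
      proof -
        have "g absolutely_integrable_on {p..q}" using ACD[OF v, of p q] pq by auto
        then have 1: "(\<lambda>x. indicator {p..q} x * g x) \<in> borel_measurable lebesgue"
          unfolding set_integrable_def by (simp add: borel_measurable_integrable)
        have "continuous_on {p..q} (\<lambda>x. W (v x))"
          by (rule continuous_on_compose2[OF W_cont vc]) auto
        then have "(\<lambda>x. indicator {p..q} x *\<^sub>R W (v x)) \<in> borel_measurable borel"
          by (intro borel_measurable_continuous_on_indicator) auto
        then have 2: "(\<lambda>x. indicator {p..q} x * W (v x)) \<in> borel_measurable lebesgue" by (simp add: measurable_completion)
        have 3: "c \<in> borel_measurable lebesgue" using cm by (simp add: measurable_completion)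
        have 4: "indicator {p'..q'} \<in> borel_measurable lebesgue" by (intro borel_measurable_indicator) auto
        have "(\<lambda>x. ennreal (\<epsilon> / 2 * (A x)\<^sup>2 + 1 / \<epsilon> * C x * V x) * D x) \<in> borel_measurable lebesgue"
          if [measurable]: "A \<in> borel_measurable lebesgue" "C \<in> borel_measurable lebesgue"
            "V \<in> borel_measurable lebesgue" "D \<in> borel_measurable lebesgue"
          for A C V :: "real => real" and D :: "real => ennreal" by measurable
        from this[OF 1 3 2 4] show ?thesis unfolding F_def[abs_def] .
      qed
      have Hb: "ennreal (H y) <= ennreal \<epsilon> * F (\<epsilon> * real_of_int k + \<epsilon> * y) + ennreal M * indicator {y0-\<eta>..y0} y + ennreal M * indicator {y1..y1+\<eta>} y" for y
      proof -
        let ?X = "\<epsilon> * real_of_int k + \<epsilon> * y"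
        have cW: "c ?X * W (w y) <= tu * W_max" using cb W_le_max[OF w_range[of y]] W_nonneg W_max_nonneg by (intro mult_mono) (auto intro: tu)
        consider "y < y0 - \<eta> \<or> y > y1 + \<eta> \<or> y = y0 - \<eta>" | "y0 - \<eta> < y" "y <= y0" | "y0 < y" "y <= y1" | "y1 < y" "y <= y1 + \<eta>" by linarith
        then show ?thesis
        proof cases
          case 1
          then have "H y = 0" using W_zeros y01 \<eta> by (auto simp: H_def h_def w_def)
          then show ?thesis by simp
        next
          case 2
          then have "H y <= M" using cW by (simp add: H_def h_def M_def)
          moreover have "indicator {y0-\<eta>..y0} y = (1::ennreal)" using 2 by simp
          ultimately show ?thesis using ennreal_leI[of "H y" M] by (simp add: add_increasing add_increasing2)
        next
          case 4
          then have "H y <= M" using cW y01 \<eta> by (simp add: H_def h_def M_def)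
          moreover have "indicator {y1..y1+\<eta>} y = (1::ennreal)" using 4 by simp
          ultimately show ?thesis using ennreal_leI[of "H y" M] by (simp add: add_increasing)
        next
          case 3
          have X': "?X = \<epsilon> * y + \<epsilon> * real_of_int k" by simp
          have "y \<in> (\<lambda>y. \<epsilon> * y + \<epsilon> * real_of_int k) -` {p'..q'}" unfolding pre using 3 by auto
          then have "?X \<in> {p'..q'}" unfolding X' by (rule vimageD)
          then have ind: "indicator {p..q} ?X = (1::real)" "indicator {p'..q'} ?X = (1::ennreal)" using pq' by auto
          have hy: "h y = \<epsilon> * g ?X" and wy: "w y = v ?X" using 3 \<eta> by (auto simp: h_def w_def X')
          have nn: "0 <= \<epsilon> / 2 * (g ?X)\<^sup>2 + 1 / \<epsilon> * c ?X * W (v ?X)" using \<epsilon> cb W_nonneg by simp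
          have "H y = \<epsilon> * (\<epsilon> / 2 * (g ?X)\<^sup>2 + 1 / \<epsilon> * c ?X * W (v ?X))"
            unfolding H_def hy wy using \<epsilon> by (simp add: algebra_simps power2_eq_square)
          then have "ennreal (H y) = ennreal \<epsilon> * ennreal (\<epsilon> / 2 * (g ?X)\<^sup>2 + 1 / \<epsilon> * c ?X * W (v ?X))"
            using nn \<epsilon> by (simp only: ennreal_mult)
          also have "\<dots> = ennreal \<epsilon> * F ?X" unfolding F_def ind by simp
          finally show ?thesis by (simp add: add_increasing2)
        qed
      qed
      have Fam: "(\<lambda>y. F (\<epsilon> * real_of_int k + \<epsilon> * y)) \<in> borel_measurable lebesgue"
      proof -
        have "(\<lambda>y. \<epsilon> * real_of_int k + (\<Sum>j\<in>Basis. (\<epsilon> * (y \<bullet> j)) *\<^sub>R j)) \<in> lebesgue \<rightarrow>\<^sub>M lebesgue"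
          using lebesgue_affine_measurable[where c="\<lambda>_. \<epsilon>" and t="\<epsilon> * real_of_int k"] \<epsilon> by auto
        then have "(\<lambda>y. \<epsilon> * real_of_int k + \<epsilon> * y) \<in> lebesgue \<rightarrow>\<^sub>M lebesgue" by simp
        from measurable_compose[OF this Fm] show ?thesis .
      qed
      have aff: "(\<integral>\<^sup>+y. ennreal \<epsilon> * F (\<epsilon> * real_of_int k + \<epsilon> * y) \<partial>lebesgue) = (\<integral>\<^sup>+x. F x \<partial>lebesgue)"
      proof -
        show ?thesis
          using nn_integral_real_affine_lebesgue[OF Fm, of \<epsilon> "\<epsilon> * real_of_int k"] \<epsilon> Fam by (simp add: nn_integral_cmult)
      qed
      have Fe: "(\<integral>\<^sup>+x. F x \<partial>lebesgue) <= ennreal e"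
      proof -
        have "(\<integral>\<^sup>+x. F x \<partial>lebesgue) <= (\<integral>\<^sup>+x\<in>{p..q}. ennreal (\<epsilon> / 2 * (g x)\<^sup>2 + 1 / \<epsilon> * c x * W (v x)) \<partial>lebesgue)"
          by (intro nn_integral_mono) (use pq' in \<open>auto simp: F_def indicator_def\<close>)
        then show ?thesis using en by simp
      qed
      have Hn: "(\<integral>\<^sup>+y. ennreal (H y) \<partial>lebesgue) <= ennreal (e + \<eta> * (1 + 2 * tu * W_max))"
      proof -
        have 0: "(\<lambda>y. ennreal \<epsilon> * F (\<epsilon> * real_of_int k + \<epsilon> * y)) \<in> borel_measurable lebesgue"
          using Fam by simp
        have i: "(\<lambda>y. ennreal M * indicator {a..b} y) \<in> borel_measurable lebesgue" for a b :: real
          by (intro borel_measurable_times_ennreal borel_measurable_indicator) auto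
        have ii: "(\<integral>\<^sup>+y. ennreal M * indicator {a..a+\<eta>} y \<partial>lebesgue) = ennreal (M * \<eta>)" for a :: real
        proof -
          have "(\<integral>\<^sup>+y. ennreal M * indicator {a..a+\<eta>} y \<partial>lebesgue) = ennreal M * emeasure lebesgue {a..a+\<eta>}"
            by (intro nn_integral_cmult_indicator) auto
          then show ?thesis using M0 \<eta> by (simp add: ennreal_mult)
        qed
        have "(\<integral>\<^sup>+y. ennreal (H y) \<partial>lebesgue) <= (\<integral>\<^sup>+y. ennreal \<epsilon> * F (\<epsilon> * real_of_int k + \<epsilon> * y) + ennreal M * indicator {y0-\<eta>..y0} y + ennreal M * indicator {y1..y1+\<eta>} y \<partial>lebesgue)"
          by (intro nn_integral_mono Hb)
        also have "\<dots> = (\<integral>\<^sup>+x. F x \<partial>lebesgue) + ennreal (M * \<eta>) + ennreal (M * \<eta>)"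
          unfolding nn_integral_add[OF borel_measurable_add[OF 0 i] i] nn_integral_add[OF 0 i] aff
          using ii[of "y0 - \<eta>"] ii[of y1] by simp
        also have "\<dots> <= ennreal e + ennreal (M * \<eta>) + ennreal (M * \<eta>)" using Fe by (intro add_right_mono)
        also have "\<dots> = ennreal (e + \<eta> * (1 + 2 * tu * W_max))"
        proof -
          have "ennreal e + ennreal (M * \<eta>) + ennreal (M * \<eta>) = ennreal (e + M * \<eta> + M * \<eta>)"
            using e M0 \<eta> by (simp add: ennreal_plus[symmetric] del: ennreal_plus)
          also have "e + M * \<eta> + M * \<eta> = e + \<eta> * (1 + 2 * tu * W_max)" by (simp add: M_def algebra_simps)
          finally show ?thesis .
        qed
        finally show ?thesis .
      qed
      have hm: "h \<in> borel_measurable lebesgue" by (rule AC_measurable[OF AC_w])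
      have cWm: "(\<lambda>y. c (\<epsilon> * real_of_int k + \<epsilon> * y) * W (w y)) \<in> borel_measurable lebesgue"
      proof -
        have "w \<in> borel_measurable borel" "W \<in> borel_measurable borel"
          using AC_UNIV_borel(2)[OF AC_w] W_cont by (auto intro: borel_measurable_continuous_onI)
        then have "(\<lambda>y. c (\<epsilon> * real_of_int k + \<epsilon> * y) * W (w y)) \<in> borel_measurable borel"
          using cm by measurable
        then show ?thesis by (simp add: measurable_completion)
      qed
      have cW0: "0 <= c x * W s" for x s using cb W_nonneg by simp
      have i1: "integrable lebesgue (\<lambda>y. 1 / 2 * (h y)\<^sup>2)"
      proof (rule integrableI_bounded)
        have "(\<integral>\<^sup>+y. ennreal (norm (1 / 2 * (h y)\<^sup>2)) \<partial>lebesgue) <= (\<integral>\<^sup>+y. ennreal (H y) \<partial>lebesgue)"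
          using cW0 by (intro nn_integral_mono ennreal_leI) (simp add: H_def)
        also have "\<dots> < \<infinity>" using le_less_trans[OF Hn ennreal_less_top] by simp
        finally show "(\<integral>\<^sup>+y. ennreal (norm (1 / 2 * (h y)\<^sup>2)) \<partial>lebesgue) < \<infinity>" .
      qed (use hm in measurable)
      have i2: "integrable lebesgue (\<lambda>y. c (\<epsilon> * real_of_int k + \<epsilon> * y) * W (w y))"
      proof (rule integrableI_bounded[OF cWm])
        have "(\<integral>\<^sup>+y. ennreal (norm (c (\<epsilon> * real_of_int k + \<epsilon> * y) * W (w y))) \<partial>lebesgue) <= (\<integral>\<^sup>+y. ennreal (H y) \<partial>lebesgue)"
          using cW0 by (intro nn_integral_mono ennreal_leI) (simp add: H_def)
        also have "\<dots> < \<infinity>" using le_less_trans[OF Hn ennreal_less_top] by simp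
        finally show "(\<integral>\<^sup>+y. ennreal (norm (c (\<epsilon> * real_of_int k + \<epsilon> * y) * W (w y))) \<partial>lebesgue) < \<infinity>" .
      qed
      have "integrable lebesgue (\<lambda>y. (h y)\<^sup>2)" using integrable_mult_right[OF i1, of 2] by simp
      then have t: "transition W r w h"
        using AC_w w_range w_sgn r2 by (simp add: transition_def)
      have "ennreal (kinetic h + (LINT y|lebesgue. c (\<epsilon> * real_of_int k + \<epsilon> * y) * W (w y))) = ennreal (LINT y|lebesgue. H y)"
        unfolding kinetic_def H_def using i1 i2 by (subst Bochner_Integration.integral_add) auto
      also have "\<dots> = (\<integral>\<^sup>+y. ennreal (H y) \<partial>lebesgue)"
      proof (rule nn_integral_eq_integral[symmetric])
        show "integrable lebesgue H" unfolding H_def[abs_def] by (rule Bochner_Integration.integrable_add[OF i1 i2])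
        show "AE x in lebesgue. 0 <= H x" using cW0 by (simp add: H_def)
      qed
      also note Hn
      finally have "kinetic h + (LINT y|lebesgue. c (\<epsilon> * real_of_int k + \<epsilon> * y) * W (w y)) <= e + \<eta> * (1 + 2 * tu * W_max)"
        using e \<eta> tu W_max_nonneg by (subst (asm) ennreal_le_iff) auto
      then show ?thesis using t kb by blast
    qed
  qed (use r2 in simp)
qed

lemma ex_transition: "\<exists>r v g. transition W r v g"
proof -
  obtain r where r: "extraction_radius r 1 1 (1/2) (1 + 2 * W_max)"
    using ex_extraction_radius[of 1 1 "1/2" "1 + 2 * W_max"] W_max_nonneg by auto
  have "(\<integral>\<^sup>+x\<in>{-1..1}. ennreal (1 / 2 * 1\<^sup>2 + 1 / 1 * 1 * W (1 * x + 0)) \<partial>lebesgue) <= ennreal (1 + 2 * W_max)"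
  proof -
    have "(\<integral>\<^sup>+x\<in>{-1..1}. ennreal (1 / 2 * 1\<^sup>2 + 1 / 1 * 1 * W (1 * x + 0)) \<partial>lebesgue) <= (\<integral>\<^sup>+x. ennreal (1 / 2 + W_max) * indicator {-1..1::real} x \<partial>lebesgue)"
      by (intro nn_integral_mono) (auto simp: indicator_def intro!: ennreal_leI W_le_max)
    also have "\<dots> = ennreal (1 / 2 + W_max) * emeasure lebesgue {-1..1::real}" by (intro nn_integral_cmult_indicator) auto
    also have "\<dots> = ennreal (1 + 2 * W_max)"
    proof -
      have "emeasure lebesgue {-1..1::real} = ennreal 2" by simp
      then have "ennreal (1 / 2 + W_max) * emeasure lebesgue {-1..1::real} = ennreal ((1 / 2 + W_max) * 2)"
        using W_max_nonneg by (simp only: ennreal_mult)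
      then show ?thesis by (simp add: algebra_simps)
    qed
    finally show "(\<integral>\<^sup>+x\<in>{-1..1}. ennreal (1 / 2 * 1\<^sup>2 + 1 / 1 * 1 * W (1 * x + 0)) \<partial>lebesgue) <= ennreal (1 + 2 * W_max)" .
  qed
  then have "\<exists>(k::int) w h. transition W r w h \<and> -1 - 1 <= 1 * real_of_int k \<and> 1 * real_of_int k <= 1 \<and>
       kinetic h + (LINT y|lebesgue. 1 * W (w y)) <= (1 + 2 * W_max) + 1/2 * (1 + 2 * 1 * W_max)"
    using r[unfolded extraction_radius_def, THEN conjunct2, rule_format, of 1 "-1" 1 "\<lambda>x. 1 * x + 0" "\<lambda>x. 1" "\<lambda>x. 1" "1 + 2 * W_max"]
      AC_linear[of "{-1..1}" 1 0] W_max_nonneg by simp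
  then show ?thesis by blast
qed

text \<open>Profiles that only converge to \<open>\<plusminus>1\<close> can be replaced by profiles that reach them, by the extraction lemma
in a constant medium with \<open>\<epsilon> = 1\<close>. Hence \<open>sigma_bar\<close> is the infimum over transition profiles.\<close>

lemma transition_approximation:
  assumes c: "0 < c" and lim: "(u \<longlongrightarrow> -1) at_bot" "(u \<longlongrightarrow> 1) at_top"
    and fin: "F_line W c u <= ereal e" and d: "0 < d"
  shows "\<exists>r v g. transition W r v g \<and> kinetic g + c * (LINT y|lebesgue. W (v y)) <= e + d"
proof -
  have ex: "\<exists>g. has_weak_deriv UNIV u g" using fin unfolding F_line_def by (cases "\<exists>g. has_weak_deriv UNIV u g") auto
  then obtain g0 where "has_weak_deriv UNIV u g0" by blast
  from weak_deriv_AC[OF this] obtain v where v: "AC UNIV v (weak_deriv UNIV u)" and uv: "AE x in lebesgue. u x = v x"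
    by auto
  let ?g = "weak_deriv UNIV u"
  have "enn2ereal (\<integral>\<^sup>+y. ennreal (1 / 2 * (?g y)\<^sup>2 + c * W (u y)) \<partial>lebesgue) <= ereal e"
    using fin ex unfolding F_line_def by simp
  note e0 = enn2ereal_le_ereal(1)[OF this] and en = enn2ereal_le_ereal(2)[OF this]
  define \<eta> where "\<eta> = min (1/2) (d / (1 + 2 * c * W_max))"
  have pos: "0 < 1 + 2 * c * W_max" using c W_max_nonneg by (intro add_pos_nonneg) auto
  have \<eta>: "0 < \<eta>" "\<eta> < 1" "\<eta> * (1 + 2 * c * W_max) <= d"
  proof -
    show "0 < \<eta>" "\<eta> < 1" using d pos by (auto simp: \<eta>_def)
    have "\<eta> <= d / (1 + 2 * c * W_max)" unfolding \<eta>_def by (rule min.cobounded2)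
    then show "\<eta> * (1 + 2 * c * W_max) <= d" using pos by (simp add: pos_le_divide_eq)
  qed
  obtain r where r: "extraction_radius r c c \<eta> e"
    using ex_extraction_radius[of c c \<eta> e] c e0 \<eta> by auto
  have "\<forall>\<^sub>F x in at_bot. u x < -1 + \<eta>" using lim(1) \<eta> by (intro order_tendstoD) auto
  then obtain P where P: "\<And>x. x <= P ==> u x < -1 + \<eta>" by (auto simp: eventually_at_bot_linorder)
  have "\<forall>\<^sub>F x in at_top. 1 - \<eta> < u x" using lim(2) \<eta> by (intro order_tendstoD) auto
  then obtain Q where Q: "\<And>x. Q <= x ==> 1 - \<eta> < u x" by (auto simp: eventually_at_top_linorder)
  define m where "m = min P Q"
  obtain p where p: "m - 1 < p" "p < m" "u p = v p" using AE_lebesgue_dense[OF uv, of "m - 1" m] by auto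
  obtain q where q: "Q < q" "q < Q + 1" "u q = v q" using AE_lebesgue_dense[OF uv, of "Q" "Q + 1"] by auto
  have pq: "p <= q" "v p <= -1 + \<eta>" "1 - \<eta> <= v q" using p q P[of p] Q[of q] by (auto simp: m_def)
  have "(\<integral>\<^sup>+x\<in>{p..q}. ennreal (1 / 2 * (?g x)\<^sup>2 + 1 / 1 * c * W (v x)) \<partial>lebesgue) <= ennreal e"
  proof -
    have "(\<integral>\<^sup>+x\<in>{p..q}. ennreal (1 / 2 * (?g x)\<^sup>2 + 1 / 1 * c * W (v x)) \<partial>lebesgue) <= (\<integral>\<^sup>+x. ennreal (1 / 2 * (?g x)\<^sup>2 + c * W (u x)) \<partial>lebesgue)"
    proof (rule nn_integral_mono_AE)
      show "AE x in lebesgue. ennreal (1 / 2 * (?g x)\<^sup>2 + 1 / 1 * c * W (v x)) * indicator {p..q} x <= ennreal (1 / 2 * (?g x)\<^sup>2 + c * W (u x))"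
        using uv by eventually_elim (simp add: indicator_def)
    qed
    then show "(\<integral>\<^sup>+x\<in>{p..q}. ennreal (1 / 2 * (?g x)\<^sup>2 + 1 / 1 * c * W (v x)) \<partial>lebesgue) <= ennreal e" using en by simp
  qed
  then have "\<exists>(k::int) w h. transition W r w h \<and> p - 1 <= 1 * real_of_int k \<and> 1 * real_of_int k <= q \<and>
       kinetic h + (LINT y|lebesgue. c * W (w y)) <= e + \<eta> * (1 + 2 * c * W_max)"
    using r[unfolded extraction_radius_def, THEN conjunct2, rule_format, of 1 p q v ?g "\<lambda>x. c" e]
      pq c e0 AC_subset[OF v, of "{p..q}"] by simp
  then obtain w h where "transition W r w h" "kinetic h + (LINT y|lebesgue. c * W (w y)) <= e + \<eta> * (1 + 2 * c * W_max)" by blast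
  then show ?thesis using \<eta>(3) by (intro exI[of _ r] exI[of _ w] exI[of _ h]) auto
qed

end

section \<open>High probability and the rate function\<close>

context prob_space begin

text \<open>Events need not be measurable: it suffices that the exceptional set is covered by an event of small probability.
This is needed for statements that quantify over all profiles.\<close>

definition whp :: "(real => 'a => bool) => bool" where
  "whp Q \<longleftrightarrow> (\<exists>A. (\<forall>\<epsilon>. A \<epsilon> \<in> events) \<and> (\<forall>\<^sub>F \<epsilon> in at_right 0. \<forall>\<omega>\<in>space M. \<not> Q \<epsilon> \<omega> --> \<omega> \<in> A \<epsilon>) \<and>
     ((\<lambda>\<epsilon>. prob (A \<epsilon>)) \<longlongrightarrow> 0) (at_right 0))"

lemma whpI:
  assumes "\<And>\<epsilon>. A \<epsilon> \<in> events" "\<forall>\<^sub>F \<epsilon> in at_right 0. \<forall>\<omega>\<in>space M. \<not> Q \<epsilon> \<omega> --> \<omega> \<in> A \<epsilon>"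
    "\<forall>\<^sub>F \<epsilon> in at_right 0. prob (A \<epsilon>) <= g \<epsilon>" "(g \<longlongrightarrow> 0) (at_right 0)"
  shows "whp Q"
  unfolding whp_def
proof (intro exI[of _ A] conjI allI assms)
  show "((\<lambda>\<epsilon>. prob (A \<epsilon>)) \<longlongrightarrow> 0) (at_right 0)"
    by (rule tendsto_sandwich[OF _ assms(3) tendsto_const assms(4)]) auto
qed

lemma whp_mono:
  assumes "whp Q" "\<forall>\<^sub>F \<epsilon> in at_right 0. \<forall>\<omega>\<in>space M. Q \<epsilon> \<omega> --> R \<epsilon> \<omega>"
  shows "whp R"
proof -
  obtain A where A: "\<And>\<epsilon>. A \<epsilon> \<in> events" "\<forall>\<^sub>F \<epsilon> in at_right 0. \<forall>\<omega>\<in>space M. \<not> Q \<epsilon> \<omega> --> \<omega> \<in> A \<epsilon>"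
    "((\<lambda>\<epsilon>. prob (A \<epsilon>)) \<longlongrightarrow> 0) (at_right 0)" using assms(1) unfolding whp_def by blast
  have "\<forall>\<^sub>F \<epsilon> in at_right 0. \<forall>\<omega>\<in>space M. \<not> R \<epsilon> \<omega> --> \<omega> \<in> A \<epsilon>"
    using A(2) assms(2) by eventually_elim blast
  then show ?thesis unfolding whp_def using A by blast
qed

lemma whp_conj:
  assumes "whp Q" "whp R" shows "whp (\<lambda>\<epsilon> \<omega>. Q \<epsilon> \<omega> \<and> R \<epsilon> \<omega>)"
proof -
  obtain A where A: "\<And>\<epsilon>. A \<epsilon> \<in> events" "\<forall>\<^sub>F \<epsilon> in at_right 0. \<forall>\<omega>\<in>space M. \<not> Q \<epsilon> \<omega> --> \<omega> \<in> A \<epsilon>"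
    "((\<lambda>\<epsilon>. prob (A \<epsilon>)) \<longlongrightarrow> 0) (at_right 0)" using assms(1) unfolding whp_def by blast
  obtain B where B: "\<And>\<epsilon>. B \<epsilon> \<in> events" "\<forall>\<^sub>F \<epsilon> in at_right 0. \<forall>\<omega>\<in>space M. \<not> R \<epsilon> \<omega> --> \<omega> \<in> B \<epsilon>"
    "((\<lambda>\<epsilon>. prob (B \<epsilon>)) \<longlongrightarrow> 0) (at_right 0)" using assms(2) unfolding whp_def by blast
  show ?thesis
  proof (rule whpI[where A="\<lambda>\<epsilon>. A \<epsilon> \<union> B \<epsilon>" and g="\<lambda>\<epsilon>. prob (A \<epsilon>) + prob (B \<epsilon>)"])
    show "\<forall>\<^sub>F \<epsilon> in at_right 0. \<forall>\<omega>\<in>space M. \<not> (Q \<epsilon> \<omega> \<and> R \<epsilon> \<omega>) --> \<omega> \<in> A \<epsilon> \<union> B \<epsilon>"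
      using A(2) B(2) by eventually_elim blast
    show "\<forall>\<^sub>F \<epsilon> in at_right 0. prob (A \<epsilon> \<union> B \<epsilon>) <= prob (A \<epsilon>) + prob (B \<epsilon>)"
      using A(1) B(1) by (intro always_eventually allI measure_Un_le)
    show "((\<lambda>\<epsilon>. prob (A \<epsilon>) + prob (B \<epsilon>)) \<longlongrightarrow> 0) (at_right 0)"
      using tendsto_add[OF A(3) B(3)] by simp
  qed (use A B in auto)
qed

lemma whp_AE: assumes "AE \<omega> in M. Q \<omega>" shows "whp (\<lambda>\<epsilon>. Q)"
proof -
  obtain N where N: "{\<omega> \<in> space M. \<not> Q \<omega>} \<subseteq> N" "emeasure M N = 0" "N \<in> events" using AE_E[OF assms] by blast
  show ?thesis
    by (rule whpI[where A="\<lambda>_. N" and g="\<lambda>_. 0"]) (use N in \<open>auto simp: measure_def\<close>)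
qed

lemma whp_ball_finite:
  assumes "finite S" "\<And>i. i \<in> S ==> whp (Q i)" shows "whp (\<lambda>\<epsilon> \<omega>. \<forall>i\<in>S. Q i \<epsilon> \<omega>)"
  using assms
proof (induction S rule: finite_induct)
  case empty
  show ?case by (rule whp_mono[OF whp_AE[of "\<lambda>_. True"]]) auto
next
  case (insert i S)
  have "whp (\<lambda>\<epsilon> \<omega>. Q i \<epsilon> \<omega> \<and> (\<forall>i\<in>S. Q i \<epsilon> \<omega>))" using insert by (intro whp_conj) auto
  then show ?case by simp
qed

end

locale phase_transition = iid_bounded P \<Theta> tl tu + double_well W
  for P :: "'w measure" and \<Theta> :: "int => 'w => real" and tl tu :: real and W :: "real => real"
begin

abbreviation "mass v \<equiv> (LINT y|lebesgue. W (v y))"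
abbreviation "J \<equiv> rate W P (\<Theta> 0) tl"
text \<open>The real value of \<open>sigma_bar\<close>, see \<open>sigma_bar_eq\<close>.\<close>

definition "sb = real_of_ereal (sigma_bar W P (\<Theta> 0))"
definition "excess v g = kinetic g + \<mu> * mass v - sb"
definition "profile_rate v s = (SUP \<xi>\<in>{..0}. ereal (- \<xi> * s - cumulant (\<lambda>y. W (v y)) \<xi>))"

lemma mean_eq: "mean P (\<Theta> 0) = \<mu>" by (simp add: \<mu>_def)

lemma \<mu>_pos: "0 < \<mu>" using \<mu>_bounds(1) tl_pos by linarith

lemma mass_nonneg: "0 <= mass v" using W_nonneg by (intro Bochner_Integration.integral_nonneg) auto

lemma sigma_bar_le: "transition W r v g ==> sigma_bar W P (\<Theta> 0) <= ereal (kinetic g + \<mu> * mass v)"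
  unfolding sigma_bar_def mean_eq
  using F_line_transition[of r v g v \<mu>] \<mu>_pos transition_limits[of r v g]
  by (intro Inf_lower) (auto intro!: exI[of _ v])

lemma sigma_bar_eq: "sigma_bar W P (\<Theta> 0) = ereal sb"
proof -
  have "0 <= sigma_bar W P (\<Theta> 0)"
    unfolding sigma_bar_def by (intro Inf_greatest) (auto simp: F_line_def enn2ereal_nonneg)
  moreover obtain r v g where "transition W r v g" using ex_transition by blast
  ultimately show ?thesis using sigma_bar_le[of r v g] unfolding sb_def
    by (cases "sigma_bar W P (\<Theta> 0)") auto
qed

lemma excess_nonneg: "transition W r v g ==> 0 <= excess v g"
  using sigma_bar_le[of r v g] unfolding sigma_bar_eq excess_def by simp

lemma near_optimal_transition:
  assumes "0 < d" obtains r v g where "transition W r v g" "kinetic g + \<mu> * mass v <= sb + d"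
proof -
  have "sigma_bar W P (\<Theta> 0) < ereal (sb + d / 2)" using assms by (simp add: sigma_bar_eq)
  then obtain u where u: "(u \<longlongrightarrow> -1) at_bot" "(u \<longlongrightarrow> 1) at_top" "F_line W \<mu> u < ereal (sb + d / 2)"
    unfolding sigma_bar_def mean_eq Inf_less_iff by blast
  have "\<exists>r v g. transition W r v g \<and> kinetic g + \<mu> * mass v <= (sb + d / 2) + d / 2"
    by (rule transition_approximation[OF \<mu>_pos u(1,2)]) (use u(3) assms in auto)
  then show ?thesis using that by auto
qed

lemma rate_profile_eq:
  assumes t: "transition W r v g" and uv: "AE x in lebesgue. u x = v x"
  shows "rate_profile W P (\<Theta> 0) u \<zeta> = profile_rate v (\<zeta> + excess v g)"
proof -
  have F: "real_of_ereal (F_line W (mean P (\<Theta> 0)) u) = kinetic g + \<mu> * mass v"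
    unfolding mean_eq using F_line_transition[OF t uv] \<mu>_pos by simp
  have "(LINT y|lebesgue. \<Lambda> (\<xi> * W (u y))) = cumulant (\<lambda>y. W (v y)) \<xi>" for \<xi>
  proof -
    have m: "(\<lambda>y. \<Lambda> (\<xi> * W (v y))) \<in> borel_measurable lebesgue"
      by (rule borel_measurable_integrable[OF integrable_\<Lambda>[OF transition_bump[OF t]]])
    have ae: "AE y in lebesgue. \<Lambda> (\<xi> * W (v y)) = \<Lambda> (\<xi> * W (u y))" using uv by eventually_elim simp
    have "(\<lambda>y. \<Lambda> (\<xi> * W (u y))) \<in> borel_measurable lebesgue" by (rule borel_measurable_AE[OF m ae])
    from integral_cong_AE[OF m this ae] show ?thesis by (simp add: cumulant_def)
  qed
  then show ?thesis
    unfolding rate_profile_def profile_rate_def F excess_def sb_def by (simp add: algebra_simps)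
qed

lemma rate_le_profile_rate:
  assumes "transition W r v g" shows "J \<zeta> <= profile_rate v (\<zeta> + excess v g)"
proof -
  have "v \<in> profiles W tl r" using transition_profile[OF assms] tl_pos by simp
  then have "J \<zeta> <= rate_profile W P (\<Theta> 0) v \<zeta>"
    using assms unfolding rate_def rate_radius_def transition_def
    by (intro INF_lower2[of r] INF_lower) auto
  then show ?thesis using rate_profile_eq[OF assms, of v] by simp
qed

lemma rate_less:
  assumes "J \<zeta> < \<kappa>" obtains r v g where "transition W r v g" "profile_rate v (\<zeta> + excess v g) < \<kappa>"
proof -
  obtain r u where r: "1 <= r" "u \<in> profiles W tl r" "rate_profile W P (\<Theta> 0) u \<zeta> < \<kappa>"
    using assms unfolding rate_def rate_radius_def INF_less_iff by auto
  obtain v g where vg: "transition W r v g" "AE x in lebesgue. u x = v x" by (rule profile_transition[OF r(2,1) tl_pos])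
  show ?thesis using that[OF vg(1)] r(3) rate_profile_eq[OF vg] by simp
qed

lemma le_rateI:
  assumes "\<And>r v g. transition W r v g ==> c <= profile_rate v (\<zeta> + excess v g)" shows "c <= J \<zeta>"
proof (rule ccontr)
  assume "\<not> c <= J \<zeta>"
  then have "J \<zeta> < c" by simp
  then show False using assms by (metis rate_less not_le)
qed

lemma profile_rate_mono: "s <= s' ==> profile_rate v s <= profile_rate v s'"
  unfolding profile_rate_def
proof (rule SUP_mono)
  fix \<xi> :: real assume "s <= s'" "\<xi> \<in> {..0}"
  then have "- \<xi> * s <= - \<xi> * s'" by (intro mult_left_mono) auto
  then show "\<exists>m\<in>{..0}. ereal (- \<xi> * s - cumulant (\<lambda>y. W (v y)) \<xi>) <= ereal (- m * s' - cumulant (\<lambda>y. W (v y)) m)"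
    using \<open>\<xi> \<in> {..0}\<close> by (intro bexI[of _ \<xi>]) auto
qed

lemma profile_rate_nonneg: "0 <= profile_rate v s"
  unfolding profile_rate_def by (rule SUP_upper2[of 0]) (auto simp: cumulant_0)

lemma rate_mono: "\<zeta> <= \<zeta>' ==> J \<zeta> <= J \<zeta>'"
  by (rule le_rateI) (meson add_right_mono order_trans profile_rate_mono rate_le_profile_rate)

text \<open>All coefficients are at least \<open>tl\<close>, so no profile can ever cost less than \<open>c0\<close>.\<close>

lemma rate_infinite:
  assumes c0: "\<And>r v g. transition W r v g ==> c0 <= kinetic g + tl * mass v" and \<zeta>: "sb - c0 < \<zeta>"
  shows "J \<zeta> = \<infinity>"
proof -
  have "\<infinity> <= J \<zeta>"
  proof (rule le_rateI)
    fix r v g assume t: "transition W r v g"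
    have "ereal M <= profile_rate v (\<zeta> + excess v g)" if M: "0 <= M" for M
    proof -
      (* the gain times this tilt is M *)
      define \<xi> where "\<xi> = - (M / (\<zeta> + c0 - sb))"
      have \<xi>: "\<xi> <= 0" using M \<zeta> by (simp add: \<xi>_def)
      have "M = - \<xi> * (\<zeta> + c0 - sb)" using \<zeta> by (simp add: \<xi>_def)
      also have "\<dots> <= - \<xi> * (\<zeta> + (kinetic g + tl * mass v) - sb)"
        using c0[OF t] \<xi> by (intro mult_left_mono) auto
      also have "\<dots> = - \<xi> * (\<zeta> + excess v g) - \<xi> * (tl - \<mu>) * mass v"
        by (simp add: excess_def algebra_simps)
      also have "\<dots> <= - \<xi> * (\<zeta> + excess v g) - cumulant (\<lambda>y. W (v y)) \<xi>"
        using cumulant_le_linear[OF transition_bump[OF t] \<xi>] by simp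
      finally show ?thesis unfolding profile_rate_def using \<xi> by (intro SUP_upper2[of \<xi>]) auto
    qed
    then have "ereal (real n) <= profile_rate v (\<zeta> + excess v g)" for n by simp
    then show "\<infinity> <= profile_rate v (\<zeta> + excess v g)"
      by (metis ereal_infty_less_eq(1) ereal_top linear order_trans real_arch_simple ereal_less_eq(3) of_nat_0_le_iff)
  qed
  then show ?thesis by simp
qed

text \<open>The rate function is monotone, so the infimum in \<open>sigma_check\<close> separates the gains that are realized from those that
are not; \<open>rate_infinite\<close> keeps it away from \<open>sb\<close>, whence the price of a jump is positive.\<close>

lemma ex_critical_gain:
  obtains z where "0 <= z" "z < sb" "sigma_check W P (\<Theta> 0) tl \<kappa> = ereal (sb - z)"
    "\<And>\<zeta>. z < \<zeta> ==> \<kappa> <= J \<zeta>" "\<And>\<zeta>. 0 <= \<zeta> ==> \<zeta> < z ==> J \<zeta> < \<kappa>"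
proof -
  obtain c0 where c0: "c0 > 0" "\<And>r v g. transition W r v g ==> c0 <= kinetic g + tl * mass v"
    using transition_energy_lower_bound[OF tl_pos] by metis
  have "c0 <= sb"
  proof (rule field_le_epsilon)
    fix d :: real assume "0 < d"
    then obtain r v g where t: "transition W r v g" "kinetic g + \<mu> * mass v <= sb + d" using near_optimal_transition by blast
    have "tl * mass v <= \<mu> * mass v" using \<mu>_bounds(1) mass_nonneg by (intro mult_right_mono) auto
    then show "c0 <= sb + d" using c0(2)[OF t(1)] t(2) by linarith
  qed
  define S where "S = {\<zeta>. 0 <= \<zeta> \<and> \<kappa> <= J \<zeta>}"
  have big: "\<zeta> \<in> S" if "sb - c0 < \<zeta>" for \<zeta>
    using rate_infinite[OF c0(2) that] that \<open>c0 <= sb\<close> by (simp add: S_def)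
  define z where "z = Inf S"
  have bdd: "bdd_below S" by (auto simp: S_def bdd_below_def)
  have ne: "S \<noteq> {}" using big[of "sb - c0 + 1"] by auto
  have z0: "0 <= z" unfolding z_def using ne by (intro cInf_greatest) (auto simp: S_def)
  have z1: "z <= sb - c0"
  proof (rule field_le_epsilon)
    fix d :: real assume "0 < d"
    then show "z <= sb - c0 + d" unfolding z_def by (intro cInf_lower bdd big) auto
  qed
  have "Inf {ereal \<zeta> | \<zeta>. 0 <= \<zeta> \<and> \<kappa> <= J \<zeta>} = Inf (ereal ` S)"
    by (rule arg_cong[where f=Inf]) (auto simp: S_def)
  also have "\<dots> = ereal z" unfolding z_def using bdd ne by (intro ereal_Inf'[symmetric])
  finally have "sigma_check W P (\<Theta> 0) tl \<kappa> = ereal (sb - z)"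
    unfolding sigma_check_def sigma_bar_eq by simp
  moreover have "\<kappa> <= J \<zeta>" if less: "z < \<zeta>" for \<zeta>
  proof -
    obtain \<zeta>' where "\<zeta>' \<in> S" "\<zeta>' < \<zeta>" using less cInf_lessD[OF ne] unfolding z_def by blast
    then show ?thesis using rate_mono[of \<zeta>' \<zeta>] by (auto simp: S_def intro: order_trans)
  qed
  moreover have "J \<zeta> < \<kappa>" if "0 <= \<zeta>" "\<zeta> < z" for \<zeta>
    using cInf_lower[OF _ bdd, of \<zeta>] that unfolding z_def[symmetric] by (force simp: S_def not_le[symmetric])
  ultimately show ?thesis using that z0 z1 c0(1) by force
qed

text \<open>Demanding slightly more than the gain \<open>s\<close> strictly increases the rate, by a tilt bounded away from zero. The margin
\<open>\<gamma>\<close> absorbs the factor \<open>exp (o(\<epsilon> / \<delta>))\<close> by which the number of sites may exceed \<open>exp (\<kappa> \<epsilon> / \<delta>)\<close>.\<close>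

lemma strict_rate_gain:
  assumes t: "transition W r v g" and s: "0 <= s" and \<rho>: "0 < \<rho>" and K: "ereal K <= profile_rate v s"
  obtains \<xi> \<gamma> where "\<xi> <= 0" "0 < \<gamma>" "K + \<gamma> <= - \<xi> * (s + \<rho>) - cumulant (\<lambda>y. W (v y)) \<xi>"
proof -
  let ?A = "cumulant (\<lambda>y. W (v y))"
  obtain C \<tau>0 where C: "C >= 0" "\<tau>0 > 0"
    "\<And>\<xi> \<tau>. \<bar>\<tau>\<bar> <= \<tau>0 ==> ?A (\<xi> + \<tau>) <= ?A \<xi> + \<tau> * cumulant_slope (\<lambda>y. W (v y)) \<xi> + C * \<tau>\<^sup>2"
    using cumulant_quadratic[OF transition_bump[OF t]] by blast
  define \<tau> where "\<tau> = min \<tau>0 (\<rho> / (2 * (C + 1)))"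
  have \<tau>: "0 < \<tau>" "\<tau> <= \<tau>0" using C \<rho> by (auto simp: \<tau>_def)
  have "?A (- \<tau>) <= C * \<tau>\<^sup>2" using C(3)[of "-\<tau>" 0] \<tau> by (simp add: cumulant_0 cumulant_slope_0)
  also have "C * \<tau>\<^sup>2 <= \<tau> * \<rho> / 2"
  proof -
    have "C * \<tau> <= (C + 1) * (\<rho> / (2 * (C + 1)))" using C \<tau> by (intro mult_mono) (auto simp: \<tau>_def)
    also have "\<dots> = \<rho> / 2" using C by (simp add: field_simps)
    finally have "\<tau> * (C * \<tau>) <= \<tau> * (\<rho> / 2)" using \<tau> by (intro mult_left_mono) auto
    then show ?thesis by (simp add: power2_eq_square mult_ac)
  qed
  finally have A2: "?A (- \<tau>) <= \<tau> * \<rho> / 2" .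
  define c where "c = \<tau> * \<rho> / 2"
  have c: "0 < c" "?A (- \<tau>) <= c" "\<tau> * \<rho> = 2 * c" using \<tau> \<rho> A2 by (auto simp: c_def)
  have "ereal (K - c / 2) < profile_rate v s" using K c by (intro less_le_trans[OF _ K]) simp
  then obtain \<xi>1 where \<xi>1: "\<xi>1 <= 0" "K - c / 2 < - \<xi>1 * s - ?A \<xi>1"
    unfolding profile_rate_def less_SUP_iff by auto
  show ?thesis
  proof (cases "\<xi>1 <= - \<tau>")
    case True
    have "\<tau> * \<rho> <= - \<xi>1 * \<rho>" using True \<rho> by (intro mult_right_mono) auto
    then have "K + c <= - \<xi>1 * (s + \<rho>) - ?A \<xi>1" using \<xi>1(2) c by (simp add: distrib_left)
    then show ?thesis using that[OF \<xi>1(1) c(1)] by blast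
  next
    case False
    have "- \<xi>1 * s <= \<tau> * s" using False s by (intro mult_right_mono) auto
    then have "K + c / 2 <= - (- \<tau>) * (s + \<rho>) - ?A (- \<tau>)"
      using \<xi>1(2) c cumulant_nonneg[of "\<lambda>y. W (v y)" \<xi>1] by (simp add: distrib_left)
    then show ?thesis using that[of "- \<tau>" "c / 2"] \<tau> c by auto
  qed
qed

end

section \<open>Energies of a fixed profile\<close>

locale scaled_transition = phase_transition P \<Theta> tl tu W
  for P :: "'w measure" and \<Theta> :: "int => 'w => real" and tl tu :: real and W :: "real => real" +
  fixes \<delta> :: "real => real" and \<kappa> :: ereal
  assumes \<delta>_pos: "\<And>\<epsilon>. 0 < \<epsilon> ==> 0 < \<delta> \<epsilon>"
    and \<delta>_small: "((\<lambda>\<epsilon>. inverse \<epsilon> * \<delta> \<epsilon>) \<longlongrightarrow> 0) (at_right 0)"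
    and \<kappa>_nonneg: "0 <= \<kappa>"
    and \<kappa>_lim: "((\<lambda>\<epsilon>. ereal (\<delta> \<epsilon> * \<bar>ln \<epsilon>\<bar> / \<epsilon>)) \<longlongrightarrow> \<kappa>) (at_right 0)"
begin

abbreviation "\<alpha> \<epsilon> \<equiv> \<epsilon> / \<delta> \<epsilon>"

lemma eventually_pos: "\<forall>\<^sub>F \<epsilon> in at_right (0::real). 0 < \<epsilon> \<and> \<epsilon> < 1"
  unfolding eventually_at_right_field by (intro exI[of _ 1]) auto

lemma \<alpha>_pos: "0 < \<epsilon> ==> 0 < \<alpha> \<epsilon>" using \<delta>_pos by simp

lemma \<alpha>_at_top: "filterlim \<alpha> at_top (at_right 0)"
proof -
  have "\<forall>\<^sub>F \<epsilon> in at_right 0. 0 < inverse \<epsilon> * \<delta> \<epsilon>"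
    using eventually_pos by eventually_elim (use \<delta>_pos in auto)
  from filterlim_inverse_at_top[OF \<delta>_small this] show ?thesis
    by (simp add: inverse_mult_distrib divide_inverse mult.commute)
qed

lemma exp_\<alpha>_tendsto_0: "0 < c ==> ((\<lambda>\<epsilon>. C * exp (- (\<alpha> \<epsilon> * c))) \<longlongrightarrow> 0) (at_right 0)"
proof -
  assume c: "0 < c"
  have "filterlim (\<lambda>\<epsilon>. \<alpha> \<epsilon> * c) at_top (at_right 0)"
    by (rule filterlim_at_top_mult_tendsto_pos[OF tendsto_const c \<alpha>_at_top])
  then have "((\<lambda>\<epsilon>. exp (- (\<alpha> \<epsilon> * c))) \<longlongrightarrow> 0) (at_right 0)"
    by (intro filterlim_compose[OF exp_at_bot] filterlim_compose[OF filterlim_uminus_at_bot_at_top])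
  from tendsto_mult[OF tendsto_const this, of C] show ?thesis by simp
qed

lemma eventually_inverse_le:
  assumes "\<kappa> < ereal K" shows "\<forall>\<^sub>F \<epsilon> in at_right 0. 1 / \<epsilon> <= exp (\<alpha> \<epsilon> * K)"
  using order_tendstoD(2)[OF \<kappa>_lim assms] eventually_pos
proof eventually_elim
  case (elim \<epsilon>)
  then have "\<delta> \<epsilon> * \<bar>ln \<epsilon>\<bar> / \<epsilon> < K" by simp
  then have "\<bar>ln \<epsilon>\<bar> < \<alpha> \<epsilon> * K" using elim \<delta>_pos[of \<epsilon>] by (simp add: field_simps)
  then have "ln (1 / \<epsilon>) <= \<alpha> \<epsilon> * K" using elim by (simp add: ln_div)
  then show ?case using elim by (subst ln_le_cancel_iff[symmetric]) auto
qed

lemma eventually_le_inverse: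
  assumes "ereal K < \<kappa>" shows "\<forall>\<^sub>F \<epsilon> in at_right 0. exp (\<alpha> \<epsilon> * K) <= 1 / \<epsilon>"
  using order_tendstoD(1)[OF \<kappa>_lim assms] eventually_pos
proof eventually_elim
  case (elim \<epsilon>)
  then have "K < \<delta> \<epsilon> * \<bar>ln \<epsilon>\<bar> / \<epsilon>" by simp
  then have "\<alpha> \<epsilon> * K < \<bar>ln \<epsilon>\<bar>" using elim \<delta>_pos[of \<epsilon>] by (simp add: field_simps)
  then have "\<alpha> \<epsilon> * K <= ln (1 / \<epsilon>)" using elim by (simp add: ln_div)
  then have "exp (\<alpha> \<epsilon> * K) <= exp (ln (1 / \<epsilon>))" by simp
  then show ?case using elim by simp
qed

text \<open>The energy of the profile \<open>v\<close> centred at \<open>x\<close>, in the rescaled variable.\<close>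

definition "local_energy \<omega> \<epsilon> x v g = kinetic g + potential (\<lambda>z. \<Theta> z \<omega>) (\<alpha> \<epsilon>) (x / \<delta> \<epsilon>) (\<lambda>y. W (v y))"

lemma local_energy_eq:
  assumes "transition W r v g" "0 < \<epsilon>"
  shows "local_energy \<omega> \<epsilon> x v g = sb + excess v g + fluct r (\<alpha> \<epsilon>) (x / \<delta> \<epsilon>) (\<lambda>y. W (v y)) \<omega>"
  unfolding local_energy_def potential_eq_fluct[OF \<alpha>_pos[OF assms(2)] transition_bump[OF assms(1)]] excess_def
  by simp

definition "sites a b \<epsilon> = {\<lceil>a / \<epsilon>\<rceil> - 1..\<lfloor>b / \<epsilon>\<rfloor>}"

lemma finite_sites [simp]: "finite (sites a b \<epsilon>)" by (simp add: sites_def)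

lemma mem_sites: "0 < \<epsilon> ==> a - \<epsilon> <= \<epsilon> * real_of_int k ==> \<epsilon> * real_of_int k <= b ==> k \<in> sites a b \<epsilon>"
proof -
  assume e: "0 < \<epsilon>" "a - \<epsilon> <= \<epsilon> * real_of_int k" "\<epsilon> * real_of_int k <= b"
  have "a / \<epsilon> <= real_of_int k + 1" "real_of_int k <= b / \<epsilon>" using e by (simp_all add: field_simps)
  then show ?thesis unfolding sites_def atLeastAtMost_iff by linarith
qed

lemma card_sites: "0 < \<epsilon> ==> a <= b ==> real (card (sites a b \<epsilon>)) <= (b - a) / \<epsilon> + 2"
proof -
  assume e: "0 < \<epsilon>" "a <= b"
  have "a / \<epsilon> <= b / \<epsilon>" using e by (simp add: divide_right_mono)
  then have "\<lfloor>b / \<epsilon>\<rfloor> - (\<lceil>a / \<epsilon>\<rceil> - 1) >= 0" by linarith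
  then have "real (card (sites a b \<epsilon>)) = real_of_int (\<lfloor>b / \<epsilon>\<rfloor> - (\<lceil>a / \<epsilon>\<rceil> - 1) + 1)"
    by (simp add: sites_def)
  also have "\<dots> <= b / \<epsilon> - a / \<epsilon> + 2" by linarith
  finally show ?thesis by (simp add: diff_divide_distrib)
qed

text \<open>A union bound over the sites. The number of sites is of order \<open>1 / \<epsilon> = exp (\<kappa> \<epsilon> / \<delta> + o(\<epsilon> / \<delta>))\<close>, and Chernoff's
bound with the tilt of \<open>strict_rate_gain\<close> has a strictly larger exponent. If \<open>\<kappa> = \<infinity>\<close>, then the rate of the
profile is infinite, and the tilts yield arbitrarily large exponents for each \<open>\<epsilon>\<close>.\<close>

lemma lower_bound_fixed_profile:
  assumes t: "transition W r v g" and ab: "a <= b" and \<zeta>: "0 <= \<zeta>" "\<kappa> <= J \<zeta>" and \<rho>: "0 < \<rho>"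
  shows "whp (\<lambda>\<epsilon> \<omega>. \<forall>k\<in>sites a b \<epsilon>. sb - \<zeta> - \<rho> < local_energy \<omega> \<epsilon> (\<epsilon> * real_of_int k) v g)"
proof -
  let ?f = "\<lambda>y. W (v y)"
  define s where "s = \<zeta> + excess v g"
  have s: "0 <= s" using excess_nonneg[OF t] \<zeta> by (simp add: s_def)
  have \<kappa>s: "\<kappa> <= profile_rate v s" using rate_le_profile_rate[OF t, of \<zeta>] \<zeta>(2) by (simp add: s_def)
  define E where "E \<epsilon> k = {\<omega> \<in> space P. fluct r (\<alpha> \<epsilon>) (\<epsilon> * real_of_int k / \<delta> \<epsilon>) ?f \<omega> <= - (s + \<rho>)}" for \<epsilon> k
  have Em: "E \<epsilon> k \<in> events" for \<epsilon> k unfolding E_def by measurable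
  define A where "A \<epsilon> = (\<Union>k\<in>sites a b \<epsilon>. E \<epsilon> k)" for \<epsilon>
  have Am: "A \<epsilon> \<in> events" for \<epsilon> unfolding A_def using Em by auto
  have EG: "prob (E \<epsilon> k) <= exp (- (\<alpha> \<epsilon> * G))"
    if "0 < \<epsilon>" "\<xi> <= 0" "G <= - \<xi> * (s + \<rho>) - cumulant ?f \<xi>" for \<epsilon> k \<xi> G
  proof -
    have "prob (E \<epsilon> k) <= prob {\<omega> \<in> space P. - \<xi> * (s + \<rho>) <= \<xi> * fluct r (\<alpha> \<epsilon>) (\<epsilon> * real_of_int k / \<delta> \<epsilon>) ?f \<omega>}"
    proof (rule finite_measure_mono)
      show "E \<epsilon> k \<subseteq> {\<omega> \<in> space P. - \<xi> * (s + \<rho>) <= \<xi> * fluct r (\<alpha> \<epsilon>) (\<epsilon> * real_of_int k / \<delta> \<epsilon>) ?f \<omega>}"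
      proof
        fix \<omega> assume "\<omega> \<in> E \<epsilon> k"
        then have "\<omega> \<in> space P" "\<xi> * (- (s + \<rho>)) <= \<xi> * fluct r (\<alpha> \<epsilon>) (\<epsilon> * real_of_int k / \<delta> \<epsilon>) ?f \<omega>"
          using that(2) unfolding E_def by (auto intro: mult_left_mono_neg)
        then show "\<omega> \<in> {\<omega> \<in> space P. - \<xi> * (s + \<rho>) <= \<xi> * fluct r (\<alpha> \<epsilon>) (\<epsilon> * real_of_int k / \<delta> \<epsilon>) ?f \<omega>}" 
            by (simp only: mem_Collect_eq mult_minus_left mult_minus_right simp_thms)
      qed
    qed measurable
    also have "\<dots> <= exp (\<alpha> \<epsilon> * (cumulant ?f \<xi> - - \<xi> * (s + \<rho>)))"
      by (rule chernoff[OF \<alpha>_pos[OF that(1)] transition_bump[OF t]])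
    also have "\<dots> <= exp (- (\<alpha> \<epsilon> * G))"
      using mult_left_mono[OF that(3), of "\<alpha> \<epsilon>"] \<alpha>_pos[OF that(1)] by (simp add: algebra_simps)
    finally show ?thesis .
  qed
  have AG: "prob (A \<epsilon>) <= ((b - a) / \<epsilon> + 2) * exp (- (\<alpha> \<epsilon> * G))"
    if "0 < \<epsilon>" "\<xi> <= 0" "G <= - \<xi> * (s + \<rho>) - cumulant ?f \<xi>" for \<epsilon> \<xi> G
  proof -
    have "prob (A \<epsilon>) <= (\<Sum>k\<in>sites a b \<epsilon>. prob (E \<epsilon> k))"
      unfolding A_def by (rule finite_measure_subadditive_finite) (use Em in auto)
    also have "\<dots> <= (\<Sum>k\<in>sites a b \<epsilon>. exp (- (\<alpha> \<epsilon> * G)))" by (intro sum_mono EG[OF that])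
    also have "\<dots> = real (card (sites a b \<epsilon>)) * exp (- (\<alpha> \<epsilon> * G))" by simp
    also have "\<dots> <= ((b - a) / \<epsilon> + 2) * exp (- (\<alpha> \<epsilon> * G))"
      by (intro mult_right_mono card_sites that ab) simp
    finally show ?thesis .
  qed
  obtain h where h: "\<forall>\<^sub>F \<epsilon> in at_right 0. prob (A \<epsilon>) <= h \<epsilon>" "(h \<longlongrightarrow> 0) (at_right 0)"
  proof (cases \<kappa>)
    case (real K)
    then have "ereal K <= profile_rate v s" using \<kappa>s by simp
    then obtain \<xi> \<gamma> where \<xi>: "\<xi> <= 0" "0 < \<gamma>" "K + \<gamma> <= - \<xi> * (s + \<rho>) - cumulant ?f \<xi>"
      using strict_rate_gain[OF t s \<rho>] by blast
    have K: "\<kappa> < ereal (K + \<gamma> / 2)" using real \<xi> by simp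
    have "\<forall>\<^sub>F \<epsilon> in at_right 0. prob (A \<epsilon>) <= (b - a + 2) * exp (- (\<alpha> \<epsilon> * (\<gamma> / 2)))"
      using eventually_inverse_le[OF K] eventually_pos
    proof eventually_elim
      case (elim \<epsilon>)
      have e: "0 < \<epsilon>" using elim by simp
      have "(b - a) / \<epsilon> + 2 <= (b - a + 2) * (1 / \<epsilon>)" using elim by (simp add: field_simps)
      also have "\<dots> <= (b - a + 2) * exp (\<alpha> \<epsilon> * (K + \<gamma> / 2))" using elim ab by (intro mult_left_mono) auto
      finally have "prob (A \<epsilon>) <= (b - a + 2) * exp (\<alpha> \<epsilon> * (K + \<gamma> / 2)) * exp (- (\<alpha> \<epsilon> * (K + \<gamma>)))"
        using AG[OF e \<xi>(1,3)] by (meson exp_ge_zero mult_right_mono order_trans)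
      also have "\<dots> = (b - a + 2) * exp (- (\<alpha> \<epsilon> * (\<gamma> / 2)))"
      proof -
        have "exp (\<alpha> \<epsilon> * (K + \<gamma> / 2)) * exp (- (\<alpha> \<epsilon> * (K + \<gamma>))) = exp (- (\<alpha> \<epsilon> * (\<gamma> / 2)))"
          unfolding exp_add[symmetric] by (rule arg_cong[where f=exp]) (simp add: distrib_left)
        then show ?thesis by (simp only: mult.assoc)
      qed
      finally show ?case .
    qed
    then show ?thesis using that exp_\<alpha>_tendsto_0[of "\<gamma> / 2" "b - a + 2"] \<xi>(2) by auto
  next
    case PInf
    have "\<forall>\<^sub>F \<epsilon> in at_right 0. prob (A \<epsilon>) <= 0"
      using eventually_pos
    proof eventually_elim
      case (elim \<epsilon>)
      have e: "0 < \<epsilon>" using elim by simp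
      have bd: "prob (A \<epsilon>) <= ((b - a) / \<epsilon> + 2) * exp (- (\<alpha> \<epsilon> * real n))" for n
      proof -
        have "ereal (real n) < profile_rate v s" using \<kappa>s PInf by (simp add: less_le_trans)
        then obtain \<xi> where "\<xi> <= 0" "real n < - \<xi> * s - cumulant ?f \<xi>"
          unfolding profile_rate_def less_SUP_iff by auto
        moreover have "- \<xi> * s <= - \<xi> * (s + \<rho>)" using \<open>\<xi> <= 0\<close> \<rho> by (intro mult_left_mono) auto
        ultimately show ?thesis using AG[OF e, of \<xi> "real n"] by auto
      qed
      have "filterlim (\<lambda>n. \<alpha> \<epsilon> * real n) at_top sequentially"
        using \<alpha>_pos[OF e] by (intro filterlim_tendsto_pos_mult_at_top[OF tendsto_const] filterlim_real_sequentially)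
      then have "(\<lambda>n. exp (- (\<alpha> \<epsilon> * real n))) \<longlonglongrightarrow> 0"
        by (intro filterlim_compose[OF exp_at_bot] filterlim_compose[OF filterlim_uminus_at_bot_at_top])
      from tendsto_mult[OF tendsto_const this, of "(b - a) / \<epsilon> + 2"]
      have "(\<lambda>n. ((b - a) / \<epsilon> + 2) * exp (- (\<alpha> \<epsilon> * real n))) \<longlonglongrightarrow> 0" by simp
      then show ?case by (rule LIMSEQ_le_const) (use bd in auto)
    qed
    then show ?thesis by (rule that) (rule tendsto_const)
  next
    case MInf
    then show ?thesis using \<kappa>_nonneg by simp
  qed
  show ?thesis
  proof (rule whpI[OF Am _ h])
    show "\<forall>\<^sub>F \<epsilon> in at_right 0. \<forall>\<omega>\<in>space P.
       \<not> (\<forall>k\<in>sites a b \<epsilon>. sb - \<zeta> - \<rho> < local_energy \<omega> \<epsilon> (\<epsilon> * real_of_int k) v g) --> \<omega> \<in> A \<epsilon>"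
      using eventually_pos
    proof eventually_elim
      case (elim \<epsilon>)
      show ?case
      proof (intro ballI impI)
        fix \<omega> assume \<omega>: "\<omega> \<in> space P" and "\<not> (\<forall>k\<in>sites a b \<epsilon>. sb - \<zeta> - \<rho> < local_energy \<omega> \<epsilon> (\<epsilon> * real_of_int k) v g)"
        then obtain k where k: "k \<in> sites a b \<epsilon>" "local_energy \<omega> \<epsilon> (\<epsilon> * real_of_int k) v g <= sb - \<zeta> - \<rho>" by force
        have e: "0 < \<epsilon>" using elim by simp
        have "fluct r (\<alpha> \<epsilon>) (\<epsilon> * real_of_int k / \<delta> \<epsilon>) ?f \<omega> <= - (s + \<rho>)"
          using k(2) unfolding local_energy_eq[OF t e] s_def by linarith
        then have "\<omega> \<in> E \<epsilon> k" using \<omega> by (simp only: E_def mem_Collect_eq)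
        then show "\<omega> \<in> A \<epsilon>" using k unfolding A_def by blast
      qed
    qed
  qed
qed

text \<open>For \<open>z = 0\<close> this is the law of large numbers at a single location, for a nearly optimal profile. For \<open>z > 0\<close> there is
a profile whose rate at a gain slightly below \<open>z\<close> is less than \<open>\<kappa>\<close>; it is tried at about \<open>1 / \<epsilon>\<close> locations that use
disjoint sets of cells, and the expected number of successes tends to infinity.\<close>

lemma upper_bound_realized:
  assumes cd: "c < d" and z: "0 <= z" "\<And>\<zeta>. 0 <= \<zeta> ==> \<zeta> < z ==> J \<zeta> < \<kappa>" and \<rho>: "0 < \<rho>"
  shows "\<exists>r v g. transition W r v g \<and>
     whp (\<lambda>\<epsilon> \<omega>. \<exists>x. c <= x - r * \<epsilon> \<and> x + r * \<epsilon> <= d \<and> local_energy \<omega> \<epsilon> x v g <= sb - z + \<rho>)"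
proof (cases "z = 0")
  case True
  obtain r v g where t: "transition W r v g" "kinetic g + \<mu> * mass v <= sb + \<rho> / 2"
    using near_optimal_transition[of "\<rho> / 2"] \<rho> by auto
  let ?f = "\<lambda>y. W (v y)"
  let ?Q = "\<lambda>\<epsilon> \<omega>. \<exists>x. c <= x - r * \<epsilon> \<and> x + r * \<epsilon> <= d \<and> local_energy \<omega> \<epsilon> x v g <= sb - z + \<rho>"
  have f: "bump_profile r ?f" by (rule transition_bump[OF t(1)])
  obtain C \<tau>0 where C: "C >= 0" "\<tau>0 > 0"
    "\<And>\<xi> \<tau>. \<bar>\<tau>\<bar> <= \<tau>0 ==> cumulant ?f (\<xi> + \<tau>) <= cumulant ?f \<xi> + \<tau> * cumulant_slope ?f \<xi> + C * \<tau>\<^sup>2"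
    using cumulant_quadratic[OF f] by blast
  define \<tau> where "\<tau> = min \<tau>0 (\<rho> / (4 * (C + 1)))"
  have \<tau>: "0 < \<tau>" "\<tau> <= \<tau>0" using C \<rho> by (auto simp: \<tau>_def)
  have "cumulant ?f \<tau> <= C * \<tau>\<^sup>2" using C(3)[of "\<tau>" 0] \<tau> by (simp add: cumulant_0 cumulant_slope_0)
  also have "C * \<tau>\<^sup>2 <= \<tau> * (\<rho> / 4)"
  proof -
    have "C * \<tau> <= (C + 1) * (\<rho> / (4 * (C + 1)))" using C \<tau> by (intro mult_mono) (auto simp: \<tau>_def)
    also have "\<dots> = \<rho> / 4" using C by (simp add: field_simps)
    finally have "\<tau> * (C * \<tau>) <= \<tau> * (\<rho> / 4)" using \<tau> by (intro mult_left_mono) auto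
    then show ?thesis by (simp add: power2_eq_square mult_ac)
  qed
  finally have A2: "cumulant ?f \<tau> <= \<tau> * (\<rho> / 4)" .
  define A where "A \<epsilon> = {\<omega> \<in> space P. \<tau> * (\<rho> / 2) <= \<tau> * fluct r (\<alpha> \<epsilon>) ((c + d) / 2 / \<delta> \<epsilon>) ?f \<omega>}" for \<epsilon>
  have r: "1 <= r" using t(1) by (simp add: transition_def)
  have "whp ?Q"
  proof (rule whpI[where A=A and g="\<lambda>\<epsilon>. 1 * exp (- (\<alpha> \<epsilon> * (\<tau> * (\<rho> / 4))))"])
    show "A \<epsilon> \<in> events" for \<epsilon> unfolding A_def by measurable
    have small: "\<forall>\<^sub>F \<epsilon> in at_right 0. 0 < \<epsilon> \<and> \<epsilon> < (d - c) / (2 * r)"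
      unfolding eventually_at_right_field using cd r by (intro exI[of _ "(d - c) / (2 * r)"]) auto
    show "\<forall>\<^sub>F \<epsilon> in at_right 0. \<forall>\<omega>\<in>space P. \<not> ?Q \<epsilon> \<omega> --> \<omega> \<in> A \<epsilon>"
      using small
    proof eventually_elim
      case (elim \<epsilon>)
      have "r * \<epsilon> < (d - c) / 2" using elim r by (simp add: field_simps)
      then have in_I: "c <= (c + d) / 2 - r * \<epsilon>" "(c + d) / 2 + r * \<epsilon> <= d" by (simp_all add: field_simps)
      show ?case
      proof (intro ballI impI)
        fix \<omega> assume \<omega>: "\<omega> \<in> space P" and n: "\<not> ?Q \<epsilon> \<omega>"
        then have "sb - z + \<rho> < local_energy \<omega> \<epsilon> ((c + d) / 2) v g" using in_I by (meson not_le)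
        then have "\<rho> / 2 < fluct r (\<alpha> \<epsilon>) ((c + d) / 2 / \<delta> \<epsilon>) ?f \<omega>"
          using local_energy_eq[OF t(1), of \<epsilon>] elim t(2) True by (simp add: excess_def)
        then show "\<omega> \<in> A \<epsilon>" using \<omega> \<tau> unfolding A_def by simp
      qed
    qed
    show "\<forall>\<^sub>F \<epsilon> in at_right 0. prob (A \<epsilon>) <= 1 * exp (- (\<alpha> \<epsilon> * (\<tau> * (\<rho> / 4))))"
      using eventually_pos
    proof eventually_elim
      case (elim \<epsilon>)
      then have a: "0 < \<alpha> \<epsilon>" using \<alpha>_pos by simp
      have "prob (A \<epsilon>) <= exp (\<alpha> \<epsilon> * (cumulant ?f \<tau> - \<tau> * (\<rho> / 2)))"
        unfolding A_def by (rule chernoff[OF a f])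
      also have "\<dots> <= 1 * exp (- (\<alpha> \<epsilon> * (\<tau> * (\<rho> / 4))))"
      proof -
        have "cumulant ?f \<tau> - \<tau> * (\<rho> / 2) <= - (\<tau> * (\<rho> / 4))" using A2 by simp
        from mult_left_mono[OF this, of "\<alpha> \<epsilon>"] a show ?thesis by simp
      qed
      finally show ?case .
    qed
    show "((\<lambda>\<epsilon>. 1 * exp (- (\<alpha> \<epsilon> * (\<tau> * (\<rho> / 4))))) \<longlongrightarrow> 0) (at_right 0)"
      by (rule exp_\<alpha>_tendsto_0) (use \<tau> \<rho> in auto)
  qed
  then show ?thesis using t(1) by blast
next
  case False
  (* positive, so that the gain s below is positive even for an optimal profile *)
  define \<zeta> where "\<zeta> = z - min (z / 2) (\<rho> / 2)"
  have \<zeta>: "0 < \<zeta>" "\<zeta> < z" "z - \<zeta> <= \<rho> / 2" using False z(1) \<rho> by (auto simp: \<zeta>_def min_def)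
  obtain r v g where t: "transition W r v g" and R: "profile_rate v (\<zeta> + excess v g) < \<kappa>"
    using rate_less[OF z(2)[of \<zeta>]] \<zeta> by (metis less_imp_le)
  let ?f = "\<lambda>y. W (v y)"
  let ?Q = "\<lambda>\<epsilon> \<omega>. \<exists>x. c <= x - r * \<epsilon> \<and> x + r * \<epsilon> <= d \<and> local_energy \<omega> \<epsilon> x v g <= sb - z + \<rho>"
  have f: "bump_profile r ?f" by (rule transition_bump[OF t])
  have r: "1 <= r" using t by (simp add: transition_def)
  define s where "s = \<zeta> + excess v g"
  have s: "0 < s" using excess_nonneg[OF t] \<zeta> by (simp add: s_def)
  obtain K where K: "profile_rate v s < ereal K" "ereal K < \<kappa>" using R ereal_dense2 unfolding s_def by blast
  (* probability of success at least exp (- \<alpha> K), number of trials at least of order exp (\<alpha> K') *)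
  obtain K' where K': "ereal K < ereal K'" "ereal K' < \<kappa>" using K(2) ereal_dense2 by blast
  define J0 where "J0 = real_of_ereal (profile_rate v s)"
  have J0: "profile_rate v s = ereal J0"
    using K(1) profile_rate_nonneg[of v s] unfolding J0_def by (cases "profile_rate v s") auto
  have J0K: "0 <= J0" "J0 < K" "K < K'" using K(1) K'(1) profile_rate_nonneg[of v s] J0 by auto
  have J: "- \<xi> * s - cumulant ?f \<xi> <= J0" if "\<xi> <= 0" for \<xi>
  proof -
    have "ereal (- \<xi> * s - cumulant ?f \<xi>) <= profile_rate v s"
      unfolding profile_rate_def using that by (intro SUP_upper) auto
    then show ?thesis by (simp add: J0)
  qed
  obtain \<alpha>1 where \<alpha>1: "\<alpha>1 > 0" "\<And>\<alpha> \<beta>. \<alpha> >= \<alpha>1 ==> exp (- \<alpha> * K) <= prob {\<omega> \<in> space P. fluct r \<alpha> \<beta> ?f \<omega> <= - s + \<rho> / 2}"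
    using cramer_lower_bound[OF f s _ J0K(2) J, of "\<rho> / 2"] \<rho> by auto
  (* the spacing (2 r + 3) \<epsilon> leaves a gap of three units between rescaled profiles, so that they share no cell *)
  define N where "N \<epsilon> = nat \<lfloor>(d - c) / ((2 * r + 3) * \<epsilon>)\<rfloor>" for \<epsilon> :: real
  define x where "x \<epsilon> i = c + (2 * r + 3) * \<epsilon> * real i + r * \<epsilon>" for \<epsilon> :: real and i :: nat
  define A where "A \<epsilon> = {\<omega> \<in> space P. \<forall>i\<in>{..<N \<epsilon>}. - s + \<rho> / 2 < fluct r (\<alpha> \<epsilon>) (x \<epsilon> i / \<delta> \<epsilon>) ?f \<omega>}" for \<epsilon>
  define c' where "c' = (d - c) / (2 * r + 3)"
  have c': "0 < c'" using cd r by (simp add: c'_def)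
  have "whp ?Q"
  proof (rule whpI[where A=A and g="\<lambda>\<epsilon>. exp (1 - c' * exp (\<alpha> \<epsilon> * (K' - K)))"])
    show "A \<epsilon> \<in> events" for \<epsilon> unfolding A_def by measurable
    show "\<forall>\<^sub>F \<epsilon> in at_right 0. \<forall>\<omega>\<in>space P. \<not> ?Q \<epsilon> \<omega> --> \<omega> \<in> A \<epsilon>"
      using eventually_pos
    proof eventually_elim
      case (elim \<epsilon>)
      show ?case
      proof (intro ballI impI)
        fix \<omega> assume \<omega>: "\<omega> \<in> space P" and n: "\<not> ?Q \<epsilon> \<omega>"
        have "- s + \<rho> / 2 < fluct r (\<alpha> \<epsilon>) (x \<epsilon> i / \<delta> \<epsilon>) ?f \<omega>" if i: "i < N \<epsilon>" for i
        proof -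
          have l: "c <= x \<epsilon> i - r * \<epsilon>" using elim r by (simp add: x_def)
          have pos: "0 < (2 * r + 3) * \<epsilon>" using elim r by simp
          have "real i + 1 <= real (N \<epsilon>)" using i by simp
          also have "real (N \<epsilon>) <= (d - c) / ((2 * r + 3) * \<epsilon>)"
            using cd pos unfolding N_def by (simp add: of_nat_nat)
          finally have "(real i + 1) * ((2 * r + 3) * \<epsilon>) <= d - c" using pos by (simp add: pos_le_divide_eq)
          then have u: "x \<epsilon> i + r * \<epsilon> <= d" using elim by (simp add: x_def algebra_simps)
          have "sb - z + \<rho> < local_energy \<omega> \<epsilon> (x \<epsilon> i) v g" using n l u by (meson not_le)
          then show ?thesis using local_energy_eq[OF t, of \<epsilon>] elim \<zeta>(3) by (simp add: s_def)
        qed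
        then show "\<omega> \<in> A \<epsilon>" using \<omega> unfolding A_def by simp
      qed
    qed
    have "\<forall>\<^sub>F \<epsilon> in at_right 0. max \<alpha>1 1 <= \<alpha> \<epsilon>"
      using \<alpha>_at_top unfolding filterlim_at_top by blast
    then show "\<forall>\<^sub>F \<epsilon> in at_right 0. prob (A \<epsilon>) <= exp (1 - c' * exp (\<alpha> \<epsilon> * (K' - K)))"
      using eventually_pos eventually_le_inverse[OF K'(2)]
    proof eventually_elim
      case (elim \<epsilon>)
      have a: "\<alpha>1 <= \<alpha> \<epsilon>" "1 <= \<alpha> \<epsilon>" using elim by auto
      have \<delta>: "0 < \<delta> \<epsilon>" using \<delta>_pos elim by simp
      define p where "p = exp (- \<alpha> \<epsilon> * K)"
      have "0 <= \<alpha> \<epsilon> * K" using a(2) J0K by (intro mult_nonneg_nonneg) linarith+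
      then have p: "0 < p" "p <= 1" by (simp_all add: p_def)
      have Nlow: "c' / \<epsilon> - 1 <= real (N \<epsilon>)"
      proof -
        have "c' / \<epsilon> = (d - c) / ((2 * r + 3) * \<epsilon>)" by (simp add: c'_def)
        then show ?thesis unfolding N_def by linarith
      qed
      have "prob (A \<epsilon>) <= (1 - p) ^ N \<epsilon>"
      proof (cases "N \<epsilon> = 0")
        case False
        have dis: "disjoint_family_on (\<lambda>i. cells (\<alpha> \<epsilon>) (x \<epsilon> i / \<delta> \<epsilon>) r) {..<N \<epsilon>}"
          unfolding disjoint_family_on_def
        proof (intro ballI impI)
          fix i j :: nat assume ij: "i \<noteq> j"
          have "cells (\<alpha> \<epsilon>) (x \<epsilon> i / \<delta> \<epsilon>) r \<inter> cells (\<alpha> \<epsilon>) (x \<epsilon> j / \<delta> \<epsilon>) r = {}" if ij: "i < j" for i j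
          proof (rule ccontr)
            assume "cells (\<alpha> \<epsilon>) (x \<epsilon> i / \<delta> \<epsilon>) r \<inter> cells (\<alpha> \<epsilon>) (x \<epsilon> j / \<delta> \<epsilon>) r \<noteq> {}"
            then obtain z where z: "\<bar>real_of_int z - x \<epsilon> i / \<delta> \<epsilon>\<bar> <= \<alpha> \<epsilon> * r + 1/2" "\<bar>real_of_int z - x \<epsilon> j / \<delta> \<epsilon>\<bar> <= \<alpha> \<epsilon> * r + 1/2"
              by (auto simp: mem_cells)
            have "x \<epsilon> j / \<delta> \<epsilon> - x \<epsilon> i / \<delta> \<epsilon> = (2 * r + 3) * \<alpha> \<epsilon> * (real j - real i)"
            proof -
              have "x \<epsilon> j - x \<epsilon> i = (2 * r + 3) * \<epsilon> * (real j - real i)" by (simp add: x_def algebra_simps)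
              then show ?thesis by (simp add: diff_divide_distrib[symmetric])
            qed
            moreover have "(2 * r + 3) * \<alpha> \<epsilon> * 1 <= (2 * r + 3) * \<alpha> \<epsilon> * (real j - real i)"
              using r a(2) ij by (intro mult_left_mono mult_nonneg_nonneg[of "2 * r + 3" "\<alpha> \<epsilon>"]) linarith+
            moreover have "(2 * r + 3) * \<alpha> \<epsilon> = 2 * (\<alpha> \<epsilon> * r) + 3 * \<alpha> \<epsilon>" by (simp add: algebra_simps)
            ultimately show False using z a(2) by linarith
          qed
          from this[of i j] this[of j i] ij
          show "cells (\<alpha> \<epsilon>) (x \<epsilon> i / \<delta> \<epsilon>) r \<inter> cells (\<alpha> \<epsilon>) (x \<epsilon> j / \<delta> \<epsilon>) r = {}" by (metis Int_commute linorder_neqE_nat)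
        qed
        have "prob (A \<epsilon>) = (\<Prod>i\<in>{..<N \<epsilon>}. prob {\<omega> \<in> space P. - s + \<rho> / 2 < fluct r (\<alpha> \<epsilon>) (x \<epsilon> i / \<delta> \<epsilon>) ?f \<omega>})"
          unfolding A_def by (rule fluct_indep[OF _ _ dis]) (use False in auto)
        also have "\<dots> <= (\<Prod>i\<in>{..<N \<epsilon>}. 1 - p)"
        proof (intro prod_mono conjI)
          fix i
          have m: "{\<omega> \<in> space P. fluct r (\<alpha> \<epsilon>) (x \<epsilon> i / \<delta> \<epsilon>) ?f \<omega> <= - s + \<rho> / 2} \<in> events" by measurable
          have "{\<omega> \<in> space P. - s + \<rho> / 2 < fluct r (\<alpha> \<epsilon>) (x \<epsilon> i / \<delta> \<epsilon>) ?f \<omega>} = space P - {\<omega> \<in> space P. fluct r (\<alpha> \<epsilon>) (x \<epsilon> i / \<delta> \<epsilon>) ?f \<omega> <= - s + \<rho> / 2}" by auto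
          then have "prob {\<omega> \<in> space P. - s + \<rho> / 2 < fluct r (\<alpha> \<epsilon>) (x \<epsilon> i / \<delta> \<epsilon>) ?f \<omega>} = 1 - prob {\<omega> \<in> space P. fluct r (\<alpha> \<epsilon>) (x \<epsilon> i / \<delta> \<epsilon>) ?f \<omega> <= - s + \<rho> / 2}"
            using prob_compl[OF m] by simp
          then show "prob {\<omega> \<in> space P. - s + \<rho> / 2 < fluct r (\<alpha> \<epsilon>) (x \<epsilon> i / \<delta> \<epsilon>) ?f \<omega>} <= 1 - p"
            using \<alpha>1(2)[OF a(1), of "x \<epsilon> i / \<delta> \<epsilon>"] unfolding p_def by linarith
        qed simp
        finally show ?thesis by simp
      qed simp
      also have "\<dots> <= exp (- p) ^ N \<epsilon>"
        using exp_ge_add_one_self[of "- p"] p by (intro power_mono) auto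
      also have "\<dots> = exp (- (real (N \<epsilon>) * p))" by (simp add: exp_of_nat_mult[symmetric])
      also have "\<dots> <= exp (1 - c' * exp (\<alpha> \<epsilon> * (K' - K)))"
      proof -
        have "c' * exp (\<alpha> \<epsilon> * K') - 1 <= c' * (1 / \<epsilon>) - 1" using elim c' by (intro diff_right_mono mult_left_mono) auto
        then have "c' * exp (\<alpha> \<epsilon> * K') - 1 <= real (N \<epsilon>)" using Nlow by simp
        then have le: "(c' * exp (\<alpha> \<epsilon> * K') - 1) * p <= real (N \<epsilon>) * p" using p by (intro mult_right_mono) auto
        have "exp (\<alpha> \<epsilon> * K') * p = exp (\<alpha> \<epsilon> * (K' - K))"
          unfolding p_def exp_add[symmetric] by (rule arg_cong[where f=exp]) (simp add: right_diff_distrib)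
        then have "(c' * exp (\<alpha> \<epsilon> * K') - 1) * p = c' * exp (\<alpha> \<epsilon> * (K' - K)) - p"
          by (simp only: left_diff_distrib mult.assoc mult_1)
        then have "- (real (N \<epsilon>) * p) <= 1 - c' * exp (\<alpha> \<epsilon> * (K' - K))" using le p by linarith
        then show ?thesis by (simp only: exp_le_cancel_iff)
      qed
      finally show ?case .
    qed
    show "((\<lambda>\<epsilon>. exp (1 - c' * exp (\<alpha> \<epsilon> * (K' - K)))) \<longlongrightarrow> 0) (at_right 0)"
    proof (rule filterlim_compose[OF exp_at_bot])
      have "filterlim (\<lambda>\<epsilon>. \<alpha> \<epsilon> * (K' - K)) at_top (at_right 0)"
        by (rule filterlim_at_top_mult_tendsto_pos[OF tendsto_const _ \<alpha>_at_top]) (use J0K in auto)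
      then have "filterlim (\<lambda>\<epsilon>. exp (\<alpha> \<epsilon> * (K' - K))) at_top (at_right 0)" by (rule filterlim_compose[OF exp_at_top])
      then have "filterlim (\<lambda>\<epsilon>. c' * exp (\<alpha> \<epsilon> * (K' - K))) at_top (at_right 0)"
        by (rule filterlim_tendsto_pos_mult_at_top[OF tendsto_const c'])
      then have "filterlim (\<lambda>\<epsilon>. -1 + c' * exp (\<alpha> \<epsilon> * (K' - K))) at_top (at_right 0)"
        by (rule filterlim_tendsto_add_at_top[OF tendsto_const])
      then show "filterlim (\<lambda>\<epsilon>. 1 - c' * exp (\<alpha> \<epsilon> * (K' - K))) at_bot (at_right 0)"
        by (simp add: filterlim_uminus_at_top)
    qed
  qed
  then show ?thesis using t by blast
qed

end

section \<open>Energies of all profiles\<close>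

lemma integrable_indicator_Icc: "integrable lebesgue (indicator {x..y::real} :: real => real)"
proof (rule integrable_real_indicator)
  show "emeasure lebesgue {x..y} < \<infinity>" by (cases "x <= y") auto
qed auto

context double_well begin

lemma W_uniformly_continuous:
  assumes "0 < \<rho>"
  obtains d where "0 < d" "\<And>s t. s \<in> {-1..1} ==> t \<in> {-1..1} ==> \<bar>s - t\<bar> < d ==> \<bar>W s - W t\<bar> < \<rho>"
proof -
  have "uniformly_continuous_on {-1..1} W"
    by (intro compact_uniformly_continuous continuous_on_subset[OF W_cont]) auto
  then obtain d where "0 < d" "\<And>x y. x \<in> {-1..1} ==> y \<in> {-1..1} ==> dist y x < d ==> dist (W y) (W x) < \<rho>"
    unfolding uniformly_continuous_on_def using assms by metis
  then show ?thesis using that[of d] by (simp add: dist_real_def)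
qed

text \<open>Young's inequality with a weight \<open>l\<close>, integrated: transitions of bounded energy are equicontinuous.\<close>

lemma transition_modulus:
  assumes t: "transition W r v g" and le: "x <= y" and l: "0 < l"
  shows "\<bar>v y - v x\<bar> <= l * kinetic g + (y - x) / (2 * l)"
proof -
  have v: "AC UNIV v g" and g2: "integrable lebesgue (\<lambda>x. (g x)\<^sup>2)" using t by (auto simp: transition_def)
  have gi: "g absolutely_integrable_on {x..y}" and gv: "integral {x..y} g = v y - v x" using ACD[OF v] le by auto
  have gi': "integrable lebesgue (\<lambda>z. indicator {x..y} z * g z)" using gi unfolding set_integrable_def by simp
  have i1: "integrable lebesgue (\<lambda>z. l * (1 / 2 * (g z)\<^sup>2))" using g2 by simp
  have ind: "integrable lebesgue (\<lambda>z. indicator {x..y} z :: real)" by (rule integrable_indicator_Icc)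
  have "v y - v x = (LINT z|lebesgue. indicator {x..y} z * g z)"
    using set_lebesgue_integral_eq_integral(2)[OF gi] gv by (simp add: set_lebesgue_integral_def)
  also have "\<bar>\<dots>\<bar> <= (LINT z|lebesgue. l * (1 / 2 * (g z)\<^sup>2) + 1 / (2 * l) * indicator {x..y} z)"
    unfolding real_norm_def[symmetric]
  proof (rule Bochner_Integration.integral_norm_bound_integral[OF gi'])
    show "integrable lebesgue (\<lambda>z. l * (1 / 2 * (g z)\<^sup>2) + 1 / (2 * l) * indicator {x..y} z)"
      by (intro Bochner_Integration.integrable_add i1 integrable_mult_right ind)
    fix z
    have "0 <= (l * \<bar>g z\<bar> - 1)\<^sup>2" by simp
    then have "2 * (l * \<bar>g z\<bar>) <= l\<^sup>2 * (g z)\<^sup>2 + 1" by (simp add: power2_diff power_mult_distrib)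
    then have "\<bar>g z\<bar> <= (l\<^sup>2 * (g z)\<^sup>2 + 1) / (2 * l)" using l by (simp add: pos_le_divide_eq mult_ac)
    also have "\<dots> = l * (1 / 2 * (g z)\<^sup>2) + 1 / (2 * l)" using l by (simp add: field_simps power2_eq_square)
    finally show "norm (indicator {x..y} z * g z) <= l * (1 / 2 * (g z)\<^sup>2) + 1 / (2 * l) * indicator {x..y} z"
      using l by (cases "z \<in> {x..y}") auto
  qed
  also have "\<dots> = l * kinetic g + (y - x) / (2 * l)"
  proof -
    have "(LINT z|lebesgue. indicator {x..y} z) = y - x" using le by simp
    then show ?thesis unfolding kinetic_def
      by (subst Bochner_Integration.integral_add[OF i1 integrable_mult_right[OF ind]]) (simp only: integral_mult_right_zero, simp)
  qed
  finally show ?thesis .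
qed

definition "bounded_transitions r E = {(v, g). transition W r v g \<and> kinetic g <= E}"

text \<open>Compactness by pigeonholing: profiles are classified by their rounded kinetic energy and their rounded values on a
fine grid, and one representative is kept for each class. Equicontinuity controls them between grid points.\<close>

lemma finite_transition_net:
  assumes \<rho>: "0 < \<rho>" and E: "0 <= E"
  obtains \<N> where "finite \<N>" "\<N> \<subseteq> bounded_transitions r E"
    "\<And>v g. (v, g) \<in> bounded_transitions r E ==>
       \<exists>(v', g')\<in>\<N>. \<bar>kinetic g - kinetic g'\<bar> <= \<rho> \<and> (\<forall>y. \<bar>W (v y) - W (v' y)\<bar> <= \<rho>)"
proof -
  obtain d where d: "0 < d" "\<And>s t. s \<in> {-1..1} ==> t \<in> {-1..1} ==> \<bar>s - t\<bar> < d ==> \<bar>W s - W t\<bar> < \<rho>"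
    using W_uniformly_continuous[OF \<rho>] by blast
  define l where "l = d / (10 * (E + 1))"
  (* with weight l, both terms of transition_modulus are at most d / 10 on grid cells *)
  define \<tau> where "\<tau> = l * d / 5"
  define q where "q = d / 5"
  have l: "0 < l" and \<tau>: "0 < \<tau>" and q: "0 < q" using d E by (auto simp: l_def \<tau>_def q_def)
  have close: "\<bar>v y - v x\<bar> <= d / 5" if "(v, g) \<in> bounded_transitions r E" "x <= y" "y - x <= \<tau>" for v g x y
  proof -
    have t: "transition W r v g" "kinetic g <= E" using that by (auto simp: bounded_transitions_def)
    have "\<bar>v y - v x\<bar> <= l * kinetic g + (y - x) / (2 * l)" by (rule transition_modulus[OF t(1) that(2) l])
    also have "\<dots> <= l * (E + 1) + \<tau> / (2 * l)"
      using t(2) that l by (intro add_mono mult_left_mono divide_right_mono) auto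
    also have "l * (E + 1) = d / 10"
    proof -
      have "E + 1 \<noteq> 0" using E by linarith
      then show ?thesis unfolding l_def by (metis (no_types) divide_divide_eq_left mult.commute nonzero_eq_divide_eq times_divide_eq_left)
    qed
    also have "\<tau> / (2 * l) = d / 10" using l by (simp add: \<tau>_def)
    finally show ?thesis by simp
  qed
  define m where "m = \<lceil>r / \<tau>\<rceil> + 1"
  define L where "L = \<lceil>1 / q\<rceil> + 1"
  (* the classes, with finitely many labels because kinetic energies and values are bounded *)
  define cls where "cls = (\<lambda>(v :: real => real, g). (\<lfloor>kinetic g / \<rho>\<rfloor>, \<lambda>i\<in>{-m..m}. \<lfloor>v (real_of_int i * \<tau>) / q\<rfloor>))"
  have "cls ` bounded_transitions r E \<subseteq> {0..\<lfloor>E / \<rho>\<rfloor>} \<times> PiE {-m..m} (\<lambda>_. {-L..L})"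
  proof
    fix c assume "c \<in> cls ` bounded_transitions r E"
    then obtain v g where vg: "transition W r v g" "kinetic g <= E" "c = cls (v, g)" by (auto simp: bounded_transitions_def)
    have "0 <= \<lfloor>kinetic g / \<rho>\<rfloor>" "\<lfloor>kinetic g / \<rho>\<rfloor> <= \<lfloor>E / \<rho>\<rfloor>"
      using vg(2) kinetic_nonneg[of g] \<rho> by (auto intro!: floor_mono divide_right_mono)
    moreover have "\<lfloor>v x / q\<rfloor> \<in> {-L..L}" for x
    proof -
      have "v x \<in> {-1..1}" using vg(1) by (auto simp: transition_def)
      then have "- (1 / q) <= v x / q" "v x / q <= 1 / q" using q by (auto simp: field_simps)
      then show ?thesis unfolding L_def atLeastAtMost_iff by linarith
    qed
    ultimately show "c \<in> {0..\<lfloor>E / \<rho>\<rfloor>} \<times> PiE {-m..m} (\<lambda>_. {-L..L})" unfolding vg(3) cls_def by auto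
  qed
  then have fin: "finite (cls ` bounded_transitions r E)"
    by (rule finite_subset) (intro finite_cartesian_product finite_PiE finite_atLeastAtMost_int)
  define rep where "rep = inv_into (bounded_transitions r E) cls"
  define \<N> where "\<N> = rep ` cls ` bounded_transitions r E"
  show ?thesis
  proof (rule that[of \<N>])
    show "finite \<N>" unfolding \<N>_def using fin by (rule finite_imageI)
    show "\<N> \<subseteq> bounded_transitions r E" unfolding \<N>_def rep_def using inv_into_into[of _ cls "bounded_transitions r E"] by blast
    fix v g assume vg: "(v, g) \<in> bounded_transitions r E"
    obtain v' g' where vg': "rep (cls (v, g)) = (v', g')" by force
    have inN: "(v', g') \<in> \<N>" unfolding \<N>_def vg'[symmetric] using vg by blast
    have vgb': "(v', g') \<in> bounded_transitions r E" unfolding vg'[symmetric] rep_def using vg by (auto intro!: inv_into_into)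
    have eq: "cls (v', g') = cls (v, g)" unfolding vg'[symmetric] rep_def using vg by (auto intro!: f_inv_into_f)
    have near: "\<bar>x - y\<bar> <= c" if "\<lfloor>x / c\<rfloor> = \<lfloor>y / c\<rfloor>" "0 < c" for x y c :: real
    proof -
      have "\<bar>x / c - y / c\<bar> <= 1" using that(1) by linarith
      then have "\<bar>x - y\<bar> / c <= 1" using that(2) by (simp add: diff_divide_distrib[symmetric])
      then show ?thesis using that(2) by (simp add: pos_divide_le_eq)
    qed
    have "\<lfloor>kinetic g / \<rho>\<rfloor> = \<lfloor>kinetic g' / \<rho>\<rfloor>" using eq by (simp add: cls_def)
    then have k: "\<bar>kinetic g - kinetic g'\<bar> <= \<rho>" using \<rho> by (rule near)
    have grid: "\<bar>v (real_of_int i * \<tau>) - v' (real_of_int i * \<tau>)\<bar> <= q" if "i \<in> {-m..m}" for i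
    proof (rule near[OF _ q])
      have "(\<lambda>i\<in>{-m..m}. \<lfloor>v' (real_of_int i * \<tau>) / q\<rfloor>) i = (\<lambda>i\<in>{-m..m}. \<lfloor>v (real_of_int i * \<tau>) / q\<rfloor>) i"
        using eq unfolding cls_def by simp
      then show "\<lfloor>v (real_of_int i * \<tau>) / q\<rfloor> = \<lfloor>v' (real_of_int i * \<tau>) / q\<rfloor>" using that by simp
    qed
    have ran: "v y \<in> {-1..1}" "v' y \<in> {-1..1}" for y using vg vgb' by (auto simp: bounded_transitions_def transition_def)
    have "\<bar>W (v y) - W (v' y)\<bar> <= \<rho>" for y
    proof (cases "r <= \<bar>y\<bar>")
      case True
      then have "v y = v' y" using vg vgb' by (auto simp: bounded_transitions_def transition_def)
      then show ?thesis using \<rho> by simp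
    next
      case False
      define i where "i = \<lfloor>y / \<tau>\<rfloor>"
      have i1: "real_of_int i <= y / \<tau>" "y / \<tau> < real_of_int i + 1" unfolding i_def by linarith+
      have "\<bar>y / \<tau>\<bar> <= r / \<tau>" using False \<tau> by (simp add: divide_right_mono)
      then have im: "i \<in> {-m..m}" using i1 unfolding m_def atLeastAtMost_iff by linarith
      have i2: "real_of_int i * \<tau> <= y" "y - real_of_int i * \<tau> <= \<tau>" using i1 \<tau> by (simp_all add: field_simps)
      have "\<bar>v y - v' y\<bar> <= d / 5 + q + d / 5"
        using close[OF vg i2] close[OF vgb' i2] grid[OF im] by linarith
      also have "\<dots> < d" using d by (simp add: q_def)
      finally show ?thesis using d(2)[OF ran] by (simp add: less_imp_le)
    qed
    then show "\<exists>(v', g')\<in>\<N>. \<bar>kinetic g - kinetic g'\<bar> <= \<rho> \<and> (\<forall>y. \<bar>W (v y) - W (v' y)\<bar> <= \<rho>)"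
      using k inN by blast
  qed
qed

end

lemma potential_close:
  assumes f: "bump_profile r f" "bump_profile r f'" and t: "\<And>z. th <= t z \<and> t z <= tu" "0 < th"
    and c: "\<And>y. \<bar>f y - f' y\<bar> <= \<rho>"
  shows "\<bar>potential t \<alpha> \<beta> f - potential t \<alpha> \<beta> f'\<bar> <= 2 * r * tu * \<rho>"
proof -
  have tu: "0 <= tu" and r: "0 < r" using t(1)[of 0] t(2) f by (auto simp: bump_profile_def)
  have \<rho>: "0 <= \<rho>" using c[of 0] by linarith
  note cb = checkerboard_bounds(1,2)[OF t]
  have cm: "(\<lambda>y. checkerboard t (\<alpha> * y + \<beta>)) \<in> borel_measurable borel"
    by (rule measurable_compose[OF _ checkerboard_measurable]) simp
  have i: "integrable lebesgue (\<lambda>y. checkerboard t (\<alpha> * y + \<beta>) * f y)" if f: "bump_profile r f" for f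
  proof -
    obtain C where C: "\<And>y. \<bar>f y\<bar> <= C" using bump_profile_bounded[OF f] by metis
    show ?thesis
    proof (rule integrable_supported[where C="tu * C" and r=r])
      have "f \<in> borel_measurable borel" using f by (auto simp: bump_profile_def intro: borel_measurable_continuous_onI)
      then show "(\<lambda>y. checkerboard t (\<alpha> * y + \<beta>) * f y) \<in> borel_measurable borel" using cm by measurable
      show "\<bar>checkerboard t (\<alpha> * y + \<beta>) * f y\<bar> <= tu * C" for y
        unfolding abs_mult using cb tu C by (intro mult_mono) auto
      show "y \<in> {-r..r}" if "checkerboard t (\<alpha> * y + \<beta>) * f y \<noteq> 0" for y
        using that f by (auto simp: bump_profile_def)
    qed
  qed
  have ind: "integrable lebesgue (\<lambda>z. indicator {-r..r} z :: real)" by (rule integrable_indicator_Icc)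
  have "\<bar>potential t \<alpha> \<beta> f - potential t \<alpha> \<beta> f'\<bar> = norm (LINT y|lebesgue. checkerboard t (\<alpha> * y + \<beta>) * f y - checkerboard t (\<alpha> * y + \<beta>) * f' y)"
    unfolding potential_def using i[OF f(1)] i[OF f(2)] by simp
  also have "\<dots> <= (LINT y|lebesgue. tu * \<rho> * indicator {-r..r} y)"
  proof (rule Bochner_Integration.integral_norm_bound_integral)
    fix y
    have "\<bar>checkerboard t (\<alpha> * y + \<beta>) * (f y - f' y)\<bar> <= tu * \<rho>"
      unfolding abs_mult using cb tu c by (intro mult_mono) auto
    moreover have "f y - f' y = 0" if "y \<notin> {-r..r}"
    proof -
      have "f y = 0" "f' y = 0" using f that unfolding bump_profile_def by blast+
      then show ?thesis by simp
    qed
    ultimately show "norm (checkerboard t (\<alpha> * y + \<beta>) * f y - checkerboard t (\<alpha> * y + \<beta>) * f' y) <= tu * \<rho> * indicator {-r..r} y"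
      unfolding right_diff_distrib[symmetric] by (cases "y \<in> {-r..r}") auto
  qed (use i f ind in auto)
  also have "\<dots> = tu * \<rho> * (2 * r)" using r by simp
  finally show ?thesis by (simp add: mult_ac)
qed

context scaled_transition begin

lemma nice_environment: "AE \<omega> in P. \<forall>z. tl <= \<Theta> z \<omega> \<and> \<Theta> z \<omega> <= tu"
  unfolding AE_all_countable using bounds by blast

text \<open>Every profile is compared with a member of the net, in which the bound holds with high probability; the potential
energies differ little since the medium is bounded.\<close>

lemma lower_bound_uniform:
  assumes ab: "a <= b" and z: "0 <= z" "\<And>\<zeta>. z < \<zeta> ==> \<kappa> <= J \<zeta>" and \<rho>: "0 < \<rho>" and E: "0 <= E" and r: "1 <= r"
  shows "whp (\<lambda>\<epsilon> \<omega>. \<forall>v g. transition W r v g --> kinetic g <= E -->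
     (\<forall>k\<in>sites a b \<epsilon>. sb - z - \<rho> < local_energy \<omega> \<epsilon> (\<epsilon> * real_of_int k) v g))"
proof -
  have tu: "0 <= tu" using \<mu>_bounds tl_pos by linarith
  define \<rho>' where "\<rho>' = \<rho> / (2 * (1 + 2 * r * tu))"
  have pos: "0 < 1 + 2 * r * tu" using r tu by (intro add_pos_nonneg) auto
  define q where "q = 1 + 2 * r * tu"
  have "0 < \<rho>'" "q * \<rho>' = \<rho> / 2" using \<rho> pos unfolding \<rho>'_def q_def[symmetric] by auto
  then have \<rho>': "0 < \<rho>'" "(1 + 2 * r * tu) * \<rho>' = \<rho> / 2" by (simp_all add: q_def)
  obtain \<N> where \<N>: "finite \<N>" "\<N> \<subseteq> bounded_transitions r E"
    "\<And>v g. (v, g) \<in> bounded_transitions r E ==>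
       \<exists>(v', g')\<in>\<N>. \<bar>kinetic g - kinetic g'\<bar> <= \<rho>' \<and> (\<forall>y. \<bar>W (v y) - W (v' y)\<bar> <= \<rho>')"
    using finite_transition_net[OF \<rho>'(1) E, of r] by blast
  have "whp (\<lambda>\<epsilon> \<omega>. \<forall>i\<in>\<N>. \<forall>k\<in>sites a b \<epsilon>. sb - (z + \<rho> / 4) - \<rho> / 4 < local_energy \<omega> \<epsilon> (\<epsilon> * real_of_int k) (fst i) (snd i))"
  proof (rule whp_ball_finite[OF \<N>(1)])
    fix i assume "i \<in> \<N>"
    then have "transition W r (fst i) (snd i)" using \<N>(2) by (auto simp: bounded_transitions_def)
    then show "whp (\<lambda>\<epsilon> \<omega>. \<forall>k\<in>sites a b \<epsilon>. sb - (z + \<rho> / 4) - \<rho> / 4 < local_energy \<omega> \<epsilon> (\<epsilon> * real_of_int k) (fst i) (snd i))"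
      by (rule lower_bound_fixed_profile) (use ab z \<rho> in auto)
  qed
  from whp_conj[OF this whp_AE[OF nice_environment]] show ?thesis
  proof (rule whp_mono)
    show "\<forall>\<^sub>F \<epsilon> in at_right 0. \<forall>\<omega>\<in>space P.
        (\<forall>i\<in>\<N>. \<forall>k\<in>sites a b \<epsilon>. sb - (z + \<rho> / 4) - \<rho> / 4 < local_energy \<omega> \<epsilon> (\<epsilon> * real_of_int k) (fst i) (snd i)) \<and>
        (\<forall>z. tl <= \<Theta> z \<omega> \<and> \<Theta> z \<omega> <= tu) -->
        (\<forall>v g. transition W r v g --> kinetic g <= E --> (\<forall>k\<in>sites a b \<epsilon>. sb - z - \<rho> < local_energy \<omega> \<epsilon> (\<epsilon> * real_of_int k) v g))"
    proof (intro always_eventually allI ballI impI, elim conjE)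
      fix \<epsilon> \<omega> v g k
      assume L: "\<forall>i\<in>\<N>. \<forall>k\<in>sites a b \<epsilon>. sb - (z + \<rho> / 4) - \<rho> / 4 < local_energy \<omega> \<epsilon> (\<epsilon> * real_of_int k) (fst i) (snd i)"
        and nice: "\<forall>z. tl <= \<Theta> z \<omega> \<and> \<Theta> z \<omega> <= tu"
        and t: "transition W r v g" "kinetic g <= E" and k: "k \<in> sites a b \<epsilon>"
      have "(v, g) \<in> bounded_transitions r E" using t by (simp add: bounded_transitions_def)
      then obtain v' g' where v': "(v', g') \<in> \<N>" "\<bar>kinetic g - kinetic g'\<bar> <= \<rho>'" "\<And>y. \<bar>W (v y) - W (v' y)\<bar> <= \<rho>'"
        using \<N>(3) by fast
      have t': "transition W r v' g'" using v'(1) \<N>(2) by (auto simp: bounded_transitions_def)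
      have "\<bar>potential (\<lambda>z. \<Theta> z \<omega>) (\<alpha> \<epsilon>) (\<epsilon> * real_of_int k / \<delta> \<epsilon>) (\<lambda>y. W (v y)) - potential (\<lambda>z. \<Theta> z \<omega>) (\<alpha> \<epsilon>) (\<epsilon> * real_of_int k / \<delta> \<epsilon>) (\<lambda>y. W (v' y))\<bar> <= 2 * r * tu * \<rho>'"
        by (rule potential_close[OF transition_bump[OF t(1)] transition_bump[OF t'] _ tl_pos v'(3)]) (use nice in blast)
      moreover have "sb - (z + \<rho> / 4) - \<rho> / 4 < local_energy \<omega> \<epsilon> (\<epsilon> * real_of_int k) v' g'"
        using L v'(1) k by force
      moreover have "\<rho>' + 2 * r * tu * \<rho>' = \<rho> / 2" using \<rho>'(2) by (simp add: distrib_right)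
      ultimately show "sb - z - \<rho> < local_energy \<omega> \<epsilon> (\<epsilon> * real_of_int k) v g"
        using v'(2) unfolding local_energy_def by linarith
    qed
  qed
qed

end

lemma (in iid_bounded) iid_bounded_reflect: "iid_bounded P (\<lambda>z. \<Theta> (- z)) tl tu"
proof unfold_locales
  have "indep_vars (\<lambda>j. PiM {- j} (\<lambda>_. borel)) (\<lambda>j \<omega>. restrict (\<lambda>i. \<Theta> i \<omega>) {- j}) (UNIV :: int set)"
    by (rule indep_vars_restrict[OF indep]) (auto simp: disjoint_family_on_def)
  then have "indep_vars (\<lambda>_. borel) (\<lambda>j \<omega>. (\<lambda>g. g (- j)) (restrict (\<lambda>i. \<Theta> i \<omega>) {- j})) (UNIV :: int set)"
    by (rule indep_vars_compose2) measurable
  then show "indep_vars (\<lambda>_. borel) (\<lambda>z. \<Theta> (- z)) UNIV" by simp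
qed (use ident[of "- z" for z] ident bounds tl_pos in auto)

section \<open>Step functions and bounded variation\<close>

text \<open>The variation of a function with values in \<open>{-1, 1}\<close> is measured by the length of such chains.\<close>

definition alternating :: "(real => real) => (nat => real) => nat => bool" where
  "alternating u p m \<longleftrightarrow> (\<forall>i<m. p i < p (Suc i) \<and> u (p i) \<noteq> u (p (Suc i)))"

text \<open>The first argument is the value to the left of all jumps.\<close>

fun stepfun :: "real => real list => real => real" where
  "stepfun s [] x = s"
| "stepfun s (p # ps) x = (if x < p then s else stepfun (- s) ps x)"

lemma alternating_less: "alternating u p m ==> i < j ==> j <= m ==> p i < p j"
proof (induction j)
  case (Suc j)
  have "p j < p (Suc j)" using Suc.prems by (simp add: alternating_def)
  then show ?case using Suc by (cases "i = j") auto
qed simp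

lemma alternating_Cons:
  assumes "alternating u p m" "x < p 0" "u x \<noteq> u (p 0)"
  shows "alternating u (case_nat x p) (Suc m)"
  unfolding alternating_def
proof (intro allI impI)
  fix i assume "i < Suc m"
  then show "case_nat x p i < case_nat x p (Suc i) \<and> u (case_nat x p i) \<noteq> u (case_nat x p (Suc i))"
    using assms unfolding alternating_def by (cases i) simp_all
qed

lemma alternating_mono: "alternating u p m ==> k <= m ==> alternating u p k"
  by (simp add: alternating_def)

lemma stepfun_range: "s \<in> {-1, 1} ==> stepfun s ps x \<in> {-1, 1}"
proof (induction ps arbitrary: s)
  case (Cons p ps)
  have "- s \<in> {-1, 1}" using Cons.prems by auto
  from Cons.IH[OF this] Cons.prems show ?case by simp
qed simp

lemma stepfun_before: "(\<And>p. p \<in> set ps ==> x < p) ==> stepfun s ps x = s"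
  by (cases ps) auto

text \<open>Induction on the maximal length of a chain to the right of \<open>c\<close>. The first jump is the infimum \<open>x1\<close> of the points of \<open>G\<close>
at which \<open>u\<close> differs from its initial value \<open>s\<close>. Any chain to the right of \<open>x1\<close> can be prolonged to the left, either by
an earlier point with value \<open>s\<close> or by a point with the other value close to \<open>x1\<close>, hence is shorter.\<close>

lemma bounded_alternation_imp_stepfun:
  assumes dense: "\<And>x y. a <= x ==> x < y ==> y <= b ==> \<exists>z\<in>G. x < z \<and> z < y"
    and vals: "\<And>x. x \<in> G ==> u x \<in> {-1, 1::real}"
    and right: "\<And>x h. x \<in> G ==> 0 < h ==> \<exists>y\<in>G. x < y \<and> y < x + h \<and> u y = u x"
    and G: "G \<subseteq> {a<..<b}"
  shows "a <= c ==> c < b ==> \<not> (\<exists>p. alternating u p (Suc M) \<and> (\<forall>i\<le>Suc M. p i \<in> G \<and> c < p i)) ==>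
    \<exists>s ps. s \<in> {-1, 1} \<and> sorted_wrt (<) ps \<and> set ps \<subseteq> {c<..<b} \<and>
      (\<forall>x\<in>G. c < x --> x \<notin> set ps --> u x = stepfun s ps x)"
proof (induction M arbitrary: c)
  case 0
  obtain z where z: "z \<in> G" "c < z" "z < b" using dense[OF 0(1,2)] by auto
  have "u x = u z" if x: "x \<in> G" "c < x" for x
  proof (rule ccontr)
    assume ne: "u x \<noteq> u z"
    define p where "p i = (if i = 0 then min x z else max x z)" for i :: nat
    have "x \<noteq> z" using ne by auto
    then have "x < z \<or> z < x" by auto
    then have "alternating u p (Suc 0)" using ne by (auto simp: alternating_def p_def min_def max_def)
    moreover have "p i \<in> G \<and> c < p i" for i using x z by (auto simp: p_def min_def max_def)
    ultimately show False using 0(3) by blast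
  qed
  then show ?case using vals[OF z(1)] by (intro exI[of _ "u z"] exI[of _ "[]"]) auto
next
  case (Suc M)
  obtain z where z: "z \<in> G" "c < z" "z < b" using dense[OF Suc(2,3)] by auto
  show ?case
  proof (cases "\<forall>x\<in>G. c < x --> u x = u z")
    case True
    then show ?thesis using vals[OF z(1)] by (intro exI[of _ "u z"] exI[of _ "[]"]) auto
  next
    case False
    define Q where "Q m \<longleftrightarrow> (\<exists>p. alternating u p m \<and> (\<forall>i\<le>m. p i \<in> G \<and> c < p i))" for m
    have Q0: "Q 0" unfolding Q_def using z by (intro exI[of _ "\<lambda>_. z"]) (auto simp: alternating_def)
    have Qb: "m <= Suc M" if "Q m" for m
    proof (rule ccontr)
      assume "\<not> m <= Suc M"
      then have "Suc (Suc M) <= m" by simp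
      with that have "Q (Suc (Suc M))" unfolding Q_def using alternating_mono by (meson order_trans)
      then show False using Suc.prems(3) by (simp add: Q_def)
    qed
    define m where "m = (GREATEST m. Q m)"
    have Qm: "Q m" unfolding m_def by (rule GreatestI_nat[of Q, OF Q0 Qb])
    have max: "k <= m" if "Q k" for k unfolding m_def by (rule Greatest_le_nat[of Q, OF that Qb])
    obtain p where p: "alternating u p m" "\<And>i. i <= m ==> p i \<in> G \<and> c < p i" using Qm unfolding Q_def by blast
    define s where "s = u (p 0)"
    have p0: "p 0 \<in> G" "c < p 0" using p(2)[of 0] by auto
    have s: "s \<in> {-1, 1}" unfolding s_def by (rule vals[OF p0(1)])
    have left: "u x = s" if x: "x \<in> G" "c < x" "x < p 0" for x
    proof (rule ccontr)
      assume "u x \<noteq> s"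
      then have "alternating u (case_nat x p) (Suc m)" using alternating_Cons[OF p(1) x(3)] by (simp add: s_def)
      moreover have "case_nat x p i \<in> G \<and> c < case_nat x p i" if "i <= Suc m" for i
        using that p(2) x by (cases i) auto
      ultimately have "Q (Suc m)" unfolding Q_def by blast
      from max[OF this] show False by simp
    qed
    define X where "X = {x \<in> G. c < x \<and> u x \<noteq> s}"
    have "X \<noteq> {}"
    proof
      assume "X = {}"
      then have "\<forall>x\<in>G. c < x --> u x = s" by (auto simp: X_def)
      then show False using False z by metis
    qed
    have Xp: "p 0 <= x" if "x \<in> X" for x using that left by (force simp: X_def)
    have bdd: "bdd_below X" using Xp by (rule bdd_belowI)
    (* the first jump *)
    define x1 where "x1 = Inf X"
    have x1p: "p 0 <= x1" unfolding x1_def using \<open>X \<noteq> {}\<close> Xp by (rule cInf_greatest)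
    obtain x0 where "x0 \<in> X" using \<open>X \<noteq> {}\<close> by blast
    then have x1b: "x1 < b" using cInf_lower[OF _ bdd, of x0] G unfolding x1_def by (force simp: X_def)
    have near: "\<exists>y\<in>X. x1 < y \<and> y < x1 + h" if h: "h > 0" for h
    proof -
      obtain y where y: "y \<in> X" "y < x1 + h" using cInf_lessD[OF \<open>X \<noteq> {}\<close>, of "x1 + h"] h unfolding x1_def by auto
      have "x1 <= y" unfolding x1_def by (rule cInf_lower[OF y(1) bdd])
      show ?thesis
      proof (cases "x1 = y")
        case True
        have yG: "y \<in> G" "c < y" "u y \<noteq> s" using y(1) by (auto simp: X_def)
        obtain y' where "y' \<in> G" "y < y'" "y' < y + h" "u y' = u y" using right[OF yG(1) h] by blast
        then show ?thesis using True yG by (intro bexI[of _ y']) (auto simp: X_def)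
      next
        case False
        then show ?thesis using y \<open>x1 <= y\<close> by (intro bexI[of _ y]) auto
      qed
    qed
    have "\<not> (\<exists>q. alternating u q (Suc M) \<and> (\<forall>i\<le>Suc M. q i \<in> G \<and> x1 < q i))"
    proof
      assume "\<exists>q. alternating u q (Suc M) \<and> (\<forall>i\<le>Suc M. q i \<in> G \<and> x1 < q i)"
      then obtain q where q: "alternating u q (Suc M)" "\<And>i. i <= Suc M ==> q i \<in> G \<and> x1 < q i" by blast
      have "\<exists>x. x \<in> G \<and> c < x \<and> x < q 0 \<and> u x \<noteq> u (q 0)"
      proof (cases "u (q 0) = s")
        case False
        then show ?thesis using p0 x1p q(2)[of 0] by (intro exI[of _ "p 0"]) (auto simp: s_def)
      next
        case True
        obtain y where "y \<in> X" "y < q 0" using near[of "q 0 - x1"] q(2)[of 0] by auto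
        then show ?thesis using True by (intro exI[of _ y]) (auto simp: X_def)
      qed
      then obtain x where x: "x \<in> G" "c < x" "x < q 0" "u x \<noteq> u (q 0)" by blast
      have "c < q i" if "i <= Suc M" for i using q(2)[OF that] x1p p0 by auto
      then have "case_nat x q i \<in> G \<and> c < case_nat x q i" if "i <= Suc (Suc M)" for i
        using that q(2) x by (cases i) auto
      then have "Q (Suc (Suc M))" unfolding Q_def using alternating_Cons[OF q(1) x(3,4)] by blast
      then show False using Suc.prems(3) by (simp add: Q_def)
    qed
    note nochain = this
    have ax1: "a <= x1" using x1p p0 Suc.prems(1) by linarith
    obtain s' ps where ps: "s' \<in> {-1, 1}" "sorted_wrt (<) ps" "set ps \<subseteq> {x1<..<b}"
      "\<And>x. x \<in> G ==> x1 < x ==> x \<notin> set ps ==> u x = stepfun s' ps x"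
      using Suc.IH[OF ax1 x1b nochain] by blast
    define h where "h = Min (insert b (set ps)) - x1"
    have h: "0 < h" unfolding h_def using ps(3) x1b by (simp add: subset_eq)
    obtain y where y: "y \<in> X" "x1 < y" "y < x1 + h" using near[OF h] by blast
    have yl: "y < q" if "q \<in> set ps" for q
    proof -
      have "x1 + h <= q" unfolding h_def using that by simp
      then show ?thesis using y by simp
    qed
    have "u y = stepfun s' ps y" using y yl by (intro ps(4)) (auto simp: X_def)
    also have "\<dots> = s'" using yl by (rule stepfun_before)
    finally have "s' \<noteq> s" using y by (auto simp: X_def)
    then have s': "s' = - s" using s ps(1) by auto
    show ?thesis
    proof (intro exI[of _ s] exI[of _ "x1 # ps"] conjI ballI impI)
      show "sorted_wrt (<) (x1 # ps)" using ps(2,3) by auto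
      show "set (x1 # ps) \<subseteq> {c<..<b}" using ps(3) x1b x1p p0 by auto
      fix x assume x: "x \<in> G" "c < x" "x \<notin> set (x1 # ps)"
      show "u x = stepfun s (x1 # ps) x"
      proof (cases "x < x1")
        case True
        have "x \<notin> X" using True cInf_lower[OF _ bdd, of x] unfolding x1_def[symmetric] by auto
        then show ?thesis using True x by (auto simp: X_def)
      next
        case False
        then show ?thesis using x ps(4)[of x] s' by auto
      qed
    qed (rule s)
  qed
qed

lemma L1_imp_L1_loc:
  assumes "u \<in> L1 I" "I \<in> sets lebesgue" shows "u \<in> L1_loc I"
  unfolding L1_loc_def
proof (intro CollectI allI impI, elim conjE)
  fix K assume K: "compact K" "K \<subseteq> I"
  have Km: "K \<in> sets lebesgue" using borel_compact[OF K(1)] by (simp add: sets_completionI_sets)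
  have "u absolutely_integrable_on I" using assms by (simp add: L1_def integrable_lebesgue_on_iff)
  then show "integrable (lebesgue_on K) u"
    using set_integrable_subset[OF _ Km K(2)] by (simp add: integrable_lebesgue_on_iff[OF Km])
qed

lemma integrable_mult_test_deriv:
  assumes u: "u \<in> L1 I" and I: "I \<in> sets lebesgue" and \<phi>: "\<phi> \<in> test_functions I"
  shows "integrable (lebesgue_on I) (\<lambda>x. u x * deriv \<phi> x)"
proof -
  have sm: "smooth \<phi>" using \<phi> by (simp add: test_functions_iff)
  obtain K where K: "compact K" "\<And>x. x \<notin> K ==> \<phi> x = 0" using \<phi> by (auto simp: test_functions_iff)
  have d0: "deriv \<phi> x = 0" if "x \<notin> K" for x
    by (rule deriv_zero_on_open[of "- K"]) (use that K in \<open>auto simp: compact_imp_closed open_Compl\<close>)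
  have cd: "continuous_on A (deriv \<phi>)" for A by (intro smooth_imp_continuous smooth_deriv sm)
  obtain B where B: "B > 0" "\<And>x. x \<in> K ==> \<bar>deriv \<phi> x\<bar> <= B"
    using compact_imp_bounded[OF compact_continuous_image[OF cd K(1)]] bounded_pos by (metis imageI real_norm_def)
  have Bb: "\<bar>deriv \<phi> x\<bar> <= B" for x using B d0 by (cases "x \<in> K") auto
  have ui: "integrable (lebesgue_on I) u" using u by (simp add: L1_def)
  show ?thesis
  proof (rule Bochner_Integration.integrable_bound)
    show "integrable (lebesgue_on I) (\<lambda>x. B * \<bar>u x\<bar>)" using ui by simp
    show "(\<lambda>x. u x * deriv \<phi> x) \<in> borel_measurable (lebesgue_on I)"
      by (intro borel_measurable_times borel_measurable_integrable[OF ui] continuous_imp_measurable_on_sets_lebesgue cd I)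
    show "AE x in lebesgue_on I. norm (u x * deriv \<phi> x) <= norm (B * \<bar>u x\<bar>)"
    proof (intro AE_I2)
      fix x
      show "norm (u x * deriv \<phi> x) <= norm (B * \<bar>u x\<bar>)"
        using mult_left_mono[OF Bb abs_ge_zero, of "u x" x] B(1) by (simp add: abs_mult mult.commute)
    qed
  qed
qed

text \<open>The test functions take the values \<open>u (P i)\<close> on \<open>{P i..P (Suc i)}\<close>. By telescoping they are bounded by one, and for
vanishing width \<open>\<tau>\<close> each sign change contributes \<open>2\<close> to the integral. The last interval ends at the auxiliary point \<open>q\<close>.\<close>

lemma BV_alternation_bound:
  assumes u: "u \<in> L1 {a<..<b}"
    and C: "\<And>\<phi>. \<phi> \<in> test_functions {a<..<b} ==> (\<forall>x. \<bar>\<phi> x\<bar> <= 1) ==> (LINT x|lebesgue_on {a<..<b}. u x * deriv \<phi> x) <= C"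
    and alt: "alternating u p m"
    and p: "\<And>i. i <= m ==> p i \<in> {a<..<b} \<and> lebesgue_point u (p i) \<and> u (p i) \<in> {-1, 1}"
    and q: "p m < q" "q < b" "lebesgue_point u q" "u q \<in> {-1, 1}"
  shows "2 * real m <= C"
proof -
  let ?I = "{a<..<b}"
  have Im: "?I \<in> sets lebesgue" by auto
  define P where "P i = (if i <= m then p i else q)" for i
  have Plt: "P i < P (Suc i)" if "i <= m" for i
    using that q(1) alt by (auto simp: P_def alternating_def le_less dest: le_neq_implies_less)
  have Pin: "P i \<in> ?I" "lebesgue_point u (P i)" "u (P i) \<in> {-1, 1}" for i
    using p[of i] p[of m] q by (auto simp: P_def)
  have P0: "P 0 <= P i" "P i <= P (Suc m)" if "i <= Suc m" for i
  proof -
    show "P 0 <= P i" using that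
    proof (induction i)
      case (Suc i) then show ?case using Plt[of i] by simp
    qed simp
    show "P i <= P (Suc m)"
      using that
    proof (induction rule: inc_induct)
      case (step n) then show ?case using Plt[of n] by simp
    qed simp
  qed
  define \<phi> where "\<phi> \<tau> x = (\<Sum>i\<le>m. u (P i) * plateau \<tau> (P i) (P (Suc i)) x)" for \<tau> x
  define \<tau>0 where "\<tau>0 = (b - P (Suc m)) / 2"
  have \<tau>0: "0 < \<tau>0" "P (Suc m) + \<tau>0 < b" using Pin(1)[of "Suc m"] by (auto simp: \<tau>0_def field_simps)
  have test: "\<phi> \<tau> \<in> test_functions ?I \<and> (\<forall>x. \<bar>\<phi> \<tau> x\<bar> <= 1) \<and>
      (LINT x|lebesgue_on ?I. u x * deriv (\<phi> \<tau>) x) = (\<Sum>i\<le>m. u (P i) * (LINT x|lebesgue_on ?I. u x * deriv (plateau \<tau> (P i) (P (Suc i))) x))"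
    if \<tau>: "0 < \<tau>" "\<tau> < \<tau>0" for \<tau>
  proof (intro conjI allI)
    have sm: "smooth (\<phi> \<tau>)"
    proof -
      have "smooth (\<lambda>x. u (P i) * plateau \<tau> (P i) (P (Suc i)) (1 * x + 0))" for i by (intro smooth_affine smooth_plateau)
      then show ?thesis unfolding \<phi>_def[abs_def] by (intro smooth_sum) simp
    qed
    show "\<phi> \<tau> \<in> test_functions ?I"
      unfolding test_functions_iff
    proof (intro conjI sm exI[of _ "{P 0..P (Suc m) + \<tau>}"] allI impI)
      show "{P 0..P (Suc m) + \<tau>} \<subseteq> ?I" using Pin(1)[of 0] \<tau> \<tau>0 by auto
      fix x assume x: "x \<notin> {P 0..P (Suc m) + \<tau>}"
      have "plateau \<tau> (P i) (P (Suc i)) x = 0" if "i <= m" for i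
        using x P0(1)[of i] P0(2)[of "Suc i"] that
        by (intro plateau_zero \<tau>(1) less_imp_le[OF Plt]) auto
      then show "\<phi> \<tau> x = 0" by (simp add: \<phi>_def)
    qed auto
    fix x
    have "\<bar>\<phi> \<tau> x\<bar> <= (\<Sum>i\<le>m. \<bar>u (P i) * plateau \<tau> (P i) (P (Suc i)) x\<bar>)" unfolding \<phi>_def by (rule sum_abs)
    also have "\<dots> = (\<Sum>i\<le>m. plateau \<tau> (P i) (P (Suc i)) x)"
    proof (rule sum.cong)
      fix i assume "i \<in> {..m}"
      then have "0 <= plateau \<tau> (P i) (P (Suc i)) x" using plateau_bounds[OF \<tau>(1) less_imp_le[OF Plt]] by auto
      then show "\<bar>u (P i) * plateau \<tau> (P i) (P (Suc i)) x\<bar> = plateau \<tau> (P i) (P (Suc i)) x"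
        using Pin(3)[of i] by auto
    qed simp
    also have "\<dots> = smooth_step ((x - P 0) / \<tau>) - smooth_step ((x - P (Suc m)) / \<tau>)"
      unfolding plateau_def by (rule sum_telescope)
    also have "\<dots> <= 1" using smooth_step_range[of "(x - P 0) / \<tau>"] smooth_step_range[of "(x - P (Suc m)) / \<tau>"] by simp
    finally show "\<bar>\<phi> \<tau> x\<bar> <= 1" .
  next
    have tf: "plateau \<tau> (P i) (P (Suc i)) \<in> test_functions ?I" if "i <= m" for i
    proof (rule plateau_test_function[OF \<tau>(1) less_imp_le[OF Plt[OF that]]])
      show "{P i..P (Suc i) + \<tau>} \<subseteq> ?I" using Pin(1)[of i] P0(2)[of "Suc i"] that \<tau> \<tau>0 by auto
    qed
    have "deriv (\<phi> \<tau>) x = (\<Sum>i\<le>m. u (P i) * deriv (plateau \<tau> (P i) (P (Suc i))) x)" for x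
      unfolding \<phi>_def[abs_def]
      by (intro DERIV_imp_deriv DERIV_sum DERIV_cmult smooth_has_derivative smooth_plateau)
    then have "(LINT x|lebesgue_on ?I. u x * deriv (\<phi> \<tau>) x) = (LINT x|lebesgue_on ?I. (\<Sum>i\<le>m. u (P i) * (u x * deriv (plateau \<tau> (P i) (P (Suc i))) x)))"
      by (simp add: sum_distrib_left mult.left_commute)
    also have "\<dots> = (\<Sum>i\<le>m. (LINT x|lebesgue_on ?I. u (P i) * (u x * deriv (plateau \<tau> (P i) (P (Suc i))) x)))"
      using tf by (intro Bochner_Integration.integral_sum integrable_mult_right integrable_mult_test_deriv u Im) auto
    finally show "(LINT x|lebesgue_on ?I. u x * deriv (\<phi> \<tau>) x) = (\<Sum>i\<le>m. u (P i) * (LINT x|lebesgue_on ?I. u x * deriv (plateau \<tau> (P i) (P (Suc i))) x))"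
      by simp
  qed
  have "((\<lambda>\<tau>. \<Sum>i\<le>m. u (P i) * (LINT x|lebesgue_on ?I. u x * deriv (plateau \<tau> (P i) (P (Suc i))) x)) \<longlongrightarrow>
      (\<Sum>i\<le>m. u (P i) * (u (P i) - u (P (Suc i))))) (at_right 0)"
    by (intro tendsto_sum tendsto_mult tendsto_const LINT_mult_deriv_plateau_tendsto L1_imp_L1_loc[OF u Im] Pin) auto
  moreover have "\<forall>\<^sub>F \<tau> in at_right 0. (\<Sum>i\<le>m. u (P i) * (LINT x|lebesgue_on ?I. u x * deriv (plateau \<tau> (P i) (P (Suc i))) x)) <= C"
    unfolding eventually_at_right_field
  proof (intro exI[of _ \<tau>0] conjI allI impI \<tau>0(1))
    fix \<tau> assume "0 < \<tau>" "\<tau> < \<tau>0"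
    from test[OF this] C[of "\<phi> \<tau>"]
    show "(\<Sum>i\<le>m. u (P i) * (LINT x|lebesgue_on ?I. u x * deriv (plateau \<tau> (P i) (P (Suc i))) x)) <= C" by metis
  qed
  ultimately have "(\<Sum>i\<le>m. u (P i) * (u (P i) - u (P (Suc i)))) <= C"
    by (rule tendsto_upperbound) simp
  moreover have "2 * real m <= (\<Sum>i\<le>m. u (P i) * (u (P i) - u (P (Suc i))))"
  proof -
    have "(\<Sum>i<m. 2) <= (\<Sum>i<m. u (P i) * (u (P i) - u (P (Suc i))))"
    proof (rule sum_mono)
      fix i assume "i \<in> {..<m}"
      then have "u (P i) \<noteq> u (P (Suc i))" using alt by (simp add: P_def alternating_def)
      then show "2 <= u (P i) * (u (P i) - u (P (Suc i)))" using Pin(3)[of i] Pin(3)[of "Suc i"] by auto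
    qed
    moreover have "0 <= u (P m) * (u (P m) - u (P (Suc m)))" using Pin(3)[of m] Pin(3)[of "Suc m"] by auto
    ultimately show ?thesis by (simp add: lessThan_Suc_atMost[symmetric])
  qed
  ultimately show ?thesis by linarith
qed

lemma lebesgue_point_right_value:
  assumes L: "lebesgue_point u x" and ae: "AE y in lebesgue. y \<in> {a<..<b} --> y \<in> G"
    and G: "\<And>y. y \<in> G ==> u y \<in> {-1, 1}" and x: "x \<in> {a<..<b}" "u x \<in> {-1, 1::real}" and h: "0 < h"
  shows "\<exists>y\<in>G. x < y \<and> y < x + h \<and> u y = u x"
proof (rule ccontr)
  assume no: "\<not> ?thesis"
  obtain N where N: "negligible N" "\<And>y. y \<notin> N ==> y \<in> {a<..<b} --> y \<in> G"
    using AE_lebesgue_obtain_negligible[OF ae] by metis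
  define h0 where "h0 = min h (b - x)"
  have h0: "0 < h0" using h x by (simp add: h0_def)
  have "integral {x..x+k} (\<lambda>y. \<bar>u y - u x\<bar>) / k = 2" if k: "0 < k" "k < h0" for k
  proof -
    have "integral {x..x+k} (\<lambda>y. \<bar>u y - u x\<bar>) = integral {x..x+k} (\<lambda>y. 2)"
    proof (rule integral_spike[of "insert x N"])
      show "negligible (insert x N)" using N(1) by simp
      fix y assume y: "y \<in> {x..x+k} - insert x N"
      then have "y \<in> G" "x < y" "y < x + h" using N(2)[of y] k x(1) by (auto simp: h0_def)
      then have "u y \<noteq> u x" "u y \<in> {-1, 1}" using no G by auto
      then show "2 = \<bar>u y - u x\<bar>" using x(2) by auto
    qed
    then show ?thesis using k by simp
  qed
  then have "\<forall>\<^sub>F k in at_right 0. integral {x..x+k} (\<lambda>y. \<bar>u y - u x\<bar>) / k = 2"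
    unfolding eventually_at_right_field using h0 by blast
  then have "((\<lambda>k. integral {x..x+k} (\<lambda>y. \<bar>u y - u x\<bar>) / k) \<longlongrightarrow> 2) (at_right 0)" by (rule tendsto_eventually)
  from tendsto_unique[OF _ this L[unfolded lebesgue_point_def]] show False by simp
qed

text \<open>Chains are only needed in a set of full measure, described by the predicate \<open>S\<close>, which may be chosen as convenient.\<close>

lemma pm1_stepfun:
  assumes ab: "a < b" and u: "u \<in> L1 {a<..<b}" and pm: "AE x in lebesgue. x \<in> {a<..<b} --> u x \<in> {-1, 1}"
    and S: "AE x in lebesgue. x \<in> {a<..<b} --> S x"
    and bd: "\<And>p m. alternating u p m ==> (\<And>i. i <= m ==> p i \<in> {a<..<b} \<and> lebesgue_point u (p i) \<and> u (p i) \<in> {-1, 1} \<and> S (p i)) ==> real m <= C"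
  obtains s ps where "s \<in> {-1, 1}" "sorted_wrt (<) ps" "set ps \<subseteq> {a<..<b}" "AE x in lebesgue. x \<in> {a<..<b} --> u x = stepfun s ps x"
proof -
  have "u \<in> L1_loc {a<..<b}" by (rule L1_imp_L1_loc[OF u]) auto
  then have L: "AE x in lebesgue. x \<in> {a<..<b} --> lebesgue_point u x" by (intro AE_lebesgue_point_open) auto
  define G where "G = {x \<in> {a<..<b}. lebesgue_point u x \<and> u x \<in> {-1, 1} \<and> S x}"
  have ae: "AE x in lebesgue. x \<in> {a<..<b} --> x \<in> G"
    using L pm S by eventually_elim (auto simp: G_def)
  obtain M :: nat where M: "C < real (Suc M)" using reals_Archimedean2[of C] by (metis less_trans lessI of_nat_less_iff)
  have "\<exists>s ps. s \<in> {-1, 1} \<and> sorted_wrt (<) ps \<and> set ps \<subseteq> {a<..<b} \<and> (\<forall>x\<in>G. a < x --> x \<notin> set ps --> u x = stepfun s ps x)"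
  proof (rule bounded_alternation_imp_stepfun[where a=a and G=G and M=M])
    show "\<exists>z\<in>G. x < z \<and> z < y" if "a <= x" "x < y" "y <= b" for x y
      using AE_lebesgue_dense[OF ae that(2)] that by auto
    show "\<exists>y\<in>G. x < y \<and> y < x + h \<and> u y = u x" if "x \<in> G" "0 < h" for x h
      using that by (intro lebesgue_point_right_value[OF _ ae]) (auto simp: G_def)
    show "\<not> (\<exists>p. alternating u p (Suc M) \<and> (\<forall>i\<le>Suc M. p i \<in> G \<and> a < p i))"
    proof
      assume "\<exists>p. alternating u p (Suc M) \<and> (\<forall>i\<le>Suc M. p i \<in> G \<and> a < p i)"
      then obtain p where "alternating u p (Suc M)" "\<And>i. i <= Suc M ==> p i \<in> G" by blast
      from bd[OF this(1)] this(2) M show False by (auto simp: G_def)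
    qed
  qed (use ab in \<open>auto simp: G_def\<close>)
  then obtain s ps where ps: "s \<in> {-1, 1}" "sorted_wrt (<) ps" "set ps \<subseteq> {a<..<b}" "\<And>x. x \<in> G ==> x \<notin> set ps ==> u x = stepfun s ps x"
    by (auto simp: G_def)
  have "set ps \<in> null_sets lebesgue" by (simp add: finite_imp_null_set_lborel null_sets_completionI)
  then have "AE x in lebesgue. x \<notin> set ps" by (rule AE_not_in)
  then have "AE x in lebesgue. x \<in> {a<..<b} --> u x = stepfun s ps x"
    using ae by eventually_elim (use ps(4) in auto)
  then show ?thesis using that ps by blast
qed

lemma stepfun_alternating:
  assumes dense: "\<And>x y. c <= x ==> x < y ==> y <= b ==> \<exists>z\<in>G. x < z \<and> z < y"
    and s: "s \<in> {-1, 1}" and ps: "sorted_wrt (<) ps" "set ps \<subseteq> {c<..<b}" and cb: "c < b"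
    and u: "\<And>x. x \<in> G ==> c < x ==> x < b ==> x \<notin> set ps ==> u x = stepfun s ps x"
  shows "\<exists>p. alternating u p (length ps) \<and> (\<forall>i\<le>length ps. p i \<in> G \<and> c < p i \<and> p i < b) \<and> u (p 0) = s"
  using dense s ps cb u
proof (induction ps arbitrary: s c)
  case Nil
  obtain z where "z \<in> G" "c < z" "z < b" using Nil.prems(1)[of c b] Nil.prems(5) by auto
  then show ?case using Nil.prems(6) by (intro exI[of _ "\<lambda>_. z"]) (auto simp: alternating_def)
next
  case (Cons x ps)
  have x: "c < x" "x < b" using Cons.prems(4) by auto
  have "\<exists>p. alternating u p (length ps) \<and> (\<forall>i\<le>length ps. p i \<in> G \<and> x < p i \<and> p i < b) \<and> u (p 0) = - s"
  proof (rule Cons.IH)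
    show "\<exists>z\<in>G. x' < z \<and> z < y" if "x <= x'" "x' < y" "y <= b" for x' y using Cons.prems(1)[of x' y] that x by auto
    show "u y = stepfun (- s) ps y" if "y \<in> G" "x < y" "y < b" "y \<notin> set ps" for y
      using Cons.prems(6)[of y] that x by auto
  qed (use Cons.prems x in auto)
  then obtain p where p: "alternating u p (length ps)" "\<And>i. i <= length ps ==> p i \<in> G \<and> x < p i \<and> p i < b" "u (p 0) = - s" by blast
  obtain z where z: "z \<in> G" "c < z" "z < x" using Cons.prems(1)[of c x] x by auto
  have zs: "z \<notin> set (x # ps)" using z Cons.prems(3) by auto
  have "u z = s" using Cons.prems(6)[of z] z x zs by auto
  have "s \<noteq> - s" using Cons.prems(2) by auto
  then have "alternating u (case_nat z p) (Suc (length ps))"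
    using p(2)[of 0] z p(3) \<open>u z = s\<close> by (intro alternating_Cons[OF p(1)]) auto
  moreover have "case_nat z p i \<in> G \<and> c < case_nat z p i \<and> case_nat z p i < b" if "i <= Suc (length ps)" for i
    using that p(2)[of "i - 1"] z x by (cases i) auto
  ultimately show ?case using \<open>u z = s\<close> by (intro exI[of _ "case_nat z p"]) auto
qed

lemma stepfun_local:
  assumes "sorted_wrt (<) ps"
  obtains h l where "0 < h" "l \<in> {s, - s}" "\<And>y. x - h < y ==> y < x ==> stepfun s ps y = l"
    "\<And>y. x < y ==> y < x + h ==> stepfun s ps y = (if x \<in> set ps then - l else l)"
proof -
  have "\<exists>h l. 0 < h \<and> l \<in> {s, - s} \<and> (\<forall>y. x - h < y --> y < x --> stepfun s ps y = l) \<and>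
    (\<forall>y. x < y --> y < x + h --> stepfun s ps y = (if x \<in> set ps then - l else l))"
    using assms
  proof (induction ps arbitrary: s)
    case Nil
    show ?case by (intro exI[of _ 1] exI[of _ s]) auto
  next
    case (Cons p ps)
    obtain h l where IH: "0 < h" "l \<in> {- s, - (- s)}" "\<And>y. x - h < y ==> y < x ==> stepfun (- s) ps y = l"
      "\<And>y. x < y ==> y < x + h ==> stepfun (- s) ps y = (if x \<in> set ps then - l else l)"
      using Cons.IH[of "- s"] Cons.prems by auto
    consider "x < p" | "x = p" | "p < x" by linarith
    then show ?case
    proof cases
      case 1
      then have "x \<notin> set (p # ps)" using Cons.prems by auto
      then show ?thesis using 1 by (intro exI[of _ "p - x"] exI[of _ s]) auto
    next
      case 2
      have "stepfun (- s) ps y = - s" if "p < y" "y < p + (Min (insert (p + 1) (set ps)) - p)" for y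
      proof (rule stepfun_before)
        fix q assume "q \<in> set ps"
        then have "Min (insert (p + 1) (set ps)) <= q" by (intro Min_le) auto
        then show "y < q" using that by linarith
      qed
      moreover have "0 < Min (insert (p + 1) (set ps)) - p" using Cons.prems by simp
      ultimately show ?thesis using 2 by (intro exI[of _ "Min (insert (p + 1) (set ps)) - p"] exI[of _ s]) auto
    next
      case 3
      then have "x \<in> set (p # ps) \<longleftrightarrow> x \<in> set ps" by auto
      then show ?thesis using IH 3 by (intro exI[of _ "min h (x - p)"] exI[of _ l]) auto
    qed
  qed
  then show ?thesis using that by blast
qed

lemma one_sided_mean_constant:
  assumes c: "AE y in lebesgue. y \<in> S --> u y = c" and S: "S \<in> sets lebesgue"
  shows "(LINT y|lebesgue_on S. \<bar>u y - a\<bar>) = (LINT y|lebesgue_on S. \<bar>c - a\<bar> :: real)"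
proof -
  have "(LINT y|lebesgue_on S. \<bar>u y - a\<bar>) = (LINT y|lebesgue. (if y \<in> S then \<bar>u y - a\<bar> else 0))"
    by (rule Lebesgue_Measure.integral_restrict_UNIV[OF S, symmetric])
  also have "\<dots> = (LINT y|lebesgue. (if y \<in> S then \<bar>c - a\<bar> else 0))"
  proof (rule integral_cong_AE)
    show m: "(\<lambda>y. if y \<in> S then \<bar>c - a\<bar> else 0) \<in> borel_measurable lebesgue" using S by (intro measurable_If_set) auto
    have "AE y in lebesgue. (if y \<in> S then \<bar>c - a\<bar> else 0) = (if y \<in> S then \<bar>u y - a\<bar> else 0)"
      using c by eventually_elim auto
    from borel_measurable_AE[OF m this] show "(\<lambda>y. if y \<in> S then \<bar>u y - a\<bar> else 0) \<in> borel_measurable lebesgue" .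
    show "AE y in lebesgue. (if y \<in> S then \<bar>u y - a\<bar> else 0) = (if y \<in> S then \<bar>c - a\<bar> else 0)"
      using c by eventually_elim auto
  qed
  also have "\<dots> = (LINT y|lebesgue_on S. \<bar>c - a\<bar>)" by (rule Lebesgue_Measure.integral_restrict_UNIV[OF S])
  finally show ?thesis .
qed

lemma one_sided_limit_constant:
  assumes h: "0 < h" and S: "\<And>r. 0 < r ==> r < h ==> S r \<in> sets lebesgue \<and> measure lebesgue (S r) = r \<and> (AE y in lebesgue. y \<in> S r --> u y = c)"
  shows "((\<lambda>r. (LINT y|lebesgue_on (S r). \<bar>u y - a\<bar>) / r) \<longlongrightarrow> 0) (at_right 0) \<longleftrightarrow> c = a"
proof -
  have "(LINT y|lebesgue_on (S r). \<bar>u y - a\<bar>) / r = \<bar>c - a\<bar>" if "0 < r" "r < h" for r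
  proof -
    have "(LINT y|lebesgue_on (S r). \<bar>u y - a\<bar>) = (LINT y|lebesgue_on (S r). \<bar>c - a\<bar>)"
      using S[OF that] by (intro one_sided_mean_constant) auto
    also have "\<dots> = measure lebesgue (S r) * \<bar>c - a\<bar>" using S[OF that] by (simp add: measure_restrict_space)
    finally show ?thesis using S[OF that] that by simp
  qed
  then have "\<forall>\<^sub>F r in at_right 0. (LINT y|lebesgue_on (S r). \<bar>u y - a\<bar>) / r = \<bar>c - a\<bar>"
    unfolding eventually_at_right_field using h by blast
  then have l: "((\<lambda>r. (LINT y|lebesgue_on (S r). \<bar>u y - a\<bar>) / r) \<longlongrightarrow> \<bar>c - a\<bar>) (at_right 0)" by (rule tendsto_eventually)
  show ?thesis
  proof
    assume "((\<lambda>r. (LINT y|lebesgue_on (S r). \<bar>u y - a\<bar>) / r) \<longlongrightarrow> 0) (at_right 0)"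
    from tendsto_unique[OF _ l this] show "c = a" by simp
  qed (use l in simp)
qed

lemma jump_set_stepfun:
  assumes u: "AE x in lebesgue. x \<in> {a<..<b} --> u x = stepfun s ps x"
    and ps: "sorted_wrt (<) ps" "set ps \<subseteq> {a<..<b}" and s: "s \<in> {-1, 1}"
  shows "jump_set u \<inter> {a<..<b} = set ps"
proof -
  have "x \<in> jump_set u \<longleftrightarrow> x \<in> set ps" if x: "x \<in> {a<..<b}" for x
  proof -
    obtain h l where hl: "0 < h" "l \<in> {s, - s}" "\<And>y. x - h < y ==> y < x ==> stepfun s ps y = l"
      "\<And>y. x < y ==> y < x + h ==> stepfun s ps y = (if x \<in> set ps then - l else l)"
      using stepfun_local[OF ps(1), of s x] by metis
    define h' where "h' = min h (min (x - a) (b - x))"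
    have h': "0 < h'" using hl x by (simp add: h'_def)
    define R where "R = (if x \<in> set ps then - l else l)"
    have L: "((\<lambda>r. (LINT y|lebesgue_on {x - r<..<x}. \<bar>u y - c\<bar>) / r) \<longlongrightarrow> 0) (at_right 0) \<longleftrightarrow> l = c" for c
    proof (rule one_sided_limit_constant[OF h'])
      fix r :: real assume r: "0 < r" "r < h'"
      have "AE y in lebesgue. y \<in> {x - r<..<x} --> u y = l"
        using u by eventually_elim (use hl(3) r x in \<open>auto simp: h'_def\<close>)
      then show "{x - r<..<x} \<in> sets lebesgue \<and> measure lebesgue {x - r<..<x} = r \<and> (AE y in lebesgue. y \<in> {x - r<..<x} --> u y = l)"
        using r by auto
    qed
    have Rr: "((\<lambda>r. (LINT y|lebesgue_on {x<..<x + r}. \<bar>u y - c\<bar>) / r) \<longlongrightarrow> 0) (at_right 0) \<longleftrightarrow> R = c" for c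
    proof (rule one_sided_limit_constant[OF h'])
      fix r :: real assume r: "0 < r" "r < h'"
      have "AE y in lebesgue. y \<in> {x<..<x + r} --> u y = R"
        using u by eventually_elim (use hl(4) r x in \<open>auto simp: h'_def R_def\<close>)
      then show "{x<..<x + r} \<in> sets lebesgue \<and> measure lebesgue {x<..<x + r} = r \<and> (AE y in lebesgue. y \<in> {x<..<x + r} --> u y = R)"
        using r by auto
    qed
    have "l \<noteq> - l" using hl(2) s by auto
    moreover have "x \<in> jump_set u \<longleftrightarrow> (\<exists>c d. c \<noteq> d \<and> l = c \<and> R = d)"
      unfolding jump_set_def mem_Collect_eq L Rr ..
    ultimately show ?thesis by (simp add: R_def)
  qed
  then show ?thesis using ps(2) by blast
qed

text \<open>Integration over each of the intervals of constancy produces two boundary values of the test function.\<close>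

lemma stepfun_test_integral:
  assumes der: "\<And>x. (\<phi> has_real_derivative \<phi>' x) (at x)" and bd: "\<And>x. \<bar>\<phi> x\<bar> <= 1" and s: "s \<in> {-1, 1}"
  shows "sorted_wrt (<) ps ==> p <= q ==> \<exists>I. ((\<lambda>x. stepfun s ps x * \<phi>' x) has_integral I) {p..q} \<and> \<bar>I\<bar> <= 2 * real (length ps) + 2"
  using s
proof (induction ps arbitrary: s p)
  case Nil
  have "(\<phi>' has_integral (\<phi> q - \<phi> p)) {p..q}"
    using der Nil by (intro fundamental_theorem_of_calculus)
      (auto simp: has_real_derivative_iff_has_vector_derivative[symmetric] intro: has_field_derivative_at_within)
  from has_integral_mult_right[OF this, of s]
  have "((\<lambda>x. stepfun s [] x * \<phi>' x) has_integral s * (\<phi> q - \<phi> p)) {p..q}" by simp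
  moreover have "\<bar>s * (\<phi> q - \<phi> p)\<bar> <= 2" using Nil bd[of p] bd[of q] by (auto simp: abs_mult)
  ultimately show ?case by auto
next
  case (Cons x ps)
  have ft: "(\<phi>' has_integral (\<phi> r - \<phi> p)) {p..r}" if pr: "p <= r" for r
    using der pr by (intro fundamental_theorem_of_calculus)
      (auto simp: has_real_derivative_iff_has_vector_derivative[symmetric] intro: has_field_derivative_at_within)
  have s': "- s \<in> {-1, 1}" and srt: "sorted_wrt (<) ps" using Cons.prems by auto
  have const: "((\<lambda>y. stepfun s (x # ps) y * \<phi>' y) has_integral s * (\<phi> r - \<phi> p)) {p..r} \<and> \<bar>s * (\<phi> r - \<phi> p)\<bar> <= 2" if pr: "p <= r" and rx: "r <= x" for r
  proof
    show "((\<lambda>y. stepfun s (x # ps) y * \<phi>' y) has_integral s * (\<phi> r - \<phi> p)) {p..r}"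
      by (rule has_integral_spike[OF _ _ has_integral_mult_right[OF ft[OF pr], of s], of "{x}"]) (use rx in auto)
    show "\<bar>s * (\<phi> r - \<phi> p)\<bar> <= 2" using Cons.prems bd[of p] bd[of r] by (auto simp: abs_mult)
  qed
  have rest: "\<exists>I. ((\<lambda>y. stepfun s (x # ps) y * \<phi>' y) has_integral I) {r..q} \<and> \<bar>I\<bar> <= 2 * real (length ps) + 2" if xr: "x <= r" and rq: "r <= q" for r
  proof -
    obtain I where I: "((\<lambda>y. stepfun (- s) ps y * \<phi>' y) has_integral I) {r..q}" "\<bar>I\<bar> <= 2 * real (length ps) + 2"
      using Cons.IH[OF srt rq s'] by blast
    have "((\<lambda>y. stepfun s (x # ps) y * \<phi>' y) has_integral I) {r..q}"
      by (rule has_integral_eq[OF _ I(1)]) (use xr in auto)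
    then show ?thesis using I(2) by blast
  qed
  consider "x <= p" | "p < x" "x <= q" | "q < x" by linarith
  then show ?case
  proof cases
    case 1
    then show ?thesis using rest[of p] Cons.prems by force
  next
    case 3
    then show ?thesis using const[of q] Cons.prems by force
  next
    case 2
    obtain I where I: "((\<lambda>y. stepfun s (x # ps) y * \<phi>' y) has_integral I) {x..q}" "\<bar>I\<bar> <= 2 * real (length ps) + 2"
      using rest[of x] 2 by blast
    have c: "((\<lambda>y. stepfun s (x # ps) y * \<phi>' y) has_integral s * (\<phi> x - \<phi> p)) {p..x}" "\<bar>s * (\<phi> x - \<phi> p)\<bar> <= 2"
      using const[of x] 2 by auto
    have "((\<lambda>y. stepfun s (x # ps) y * \<phi>' y) has_integral (s * (\<phi> x - \<phi> p) + I)) {p..q}"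
      by (rule has_integral_combine[OF _ _ c(1) I(1)]) (use 2 in auto)
    moreover have "\<bar>s * (\<phi> x - \<phi> p) + I\<bar> <= 2 * real (length (x # ps)) + 2" using c(2) I(2) by simp
    ultimately show ?thesis by blast
  qed
qed

lemma stepfun_BV:
  assumes ab: "a < b" and u: "u \<in> L1 {a<..<b}" and us: "AE x in lebesgue. x \<in> {a<..<b} --> u x = stepfun s ps x"
    and ps: "sorted_wrt (<) ps" and s: "s \<in> {-1, 1}"
  shows "u \<in> BV_pm1 {a<..<b}"
proof -
  let ?I = "{a<..<b}"
  have Im: "?I \<in> sets lebesgue" by auto
  obtain N where N: "negligible N" "\<And>x. x \<notin> N ==> x \<in> ?I --> u x = stepfun s ps x"
    using AE_lebesgue_obtain_negligible[OF us] by metis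
  have "AE x in lebesgue. x \<in> ?I --> u x = -1 \<or> u x = 1"
    using us by eventually_elim (use stepfun_range[OF s, of ps] in auto)
  then have "AE x in lebesgue_on ?I. u x = -1 \<or> u x = 1"
    using AE_restrict_space_iff[of ?I lebesgue] Im by simp
  moreover have "(LINT x|lebesgue_on ?I. u x * deriv \<phi> x) <= 2 * real (length ps) + 2"
    if \<phi>: "\<phi> \<in> test_functions ?I" and bd: "\<forall>x. \<bar>\<phi> x\<bar> <= 1" for \<phi>
  proof -
    have sm: "smooth \<phi>" using \<phi> by (simp add: test_functions_iff)
    have "open ?I" "is_interval ?I" "?I \<noteq> {}" using ab by auto
    from test_function_support[OF \<phi> this]
    obtain p q where pq: "p <= q" "{p..q} \<subseteq> ?I" "\<And>x. x \<notin> {p<..<q} ==> \<phi> x = 0" by metis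
    have d0: "deriv \<phi> x = 0" if "x \<notin> {p..q}" for x
      by (rule deriv_zero_on_open[of "- {p..q}"]) (use that pq(3) in auto)
    have Pm: "{p..q} \<in> sets lebesgue" by auto
    have "(LINT x|lebesgue_on ?I. u x * deriv \<phi> x) = (LINT x|lebesgue_on {p..q}. u x * deriv \<phi> x)"
      by (rule LINT_supported[OF pq(2) Im Pm]) (use d0 in auto)
    also have "\<dots> = integral {p..q} (\<lambda>x. u x * deriv \<phi> x)"
      using absolutely_integrable_continuous_mult[OF smooth_imp_continuous[OF smooth_deriv[OF sm]] L1_loc_interval[OF L1_imp_L1_loc[OF u Im] pq(2)]]
      by (intro LINT_eq_integral Pm) (simp add: mult.commute)
    also have "\<dots> = integral {p..q} (\<lambda>x. stepfun s ps x * deriv \<phi> x)"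
      by (rule integral_spike[OF N(1)]) (use N(2) pq(2) in auto)
    also have "\<dots> <= 2 * real (length ps) + 2"
      using stepfun_test_integral[of \<phi> "deriv \<phi>" s ps p q, OF smooth_has_derivative[OF sm] _ s ps pq(1)] bd
      by (auto simp: has_integral_iff abs_le_iff)
    finally show ?thesis .
  qed
  ultimately show ?thesis using u unfolding BV_pm1_def by blast
qed

lemma BV_imp_stepfun:
  assumes ab: "a < b" and u: "u \<in> BV_pm1 {a<..<b}"
  obtains s ps where "s \<in> {-1, 1}" "sorted_wrt (<) ps" "set ps \<subseteq> {a<..<b}" "AE x in lebesgue. x \<in> {a<..<b} --> u x = stepfun s ps x"
proof -
  have Im: "{a<..<b} \<in> sets lebesgue" by auto
  have uL: "u \<in> L1 {a<..<b}" using u by (simp add: BV_pm1_def)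
  have "AE x in lebesgue_on {a<..<b}. u x = -1 \<or> u x = 1" using u by (simp add: BV_pm1_def)
  then have pm: "AE x in lebesgue. x \<in> {a<..<b} --> u x \<in> {-1, 1}"
    using AE_restrict_space_iff[of "{a<..<b}" lebesgue] Im by simp
  obtain C where C: "\<And>\<phi>. \<phi> \<in> test_functions {a<..<b} ==> (\<forall>x. \<bar>\<phi> x\<bar> <= 1) ==> (LINT x|lebesgue_on {a<..<b}. u x * deriv \<phi> x) <= C"
    using u by (auto simp: BV_pm1_def)
  have L: "AE x in lebesgue. x \<in> {a<..<b} --> lebesgue_point u x"
    by (intro AE_lebesgue_point_open L1_imp_L1_loc[OF uL Im]) auto
  have both: "AE x in lebesgue. x \<in> {a<..<b} --> lebesgue_point u x \<and> u x \<in> {-1, 1}" using L pm by eventually_elim blast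
  show ?thesis
  proof (rule pm1_stepfun[OF ab uL pm, where S="\<lambda>_. True" and C="C / 2"])
    fix p m assume alt: "alternating u p m" and p: "\<And>i. i <= m ==> p i \<in> {a<..<b} \<and> lebesgue_point u (p i) \<and> u (p i) \<in> {-1, 1} \<and> True"
    have "p m < b" using p[of m] by simp
    then obtain q where q: "p m < q" "q < b" "q \<in> {a<..<b} --> lebesgue_point u q \<and> u q \<in> {-1, 1}"
      using AE_lebesgue_dense[OF both] by blast
    have qI: "q \<in> {a<..<b}" using p[of m] q by simp
    have "2 * real m <= C"
      by (rule BV_alternation_bound[OF uL C alt _ q(1,2)]) (use p q(3) qI in blast)+
    then show "real m <= C / 2" by simp
  qed (use that in auto)
qed

section \<open>The cost of alternation\<close>

lemma AC_Icc_measurable: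
  assumes v: "AC {p..q} v g" and c: "c \<in> borel_measurable borel" and W: "continuous_on UNIV W"
  shows "(\<lambda>x. ennreal (\<epsilon> / 2 * (g x)\<^sup>2 + 1 / \<epsilon> * c x * W (v x)) * indicator {p..q} x) \<in> borel_measurable lebesgue"
proof (cases "p <= q")
  case True
  have "g absolutely_integrable_on {p..q}" using ACD[OF v, of p q] True by auto
  then have gm: "(\<lambda>x. indicator {p..q} x * g x) \<in> borel_measurable lebesgue"
    unfolding set_integrable_def by (auto dest: borel_measurable_integrable)
  have "continuous_on {p..q} (\<lambda>x. W (v x))"
    by (rule continuous_on_compose2[OF W AC_continuous_Icc[OF v]]) auto
  then have "(\<lambda>x. indicator {p..q} x *\<^sub>R W (v x)) \<in> borel_measurable borel"
    by (intro borel_measurable_continuous_on_indicator) auto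
  then have wm: "(\<lambda>x. indicator {p..q} x * W (v x)) \<in> borel_measurable lebesgue"
    by (simp add: measurable_completion)
  have cm: "c \<in> borel_measurable lebesgue" using c by (simp add: measurable_completion)
  have "(\<lambda>x. ennreal (\<epsilon> / 2 * (indicator {p..q} x * g x)\<^sup>2 + 1 / \<epsilon> * c x * (indicator {p..q} x * W (v x)))) \<in> borel_measurable lebesgue"
    using gm wm cm by measurable
  moreover have "(\<lambda>x. ennreal (\<epsilon> / 2 * (indicator {p..q} x * g x)\<^sup>2 + 1 / \<epsilon> * c x * (indicator {p..q} x * W (v x)))) =
      (\<lambda>x. ennreal (\<epsilon> / 2 * (g x)\<^sup>2 + 1 / \<epsilon> * c x * W (v x)) * indicator {p..q} x)"
    by (auto simp: indicator_def)
  ultimately show ?thesis by simp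
qed simp

lemma nn_integral_reflect_Icc:
  fixes F :: "real => ennreal"
  assumes "(\<lambda>x. F x * indicator {p..q} x) \<in> borel_measurable lebesgue"
  shows "(\<integral>\<^sup>+x\<in>{p..q}. F x \<partial>lebesgue) = (\<integral>\<^sup>+x\<in>{-q..-p}. F (- x) \<partial>lebesgue)"
proof -
  have "(\<integral>\<^sup>+x\<in>{p..q}. F x \<partial>lebesgue) = (\<integral>\<^sup>+x. F (0 + (-1) * x) * indicator {p..q} (0 + (-1) * x) \<partial>lebesgue)"
    using nn_integral_real_affine_lebesgue[OF assms, of "-1" 0] by simp
  also have "\<dots> = (\<integral>\<^sup>+x\<in>{-q..-p}. F (- x) \<partial>lebesgue)"
    by (intro nn_integral_cong) (auto simp: indicator_def)
  finally show ?thesis .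
qed

lemma AE_reflect:
  fixes Q :: "real => bool"
  assumes "AE x in lebesgue. Q x" shows "AE x in lebesgue. Q (- x)"
proof -
  obtain N where N: "negligible N" "\<And>x. x \<notin> N ==> Q x" using AE_lebesgue_obtain_negligible[OF assms] by metis
  have "negligible (uminus ` N)" by (rule negligible_differentiable_image_negligible[OF _ N(1)]) (auto intro!: derivative_intros simp: differentiable_on_def)
  then have "uminus ` N \<in> null_sets lebesgue" by (simp add: negligible_iff_null_sets)
  from AE_not_in[OF this] show ?thesis
    by eventually_elim (use N(2) in \<open>force simp: image_iff\<close>)
qed

context double_well begin

abbreviation energy :: "real => (real => real) => (real => real) => (real => real) => real set => ennreal" where
  "energy \<epsilon> c v g S \<equiv> (\<integral>\<^sup>+x\<in>S. ennreal (\<epsilon> / 2 * (g x)\<^sup>2 + 1 / \<epsilon> * c x * W (v x)) \<partial>lebesgue)"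

text \<open>A checkerboard vanishes on the boundaries of its cells, so its lower bound holds only almost everywhere.\<close>

definition medium :: "real => real => (real => real) => bool" where
  "medium th tu c \<longleftrightarrow> c \<in> borel_measurable borel \<and> (\<forall>x. 0 <= c x \<and> c x <= tu) \<and> (AE x in lebesgue. th <= c x)"

lemma medium_reflect: "medium th tu c ==> medium th tu (\<lambda>x. c (- x))"
  unfolding medium_def
proof (elim conjE, intro conjI)
  show "AE x in lebesgue. th <= c x ==> AE x in lebesgue. th <= c (- x)" by (rule AE_reflect)
qed auto

text \<open>No profile of radius \<open>r\<close> is cheaper than \<open>s - \<rho>\<close> at any site of the interval. Only profiles of kinetic energy at most \<open>s\<close>
matter, since the others are more expensive anyway.\<close>

definition barrier :: "real => (real => real) => real => real => real => real => real => bool" where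
  "barrier \<epsilon> c a b s \<rho> r \<longleftrightarrow> (\<forall>v g (k::int). transition W r v g --> kinetic g <= s --> a - \<epsilon> <= \<epsilon> * real_of_int k -->
     \<epsilon> * real_of_int k <= b --> s - \<rho> < kinetic g + (LINT y|lebesgue. c (\<epsilon> * real_of_int k + \<epsilon> * y) * W (v y)))"

abbreviation "crossing_loss tu \<rho> \<eta> \<equiv> \<rho> + \<eta> * (1 + 2 * tu * W_max)"

lemma upward_crossing_cost:
  assumes r: "extraction_radius r th tu \<eta> s" and \<epsilon>: "0 < \<epsilon>" and c: "medium th tu c" and bar: "barrier \<epsilon> c a b s \<rho> r"
    and loss: "0 <= \<rho>" "0 <= \<eta>" and pq: "a <= p" "p <= q" "q <= b" and v: "AC {p..q} v g" "v p <= -1 + \<eta>" "1 - \<eta> <= v q"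
  shows "ennreal (s - crossing_loss tu \<rho> \<eta>) <= energy \<epsilon> c v g {p..q}"
proof (rule ccontr)
  assume "\<not> ?thesis"
  define e where "e = s - crossing_loss tu \<rho> \<eta>"
  from \<open>\<not> ?thesis\<close> have lt: "energy \<epsilon> c v g {p..q} < ennreal e" by (simp only: e_def not_le)
  then have "0 < ennreal e" by (rule le_less_trans[OF zero_le])
  then have "0 < e" by simp
  have tu: "0 <= tu" using c unfolding medium_def by (meson order_trans)
  have "0 <= \<eta> * (1 + 2 * tu * W_max)" using loss(2) tu W_max_nonneg by simp
  then have es: "e <= s" using loss(1) by (simp add: e_def)
  obtain k :: int and w h where k: "transition W r w h" "p - \<epsilon> <= \<epsilon> * real_of_int k" "\<epsilon> * real_of_int k <= q"
     "kinetic h + (LINT y|lebesgue. c (\<epsilon> * real_of_int k + \<epsilon> * y) * W (w y)) <= e + \<eta> * (1 + 2 * tu * W_max)"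
  proof -
    have cc: "c \<in> borel_measurable borel" "\<And>x. 0 <= c x \<and> c x <= tu" "AE x in lebesgue. th <= c x"
      using c by (auto simp: medium_def)
    have "\<exists>k w h. transition W r w h \<and> p - \<epsilon> <= \<epsilon> * real_of_int k \<and> \<epsilon> * real_of_int k <= q \<and>
       kinetic h + (LINT y|lebesgue. c (\<epsilon> * real_of_int k + \<epsilon> * y) * W (w y)) <= e + \<eta> * (1 + 2 * tu * W_max)"
      by (rule r[unfolded extraction_radius_def, THEN conjunct2, rule_format, OF \<epsilon> pq(2) v(1) cc(1) cc(2) cc(3) v(2,3)
        less_imp_le[OF \<open>0 < e\<close>] es less_imp_le[OF lt]])
    then show ?thesis using that by blast
  qed
  have "0 <= (LINT y|lebesgue. c (\<epsilon> * real_of_int k + \<epsilon> * y) * W (w y))"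
    using c unfolding medium_def by (intro Bochner_Integration.integral_nonneg mult_nonneg_nonneg W_nonneg) blast
  moreover have ee: "e + \<eta> * (1 + 2 * tu * W_max) = s - \<rho>" by (simp add: e_def)
  ultimately have "kinetic h <= s" using k(4) loss(1) by linarith
  moreover have "a - \<epsilon> <= \<epsilon> * real_of_int k" "\<epsilon> * real_of_int k <= b" using k(2,3) pq by linarith+
  ultimately have "s - \<rho> < kinetic h + (LINT y|lebesgue. c (\<epsilon> * real_of_int k + \<epsilon> * y) * W (w y))"
    using bar k(1) unfolding barrier_def by blast
  then show False using k(4) ee by linarith
qed

lemma downward_crossing_cost:
  assumes r: "extraction_radius r th tu \<eta> s" and \<epsilon>: "0 < \<epsilon>" and c: "medium th tu c" and bar: "barrier \<epsilon> (\<lambda>x. c (- x)) (- b) (- a) s \<rho> r"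
    and loss: "0 <= \<rho>" "0 <= \<eta>" and pq: "a <= p" "p <= q" "q <= b" and v: "AC {p..q} v g" "1 - \<eta> <= v p" "v q <= -1 + \<eta>"
  shows "ennreal (s - crossing_loss tu \<rho> \<eta>) <= energy \<epsilon> c v g {p..q}"
proof -
  have pre: "uminus -` {p..q} = {-q..-p}" by auto
  have "ennreal (s - crossing_loss tu \<rho> \<eta>) <= energy \<epsilon> (\<lambda>x. c (- x)) (\<lambda>x. v (- x)) (\<lambda>x. - g (- x)) {-q..-p}"
    using AC_reflect[OF v(1), unfolded pre] v(2,3) pq
    by (intro upward_crossing_cost[OF r \<epsilon> medium_reflect[OF c] bar loss]) auto
  also have "\<dots> = energy \<epsilon> c v g {p..q}"
    using nn_integral_reflect_Icc[OF AC_Icc_measurable[OF v(1) _ W_cont], of c \<epsilon>] c by (simp add: medium_def)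
  finally show ?thesis .
qed

lemma energy_Icc_split:
  assumes v: "AC {p..q} v g" and c: "medium th tu c" and l: "p <= l" "l <= q"
  shows "energy \<epsilon> c v g {p..l} + energy \<epsilon> c v g {l..q} <= energy \<epsilon> c v g {p..q}"
proof -
  have cm: "c \<in> borel_measurable borel" using c by (simp add: medium_def)
  have m: "(\<lambda>x. ennreal (\<epsilon> / 2 * (g x)\<^sup>2 + 1 / \<epsilon> * c x * W (v x)) * indicator {p..l} x) \<in> borel_measurable lebesgue"
    "(\<lambda>x. ennreal (\<epsilon> / 2 * (g x)\<^sup>2 + 1 / \<epsilon> * c x * W (v x)) * indicator {l..q} x) \<in> borel_measurable lebesgue"
    by (intro AC_Icc_measurable AC_subset[OF v] cm W_cont; use l in auto)+
  have "AE x in lebesgue. x \<noteq> l" using AE_not_in[of "{l}" lebesgue] by (simp add: null_sets_completionI)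
  then show ?thesis
    unfolding nn_integral_add[OF m, symmetric]
    by (intro nn_integral_mono_AE, eventually_elim) (use l in \<open>auto simp: indicator_def\<close>)
qed

text \<open>The crossings between consecutive points of the chain take place on non-overlapping intervals.\<close>

lemma alternation_cost:
  assumes r: "extraction_radius r th tu \<eta> s" and \<epsilon>: "0 < \<epsilon>" and c: "medium th tu c"
    and bar: "barrier \<epsilon> c a b s \<rho> r" "barrier \<epsilon> (\<lambda>x. c (- x)) (- b) (- a) s \<rho> r"
    and loss: "0 <= \<rho>" "0 <= \<eta>" and v: "AC {a<..<b} v g"
    and u: "alternating u p m" "\<And>i. i <= m ==> p i \<in> {a<..<b} \<and> u (p i) \<in> {-1, 1} \<and> \<bar>v (p i) - u (p i)\<bar> <= \<eta>"
  shows "ennreal (real m * (s - crossing_loss tu \<rho> \<eta>)) <= energy \<epsilon> c v g {p 0..p m}"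
  using u
proof (induction m)
  case (Suc m)
  let ?e = "s - crossing_loss tu \<rho> \<eta>"
  have alt: "p m < p (Suc m)" "u (p m) \<noteq> u (p (Suc m))" using Suc.prems(1) by (auto simp: alternating_def)
  have P: "p i \<in> {a<..<b}" "u (p i) \<in> {-1, 1}" "\<bar>v (p i) - u (p i)\<bar> <= \<eta>" if "i <= Suc m" for i using Suc.prems(2)[OF that] by auto
  have p0: "p 0 <= p m" using alternating_less[OF Suc.prems(1), of 0 m] by (cases "m = 0") auto
  have A: "AC {p 0..p (Suc m)} v g" "AC {p m..p (Suc m)} v g" using P(1)[of 0] P(1)[of m] P(1)[of "Suc m"] by (auto intro!: AC_subset[OF v])
  have pI: "a <= p m" "p m <= p (Suc m)" "p (Suc m) <= b" using P(1)[of m] P(1)[of "Suc m"] alt by auto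
  have step: "ennreal ?e <= energy \<epsilon> c v g {p m..p (Suc m)}"
  proof (cases "u (p m) = -1")
    case True
    then have "u (p (Suc m)) = 1" using alt P(2)[of "Suc m"] by auto
    then show ?thesis using True P(3)[of m] P(3)[of "Suc m"]
      by (intro upward_crossing_cost[OF r \<epsilon> c bar(1) loss pI A(2)]) (auto simp: abs_le_iff)
  next
    case False
    then have "u (p m) = 1" "u (p (Suc m)) = -1" using alt P(2)[of m] P(2)[of "Suc m"] by auto
    then show ?thesis using P(3)[of m] P(3)[of "Suc m"]
      by (intro downward_crossing_cost[OF r \<epsilon> c bar(2) loss pI A(2)]) (auto simp: abs_le_iff)
  qed
  have "ennreal (real m * ?e) <= energy \<epsilon> c v g {p 0..p m}"
    by (rule Suc.IH) (use alternating_mono[OF Suc.prems(1)] P in auto)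
  have "ennreal (real (Suc m) * ?e) <= ennreal (real m * ?e) + ennreal ?e"
  proof (cases "0 <= ?e")
    case True
    have "real (Suc m) * ?e = real m * ?e + ?e" by (simp add: distrib_right)
    then show ?thesis using True by (simp only: ennreal_plus[symmetric] mult_nonneg_nonneg of_nat_0_le_iff order_refl)
  next
    case False
    then have "real (Suc m) * ?e <= 0" by (intro mult_nonneg_nonpos) auto
    then show ?thesis by (simp only: ennreal_neg zero_le)
  qed
  also have "\<dots> <= energy \<epsilon> c v g {p 0..p m} + energy \<epsilon> c v g {p m..p (Suc m)}"
    by (intro add_mono step) fact
  also have "\<dots> <= energy \<epsilon> c v g {p 0..p (Suc m)}"
    by (rule energy_Icc_split[OF A(1) c p0 pI(2)])
  finally show ?case .
qed simp

text \<open>The energy bound forces the integral of \<open>W\<close> along the sequence to zero; Fatou's lemma passes this to the limit.\<close>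

lemma bounded_energy_limit_pm1:
  assumes \<epsilon>: "\<And>n. 0 < \<epsilon> n" "\<epsilon> \<longlonglongrightarrow> 0" and th: "0 < th" and c: "\<forall>\<^sub>F n in sequentially. medium th tu (c n)"
    and v: "\<And>n. AC {a<..<b} (v n) (g n)" and l: "\<And>n. energy (\<epsilon> n) (c n) (v n) (g n) {a<..<b} <= ennreal l"
    and lim: "AE x in lebesgue. x \<in> {a<..<b} --> (\<lambda>n. v n x) \<longlonglongrightarrow> u x"
  shows "AE x in lebesgue. x \<in> {a<..<b} --> u x \<in> {-1, 1}"
proof -
  define I where "I = {a<..<b}"
  let ?f = "\<lambda>n x. ennreal (indicator I x * W (v n x))"
  have fm: "?f n \<in> borel_measurable lebesgue" for n
  proof -
    have "continuous_on I (\<lambda>x. W (v n x))"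
      by (rule continuous_on_compose2[OF W_cont AC_continuous_open[OF v[of n, folded I_def]]]) (auto simp: I_def)
    then have "(\<lambda>x. indicator I x *\<^sub>R W (v n x)) \<in> borel_measurable borel"
      by (intro borel_measurable_continuous_on_indicator) (auto simp: I_def)
    then show ?thesis by (simp add: measurable_completion)
  qed
  have bound: "\<forall>\<^sub>F n in sequentially. (\<integral>\<^sup>+x. ?f n x \<partial>lebesgue) <= ennreal (\<epsilon> n / th) * ennreal l"
    using c
  proof eventually_elim
    case (elim n)
    have "ennreal (th / \<epsilon> n) * (\<integral>\<^sup>+x. ?f n x \<partial>lebesgue) = (\<integral>\<^sup>+x. ennreal (th / \<epsilon> n) * ?f n x \<partial>lebesgue)"
      by (rule nn_integral_cmult[OF fm, symmetric])
    also have "\<dots> <= energy (\<epsilon> n) (c n) (v n) (g n) I"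
    proof (rule nn_integral_mono_AE)
      have "AE x in lebesgue. th <= c n x" using elim by (simp add: medium_def)
      then show "AE x in lebesgue. ennreal (th / \<epsilon> n) * ?f n x <= ennreal (\<epsilon> n / 2 * (g n x)\<^sup>2 + 1 / \<epsilon> n * c n x * W (v n x)) * indicator I x"
      proof eventually_elim
        case (elim x)
        have w: "0 <= W (v n x)" by (rule W_nonneg)
        have "th / \<epsilon> n * W (v n x) <= 1 / \<epsilon> n * c n x * W (v n x)"
          using elim \<epsilon>(1)[of n] w by (intro mult_right_mono) (auto simp: divide_right_mono)
        moreover have "0 <= \<epsilon> n / 2 * (g n x)\<^sup>2" using \<epsilon>(1)[of n] by simp
        ultimately have "th / \<epsilon> n * W (v n x) <= \<epsilon> n / 2 * (g n x)\<^sup>2 + 1 / \<epsilon> n * c n x * W (v n x)" by linarith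
        then have "ennreal (th / \<epsilon> n) * ennreal (W (v n x)) <= ennreal (\<epsilon> n / 2 * (g n x)\<^sup>2 + 1 / \<epsilon> n * c n x * W (v n x))"
          using \<epsilon>(1)[of n] th by (subst ennreal_mult'[symmetric]) (auto intro: ennreal_leI)
        then show ?case by (auto simp: indicator_def)
      qed
    qed
    also have "\<dots> <= ennreal l" using l[of n] by (simp add: I_def)
    finally have "ennreal (\<epsilon> n / th) * (ennreal (th / \<epsilon> n) * (\<integral>\<^sup>+x. ?f n x \<partial>lebesgue)) <= ennreal (\<epsilon> n / th) * ennreal l"
      by (rule mult_left_mono) simp
    moreover have "ennreal (\<epsilon> n / th) * ennreal (th / \<epsilon> n) = 1"
      using \<epsilon>(1)[of n] th by (simp add: ennreal_mult[symmetric])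
    ultimately show ?case by (simp add: mult.assoc[symmetric])
  qed
  have "(\<integral>\<^sup>+x. liminf (\<lambda>n. ?f n x) \<partial>lebesgue) <= liminf (\<lambda>n. (\<integral>\<^sup>+x. ?f n x \<partial>lebesgue))"
    by (rule nn_integral_liminf[OF fm])
  also have "\<dots> <= liminf (\<lambda>n. ennreal (\<epsilon> n / th) * ennreal l)" by (rule Liminf_mono[OF bound])
  also have "\<dots> = 0"
  proof (rule lim_imp_Liminf)
    have "(\<lambda>n. ennreal (\<epsilon> n / th * max 0 l)) \<longlonglongrightarrow> ennreal (0 / th * max 0 l)"
      by (intro tendsto_ennrealI tendsto_intros \<epsilon>(2)) (use th in auto)
    moreover have "ennreal (\<epsilon> n / th * max 0 l) = ennreal (\<epsilon> n / th) * ennreal l" for n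
      using \<epsilon>(1)[of n] th by (subst ennreal_mult) (auto simp: max_def ennreal_neg)
    ultimately show "(\<lambda>n. ennreal (\<epsilon> n / th) * ennreal l) \<longlonglongrightarrow> 0" by simp
  qed simp
  finally have "AE x in lebesgue. liminf (\<lambda>n. ?f n x) = 0"
    using fm by (subst nn_integral_0_iff_AE[symmetric]) (auto intro: borel_measurable_liminf)
  then show ?thesis using lim
  proof eventually_elim
    case (elim x)
    show ?case
    proof
      assume x: "x \<in> {a<..<b}"
      have "(\<lambda>n. ?f n x) \<longlonglongrightarrow> ennreal (indicator I x * W (u x))"
        using elim(2) x W_cont by (intro tendsto_ennrealI tendsto_intros continuous_on_tendsto_compose[OF W_cont]) auto
      from lim_imp_Liminf[OF _ this] elim(1) x have "ennreal (W (u x)) = 0" by (simp add: I_def)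
      then have "W (u x) <= 0" by (simp add: ennreal_eq_0_iff)
      then have "W (u x) = 0" using W_nonneg[of "u x"] by linarith
      then show "u x \<in> {-1, 1}" using W_zeros by auto
    qed
  qed
qed

text \<open>Along any chain of sign changes of the limit, the approximating functions make crossings, which cost almost \<open>s\<close> each. So
chains are bounded, the limit is a step function, and the longest chain counts its jumps.\<close>

lemma limit_energy_bound:
  assumes ab: "a < b" and \<epsilon>: "\<And>n. 0 < \<epsilon> n" "\<epsilon> \<longlonglongrightarrow> 0" and th: "0 < th" and c: "\<forall>\<^sub>F n in sequentially. medium th tu (c n)"
    and r: "\<And>j. extraction_radius (r j) th tu (\<eta> j) s" and loss: "\<And>j. 0 < \<eta> j" "\<eta> \<longlonglongrightarrow> 0"
    and bar: "\<And>j. \<forall>\<^sub>F n in sequentially. barrier (\<epsilon> n) (c n) a b s (\<eta> j) (r j) \<and>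
      barrier (\<epsilon> n) (\<lambda>x. c n (- x)) (- b) (- a) s (\<eta> j) (r j)" and s: "0 < s"
    and v: "\<And>n. AC {a<..<b} (v n) (g n)" and l: "\<And>n. energy (\<epsilon> n) (c n) (v n) (g n) {a<..<b} <= ennreal l" and l0: "0 <= l"
    and lim: "AE x in lebesgue. x \<in> {a<..<b} --> (\<lambda>n. v n x) \<longlonglongrightarrow> u x" and u: "u \<in> L1 {a<..<b}"
  shows "u \<in> BV_pm1 {a<..<b} \<and> finite (jump_set u \<inter> {a<..<b}) \<and> s * real (card (jump_set u \<inter> {a<..<b})) <= l"
proof -
  let ?I = "{a<..<b}"
  let ?S = "\<lambda>x. (\<lambda>n. v n x) \<longlonglongrightarrow> u x"
  have pm: "AE x in lebesgue. x \<in> ?I --> u x \<in> {-1, 1}"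
    by (rule bounded_energy_limit_pm1[OF \<epsilon> th c v l lim])
  have chain: "real m * s <= l"
    if alt: "alternating u p m" and p: "\<And>i. i <= m ==> p i \<in> ?I \<and> u (p i) \<in> {-1, 1} \<and> ?S (p i)" for p m
  proof -
    have step: "real m * (s - crossing_loss tu (\<eta> j) (\<eta> j)) <= l" for j
    proof -
      have "\<forall>\<^sub>F n in sequentially. \<forall>i\<in>{..m}. \<bar>v n (p i) - u (p i)\<bar> < \<eta> j"
      proof (subst eventually_ball_finite_distrib)
        show "\<forall>i\<in>{..m}. \<forall>\<^sub>F n in sequentially. \<bar>v n (p i) - u (p i)\<bar> < \<eta> j"
          using p loss(1)[of j] by (auto simp: tendsto_iff dist_real_def)
      qed simp
      then have "\<forall>\<^sub>F n in sequentially. ennreal (real m * (s - crossing_loss tu (\<eta> j) (\<eta> j))) <= ennreal l"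
        using bar[of j] c
      proof eventually_elim
        case (elim n)
        have "ennreal (real m * (s - crossing_loss tu (\<eta> j) (\<eta> j))) <= energy (\<epsilon> n) (c n) (v n) (g n) {p 0..p m}"
          using elim p loss(1)[of j] by (intro alternation_cost[OF r \<epsilon>(1) _ _ _ _ _ v alt]) (auto intro: less_imp_le)
        also have "\<dots> <= energy (\<epsilon> n) (c n) (v n) (g n) ?I"
          using p[of 0] p[of m] by (intro nn_integral_mono) (auto simp: indicator_def)
        also note l
        finally show ?case .
      qed
      then have "ennreal (real m * (s - crossing_loss tu (\<eta> j) (\<eta> j))) <= ennreal l" by simp
      then show ?thesis using l0 by (simp add: ennreal_le_iff)
    qed
    have "(\<lambda>j. real m * (s - crossing_loss tu (\<eta> j) (\<eta> j))) \<longlonglongrightarrow> real m * (s - (0 + 0 * (1 + 2 * tu * W_max)))"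
      by (intro tendsto_intros loss(2))
    from LIMSEQ_le_const2[OF this] step show ?thesis by simp
  qed
  obtain s' ps where ps: "s' \<in> {-1, 1}" "sorted_wrt (<) ps" "set ps \<subseteq> ?I" "AE x in lebesgue. x \<in> ?I --> u x = stepfun s' ps x"
  proof (rule pm1_stepfun[OF ab u pm lim, of "l / s"])
    fix p m assume "alternating u p m" "\<And>i. i <= m ==> p i \<in> ?I \<and> lebesgue_point u (p i) \<and> u (p i) \<in> {-1, 1} \<and> ?S (p i)"
    then have "real m * s <= l" using chain by blast
    then show "real m <= l / s" using s by (simp add: pos_le_divide_eq)
  qed
  define G where "G = {x \<in> ?I. u x \<in> {-1, 1} \<and> ?S x \<and> u x = stepfun s' ps x}"
  have ae: "AE x in lebesgue. x \<in> ?I --> x \<in> G" using pm lim ps(4) by eventually_elim (auto simp: G_def)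
  have "\<exists>p. alternating u p (length ps) \<and> (\<forall>i\<le>length ps. p i \<in> G \<and> a < p i \<and> p i < b) \<and> u (p 0) = s'"
  proof (rule stepfun_alternating[OF _ ps(1,2,3) ab])
    show "\<exists>z\<in>G. x < z \<and> z < y" if "a <= x" "x < y" "y <= b" for x y
      using AE_lebesgue_dense[OF ae that(2)] that by auto
  qed (simp add: G_def)
  then obtain p where p: "alternating u p (length ps)" "\<And>i. i <= length ps ==> p i \<in> G" by blast
  have "real (length ps) * s <= l" by (rule chain[OF p(1)]) (use p(2) in \<open>unfold G_def, blast\<close>)
  moreover have J: "jump_set u \<inter> ?I = set ps" by (rule jump_set_stepfun[OF ps(4,2,3,1)])
  moreover have "card (set ps) = length ps" using ps(2) by (simp add: distinct_card strict_sorted_iff)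
  ultimately show ?thesis using stepfun_BV[OF ab u ps(4,2,1)] by (simp add: mult.commute)
qed

end

section \<open>Recovery functions\<close>

context double_well begin

lemma energy_measurable:
  assumes "AC UNIV w k" "medium th tu c"
  shows "(\<lambda>x. ennreal (\<epsilon> / 2 * (k x)\<^sup>2 + 1 / \<epsilon> * c x * W (w x))) \<in> borel_measurable lebesgue"
proof -
  have k: "k \<in> borel_measurable lebesgue" by (rule AC_measurable[OF assms(1)])
  have "(\<lambda>x. W (w x)) \<in> borel_measurable borel"
    by (intro borel_measurable_continuous_onI continuous_on_compose2[OF W_cont AC_UNIV_borel(1)[OF assms(1)]]) auto
  then have w: "(\<lambda>x. W (w x)) \<in> borel_measurable lebesgue" by (simp add: measurable_completion)
  have c: "c \<in> borel_measurable lebesgue" using assms(2) by (simp add: medium_def measurable_completion)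
  show ?thesis using k w c by measurable
qed

text \<open>A \<open>bridge\<close> joins \<open>\<sigma>\<close> to \<open>- \<sigma>\<close> within \<open>{p..q}\<close> in the original variable, a form in which functions can be glued;
\<open>cheap\<close> below provides one for \<open>\<sigma> = -1\<close> in terms of a rescaled profile.\<close>

definition bridge :: "real => (real => real) => real => real => real => real => bool" where
  "bridge \<epsilon> c \<sigma> p q e \<longleftrightarrow> (\<exists>w k. AC UNIV w k \<and> (\<forall>x. w x \<in> {-1..1}) \<and> (\<forall>x\<le>p. w x = \<sigma>) \<and> (\<forall>x\<ge>q. w x = - \<sigma>) \<and>
     energy \<epsilon> c w k UNIV <= ennreal e)"

definition cheap :: "real => (real => real) => real => real => real => bool" where
  "cheap \<epsilon> c p q e \<longleftrightarrow> (\<exists>r v g x. transition W r v g \<and> p <= x - r * \<epsilon> \<and> x + r * \<epsilon> <= q \<and>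
     kinetic g + (LINT y|lebesgue. c (x + \<epsilon> * y) * W (v y)) <= e)"

lemma cheap_imp_bridge:
  assumes \<epsilon>: "0 < \<epsilon>" and c: "medium th tu c" and ch: "cheap \<epsilon> c p q e"
  shows "bridge \<epsilon> c (-1) p q e"
proof -
  obtain r v g x where t: "transition W r v g" and x: "p <= x - r * \<epsilon>" "x + r * \<epsilon> <= q"
    and e: "kinetic g + (LINT y|lebesgue. c (x + \<epsilon> * y) * W (v y)) <= e"
    using ch unfolding cheap_def by blast
  have v: "AC UNIV v g" "1 <= r" "\<And>y. v y \<in> {-1..1}" "\<And>y. r <= \<bar>y\<bar> ==> v y = sgn y" "integrable lebesgue (\<lambda>y. (g y)\<^sup>2)"
    using t by (auto simp: transition_def)
  have cc: "c \<in> borel_measurable borel" "\<And>x. 0 <= c x" "\<And>x. c x <= tu" using c by (auto simp: medium_def)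
  define w where "w y = v (1 / \<epsilon> * y + (- x / \<epsilon>))" for y
  define k where "k y = 1 / \<epsilon> * g (1 / \<epsilon> * y + (- x / \<epsilon>))" for y
  have AC: "AC UNIV w k"
    using AC_affine[OF v(1), of "1 / \<epsilon>" "- x / \<epsilon>"] \<epsilon> unfolding w_def[abs_def] k_def[abs_def] by simp
  have at: "1 / \<epsilon> * (x + \<epsilon> * y) + (- x / \<epsilon>) = y" for y using \<epsilon> by (simp add: field_simps)
  have far_left: "v y = -1" if "y <= - r" for y using v(2) v(4)[of y] that by (simp add: sgn_if)
  have far_right: "v y = 1" if "r <= y" for y using v(2) v(4)[of y] that by (simp add: sgn_if)
  have "w y = -1" if "y <= p" for y
  proof -
    have "y - x <= - r * \<epsilon>" using that x by linarith
    then have "(y - x) / \<epsilon> <= - r" using \<epsilon> by (simp add: pos_divide_le_eq)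
    then have "v ((y - x) / \<epsilon>) = -1" using far_left by blast
    moreover have "1 / \<epsilon> * y + (- x / \<epsilon>) = (y - x) / \<epsilon>" by (simp add: diff_divide_distrib)
    ultimately show ?thesis by (simp only: w_def)
  qed
  moreover have "w y = 1" if "q <= y" for y
  proof -
    have "r * \<epsilon> <= y - x" using that x by linarith
    then have "r <= (y - x) / \<epsilon>" using \<epsilon> by (simp add: pos_le_divide_eq)
    then have "v ((y - x) / \<epsilon>) = 1" using far_right by blast
    moreover have "1 / \<epsilon> * y + (- x / \<epsilon>) = (y - x) / \<epsilon>" by (simp add: diff_divide_distrib)
    ultimately show ?thesis by (simp only: w_def)
  qed
  moreover have "w y \<in> {-1..1}" for y unfolding w_def by (rule v(3))
  moreover have "energy \<epsilon> c w k UNIV <= ennreal e"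
  proof -
    let ?H = "\<lambda>y. 1 / 2 * (g y)\<^sup>2 + c (x + \<epsilon> * y) * W (v y)"
    have Wv: "(\<lambda>y. W (v y)) \<in> borel_measurable borel" "bump_profile r (\<lambda>y. W (v y))"
      using transition_bump[OF t] by (auto simp: bump_profile_def intro: borel_measurable_continuous_onI)
    have cx: "(\<lambda>y. c (x + \<epsilon> * y)) \<in> borel_measurable borel" using cc(1) by measurable
    have i2: "integrable lebesgue (\<lambda>y. c (x + \<epsilon> * y) * W (v y))"
    proof (rule integrable_supported[where C="tu * W_max" and r=r])
      show "(\<lambda>y. c (x + \<epsilon> * y) * W (v y)) \<in> borel_measurable borel" using cx Wv(1) by measurable
      show "\<bar>c (x + \<epsilon> * y) * W (v y)\<bar> <= tu * W_max" for y
      proof -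
        have "c (x + \<epsilon> * y) * W (v y) <= tu * W_max"
          using cc(2,3)[of "x + \<epsilon> * y"] order_trans[OF cc(2)[of 0] cc(3)[of 0]] by (intro mult_mono W_le_max v(3) W_nonneg) auto
        then show ?thesis using cc(2)[of "x + \<epsilon> * y"] W_nonneg[of "v y"] by simp
      qed
      show "y \<in> {-r..r}" if "c (x + \<epsilon> * y) * W (v y) \<noteq> 0" for y
        using that Wv(2) by (simp add: bump_profile_def)
    qed
    have i1: "integrable lebesgue (\<lambda>y. 1 / 2 * (g y)\<^sup>2)" using v(5) by simp
    have "energy \<epsilon> c w k UNIV = (\<integral>\<^sup>+z. ennreal (\<epsilon> / 2 * (k z)\<^sup>2 + 1 / \<epsilon> * c z * W (w z)) \<partial>lebesgue)" by simp
    also have "\<dots> = ennreal \<epsilon> * (\<integral>\<^sup>+y. ennreal (\<epsilon> / 2 * (k (x + \<epsilon> * y))\<^sup>2 + 1 / \<epsilon> * c (x + \<epsilon> * y) * W (w (x + \<epsilon> * y))) \<partial>lebesgue)"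
      using nn_integral_real_affine_lebesgue[OF energy_measurable[OF AC c, of \<epsilon>], of \<epsilon> x] \<epsilon> by simp
    also have "\<dots> = ennreal \<epsilon> * (\<integral>\<^sup>+y. ennreal (1 / \<epsilon> * ?H y) \<partial>lebesgue)"
    proof -
      have "\<epsilon> / 2 * (k (x + \<epsilon> * y))\<^sup>2 + 1 / \<epsilon> * c (x + \<epsilon> * y) * W (w (x + \<epsilon> * y)) = 1 / \<epsilon> * ?H y" for y
        unfolding k_def w_def at using \<epsilon> by (simp add: power2_eq_square field_simps)
      then show ?thesis by simp
    qed
    also have "\<dots> = (\<integral>\<^sup>+y. ennreal \<epsilon> * ennreal (1 / \<epsilon> * ?H y) \<partial>lebesgue)"
    proof (rule nn_integral_cmult[symmetric])
      have "?H \<in> borel_measurable lebesgue"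
        by (rule borel_measurable_add[OF borel_measurable_integrable[OF i1] borel_measurable_integrable[OF i2]])
      from borel_measurable_times[OF borel_measurable_const this]
      show "(\<lambda>y. ennreal (1 / \<epsilon> * ?H y)) \<in> borel_measurable lebesgue"
        by (rule measurable_compose[OF _ measurable_ennreal])
    qed
    also have "\<dots> = (\<integral>\<^sup>+y. ennreal (?H y) \<partial>lebesgue)"
      using \<epsilon> by (intro nn_integral_cong) (subst ennreal_mult'[symmetric], auto)
    also have "\<dots> = ennreal (LINT y|lebesgue. ?H y)"
      using cc(2) W_nonneg by (intro nn_integral_eq_integral Bochner_Integration.integrable_add i1 i2) auto
    also have "(LINT y|lebesgue. ?H y) = kinetic g + (LINT y|lebesgue. c (x + \<epsilon> * y) * W (v y))"
      unfolding kinetic_def by (rule Bochner_Integration.integral_add[OF i1 i2])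
    finally show ?thesis using e by (simp add: ennreal_leI)
  qed
  ultimately show ?thesis using AC unfolding bridge_def by (intro exI[of _ w] exI[of _ k]) auto
qed

lemma bridge_reflect:
  assumes c: "medium th tu c" and b: "bridge \<epsilon> (\<lambda>x. c (- x)) \<sigma> (- q) (- p) e"
  shows "bridge \<epsilon> c (- \<sigma>) p q e"
proof -
  obtain w k where w: "AC UNIV w k" "\<And>x. w x \<in> {-1..1}" "\<And>x. x <= - q ==> w x = \<sigma>" "\<And>x. - p <= x ==> w x = - \<sigma>"
    "energy \<epsilon> (\<lambda>x. c (- x)) w k UNIV <= ennreal e"
    using b unfolding bridge_def by blast
  have AC: "AC UNIV (\<lambda>x. w (- x)) (\<lambda>x. - k (- x))" using AC_reflect[OF w(1)] by simp
  have "energy \<epsilon> c (\<lambda>x. w (- x)) (\<lambda>x. - k (- x)) UNIV = energy \<epsilon> (\<lambda>x. c (- x)) w k UNIV"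
    using nn_integral_real_affine_lebesgue[OF energy_measurable[OF AC c, of \<epsilon>], of "-1" 0] by simp
  then show ?thesis unfolding bridge_def
    using AC w by (intro exI[of _ "\<lambda>x. w (- x)"] exI[of _ "\<lambda>x. - k (- x)"] conjI) auto
qed

text \<open>Bridges over disjoint intervals are glued from right to left. The last conjunct, the value \<open>s\<close> to the left of all
intervals, is what makes the next gluing continuous.\<close>

lemma bridge_chain:
  assumes c: "medium th tu c" and e: "0 <= e" and \<epsilon>: "0 < \<epsilon>"
  shows "sorted_wrt (<) ps ==> s \<in> {-1, 1} ==>
    (\<And>p. p \<in> set ps ==> L p < p \<and> p < R p \<and> bridge \<epsilon> c (-1) (L p) (R p) e \<and> bridge \<epsilon> c 1 (L p) (R p) e) ==>
    (\<And>p p'. p \<in> set ps ==> p' \<in> set ps ==> p < p' ==> R p <= L p') ==>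
    \<exists>w k. AC UNIV w k \<and> (\<forall>x. w x \<in> {-1..1}) \<and> energy \<epsilon> c w k UNIV <= ennreal (real (length ps) * e) \<and>
      (\<forall>x. (\<forall>p\<in>set ps. x \<notin> {L p..R p}) --> w x = stepfun s ps x) \<and> (\<forall>x. (\<forall>p\<in>set ps. x <= L p) --> w x = s)"
proof (induction ps arbitrary: s)
  case Nil
  then have "W s = 0" "s \<in> {-1..1}" by (auto simp: W_zeros)
  then show ?case by (intro exI[of _ "\<lambda>_. s"] exI[of _ "\<lambda>_. 0"] conjI AC_const) auto
next
  case (Cons p ps)
  have s: "- s \<in> {-1, 1}" using Cons.prems(2) by auto
  obtain w2 k2 where w2: "AC UNIV w2 k2" "\<And>x. w2 x \<in> {-1..1}" "energy \<epsilon> c w2 k2 UNIV <= ennreal (real (length ps) * e)"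
    "\<And>x. (\<forall>p\<in>set ps. x \<notin> {L p..R p}) ==> w2 x = stepfun (- s) ps x" "\<And>x. (\<forall>p\<in>set ps. x <= L p) ==> w2 x = - s"
  proof -
    have "\<exists>w k. AC UNIV w k \<and> (\<forall>x. w x \<in> {-1..1}) \<and> energy \<epsilon> c w k UNIV <= ennreal (real (length ps) * e) \<and>
      (\<forall>x. (\<forall>p\<in>set ps. x \<notin> {L p..R p}) --> w x = stepfun (- s) ps x) \<and> (\<forall>x. (\<forall>p\<in>set ps. x <= L p) --> w x = - s)"
      by (rule Cons.IH[OF _ s]) (use Cons.prems in auto)
    then show ?thesis using that by blast
  qed
  have p: "L p < p" "p < R p" "bridge \<epsilon> c s (L p) (R p) e" using Cons.prems(3)[of p] Cons.prems(2) by auto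
  obtain w1 k1 where w1: "AC UNIV w1 k1" "\<And>x. w1 x \<in> {-1..1}" "\<And>x. x <= L p ==> w1 x = s" "\<And>x. R p <= x ==> w1 x = - s"
    "energy \<epsilon> c w1 k1 UNIV <= ennreal e"
    using p(3) unfolding bridge_def by blast
  define w where "w x = (if x <= R p then w1 x else w2 x)" for x
  define k where "k x = (if x <= R p then k1 x else k2 x)" for x
  have "\<forall>p'\<in>set ps. R p <= L p'" using Cons.prems(1,4) by auto
  then have "w1 (R p) = w2 (R p)" using w1(4)[of "R p"] w2(5)[of "R p"] by simp
  then have "AC ({..R p} \<union> {R p..}) w k"
    unfolding w_def[abs_def] k_def[abs_def]
    by (intro AC_glue AC_subset[OF w1(1)] AC_subset[OF w2(1)]) auto
  moreover have "{..R p} \<union> {R p..} = UNIV" by auto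
  ultimately have AC: "AC UNIV w k" by simp
  have "energy \<epsilon> c w k UNIV <= (\<integral>\<^sup>+x. ennreal (\<epsilon> / 2 * (k1 x)\<^sup>2 + 1 / \<epsilon> * c x * W (w1 x)) + ennreal (\<epsilon> / 2 * (k2 x)\<^sup>2 + 1 / \<epsilon> * c x * W (w2 x)) \<partial>lebesgue)"
    by (intro nn_integral_mono) (simp add: w_def k_def)
  also have "\<dots> = energy \<epsilon> c w1 k1 UNIV + energy \<epsilon> c w2 k2 UNIV"
    using nn_integral_add[OF energy_measurable[OF w1(1) c] energy_measurable[OF w2(1) c]] by simp
  also have "\<dots> <= ennreal e + ennreal (real (length ps) * e)" by (intro add_mono w1(5) w2(3))
  also have "\<dots> = ennreal (real (length (p # ps)) * e)" using e by (simp add: ennreal_plus[symmetric] algebra_simps del: ennreal_plus)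
  finally have en: "energy \<epsilon> c w k UNIV <= ennreal (real (length (p # ps)) * e)" .
  have st: "w x = stepfun s (p # ps) x" if x: "\<forall>p\<in>set (p # ps). x \<notin> {L p..R p}" for x
  proof (cases "x < L p")
    case True
    then show ?thesis using w1(3)[of x] p by (simp add: w_def)
  next
    case False
    then have "R p < x" using x by auto
    then show ?thesis using w2(4)[of x] x p by (simp add: w_def)
  qed
  have "w x = s" if "\<forall>p\<in>set (p # ps). x <= L p" for x using that w1(3)[of x] p by (simp add: w_def)
  moreover have "w x \<in> {-1..1}" for x using w1(2)[of x] w2(2)[of x] by (simp add: w_def)
  ultimately show ?case using AC en st by (intro exI[of _ w] exI[of _ k] conjI allI impI) auto
qed

lemma F_eps_AC_le:
  assumes w: "AC UNIV w k" "\<And>x. w x \<in> {-1..1}" and c: "medium th tu (\<lambda>x. checkerboard t (inverse d * x))"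
    and \<epsilon>: "0 < \<epsilon>" and en: "energy \<epsilon> (\<lambda>x. checkerboard t (inverse d * x)) w k UNIV <= ennreal E" and E: "0 <= E"
  shows "w \<in> L1 {a<..<b}" "F_eps W t \<epsilon> d {a<..<b} w <= ereal E"
proof -
  let ?I = "{a<..<b}" and ?c = "\<lambda>x. checkerboard t (inverse d * x)"
  have Im: "?I \<in> sets lebesgue" "open ?I" "is_interval ?I" by auto
  have fin: "emeasure (lebesgue_on ?I) (space (lebesgue_on ?I)) < \<infinity>" by (cases "a <= b") (simp_all add: emeasure_restrict_space)
  have wm: "w \<in> borel_measurable lebesgue" using AC_UNIV_borel(2)[OF w(1)] by (simp add: measurable_completion)
  have km: "k \<in> borel_measurable lebesgue" by (rule AC_measurable[OF w(1)])
  have rm: "f \<in> borel_measurable (lebesgue_on ?I)" if "f \<in> borel_measurable lebesgue" for f :: "real => real"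
    using that by (rule measurable_restrict_space1)
  have wb: "\<bar>w x\<bar> <= 1" for x using w(2)[of x] by (auto simp: abs_le_iff)
  interpret I: finite_measure "lebesgue_on ?I" using fin by (intro finite_measureI) auto
  have L1: "w \<in> L1 ?I" unfolding L1_def using wb by (intro CollectI I.integrable_const_bound[where B=1] rm wm) auto
  have w2: "(\<lambda>x. (w x)\<^sup>2) \<in> borel_measurable lebesgue" using wm by measurable
  have "w \<in> L2 ?I" unfolding L2_def
    using wb by (intro CollectI conjI rm wm w2 I.integrable_const_bound[where B=1]) (auto simp: abs_square_le_1)
  have "k \<in> L2 ?I" unfolding L2_def
  proof (intro CollectI conjI rm km integrableI_bounded)
    show "(\<lambda>x. (k x)\<^sup>2) \<in> borel_measurable lebesgue" using km by measurable
    have "(\<integral>\<^sup>+x. ennreal (norm ((k x)\<^sup>2)) \<partial>lebesgue_on ?I) = (\<integral>\<^sup>+x. ennreal ((k x)\<^sup>2) * indicator ?I x \<partial>lebesgue)"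
      using Im by (subst nn_integral_restrict_space) auto
    also have "\<dots> <= (\<integral>\<^sup>+x. ennreal (2 / \<epsilon>) * ennreal (\<epsilon> / 2 * (k x)\<^sup>2 + 1 / \<epsilon> * ?c x * W (w x)) \<partial>lebesgue)"
    proof (rule nn_integral_mono)
      fix x
      have "0 <= 1 / \<epsilon> * ?c x * W (w x)" using c \<epsilon> W_nonneg[of "w x"] by (simp add: medium_def)
      then have "2 / \<epsilon> * (\<epsilon> / 2 * (k x)\<^sup>2) <= 2 / \<epsilon> * (\<epsilon> / 2 * (k x)\<^sup>2 + 1 / \<epsilon> * ?c x * W (w x))"
        using \<epsilon> by (intro mult_left_mono) auto
      then have "(k x)\<^sup>2 <= 2 / \<epsilon> * (\<epsilon> / 2 * (k x)\<^sup>2 + 1 / \<epsilon> * ?c x * W (w x))" using \<epsilon> by simp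
      then have "ennreal ((k x)\<^sup>2) <= ennreal (2 / \<epsilon>) * ennreal (\<epsilon> / 2 * (k x)\<^sup>2 + 1 / \<epsilon> * ?c x * W (w x))"
        using \<epsilon> by (subst ennreal_mult'[symmetric]) (auto intro: ennreal_leI)
      then show "ennreal ((k x)\<^sup>2) * indicator ?I x <= ennreal (2 / \<epsilon>) * ennreal (\<epsilon> / 2 * (k x)\<^sup>2 + 1 / \<epsilon> * ?c x * W (w x))"
        by (auto simp: indicator_def)
    qed
    also have "\<dots> = ennreal (2 / \<epsilon>) * energy \<epsilon> ?c w k UNIV"
      using nn_integral_cmult[OF energy_measurable[OF w(1) c]] by simp
    also have "\<dots> <= ennreal (2 / \<epsilon>) * ennreal E" by (intro mult_left_mono en) simp
    also have "\<dots> < \<infinity>" by (simp add: ennreal_mult_less_top)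
    finally show "(\<integral>\<^sup>+x. ennreal (norm ((k x)\<^sup>2)) \<partial>lebesgue_on ?I) < \<infinity>" .
  qed
  have AI: "AC ?I w k" by (rule AC_subset[OF w(1)]) simp
  note wd = AC_weak_deriv[OF AI Im(2,3), of w]
  have "w \<in> H1 ?I" unfolding H1_def using \<open>w \<in> L2 ?I\<close> \<open>k \<in> L2 ?I\<close> wd(1) by auto
  have "(\<integral>\<^sup>+x. ennreal (\<epsilon> / 2 * (weak_deriv ?I w x)\<^sup>2 + 1 / \<epsilon> * ?c x * W (w x)) \<partial>lebesgue_on ?I) = energy \<epsilon> ?c w (weak_deriv ?I w) ?I"
    using Im by (subst nn_integral_restrict_space) auto
  also have "\<dots> <= energy \<epsilon> ?c w k UNIV"
    using wd(2) by (intro nn_integral_mono_AE) (auto elim!: eventually_mono simp: indicator_def)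
  also note en
  finally have "F_eps W t \<epsilon> d ?I w <= enn2ereal (ennreal E)"
    unfolding F_eps_def using \<open>w \<in> H1 ?I\<close> by (simp add: less_eq_ennreal.rep_eq)
  then show "F_eps W t \<epsilon> d ?I w <= ereal E" using E by simp
  show "w \<in> L1 ?I" by (rule L1)
qed

lemma F_eps_le_imp_AC:
  assumes F: "F_eps W t \<epsilon> d {a<..<b} u <= ereal l"
  obtains v g where "AC {a<..<b} v g" "AE x in lebesgue. x \<in> {a<..<b} --> u x = v x"
    "energy \<epsilon> (\<lambda>x. checkerboard t (inverse d * x)) v g {a<..<b} <= ennreal l"
proof -
  let ?I = "{a<..<b}"
  have H: "u \<in> H1 ?I" using F by (auto simp: F_eps_def split: if_splits)
  then obtain g0 where "has_weak_deriv ?I u g0" by (auto simp: H1_def)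
  then obtain v where v: "AC ?I v (weak_deriv ?I u)" "AE x in lebesgue. x \<in> ?I --> u x = v x"
    by (rule weak_deriv_AC) auto
  have "energy \<epsilon> (\<lambda>x. checkerboard t (inverse d * x)) v (weak_deriv ?I u) ?I =
      energy \<epsilon> (\<lambda>x. checkerboard t (inverse d * x)) u (weak_deriv ?I u) ?I"
    using v(2) by (intro nn_integral_cong_AE) (auto elim!: eventually_mono simp: indicator_def)
  also have "\<dots> = (\<integral>\<^sup>+x. ennreal (\<epsilon> / 2 * (weak_deriv ?I u x)\<^sup>2 + 1 / \<epsilon> * checkerboard t (inverse d * x) * W (u x)) \<partial>lebesgue_on ?I)"
    by (subst nn_integral_restrict_space) auto
  also have "\<dots> <= ennreal l"
  proof -
    let ?X = "(\<integral>\<^sup>+x. ennreal (\<epsilon> / 2 * (weak_deriv ?I u x)\<^sup>2 + 1 / \<epsilon> * checkerboard t (inverse d * x) * W (u x)) \<partial>lebesgue_on ?I)"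
    have X: "enn2ereal ?X <= ereal l" using F H by (simp add: F_eps_def)
    then show ?thesis by (rule enn2ereal_le_ereal(2))
  qed
  finally show ?thesis using that v by blast
qed

lemma recovery_function:
  assumes ab: "a < b" and c: "medium th tu (\<lambda>x. checkerboard t (inverse d * x))" and e: "0 <= e" and \<epsilon>: "0 < \<epsilon>"
    and u: "u \<in> L1 {a<..<b}" "AE x in lebesgue. x \<in> {a<..<b} --> u x = stepfun s ps x"
    and ps: "sorted_wrt (<) ps" "s \<in> {-1, 1}"
    and LR: "\<And>p. p \<in> set ps ==> L p < p \<and> p < R p \<and> R p - L p <= l" "\<And>p p'. p \<in> set ps ==> p' \<in> set ps ==> p < p' ==> R p <= L p'"
    and ch: "\<And>p. p \<in> set ps ==> cheap \<epsilon> (\<lambda>x. checkerboard t (inverse d * x)) (L p) (R p) e \<and>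
       cheap \<epsilon> (\<lambda>x. checkerboard t (inverse d * - x)) (- R p) (- L p) e"
  shows "\<exists>w\<in>L1 {a<..<b}. F_eps W t \<epsilon> d {a<..<b} w <= ereal (real (length ps) * e) \<and>
    (LINT x|lebesgue_on {a<..<b}. \<bar>w x - u x\<bar>) <= 2 * (real (length ps) * l)"
proof -
  let ?I = "{a<..<b}" and ?c = "\<lambda>x. checkerboard t (inverse d * x)"
  have Im: "?I \<in> sets lebesgue" by auto
  have br: "bridge \<epsilon> ?c (-1) (L p) (R p) e \<and> bridge \<epsilon> ?c 1 (L p) (R p) e" if "p \<in> set ps" for p
  proof
    show "bridge \<epsilon> ?c (-1) (L p) (R p) e" using cheap_imp_bridge[OF \<epsilon> c] ch[OF that] by blast
    have "bridge \<epsilon> (\<lambda>x. ?c (- x)) (-1) (- R p) (- L p) e" using cheap_imp_bridge[OF \<epsilon> medium_reflect[OF c]] ch[OF that] by blast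
    from bridge_reflect[OF c this] show "bridge \<epsilon> ?c 1 (L p) (R p) e" by simp
  qed
  have "\<exists>w k. AC UNIV w k \<and> (\<forall>x. w x \<in> {-1..1}) \<and> energy \<epsilon> ?c w k UNIV <= ennreal (real (length ps) * e) \<and>
      (\<forall>x. (\<forall>p\<in>set ps. x \<notin> {L p..R p}) --> w x = stepfun s ps x) \<and> (\<forall>x. (\<forall>p\<in>set ps. x <= L p) --> w x = s)"
    by (rule bridge_chain[OF c e \<epsilon> ps]) (use LR br in auto)
  then obtain w k where w: "AC UNIV w k" "\<And>x. w x \<in> {-1..1}" "energy \<epsilon> ?c w k UNIV <= ennreal (real (length ps) * e)"
    "\<And>x. (\<forall>p\<in>set ps. x \<notin> {L p..R p}) ==> w x = stepfun s ps x" by blast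
  have E: "0 <= real (length ps) * e" using e by simp
  note F = F_eps_AC_le[OF w(1,2) c \<epsilon> w(3) E, of a b]
  let ?D = "\<lambda>x. \<Sum>p\<in>set ps. 2 * indicator {L p..R p} x :: real"
  have Di: "integrable lebesgue ?D" by (intro Bochner_Integration.integrable_sum integrable_mult_right integrable_indicator_Icc)
  have "(LINT x|lebesgue_on ?I. \<bar>w x - u x\<bar>) = (LINT x|lebesgue. indicator ?I x * \<bar>w x - u x\<bar>)"
    using Im by (subst integral_restrict_space) auto
  also have "\<dots> <= (LINT x|lebesgue. ?D x)"
  proof (rule integral_mono_AE)
    have "integrable (lebesgue_on ?I) (\<lambda>x. \<bar>w x - u x\<bar>)" using F(1) u(1) by (auto simp: L1_def)
    then show "integrable lebesgue (\<lambda>x. indicator ?I x * \<bar>w x - u x\<bar>)"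
      using Im by (subst (asm) integrable_restrict_space) auto
    show "AE x in lebesgue. indicator ?I x * \<bar>w x - u x\<bar> <= ?D x"
      using u(2)
    proof eventually_elim
      case (elim x)
      show ?case
      proof (cases "x \<in> ?I \<and> (\<exists>p\<in>set ps. x \<in> {L p..R p})")
        case True
        then obtain p where p: "p \<in> set ps" "x \<in> {L p..R p}" by blast
        have "\<bar>w x - u x\<bar> <= 2" using w(2)[of x] elim True stepfun_range[OF ps(2), of ps x] by (auto simp: abs_le_iff)
        also have "2 = 2 * (indicator {L p..R p} x :: real)" using p by simp
        also have "\<dots> <= ?D x" by (rule member_le_sum[OF p(1)]) auto
        finally show ?thesis using True by simp
      next
        case False
        have "0 <= ?D x" by (intro sum_nonneg) simp
        then show ?thesis using False elim w(4)[of x] by (cases "x \<in> ?I") auto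
      qed
    qed
  qed (rule Di)
  also have "\<dots> = (\<Sum>p\<in>set ps. 2 * (R p - L p))"
  proof -
    have "(LINT x|lebesgue. ?D x) = (\<Sum>p\<in>set ps. (LINT x|lebesgue. 2 * indicator {L p..R p} x))"
      by (intro Bochner_Integration.integral_sum integrable_mult_right integrable_indicator_Icc)
    also have "\<dots> = (\<Sum>p\<in>set ps. 2 * (R p - L p))"
      by (intro sum.cong refl) (use LR(1) in \<open>fastforce simp: less_imp_le\<close>)
    finally show ?thesis .
  qed
  also have "\<dots> <= (\<Sum>p\<in>set ps. 2 * l)" 
  proof (rule sum_mono)
    fix p assume "p \<in> set ps"
    from LR(1)[OF this] show "2 * (R p - L p) <= 2 * l" by simp
  qed
  also have "\<dots> = 2 * (real (length ps) * l)"
    using ps(1) by (simp add: distinct_card strict_sorted_iff)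
  finally show ?thesis using F by blast
qed

end

section \<open>Gamma-convergence in probability\<close>

text \<open>Reflected media are checkerboards of the reflected coefficients, which reduces downward crossings to upward ones.\<close>

lemma checkerboard_reflect: "checkerboard (\<lambda>z. t (- z)) x = checkerboard t (- x)"
proof -
  have "bij_betw uminus (UNIV :: int set) UNIV" by (rule bij_uminus)
  from infsum_reindex_bij_betw[OF this, of "\<lambda>z. t z * indicator {real_of_int z - 1/2 <..< real_of_int z + 1/2} (- x)"]
  have "checkerboard t (- x) = (\<Sum>\<^sub>\<infinity>z. t (- z) * indicator {real_of_int (- z) - 1/2 <..< real_of_int (- z) + 1/2} (- x))"
    by (simp add: checkerboard_def)
  also have "\<dots> = checkerboard (\<lambda>z. t (- z)) x"
    unfolding checkerboard_def by (intro infsum_cong) (auto simp: indicator_def)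
  finally show ?thesis by simp
qed

text \<open>For each \<open>n\<close> take the largest \<open>j <= n\<close> for which the requirement can be met.\<close>

lemma diagonal_sequence:
  fixes A :: "nat => nat => 'a => bool"
  assumes ex: "\<And>j. \<forall>\<^sub>F n in sequentially. \<exists>v. A j n v" and mono: "\<And>i j n v. i <= j ==> A j n v ==> A i n v"
  obtains vs where "\<And>n. vs n = v0 \<or> A 0 n (vs n)" "\<And>j. \<forall>\<^sub>F n in sequentially. A j n (vs n)"
proof -
  define J where "J n = (GREATEST j. j <= n \<and> (\<exists>v. A j n v))" for n
  define vs where "vs n = (if \<exists>v. A (J n) n v then SOME v. A (J n) n v else v0)" for n
  have vsA: "A (J n) n (vs n)" if "\<exists>v. A (J n) n v" for n
    unfolding vs_def using that by (simp add: someI_ex[of "A (J n) n"])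
  have J: "j <= J n \<and> (\<exists>v. A (J n) n v)" if "j <= n" "\<exists>v. A j n v" for j n
  proof
    show "j <= J n" unfolding J_def by (rule Greatest_le_nat[where b=n]) (use that in auto)
    have "J n <= n \<and> (\<exists>v. A (J n) n v)" unfolding J_def by (rule GreatestI_nat[where b=n and k=j]) (use that in auto)
    then show "\<exists>v. A (J n) n v" by blast
  qed
  have "vs n = v0 \<or> A 0 n (vs n)" for n
  proof (cases "\<exists>v. A (J n) n v")
    case True
    from mono[OF le0 vsA[OF this]] show ?thesis by blast
  qed (simp add: vs_def)
  moreover have "\<forall>\<^sub>F n in sequentially. A j n (vs n)" for j
    using ex[of j] eventually_ge_at_top[of j]
  proof eventually_elim
    case (elim n)
    then have "j <= J n" "\<exists>v. A (J n) n v" using J by blast+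
    then show ?case using mono vsA by blast
  qed
  ultimately show ?thesis by (rule that)
qed

lemma rational_neighbourhoods:
  fixes S :: "real set"
  assumes S: "finite S" and h: "0 < h"
  obtains L R :: "real => rat" where
    "\<And>p. p \<in> S ==> real_of_rat (L p) < p \<and> p < real_of_rat (R p) \<and> real_of_rat (R p) - real_of_rat (L p) <= h"
    "\<And>p q. p \<in> S ==> q \<in> S ==> p < q ==> real_of_rat (R p) <= real_of_rat (L q)"
proof -
  define D where "D = (\<lambda>(p, q). q - p) ` {(p, q) \<in> S \<times> S. p < q}"
  define g where "g = Min (insert h D)"
  have fin: "finite (insert h D)" unfolding D_def using S by (auto intro: finite_subset[of _ "S \<times> S"])
  have "\<forall>x\<in>insert h D. 0 < x" using h by (auto simp: D_def)
  then have g: "0 < g" unfolding g_def using fin by simp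
  have gh: "g <= h" unfolding g_def using fin by simp
  have gD: "g <= q - p" if "p \<in> S" "q \<in> S" "p < q" for p q
    unfolding g_def using that fin by (intro Min_le) (auto simp: D_def image_iff)
  have "\<forall>p. \<exists>q. p - g / 2 < real_of_rat q \<and> real_of_rat q < p" using g by (intro allI of_rat_dense) simp
  then obtain L where L: "\<And>p. p - g / 2 < real_of_rat (L p) \<and> real_of_rat (L p) < p" by metis
  have "\<forall>p. \<exists>q. p < real_of_rat q \<and> real_of_rat q < p + g / 2" using g by (intro allI of_rat_dense) simp
  then obtain R where R: "\<And>p. p < real_of_rat (R p) \<and> real_of_rat (R p) < p + g / 2" by metis
  show ?thesis
  proof
    fix p
    show "real_of_rat (L p) < p \<and> p < real_of_rat (R p) \<and> real_of_rat (R p) - real_of_rat (L p) <= h"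
      using L[of p] R[of p] gh by linarith
    fix q assume "p \<in> S" "q \<in> S" "p < q"
    then show "real_of_rat (R p) <= real_of_rat (L q)" using gD[of p q] L[of q] R[of p] by linarith
  qed
qed

context double_well begin

text \<open>The requirements are indexed by a countable type: an accuracy \<open>1 / (j + 2)\<close>, with its own radius \<open>r j\<close>, and an interval with
rational ends in which cheap crossings in both directions are required. The shift by two keeps the accuracy below one, as
the extraction lemma demands.\<close>

definition typical :: "real => (real => real) => real => real => real => real => real => (nat => real) => nat \<times> rat \<times> rat => bool" where
  "typical \<epsilon> c a b th tu s r = (\<lambda>(j, p, q). medium th tu c \<and> barrier \<epsilon> c a b s (1 / real (j + 2)) (r j) \<and>
     barrier \<epsilon> (\<lambda>x. c (- x)) (- b) (- a) s (1 / real (j + 2)) (r j) \<and>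
     (p < q --> cheap \<epsilon> c (real_of_rat p) (real_of_rat q) (s + 1 / real (j + 2)) \<and>
       cheap \<epsilon> (\<lambda>x. c (- x)) (- real_of_rat q) (- real_of_rat p) (s + 1 / real (j + 2))))"

definition "perimeter s a b u = (if u \<in> BV_pm1 {a<..<b}
   then ereal s * enn2ereal (emeasure (count_space UNIV) (jump_set u \<inter> {a<..<b})) else \<infinity>)"

lemma perimeter_finite:
  assumes "u \<in> BV_pm1 {a<..<b}" "finite (jump_set u \<inter> {a<..<b})"
  shows "perimeter s a b u = ereal (s * real (card (jump_set u \<inter> {a<..<b})))"
proof -
  have "enn2ereal (emeasure (count_space UNIV) (jump_set u \<inter> {a<..<b})) = ereal (real (card (jump_set u \<inter> {a<..<b})))"
    using assms(2) by (simp add: emeasure_count_space_finite ennreal_of_nat_eq_real_of_nat enn2ereal_ennreal)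
  then show ?thesis using assms(1) by (simp add: perimeter_def)
qed

lemma inverse_shift_tendsto: "(\<lambda>j. 1 / real (j + 2)) \<longlonglongrightarrow> 0"
  using LIMSEQ_ignore_initial_segment[OF lim_inverse_n, of 2] by (simp add: inverse_eq_divide)

text \<open>Along a subsequence realizing a smaller value of the lower limit, the energies are bounded and the functions converge
almost everywhere.\<close>

lemma liminf_inequality:
  assumes ab: "a < b" and \<epsilon>: "\<And>n. 0 < \<epsilon> n" "\<epsilon> \<longlonglongrightarrow> 0" and th: "0 < th" and s: "0 < s"
    and r: "\<And>j. extraction_radius (r j) th tu (1 / real (j + 2)) s"
    and ty: "\<And>i. \<forall>\<^sub>F n in sequentially. typical (\<epsilon> n) (\<lambda>x. checkerboard (t n) (inverse (d n) * x)) a b th tu s r i"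
    and us: "L1_tendsto {a<..<b} us u"
  shows "perimeter s a b u <= liminf (\<lambda>n. F_eps W (t n) (\<epsilon> n) (d n) {a<..<b} (us n))"
proof (rule ccontr)
  let ?I = "{a<..<b}" and ?F = "\<lambda>n. F_eps W (t n) (\<epsilon> n) (d n) {a<..<b}" and ?c = "\<lambda>n x. checkerboard (t n) (inverse (d n) * x)"
  assume "\<not> ?thesis"
  then have "liminf (\<lambda>n. ?F n (us n)) < perimeter s a b u" by simp
  then obtain l where l: "liminf (\<lambda>n. ?F n (us n)) < ereal l" "ereal l < perimeter s a b u"
    using ereal_dense2 by blast
  have "\<not> (\<forall>\<^sub>F n in sequentially. ereal l <= ?F n (us n))"
  proof
    assume "\<forall>\<^sub>F n in sequentially. ereal l <= ?F n (us n)"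
    then have "ereal l <= liminf (\<lambda>n. ?F n (us n))" by (rule Liminf_bounded)
    then show False using l(1) by simp
  qed
  then have "infinite {n. ?F n (us n) <= ereal l}"
    unfolding eventually_sequentially infinite_nat_iff_unbounded_le by (auto simp: not_le intro: less_imp_le)
  then obtain \<rho> :: "nat => nat" where \<rho>: "strict_mono \<rho>" "\<And>n. ?F (\<rho> n) (us (\<rho> n)) <= ereal l"
    using infinite_enumerate by blast
  have uL: "\<And>n. us n \<in> L1 ?I" "u \<in> L1 ?I" "(\<lambda>n. LINT x|lebesgue_on ?I. \<bar>us n x - u x\<bar>) \<longlonglongrightarrow> 0"
    using us by (auto simp: L1_tendsto_def)
  have "(\<lambda>n. LINT x|lebesgue_on ?I. norm (us (\<rho> n) x - u x)) \<longlonglongrightarrow> 0"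
    using LIMSEQ_subseq_LIMSEQ[OF uL(3) \<rho>(1)] by (simp add: comp_def)
  from tendsto_L1_AE_subseq[OF _ this] obtain \<rho>' :: "nat => nat"
    where \<rho>': "strict_mono \<rho>'" "AE x in lebesgue_on ?I. (\<lambda>n. us (\<rho> (\<rho>' n)) x - u x) \<longlonglongrightarrow> 0"
    using uL(1,2) by (auto simp: L1_def)
  define \<sigma> where "\<sigma> = \<rho> \<circ> \<rho>'"
  have \<sigma>: "strict_mono \<sigma>" unfolding \<sigma>_def by (rule strict_mono_o[OF \<rho>(1) \<rho>'(1)])
  have F: "?F (\<sigma> n) (us (\<sigma> n)) <= ereal l" for n by (simp add: \<sigma>_def \<rho>(2))
  have "0 <= ?F (\<sigma> 0) (us (\<sigma> 0))" by (simp add: F_eps_def)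
  from order_trans[OF this F] have l0: "0 <= l" by simp
  have "\<forall>n. \<exists>v g. AC ?I v g \<and> (AE x in lebesgue. x \<in> ?I --> us (\<sigma> n) x = v x) \<and>
      energy (\<epsilon> (\<sigma> n)) (?c (\<sigma> n)) v g ?I <= ennreal l"
    using F_eps_le_imp_AC[OF F] by blast
  from choice[OF this] obtain v where "\<forall>n. \<exists>g. AC ?I (v n) g \<and> (AE x in lebesgue. x \<in> ?I --> us (\<sigma> n) x = v n x) \<and>
      energy (\<epsilon> (\<sigma> n)) (?c (\<sigma> n)) (v n) g ?I <= ennreal l" by blast
  from choice[OF this] obtain g where v: "\<And>n. AC ?I (v n) (g n)" "\<And>n. AE x in lebesgue. x \<in> ?I --> us (\<sigma> n) x = v n x"
      "\<And>n. energy (\<epsilon> (\<sigma> n)) (?c (\<sigma> n)) (v n) (g n) ?I <= ennreal l" by blast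
  have "AE x in lebesgue. x \<in> ?I --> (\<lambda>n. us (\<sigma> n) x - u x) \<longlonglongrightarrow> 0"
    using \<rho>'(2) by (subst (asm) AE_restrict_space_iff) (auto simp: \<sigma>_def)
  moreover have "AE x in lebesgue. \<forall>n. x \<in> ?I --> us (\<sigma> n) x = v n x" unfolding AE_all_countable using v(2) by blast
  ultimately have lim: "AE x in lebesgue. x \<in> ?I --> (\<lambda>n. v n x) \<longlonglongrightarrow> u x"
  proof eventually_elim
    case (elim x)
    show ?case
    proof
      assume x: "x \<in> ?I"
      have "(\<lambda>n. us (\<sigma> n) x) \<longlonglongrightarrow> u x" using elim(1) x by (simp add: LIM_zero_iff)
      moreover have "us (\<sigma> n) x = v n x" for n using elim(2) x by blast
      ultimately show "(\<lambda>n. v n x) \<longlonglongrightarrow> u x" by simp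
    qed
  qed
  have ty': "\<forall>\<^sub>F n in sequentially. typical (\<epsilon> (\<sigma> n)) (?c (\<sigma> n)) a b th tu s r i" for i
    by (rule eventually_subseq[OF \<sigma> ty])
  have "u \<in> BV_pm1 ?I \<and> finite (jump_set u \<inter> ?I) \<and> s * real (card (jump_set u \<inter> ?I)) <= l"
  proof (rule limit_energy_bound[OF ab, where \<epsilon>="\<epsilon> \<circ> \<sigma>" and c="\<lambda>n. ?c (\<sigma> n)" and th=th and tu=tu and r=r
        and \<eta>="\<lambda>j. 1 / real (j + 2)" and v=v and g=g])
    show "(\<epsilon> \<circ> \<sigma>) \<longlonglongrightarrow> 0" by (rule LIMSEQ_subseq_LIMSEQ[OF \<epsilon>(2) \<sigma>])
    show "\<forall>\<^sub>F n in sequentially. medium th tu (?c (\<sigma> n))"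
      using ty'[of "(0, 0, 0)"] by eventually_elim (simp add: typical_def)
    show "\<forall>\<^sub>F n in sequentially. barrier ((\<epsilon> \<circ> \<sigma>) n) (?c (\<sigma> n)) a b s (1 / real (j + 2)) (r j) \<and>
       barrier ((\<epsilon> \<circ> \<sigma>) n) (\<lambda>x. ?c (\<sigma> n) (- x)) (- b) (- a) s (1 / real (j + 2)) (r j)" for j
      using ty'[of "(j, 0, 0)"] by eventually_elim (simp add: typical_def)
    show "energy ((\<epsilon> \<circ> \<sigma>) n) (?c (\<sigma> n)) (v n) (g n) ?I <= ennreal l" for n using v(3) by simp
  qed (use \<epsilon>(1) th r s v(1) l0 lim uL(2) inverse_shift_tendsto in auto)
  then have "perimeter s a b u <= ereal l" using perimeter_finite[of u a b s] by simp
  then show False using l(2) by simp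
qed

text \<open>Recovery functions of accuracy \<open>1 / (j + 2)\<close> exist for all large \<open>n\<close>, and \<open>j\<close> is sent to infinity along a diagonal.\<close>

lemma limsup_inequality:
  assumes ab: "a < b" and \<epsilon>: "\<And>n. 0 < \<epsilon> n" and s: "0 < s"
    and ty: "\<And>i. \<forall>\<^sub>F n in sequentially. typical (\<epsilon> n) (\<lambda>x. checkerboard (t n) (inverse (d n) * x)) a b th tu s r i"
    and uL: "u \<in> L1 {a<..<b}"
  shows "\<exists>us. L1_tendsto {a<..<b} us u \<and> limsup (\<lambda>n. F_eps W (t n) (\<epsilon> n) (d n) {a<..<b} (us n)) <= perimeter s a b u"
proof (cases "u \<in> BV_pm1 {a<..<b}")
  case False
  then show ?thesis using uL by (intro exI[of _ "\<lambda>_. u"]) (simp add: L1_tendsto_def perimeter_def)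
next
  case True
  let ?I = "{a<..<b}" and ?F = "\<lambda>n. F_eps W (t n) (\<epsilon> n) (d n) {a<..<b}" and ?c = "\<lambda>n x. checkerboard (t n) (inverse (d n) * x)"
  obtain s' ps where ps: "s' \<in> {-1, 1}" "sorted_wrt (<) ps" "set ps \<subseteq> ?I" "AE x in lebesgue. x \<in> ?I --> u x = stepfun s' ps x"
    using BV_imp_stepfun[OF ab True] by blast
  define N where "N = real (length ps)"
  define A where "A j n w \<longleftrightarrow> w \<in> L1 ?I \<and> ?F n w <= ereal (N * (s + 1 / real (j + 2))) \<and>
    (LINT x|lebesgue_on ?I. \<bar>w x - u x\<bar>) <= 2 * (N * (1 / real (j + 2)))" for j n w
  have "\<forall>\<^sub>F n in sequentially. \<exists>w. A j n w" for j
  proof -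
    obtain L R where LR: "\<And>p. p \<in> set ps ==> real_of_rat (L p) < p \<and> p < real_of_rat (R p) \<and> real_of_rat (R p) - real_of_rat (L p) <= 1 / real (j + 2)"
      "\<And>p q. p \<in> set ps ==> q \<in> set ps ==> p < q ==> real_of_rat (R p) <= real_of_rat (L q)"
      using rational_neighbourhoods[of "set ps" "1 / real (j + 2)"] by (auto simp del: of_nat_add)
    have "\<forall>\<^sub>F n in sequentially. \<forall>p\<in>set ps. typical (\<epsilon> n) (?c n) a b th tu s r (j, L p, R p)"
      by (intro eventually_ball_finite ballI ty) simp
    then show ?thesis using ty[of "(j, 0, 0)"]
    proof eventually_elim
      case (elim n)
      have "\<exists>w\<in>L1 ?I. ?F n w <= ereal (real (length ps) * (s + 1 / real (j + 2))) \<and>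
        (LINT x|lebesgue_on ?I. \<bar>w x - u x\<bar>) <= 2 * (real (length ps) * (1 / real (j + 2)))"
      proof (rule recovery_function[OF ab _ _ \<epsilon> uL ps(4,2,1), where L="\<lambda>p. real_of_rat (L p)" and R="\<lambda>p. real_of_rat (R p)" and th=th and tu=tu])
        show "medium th tu (?c n)" using elim(2) by (simp add: typical_def)
        show "0 <= s + 1 / real (j + 2)" using s by simp
        fix p assume p: "p \<in> set ps"
        then have "L p < R p" using LR(1)[OF p] by (metis of_rat_less order_less_trans)
        then show "cheap (\<epsilon> n) (?c n) (real_of_rat (L p)) (real_of_rat (R p)) (s + 1 / real (j + 2)) \<and>
          cheap (\<epsilon> n) (\<lambda>x. checkerboard (t n) (inverse (d n) * - x)) (- real_of_rat (R p)) (- real_of_rat (L p)) (s + 1 / real (j + 2))"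
          using elim(1) p by (simp add: typical_def)
      qed (use LR in blast)+
      then show ?case by (auto simp: A_def N_def)
    qed
  qed
  moreover have "A i n w" if ij: "i <= j" and A: "A j n w" for i j n w
  proof -
    have "1 / real (j + 2) <= 1 / real (i + 2)" using ij by (intro divide_left_mono) auto
    then have "N * (s + 1 / real (j + 2)) <= N * (s + 1 / real (i + 2))" "2 * (N * (1 / real (j + 2))) <= 2 * (N * (1 / real (i + 2)))"
      unfolding N_def by (intro mult_left_mono add_left_mono; simp)+
    then show ?thesis using A unfolding A_def by (meson ereal_less_eq(3) order_trans)
  qed
  ultimately obtain us where us: "\<And>n. us n = u \<or> A 0 n (us n)" "\<And>j. \<forall>\<^sub>F n in sequentially. A j n (us n)"
    using diagonal_sequence[of A u] by blast
  have "us n \<in> L1 ?I" for n using us(1)[of n] uL by (auto simp: A_def)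
  moreover have "(\<lambda>n. LINT x|lebesgue_on ?I. \<bar>us n x - u x\<bar>) \<longlonglongrightarrow> 0"
  proof (rule tendstoI)
    fix e :: real assume e: "0 < e"
    have "(\<lambda>j. 2 * (N * (1 / real (j + 2)))) \<longlonglongrightarrow> 2 * (N * 0)" by (intro tendsto_intros inverse_shift_tendsto)
    then have "\<forall>\<^sub>F j in sequentially. 2 * (N * (1 / real (j + 2))) < e" using e by (intro order_tendstoD(2)) auto
    then obtain j where j: "2 * (N * (1 / real (j + 2))) < e" using eventually_happens'[OF sequentially_bot] by blast
    show "\<forall>\<^sub>F n in sequentially. dist (LINT x|lebesgue_on ?I. \<bar>us n x - u x\<bar>) 0 < e"
      using us(2)[of j]
    proof eventually_elim
      case (elim n)
      have "0 <= (LINT x|lebesgue_on ?I. \<bar>us n x - u x\<bar>)" by (intro Bochner_Integration.integral_nonneg) simp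
      then show ?case using elim j by (simp add: A_def dist_real_def)
    qed
  qed
  ultimately have "L1_tendsto ?I us u" using uL by (simp add: L1_tendsto_def)
  moreover have "limsup (\<lambda>n. ?F n (us n)) <= perimeter s a b u"
  proof -
    have J: "jump_set u \<inter> ?I = set ps" by (rule jump_set_stepfun[OF ps(4,2,3,1)])
    have "card (set ps) = length ps" using ps(2) by (simp add: distinct_card strict_sorted_iff)
    then have P: "perimeter s a b u = ereal (N * (s + 0))" using perimeter_finite[OF True, of s] J by (simp add: N_def mult.commute)
    have "limsup (\<lambda>n. ?F n (us n)) <= ereal (N * (s + 1 / real (j + 2)))" for j
      by (rule Limsup_bounded) (use us(2)[of j] in \<open>auto elim: eventually_mono simp: A_def\<close>)
    note le = this
    have "(\<lambda>j. ereal (N * (s + 1 / real (j + 2)))) \<longlonglongrightarrow> ereal (N * (s + 0))"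
      by (intro tendsto_intros inverse_shift_tendsto)
    then show ?thesis unfolding P by (rule LIMSEQ_le_const) (use le in blast)
  qed
  ultimately show ?thesis by blast
qed

end

text \<open>For fixed \<open>\<eta>\<close> finitely many of the requirements \<open>Q i\<close> already force the distance to be at most \<open>\<eta>\<close> for small \<open>\<epsilon>\<close>:
otherwise there are parameters and environments that satisfy all of them eventually and stay at distance more than \<open>\<eta>\<close>.
Finitely many requirements hold jointly with high probability.\<close>

lemma (in prob_space) tendsto_in_probI:
  fixes Q :: "nat => real => 'a => bool"
  assumes Q: "\<And>i. whp (Q i)" and E: "E \<in> mspace m"
    and G: "\<And>\<epsilon>. 0 < \<epsilon> ==> \<epsilon> < 1 ==> AE \<omega> in M. G \<epsilon> \<omega> \<in> mspace m"
    and conv: "\<And>\<epsilon> \<omega>. (\<And>n. 0 < \<epsilon> n) ==> \<epsilon> \<longlonglongrightarrow> 0 ==> (\<And>n. \<omega> n \<in> space M) ==>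
      (\<And>i. \<forall>\<^sub>F n in sequentially. Q i (\<epsilon> n) (\<omega> n)) ==> (\<And>n. G (\<epsilon> n) (\<omega> n) \<in> mspace m) ==>
      limitin (mtopology_of m) (\<lambda>n. G (\<epsilon> n) (\<omega> n)) E sequentially"
  shows "tendsto_in_prob M m G E"
  unfolding tendsto_in_prob_def
proof (intro allI impI)
  fix \<eta> :: real assume \<eta>: "0 < \<eta>"
  interpret Metric_space "mspace m" "mdist m" by (rule Metric_space_mspace_mdist)
  have "\<exists>k. \<forall>\<epsilon> \<omega>. 0 < \<epsilon> --> \<epsilon> < 1 / real (k + 1) --> \<omega> \<in> space M --> (\<forall>i\<in>{..k}. Q i \<epsilon> \<omega>) --> G \<epsilon> \<omega> \<in> mspace m -->
      mdist m (G \<epsilon> \<omega>) E <= \<eta>"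
  proof (rule ccontr)
    assume "\<not> ?thesis"
    then have "\<forall>k. \<exists>\<epsilon> \<omega>. 0 < \<epsilon> \<and> \<epsilon> < 1 / real (k + 1) \<and> \<omega> \<in> space M \<and> (\<forall>i\<in>{..k}. Q i \<epsilon> \<omega>) \<and> G \<epsilon> \<omega> \<in> mspace m \<and>
      \<eta> < mdist m (G \<epsilon> \<omega>) E" by (auto simp: not_le)
    then obtain \<epsilon> \<omega> where *: "\<And>k. 0 < \<epsilon> k \<and> \<epsilon> k < 1 / real (k + 1) \<and> \<omega> k \<in> space M \<and> (\<forall>i\<in>{..k}. Q i (\<epsilon> k) (\<omega> k)) \<and>
      G (\<epsilon> k) (\<omega> k) \<in> mspace m \<and> \<eta> < mdist m (G (\<epsilon> k) (\<omega> k)) E" by metis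
    have "\<epsilon> \<longlonglongrightarrow> 0"
    proof (rule tendsto_sandwich[OF _ _ tendsto_const])
      show "(\<lambda>k. 1 / real (k + 1)) \<longlonglongrightarrow> 0" using LIMSEQ_Suc[OF lim_inverse_n] by (simp add: inverse_eq_divide)
      show "\<forall>\<^sub>F k in sequentially. 0 <= \<epsilon> k" using * by (intro always_eventually allI less_imp_le) blast
      show "\<forall>\<^sub>F k in sequentially. \<epsilon> k <= 1 / real (k + 1)" using * by (intro always_eventually allI less_imp_le) blast
    qed
    moreover have "\<forall>\<^sub>F k in sequentially. Q i (\<epsilon> k) (\<omega> k)" for i
      using eventually_ge_at_top[of i] by eventually_elim (use * in auto)
    ultimately have "limitin (mtopology_of m) (\<lambda>k. G (\<epsilon> k) (\<omega> k)) E sequentially"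
      using * by (intro conv) auto
    then have "\<forall>\<^sub>F k in sequentially. mdist m (G (\<epsilon> k) (\<omega> k)) E < \<eta>"
      using \<eta> unfolding mtopology_of_def limitin_metric by (auto elim: eventually_mono)
    then obtain k where "mdist m (G (\<epsilon> k) (\<omega> k)) E < \<eta>" using eventually_happens'[OF sequentially_bot] by blast
    then show False using *[of k] by simp
  qed
  then obtain k where k: "\<And>\<epsilon> \<omega>. 0 < \<epsilon> ==> \<epsilon> < 1 / real (k + 1) ==> \<omega> \<in> space M ==> \<forall>i\<in>{..k}. Q i \<epsilon> \<omega> ==> G \<epsilon> \<omega> \<in> mspace m ==>
      mdist m (G \<epsilon> \<omega>) E <= \<eta>" by blast
  have "whp (\<lambda>\<epsilon> \<omega>. \<forall>i\<in>{..k}. Q i \<epsilon> \<omega>)" by (intro whp_ball_finite Q) simp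
  then obtain A where A: "\<And>\<epsilon>. A \<epsilon> \<in> events" "\<forall>\<^sub>F \<epsilon> in at_right 0. \<forall>\<omega>\<in>space M. \<not> (\<forall>i\<in>{..k}. Q i \<epsilon> \<omega>) --> \<omega> \<in> A \<epsilon>"
    "((\<lambda>\<epsilon>. prob (A \<epsilon>)) \<longlongrightarrow> 0) (at_right 0)" unfolding whp_def by blast
  have small: "\<forall>\<^sub>F \<epsilon> in at_right 0. 0 < \<epsilon> \<and> \<epsilon> < 1 / real (k + 1)"
    unfolding eventually_at_right_field by (intro exI[of _ "1 / real (k + 1)"]) auto
  have bound: "\<forall>\<^sub>F \<epsilon> in at_right 0. outer_measure_of M {\<omega> \<in> space M. \<eta> < mdist m (G \<epsilon> \<omega>) E} <= ennreal (prob (A \<epsilon>))"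
    using A(2) small
  proof eventually_elim
    case (elim \<epsilon>)
    have "1 / real (k + 1) <= 1" by simp
    then have "\<epsilon> < 1" using elim(2) by linarith
    then obtain N where N: "{\<omega> \<in> space M. G \<epsilon> \<omega> \<notin> mspace m} \<subseteq> N" "emeasure M N = 0" "N \<in> events"
      using AE_E[OF G] elim(2) by blast
    have "{\<omega> \<in> space M. \<eta> < mdist m (G \<epsilon> \<omega>) E} \<subseteq> A \<epsilon> \<union> N"
    proof
      fix \<omega> assume \<omega>: "\<omega> \<in> {\<omega> \<in> space M. \<eta> < mdist m (G \<epsilon> \<omega>) E}"
      show "\<omega> \<in> A \<epsilon> \<union> N"
      proof (rule ccontr)
        assume no: "\<omega> \<notin> A \<epsilon> \<union> N"
        have "mdist m (G \<epsilon> \<omega>) E <= \<eta>" using elim no N(1) \<omega> by (intro k) auto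
        then show False using \<omega> by simp
      qed
    qed
    then have "outer_measure_of M {\<omega> \<in> space M. \<eta> < mdist m (G \<epsilon> \<omega>) E} <= outer_measure_of M (A \<epsilon> \<union> N)"
      by (rule outer_measure_of_mono)
    also have "\<dots> = emeasure M (A \<epsilon> \<union> N)" using A(1) N(3) by simp
    also have "\<dots> <= emeasure M (A \<epsilon>) + emeasure M N" using A(1) N(3) by (intro emeasure_subadditive)
    finally show ?case using N(2) by (simp add: emeasure_eq_measure)
  qed
  have "((\<lambda>\<epsilon>. ennreal (prob (A \<epsilon>))) \<longlongrightarrow> ennreal 0) (at_right 0)" by (intro tendsto_ennrealI A(3))
  then show "((\<lambda>\<epsilon>. outer_measure_of M {\<omega> \<in> space M. \<eta> < mdist m (G \<epsilon> \<omega>) E}) \<longlongrightarrow> 0) (at_right 0)"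
    by (intro tendsto_sandwich[OF _ bound tendsto_const]) auto
qed

context scaled_transition begin

abbreviation "coefficient \<epsilon> \<omega> x \<equiv> checkerboard (\<lambda>z. \<Theta> z \<omega>) (inverse (\<delta> \<epsilon>) * x)"

lemma local_energy_coefficient:
  "local_energy \<omega> \<epsilon> x v g = kinetic g + (LINT y|lebesgue. coefficient \<epsilon> \<omega> (x + \<epsilon> * y) * W (v y))"
proof -
  have "\<alpha> \<epsilon> * y + x / \<delta> \<epsilon> = inverse (\<delta> \<epsilon>) * (x + \<epsilon> * y)" for y by (simp add: divide_inverse algebra_simps)
  then show ?thesis by (simp add: local_energy_def potential_def)
qed

lemma barrier_whp:
  assumes "a <= b" "0 <= z" "z <= sb" "\<And>\<zeta>. z < \<zeta> ==> \<kappa> <= J \<zeta>" "0 < \<rho>" "1 <= r"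
  shows "whp (\<lambda>\<epsilon> \<omega>. barrier \<epsilon> (coefficient \<epsilon> \<omega>) a b (sb - z) \<rho> r)"
proof (rule whp_mono[OF lower_bound_uniform[OF assms(1,2,4,5) _ assms(6), of "sb - z"]])
  show "\<forall>\<^sub>F \<epsilon> in at_right 0. \<forall>\<omega>\<in>space P. (\<forall>v g. transition W r v g --> kinetic g <= sb - z -->
       (\<forall>k\<in>sites a b \<epsilon>. sb - z - \<rho> < local_energy \<omega> \<epsilon> (\<epsilon> * real_of_int k) v g)) -->
     barrier \<epsilon> (coefficient \<epsilon> \<omega>) a b (sb - z) \<rho> r"
    using eventually_pos
  proof eventually_elim
    case (elim \<epsilon>)
    then show ?case unfolding barrier_def local_energy_coefficient using mem_sites[of \<epsilon> a _ b] by blast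
  qed
qed (use assms(3) in auto)

lemma cheap_whp:
  assumes "p < q" "0 <= z" "\<And>\<zeta>. 0 <= \<zeta> ==> \<zeta> < z ==> J \<zeta> < \<kappa>" "0 < \<rho>"
  shows "whp (\<lambda>\<epsilon> \<omega>. cheap \<epsilon> (coefficient \<epsilon> \<omega>) p q (sb - z + \<rho>))"
proof -
  obtain r v g where t: "transition W r v g"
    and w: "whp (\<lambda>\<epsilon> \<omega>. \<exists>x. p <= x - r * \<epsilon> \<and> x + r * \<epsilon> <= q \<and> local_energy \<omega> \<epsilon> x v g <= sb - z + \<rho>)"
    using upper_bound_realized[OF assms] by blast
  show ?thesis
    by (rule whp_mono[OF w]) (use t in \<open>auto simp: cheap_def local_energy_coefficient intro!: always_eventually\<close>)
qed

lemma typical_whp: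
  assumes ab: "a <= b" and z: "0 <= z" "z <= sb" "\<And>\<zeta>. z < \<zeta> ==> \<kappa> <= J \<zeta>" "\<And>\<zeta>. 0 <= \<zeta> ==> \<zeta> < z ==> J \<zeta> < \<kappa>" and r: "\<And>j. 1 <= r j"
  shows "whp (\<lambda>\<epsilon> \<omega>. typical \<epsilon> (coefficient \<epsilon> \<omega>) a b tl tu (sb - z) r i)"
proof -
  obtain j p q where i: "i = (j, p, q)" by (cases i) auto
  interpret R: scaled_transition P "\<lambda>z. \<Theta> (- z)" tl tu W \<delta> \<kappa>
  proof -
    interpret R: iid_bounded P "\<lambda>z. \<Theta> (- z)" tl tu by (rule iid_bounded_reflect)
    show "scaled_transition P (\<lambda>z. \<Theta> (- z)) tl tu W \<delta> \<kappa>" by unfold_locales (fact \<delta>_pos \<delta>_small \<kappa>_nonneg \<kappa>_lim)+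
  qed
  have sbR: "R.sb = sb" by (simp add: R.sb_def sb_def)
  have cR: "R.coefficient \<epsilon> \<omega> = (\<lambda>x. coefficient \<epsilon> \<omega> (- x))" for \<epsilon> \<omega>
    using checkerboard_reflect[of "\<lambda>z. \<Theta> z \<omega>"] by auto
  have pos: "0 < 1 / real (j + 2)" by simp
  have med: "whp (\<lambda>\<epsilon> \<omega>. medium tl tu (coefficient \<epsilon> \<omega>))"
  proof (rule whp_mono[OF whp_AE[OF nice_environment]])
    show "\<forall>\<^sub>F \<epsilon> in at_right 0. \<forall>\<omega>\<in>space P. (\<forall>z. tl <= \<Theta> z \<omega> \<and> \<Theta> z \<omega> <= tu) --> medium tl tu (coefficient \<epsilon> \<omega>)"
      using eventually_pos
    proof eventually_elim
      case (elim \<epsilon>)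
      then have "inverse (\<delta> \<epsilon>) \<noteq> 0" using \<delta>_pos[of \<epsilon>] by simp
      then show ?case
        using checkerboard_bounds[of tl _ tu, OF _ tl_pos] checkerboard_bounds(3)[of tl _ tu "inverse (\<delta> \<epsilon>)" 0, OF _ tl_pos]
        unfolding medium_def by auto
    qed
  qed
  have b1: "whp (\<lambda>\<epsilon> \<omega>. barrier \<epsilon> (coefficient \<epsilon> \<omega>) a b (sb - z) (1 / real (j + 2)) (r j))"
    by (rule barrier_whp[OF ab z(1-3) pos r])
  have b2: "whp (\<lambda>\<epsilon> \<omega>. barrier \<epsilon> (\<lambda>x. coefficient \<epsilon> \<omega> (- x)) (- b) (- a) (sb - z) (1 / real (j + 2)) (r j))"
    using R.barrier_whp[of "- b" "- a" z "1 / real (j + 2)" "r j"] ab z(1-3) pos r[of j] unfolding sbR cR by simp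
  have c1: "whp (\<lambda>\<epsilon> \<omega>. p < q --> cheap \<epsilon> (coefficient \<epsilon> \<omega>) (real_of_rat p) (real_of_rat q) (sb - z + 1 / real (j + 2)))"
  proof (cases "p < q")
    case True
    then show ?thesis using cheap_whp[OF _ z(1,4) pos, of "real_of_rat p" "real_of_rat q"] by (simp add: of_rat_less)
  next
    case False
    then show ?thesis using whp_AE[of "\<lambda>_. True"] by simp
  qed
  have c2: "whp (\<lambda>\<epsilon> \<omega>. p < q --> cheap \<epsilon> (\<lambda>x. coefficient \<epsilon> \<omega> (- x)) (- real_of_rat q) (- real_of_rat p) (sb - z + 1 / real (j + 2)))"
  proof (cases "p < q")
    case True
    then show ?thesis
      using R.cheap_whp[of "- real_of_rat q" "- real_of_rat p" z "1 / real (j + 2)"] z(1,4) pos unfolding sbR cR by (simp add: of_rat_less)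
  next
    case False
    then show ?thesis using whp_AE[of "\<lambda>_. True"] by simp
  qed
  show ?thesis
    by (rule whp_mono[OF whp_conj[OF whp_conj[OF med b1] whp_conj[OF b2 whp_conj[OF c1 c2]]]])
      (auto simp: typical_def i intro!: always_eventually)
qed

theorem Gamma_convergence_in_probability:
  assumes ab: "a < b" and m: "Gamma_metric {a<..<b} m"
    and lim: "E_check W P (\<Theta> 0) tl \<kappa> {a<..<b} \<in> mspace m"
    and F: "\<And>\<epsilon>. 0 < \<epsilon> ==> \<epsilon> < 1 ==> AE \<omega> in P. F_eps W (\<lambda>z. \<Theta> z \<omega>) \<epsilon> (\<delta> \<epsilon>) {a<..<b} \<in> mspace m"
  shows "tendsto_in_prob P m (\<lambda>\<epsilon> \<omega>. F_eps W (\<lambda>z. \<Theta> z \<omega>) \<epsilon> (\<delta> \<epsilon>) {a<..<b}) (E_check W P (\<Theta> 0) tl \<kappa> {a<..<b})"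
proof -
  obtain z where z: "0 <= z" "z < sb" "sigma_check W P (\<Theta> 0) tl \<kappa> = ereal (sb - z)"
    "\<And>\<zeta>. z < \<zeta> ==> \<kappa> <= J \<zeta>" "\<And>\<zeta>. 0 <= \<zeta> ==> \<zeta> < z ==> J \<zeta> < \<kappa>"
    using ex_critical_gain by blast
  have tu: "0 <= tu" using \<mu>_bounds tl_pos by linarith
  have "\<forall>j. \<exists>r. extraction_radius r tl tu (1 / real (j + 2)) (sb - z)"
    using z by (intro allI ex_extraction_radius tl_pos tu) auto
  then obtain r where r: "\<And>j. extraction_radius (r j) tl tu (1 / real (j + 2)) (sb - z)" by metis
  have r1: "1 <= r j" for j using r[of j] by (simp add: extraction_radius_def)
  have E: "E_check W P (\<Theta> 0) tl \<kappa> {a<..<b} = perimeter (sb - z) a b"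
    by (auto simp: E_check_def perimeter_def z(3))
  show ?thesis
  proof (rule tendsto_in_probI[where Q="\<lambda>i \<epsilon> \<omega>. typical \<epsilon> (coefficient \<epsilon> \<omega>) a b tl tu (sb - z) r (from_nat i)"])
    show "whp (\<lambda>\<epsilon> \<omega>. typical \<epsilon> (coefficient \<epsilon> \<omega>) a b tl tu (sb - z) r (from_nat i))" for i
      using ab z r1 by (intro typical_whp) auto
    fix \<epsilon> :: "nat => real" and \<omega> :: "nat => 'w"
    assume \<epsilon>: "\<And>n. 0 < \<epsilon> n" "\<epsilon> \<longlonglongrightarrow> 0"
      and ty: "\<And>i. \<forall>\<^sub>F n in sequentially. typical (\<epsilon> n) (coefficient (\<epsilon> n) (\<omega> n)) a b tl tu (sb - z) r (from_nat i)"
      and mem: "\<And>n. F_eps W (\<lambda>z. \<Theta> z (\<omega> n)) (\<epsilon> n) (\<delta> (\<epsilon> n)) {a<..<b} \<in> mspace m"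
    have ty': "\<forall>\<^sub>F n in sequentially. typical (\<epsilon> n) (coefficient (\<epsilon> n) (\<omega> n)) a b tl tu (sb - z) r i" for i
      using ty[of "to_nat i"] by simp
    have s: "0 < sb - z" using z(2) by simp
    have "Gamma_tendsto {a<..<b} (\<lambda>n. F_eps W (\<lambda>z. \<Theta> z (\<omega> n)) (\<epsilon> n) (\<delta> (\<epsilon> n)) {a<..<b}) (perimeter (sb - z) a b)"
      unfolding Gamma_tendsto_def
      using liminf_inequality[OF ab \<epsilon> tl_pos s r ty'] limsup_inequality[OF ab \<epsilon>(1) s ty'] by blast
    moreover have "(\<forall>n. F_eps W (\<lambda>z. \<Theta> z (\<omega> n)) (\<epsilon> n) (\<delta> (\<epsilon> n)) {a<..<b} \<in> mspace m) \<and> perimeter (sb - z) a b \<in> mspace m"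
      using lim mem E by simp
    ultimately show "limitin (mtopology_of m) (\<lambda>n. F_eps W (\<lambda>z. \<Theta> z (\<omega> n)) (\<epsilon> n) (\<delta> (\<epsilon> n)) {a<..<b}) (E_check W P (\<Theta> 0) tl \<kappa> {a<..<b}) sequentially"
      unfolding E
      by (subst m[unfolded Gamma_metric_def, THEN conjunct2, rule_format]) auto
  qed (use lim F in auto)
qed

end

theorem corollary1:
  fixes W :: "real \<Rightarrow> real"
    and P :: "'w measure"
    and \<Theta> :: "int \<Rightarrow> 'w \<Rightarrow> real"
    and \<theta>\<^sub>l \<theta>\<^sub>u :: real
    and \<delta> :: "real \<Rightarrow> real"
    and \<kappa> :: ereal
    and a b :: real
    and m :: "functional metric"
  assumes W_cont: "continuous_on UNIV W"
    and W_nonneg: "\<And>s. 0 \<le> W s"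
    and W_zeros: "\<And>s. W s = 0 \<longleftrightarrow> s = -1 \<or> s = 1"
    and P: "prob_space P"
    and indep: "prob_space.indep_vars P (\<lambda>_. borel) \<Theta> UNIV"
    and ident: "\<And>z. distr P borel (\<Theta> z) = distr P borel (\<Theta> 0)"
    and bounds: "\<And>z. AE \<omega> in P. \<theta>\<^sub>l \<le> \<Theta> z \<omega> \<and> \<Theta> z \<omega> \<le> \<theta>\<^sub>u"
    and \<theta>\<^sub>l_pos: "0 < \<theta>\<^sub>l"
    and \<theta>\<^sub>l_essinf: "ereal \<theta>\<^sub>l = - esssup P (\<lambda>\<omega>. ereal (- \<Theta> 0 \<omega>))"
    and nonconst: "\<not> (\<exists>c. AE \<omega> in P. \<Theta> 0 \<omega> = c)"
    and \<delta>_pos: "\<And>\<epsilon>. 0 < \<epsilon> \<Longrightarrow> 0 < \<delta> \<epsilon>"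
    and \<delta>_small: "((\<lambda>\<epsilon>. inverse \<epsilon> * \<delta> \<epsilon>) \<longlongrightarrow> 0) (at_right 0)"
    and \<kappa>_nonneg: "0 \<le> \<kappa>"
    and \<kappa>_lim: "((\<lambda>\<epsilon>. ereal (\<delta> \<epsilon> * \<bar>ln \<epsilon>\<bar> / \<epsilon>)) \<longlongrightarrow> \<kappa>) (at_right 0)"
    and I: "a < b"
    and m_Gamma: "Gamma_metric {a<..<b} m"
    and m_limits: "\<And>k. 0 \<le> k \<Longrightarrow> E_check W P (\<Theta> 0) \<theta>\<^sub>l k {a<..<b} \<in> mspace m"
    and m_F: "\<And>e d. 0 < e \<Longrightarrow> e < 1 \<Longrightarrow> 0 < d \<Longrightarrow>
      AE \<omega> in P. F_eps W (\<lambda>z. \<Theta> z \<omega>) e d {a<..<b} \<in> mspace m"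
  shows "tendsto_in_prob P m (\<lambda>\<epsilon> \<omega>. F_eps W (\<lambda>z. \<Theta> z \<omega>) \<epsilon> (\<delta> \<epsilon>) {a<..<b})
           (E_check W P (\<Theta> 0) \<theta>\<^sub>l \<kappa> {a<..<b})"
proof -
  interpret prob_space P by (rule P)
  interpret scaled_transition P \<Theta> \<theta>\<^sub>l \<theta>\<^sub>u W \<delta> \<kappa>
    by unfold_locales (fact indep ident bounds \<theta>\<^sub>l_pos W_cont W_nonneg W_zeros \<delta>_pos \<delta>_small \<kappa>_nonneg \<kappa>_lim)+
  show ?thesis
    by (rule Gamma_convergence_in_probability[OF I m_Gamma m_limits[OF \<kappa>_nonneg] m_F]) (auto intro: \<delta>_pos)
qed

end
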